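(* Let $Q\subset\mathbf{R}^n$ be a bounded simply connected region (open connected set) with smooth boundary $\partial Q$ and closure $\bar Q$. Let $(\Omega,\mathcal{F},\mathbf{P})$ be a standard probability space with a right-continuous non-decreasing flow (filtration) of $\sigma$-algebras $\mathcal{F}_t\subset\mathcal{F}$, $t\ge 0$, and let $w_t$ be a standard $d$-dimensional Wiener process with respect to $(\mathcal{F}_t)$. For $i=1,2$ let $f_i:\mathbf{R}^n\to\mathbf{R}^n$ and $\beta_i:\mathbf{R}^n\to\mathbf{R}^{n\times d}$ be nonrandom functions all of whose components are continuously differentiable, and suppose that the eigenvalues of the matrices $b_i(y)=\beta_i(y)\beta_i(y)^\top$ are bounded away from zero uniformly in $y\in Q$. Let $a_1,a_2$ be $\mathcal{F}_0$-measurable random vectors with $a_i\in\bar Q$ with probability $1$, and let $y_i(t)$, $t\ge 0$, be the $n$-dimensional diffusion processes that solve the Itô equations $$dy_i(t)=f_i(y_i(t))\,dt+\beta_i(y_i(t))\,dw_t,\qquad y_i(0)=a_i,\qquad i=1,2,$$ both driven by the same Wiener process $w_t$. Let $T_i=\inf\{t\ge 0:\ y_i(t)\notin Q\}$ and $\widetilde T=T_1\wedge T_2=\min(T_1,T_2)$. Let $v_i$ be the solution, twice continuously differentiable up to the boundary, of the Dirichlet problem $$L_iv_i=-1\ \text{ in } Q,\qquad v_i|_{\partial Q}=0,$$ where $$L_i=\sum_{j=1}^n f_i^{(j)}\frac{\partial}{\partial y^{(j)}}+\frac12\sum_{j,k=1}^n b_i^{(j,k)}\frac{\partial^2}{\partial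 y^{(j)}\partial y^{(k)}}.$$ Then $$\mathbf{E}|T_1-T_2|\le \max_{i=1,2}\ \sup_{y\in Q}\left|\frac{dv_i}{dy}(y)\right|\ \mathbf{E}\,|y_1(\widetilde T)-y_2(\widetilde T)|.$$
   Context: All vectors and matrices are real and $|\cdot|$ is the Euclidean norm. $f_i^{(j)}$, $y^{(j)}$, $b_i^{(j,k)}$ denote the components of the vectors $f_i$, $y$ and of the matrix $b_i=\beta_i\beta_i^\top$. $dv_i/dy$ denotes the gradient vector with components $\partial v_i/\partial y^{(j)}$, $j=1,\dots,n$. Under the stated assumptions on $f_i,\beta_i,Q$, each Dirichlet problem has a unique solution $v_i$ that is twice continuously differentiable up to the boundary, i.e. $v_i\in C^2(\bar Q)$. $\mathbf{E}$ denotes expectation with respect to $\mathbf{P}$. *)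

theory Defs
  imports "HOL-Probability.Probability"
begin

section \<open>Differentiability classes, domains, and the Dirichlet problem\<close>

definition partial :: "'n::finite \<Rightarrow> (real^'n \<Rightarrow> real) \<Rightarrow> real^'n \<Rightarrow> real" where
  "partial j u x = frechet_derivative u (at x) (axis j 1)"

definition grad :: "(real^'n::finite \<Rightarrow> real) \<Rightarrow> real^'n \<Rightarrow> real^'n" where
  "grad u x = (\<chi> j. partial j u x)"

text \<open>Only meant for open \<^term>\<open>U\<close>: the derivatives are taken in the whole space.\<close>

fun Ck_on :: "nat \<Rightarrow> (real^'n::finite) set \<Rightarrow> (real^'n \<Rightarrow> real) \<Rightarrow> bool" where
  "Ck_on 0 U u \<longleftrightarrow> continuous_on U u"
| "Ck_on (Suc k) U u \<longleftrightarrow> (\<forall>x\<in>U. u differentiable (at x)) \<and> (\<forall>j. Ck_on k U (partial j u))"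

definition smooth_on :: "(real^'n::finite) set \<Rightarrow> (real^'n \<Rightarrow> real) \<Rightarrow> bool" where
  "smooth_on U u \<longleftrightarrow> (\<forall>k. Ck_on k U u)"

definition smooth_boundary :: "(real^'n::finite) set \<Rightarrow> bool" where
  "smooth_boundary Q \<longleftrightarrow> (\<forall>x\<in>frontier Q. \<exists>U \<phi>.
     open U \<and> x \<in> U \<and> smooth_on U \<phi> \<and> (\<forall>y\<in>U. grad \<phi> y \<noteq> 0) \<and>
     Q \<inter> U = {y\<in>U. \<phi> y < 0} \<and> frontier Q \<inter> U = {y\<in>U. \<phi> y = 0})"

definition extends_to_closure :: "(real^'n::finite) set \<Rightarrow> (real^'n \<Rightarrow> real) \<Rightarrow> bool" where
  "extends_to_closure Q u \<longleftrightarrow> (\<exists>g. continuous_on (closure Q) g \<and> (\<forall>x\<in>Q. g x = u x))"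

definition C2_up_to_boundary :: "(real^'n::finite) set \<Rightarrow> (real^'n \<Rightarrow> real) \<Rightarrow> bool" where
  "C2_up_to_boundary Q v \<longleftrightarrow> continuous_on (closure Q) v \<and> Ck_on 2 Q v \<and>
     (\<forall>j. extends_to_closure Q (partial j v)) \<and>
     (\<forall>j k. extends_to_closure Q (partial j (partial k v)))"

definition diffusion_matrix :: "(real^'n::finite \<Rightarrow> real^'d::finite^'n) \<Rightarrow> real^'n \<Rightarrow> real^'n^'n" where
  "diffusion_matrix \<beta> y = \<beta> y ** transpose (\<beta> y)"

definition is_eigenvalue :: "real^'n::finite^'n \<Rightarrow> real \<Rightarrow> bool" where
  "is_eigenvalue A l \<longleftrightarrow> (\<exists>x. x \<noteq> 0 \<and> A *v x = l *\<^sub>R x)"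

definition eigenvalues_bounded_away_from_zero ::
    "(real^'n::finite) set \<Rightarrow> (real^'n \<Rightarrow> real^'n^'n) \<Rightarrow> bool" where
  "eigenvalues_bounded_away_from_zero Q b \<longleftrightarrow>
     (\<exists>c>0. \<forall>y\<in>Q. \<forall>l. is_eigenvalue (b y) l \<longrightarrow> \<bar>l\<bar> \<ge> c)"

definition generator ::
    "(real^'n::finite \<Rightarrow> real^'n) \<Rightarrow> (real^'n \<Rightarrow> real^'d::finite^'n) \<Rightarrow>
     (real^'n \<Rightarrow> real) \<Rightarrow> real^'n \<Rightarrow> real" where
  "generator f \<beta> u y =
     (\<Sum>j\<in>UNIV. f y $ j * partial j u y) +
     1/2 * (\<Sum>j\<in>UNIV. \<Sum>k\<in>UNIV. diffusion_matrix \<beta> y $ j $ k * partial j (partial k u) y)"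

definition dirichlet_solution ::
    "(real^'n::finite) set \<Rightarrow> (real^'n \<Rightarrow> real^'n) \<Rightarrow> (real^'n \<Rightarrow> real^'d::finite^'n) \<Rightarrow>
     (real^'n \<Rightarrow> real) \<Rightarrow> bool" where
  "dirichlet_solution Q f \<beta> v \<longleftrightarrow> C2_up_to_boundary Q v \<and>
     (\<forall>y\<in>Q. generator f \<beta> v y = -1) \<and> (\<forall>y\<in>frontier Q. v y = 0)"


section \<open>Probability spaces, filtrations, and processes\<close>

text \<open>
  Standardness in the sense of Rokhlin: the space is complete and isomorphic modulo null sets to
  the completion of a Borel probability measure on the real line; atoms are allowed.
\<close>

definition standard_prob_space :: "'w measure \<Rightarrow> bool" where
  "standard_prob_space M \<longleftrightarrow> prob_space M \<and> complete_measure M \<and>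
     (\<exists>(\<nu>::real measure) N N' \<phi>. prob_space \<nu> \<and> sets \<nu> = sets borel \<and>
        N \<in> null_sets M \<and> N' \<in> null_sets (completion \<nu>) \<and>
        bij_betw \<phi> (space M - N) (UNIV - N') \<and>
        (\<forall>A. A \<subseteq> space M - N \<longrightarrow>
           (A \<in> sets M \<longleftrightarrow> \<phi> ` A \<in> sets (completion \<nu>)) \<and>
           (A \<in> sets M \<longrightarrow> emeasure M A = emeasure (completion \<nu>) (\<phi> ` A))))"

text \<open>
  Time is modelled by the nonnegative reals; the values of filtrations and processes at
  negative times are irrelevant throughout.
\<close>

definition right_continuous_filtration :: "'w measure \<Rightarrow> (real \<Rightarrow> 'w measure) \<Rightarrow> bool" where
  "right_continuous_filtration M F \<longleftrightarrow>
     (\<forall>t\<ge>0. subalgebra M (F t)) \<and>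
     (\<forall>s t. 0 \<le> s \<and> s \<le> t \<longrightarrow> sets (F s) \<subseteq> sets (F t)) \<and>
     (\<forall>t\<ge>0. (\<Inter>u\<in>{t<..}. sets (F u)) = sets (F t))"

definition adapted ::
    "(real \<Rightarrow> 'w measure) \<Rightarrow> (real \<Rightarrow> 'w \<Rightarrow> 'b::topological_space) \<Rightarrow> bool" where
  "adapted F X \<longleftrightarrow> (\<forall>t\<ge>0. X t \<in> borel_measurable (F t))"

definition continuous_paths ::
    "'w measure \<Rightarrow> (real \<Rightarrow> 'w \<Rightarrow> 'b::topological_space) \<Rightarrow> bool" where
  "continuous_paths M X \<longleftrightarrow> (\<forall>\<omega>\<in>space M. continuous_on {0..} (\<lambda>t. X t \<omega>))"

definition progressive ::
    "(real \<Rightarrow> 'w measure) \<Rightarrow> (real \<Rightarrow> 'w \<Rightarrow> 'b::topological_space) \<Rightarrow> bool" where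
  "progressive F H \<longleftrightarrow> (\<forall>t\<ge>0.
     (\<lambda>(s, \<omega>). H s \<omega>) \<in> borel_measurable (restrict_space borel {0..t} \<Otimes>\<^sub>M F t))"

definition wiener_process ::
    "'w measure \<Rightarrow> (real \<Rightarrow> 'w measure) \<Rightarrow> (real \<Rightarrow> 'w \<Rightarrow> real^'d::finite) \<Rightarrow> bool" where
  "wiener_process M F w \<longleftrightarrow>
     adapted F w \<and> continuous_paths M w \<and> (AE \<omega> in M. w 0 \<omega> = 0) \<and>
     (\<forall>s t. 0 \<le> s \<and> s < t \<longrightarrow>
        prob_space.indep_set M (sets (F s))
          (sets (vimage_algebra (space M) (\<lambda>\<omega>. w t \<omega> - w s \<omega>) borel)) \<and>
        prob_space.indep_vars M (\<lambda>_. borel) (\<lambda>k \<omega>. (w t \<omega> - w s \<omega>) $ k) UNIV \<and>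
        (\<forall>k. distributed M lborel (\<lambda>\<omega>. (w t \<omega> - w s \<omega>) $ k)
               (\<lambda>x. ennreal (normal_density 0 (sqrt (t - s)) x))))"

definition tends_in_probability ::
    "'w measure \<Rightarrow> (nat \<Rightarrow> 'w \<Rightarrow> 'b::metric_space) \<Rightarrow> ('w \<Rightarrow> 'b) \<Rightarrow> bool" where
  "tends_in_probability M X Y \<longleftrightarrow>
     (\<forall>\<epsilon>>0. (\<lambda>k. measure M {\<omega>\<in>space M. dist (X k \<omega>) (Y \<omega>) > \<epsilon>}) \<longlonglongrightarrow> 0)"


section \<open>The stochastic integral and stochastic differential equations\<close>

text \<open>
  A triple \<^term>\<open>(m, \<tau>, \<xi>)\<close> encodes the simple process that equals \<^term>\<open>\<xi> i\<close> on the time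
  interval from \<^term>\<open>\<tau> i\<close> (excluded) to \<^term>\<open>\<tau> (Suc i)\<close> (included), for \<^term>\<open>i < m\<close>,
  and vanishes at all other times.
\<close>

type_synonym ('w, 'n, 'd) simple_data = "nat \<times> (nat \<Rightarrow> real) \<times> (nat \<Rightarrow> 'w \<Rightarrow> real^'d^'n)"

definition simple_process ::
    "(real \<Rightarrow> 'w measure) \<Rightarrow> ('w, 'n::finite, 'd::finite) simple_data \<Rightarrow> bool" where
  "simple_process F = (\<lambda>(m, \<tau>, \<xi>).
     0 \<le> \<tau> 0 \<and> (\<forall>i<m. \<tau> i \<le> \<tau> (Suc i)) \<and>
     (\<forall>i<m. \<xi> i \<in> borel_measurable (F (\<tau> i)) \<and>
            (\<exists>C. \<forall>\<omega>\<in>space (F (\<tau> i)). norm (\<xi> i \<omega>) \<le> C)))"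

definition simple_value ::
    "('w, 'n::finite, 'd::finite) simple_data \<Rightarrow> real \<Rightarrow> 'w \<Rightarrow> real^'d^'n" where
  "simple_value = (\<lambda>(m, \<tau>, \<xi>) s \<omega>.
     \<Sum>i<m. indicator {\<tau> i <.. \<tau> (Suc i)} s *\<^sub>R \<xi> i \<omega>)"

definition simple_integral ::
    "(real \<Rightarrow> 'w \<Rightarrow> real^'d) \<Rightarrow> ('w, 'n::finite, 'd::finite) simple_data \<Rightarrow> real \<Rightarrow> 'w \<Rightarrow> real^'n" where
  "simple_integral w = (\<lambda>(m, \<tau>, \<xi>) t \<omega>.
     \<Sum>i<m. \<xi> i \<omega> *v (w (min t (\<tau> (Suc i))) \<omega> - w (min t (\<tau> i)) \<omega>))"

text \<open>
  \<^term>\<open>I\<close> is (a version of) the Ito integral process of the matrix-valued process \<^term>\<open>H\<close>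
  against \<^term>\<open>w\<close>, for progressive \<^term>\<open>H\<close> that is almost surely locally square integrable in
  time: \<^term>\<open>H\<close> is approximated by simple processes in the mean square over time, in
  probability, and the elementary integrals of these converge to \<^term>\<open>I\<close> in probability.  The
  norm of a matrix is the Frobenius norm.  As the paths of \<^term>\<open>I\<close> are continuous almost
  surely, \<^term>\<open>I\<close> is determined up to indistinguishability.
\<close>

definition ito_integral ::
    "'w measure \<Rightarrow> (real \<Rightarrow> 'w measure) \<Rightarrow> (real \<Rightarrow> 'w \<Rightarrow> real^'d::finite) \<Rightarrow>
     (real \<Rightarrow> 'w \<Rightarrow> real^'d^'n::finite) \<Rightarrow> (real \<Rightarrow> 'w \<Rightarrow> real^'n) \<Rightarrow> bool" where
  "ito_integral M F w H I \<longleftrightarrow>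
     progressive F H \<and>
     (AE \<omega> in M. \<forall>t\<ge>0. set_integrable lborel {0..t} (\<lambda>s. (norm (H s \<omega>))\<^sup>2)) \<and>
     (\<forall>t\<ge>0. I t \<in> borel_measurable M) \<and>
     (AE \<omega> in M. continuous_on {0..} (\<lambda>t. I t \<omega>)) \<and>
     (\<exists>S. (\<forall>k. simple_process F (S k)) \<and>
        (\<forall>t\<ge>0.
           tends_in_probability M
             (\<lambda>k \<omega>. LINT s:{0..t}|lborel. (norm (simple_value (S k) s \<omega> - H s \<omega>))\<^sup>2) (\<lambda>_. 0) \<and>
           tends_in_probability M (\<lambda>k. simple_integral w (S k) t) (I t)))"

definition sde_solution ::
    "'w measure \<Rightarrow> (real \<Rightarrow> 'w measure) \<Rightarrow> (real \<Rightarrow> 'w \<Rightarrow> real^'d::finite) \<Rightarrow>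
     (real^'n::finite \<Rightarrow> real^'n) \<Rightarrow> (real^'n \<Rightarrow> real^'d^'n) \<Rightarrow> ('w \<Rightarrow> real^'n) \<Rightarrow>
     (real \<Rightarrow> 'w \<Rightarrow> real^'n) \<Rightarrow> bool" where
  "sde_solution M F w f \<beta> a y \<longleftrightarrow>
     adapted F y \<and> continuous_paths M y \<and> (AE \<omega> in M. y 0 \<omega> = a \<omega>) \<and>
     (\<exists>I. ito_integral M F w (\<lambda>s \<omega>. \<beta> (y s \<omega>)) I \<and>
        (AE \<omega> in M. \<forall>t\<ge>0. y t \<omega> = a \<omega> + (LINT s:{0..t}|lborel. f (y s \<omega>)) + I t \<omega>))"

text \<open>The exit time is infinite on paths that never leave \<^term>\<open>Q\<close>.\<close>

definition exit_time :: "'b set \<Rightarrow> (real \<Rightarrow> 'w \<Rightarrow> 'b) \<Rightarrow> 'w \<Rightarrow> ereal" where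
  "exit_time Q y \<omega> = (INF t\<in>{t. 0 \<le> t \<and> y t \<omega> \<notin> Q}. ereal t)"

end

(* Since v_i solves L_i v_i = -1, Dynkin's formula up to a stopping time S not exceeding T_i gives
   E S = E v_i(y_i(0)) - E v_i(y_i(S)).  With S = T_i and S = T = min(T_1, T_2), and v_i = 0 on the
   boundary, this yields E(T_i - T) = E v_i(y_i(T)).  Now |T_1 - T_2| = (T_1 - T) + (T_2 - T), and at
   time T one of the processes, say y_j, is on the boundary, so that only the other summand
   v_i(y_i(T)) survives; it is at most sup |grad v_i| times the distance from y_i(T) to y_j(T).

   Dynkin's formula is obtained by Taylor expansion along a fine time grid, for processes stopped in
   a compact subset of Q.  It needs of the Ito integral only the isometry for increments stopped at
   a stopping time with bounded integrand, which makes the martingale part orthogonal over disjoint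
   steps; the remainder is controlled by a uniform second moment of the sums of squared increments. *)

theory Submission
  imports Defs
begin

section \<open>Increments of the Wiener process\<close>

locale driven_space = prob_space M for M :: "'w measure" +
  fixes F :: "real \<Rightarrow> 'w measure" and w :: "real \<Rightarrow> 'w \<Rightarrow> real^'d::finite"
  assumes filt: "right_continuous_filtration M F"
    and wien: "wiener_process M F w"
begin

lemma F_sub: "0 \<le> t \<Longrightarrow> sets (F t) \<subseteq> sets M"
  and F_space: "0 \<le> t \<Longrightarrow> space (F t) = space M"
  using filt by (auto simp: right_continuous_filtration_def subalgebra_def)

lemma F_measurable_M: "0 \<le> t \<Longrightarrow> f \<in> measurable (F t) N \<Longrightarrow> f \<in> measurable M N"
  using F_sub[of t] F_space[of t] by (auto simp: measurable_def)

lemma F_measurable_mono: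
  "0 \<le> s \<Longrightarrow> s \<le> t \<Longrightarrow> f \<in> measurable (F s) N \<Longrightarrow> f \<in> measurable (F t) N"
  using F_space[of t] F_space[of s] filt
  by (auto simp: measurable_def right_continuous_filtration_def subset_iff)

lemma F_sets_mono: "0 \<le> s \<Longrightarrow> s \<le> t \<Longrightarrow> A \<in> sets (F s) \<Longrightarrow> A \<in> sets (F t)"
  using filt by (auto simp: right_continuous_filtration_def)

lemma w_measurable_F: "0 \<le> t \<Longrightarrow> w t \<in> borel_measurable (F t)"
  using wien by (auto simp: wiener_process_def adapted_def)

lemma w_measurable: "0 \<le> t \<Longrightarrow> w t \<in> borel_measurable M"
  using F_measurable_M w_measurable_F by blast

lemma indep_increment:
  fixes U :: "'w \<Rightarrow> real" and h :: "real^'d \<Rightarrow> real"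
  assumes "0 \<le> s" "s < t" and U: "U \<in> borel_measurable (F s)" and h: "h \<in> borel_measurable borel"
  shows "indep_var borel U borel (\<lambda>\<omega>. h (w t \<omega> - w s \<omega>))"
proof -
  have ind: "indep_set (sets (F s)) (sets (vimage_algebra (space M) (\<lambda>\<omega>. w t \<omega> - w s \<omega>) borel))"
    using wien assms by (auto simp: wiener_process_def)
  have m: "(\<lambda>\<omega>. w t \<omega> - w s \<omega>) \<in> borel_measurable M"
    using w_measurable[of s] w_measurable[of t] assms by auto
  have 1: "sigma_sets (space M) {U -` A \<inter> space M | A. A \<in> sets borel} \<subseteq> sets (F s)"
    using measurable_sets[OF U] F_space[OF assms(1)]
    by (intro sets.sigma_sets_subset'[where M="F s", simplified F_space[OF assms(1)]])
       (auto, metis F_space assms(1) sets.top)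
  have 2: "sigma_sets (space M) {(\<lambda>\<omega>. h (w t \<omega> - w s \<omega>)) -` A \<inter> space M | A. A \<in> sets borel}
     \<subseteq> sets (vimage_algebra (space M) (\<lambda>\<omega>. w t \<omega> - w s \<omega>) borel)"
  proof -
    let ?V = "vimage_algebra (space M) (\<lambda>\<omega>. w t \<omega> - w s \<omega>) borel"
    have "(\<lambda>\<omega>. w t \<omega> - w s \<omega>) \<in> measurable ?V borel"
      by (rule measurable_vimage_algebra1) auto
    hence *: "(\<lambda>\<omega>. h (w t \<omega> - w s \<omega>)) \<in> measurable ?V borel"
      using h by measurable
    show ?thesis
      using measurable_sets[OF *]
      by (intro sets.sigma_sets_subset'[where M="?V", simplified space_vimage_algebra])
         (auto, metis sets.top space_vimage_algebra)
  qed
  have "indep_set (sigma_sets (space M) {U -` A \<inter> space M | A. A \<in> sets borel})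
     (sigma_sets (space M) {(\<lambda>\<omega>. h (w t \<omega> - w s \<omega>)) -` A \<inter> space M | A. A \<in> sets borel})"
    using ind unfolding indep_set_def
    by (rule indep_sets_mono_sets) (use 1 2 in \<open>auto split: bool.splits\<close>)
  moreover have "U \<in> borel_measurable M" using F_measurable_M[OF assms(1) U] .
  moreover have "(\<lambda>\<omega>. h (w t \<omega> - w s \<omega>)) \<in> borel_measurable M" using m h by measurable
  ultimately show ?thesis by (simp add: indep_var_eq)
qed

lemma increment_moments:
  assumes "0 \<le> s" "s < t"
  shows "integrable M (\<lambda>\<omega>. (w t \<omega> - w s \<omega>) $ k)"
    and "expectation (\<lambda>\<omega>. (w t \<omega> - w s \<omega>) $ k) = 0"
    and "integrable M (\<lambda>\<omega>. (w t \<omega> - w s \<omega>) $ k * (w t \<omega> - w s \<omega>) $ j)"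
    and "expectation (\<lambda>\<omega>. (w t \<omega> - w s \<omega>) $ k * (w t \<omega> - w s \<omega>) $ j) = (if k = j then t - s else 0)"
proof -
  let ?D = "\<lambda>k \<omega>. (w t \<omega> - w s \<omega>) $ k"
  let ?\<sigma> = "sqrt (t - s)"
  have pos: "0 < ?\<sigma>" using assms by simp
  have d: "distributed M lborel (?D k) (\<lambda>x. ennreal (normal_density 0 ?\<sigma> x))" for k
    using wien assms by (auto simp: wiener_process_def)
  have i1: "integrable M (?D k)" for k
    by (rule distributed_integrable_var[OF d])
       (use integrable_normal_moment[OF pos, of 0 1] in \<open>auto\<close>)
  have e1: "expectation (?D k) = 0" for k
    using distributed_integral[OF d, of "\<lambda>x. x"] integral_normal_moment_odd[OF pos, of 0 0] by simp
  have i2: "integrable M (\<lambda>\<omega>. ?D k \<omega> * ?D k \<omega>)" for k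
    using distributed_integrable[OF d, of "\<lambda>x. x * x"] integrable_normal_moment[OF pos, of 0 2]
    by (simp add: power2_eq_square)
  have e2: "expectation (\<lambda>\<omega>. ?D k \<omega> * ?D k \<omega>) = t - s" for k
    using distributed_integral[OF d, of "\<lambda>x. x * x"] integral_normal_moment_even[OF pos, of 0 1] assms
    by (simp add: power2_eq_square)
  have iv: "indep_vars (\<lambda>_. borel) ?D UNIV"
    using wien assms by (auto simp: wiener_process_def)
  have ij: "integrable M (\<lambda>\<omega>. ?D k \<omega> * ?D j \<omega>) \<and> expectation (\<lambda>\<omega>. ?D k \<omega> * ?D j \<omega>) = 0" if "k \<noteq> j" for k j
  proof -
    have "indep_vars (\<lambda>_. borel) ?D {k, j}" using iv by (rule indep_vars_subset) auto
    from indep_vars_integrable[OF _ this] indep_vars_lebesgue_integral[OF _ this] i1 e1 that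
    show ?thesis by simp
  qed
  show "integrable M (?D k)" "expectation (?D k) = 0" by (fact i1 e1)+
  show "integrable M (\<lambda>\<omega>. ?D k \<omega> * ?D j \<omega>)"
  proof (cases "k = j")
    case True then show ?thesis using i2 by simp
  next
    case False
    show ?thesis using ij[OF False] by simp
  qed
  show "expectation (\<lambda>\<omega>. ?D k \<omega> * ?D j \<omega>) = (if k = j then t - s else 0)"
  proof (cases "k = j")
    case True then show ?thesis using e2 by simp
  next
    case False
    show ?thesis using ij[OF False] False by simp
  qed
qed

lemma increment_mean_zero:
  assumes "0 \<le> s" "s \<le> t" and U: "U \<in> borel_measurable (F s)" "integrable M U"
  shows "integrable M (\<lambda>\<omega>. U \<omega> * (w t \<omega> - w s \<omega>) $ k)"
    and "expectation (\<lambda>\<omega>. U \<omega> * (w t \<omega> - w s \<omega>) $ k) = 0"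
proof -
  have "integrable M (\<lambda>\<omega>. U \<omega> * (w t \<omega> - w s \<omega>) $ k) \<and> expectation (\<lambda>\<omega>. U \<omega> * (w t \<omega> - w s \<omega>) $ k) = 0"
  proof (cases "s = t")
    case False
    with assms have st: "s < t" by simp
    have ind: "indep_var borel U borel (\<lambda>\<omega>. (w t \<omega> - w s \<omega>) $ k)"
      by (rule indep_increment[OF assms(1) st U(1)]) measurable
    show ?thesis
      using indep_var_integrable[OF ind U(2) increment_moments(1)[OF assms(1) st]]
        indep_var_lebesgue_integral[OF ind U(2) increment_moments(1)[OF assms(1) st]]
        increment_moments(2)[OF assms(1) st] by simp
  qed simp
  then show "integrable M (\<lambda>\<omega>. U \<omega> * (w t \<omega> - w s \<omega>) $ k)"
    "expectation (\<lambda>\<omega>. U \<omega> * (w t \<omega> - w s \<omega>) $ k) = 0" by auto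
qed

lemma increment_covariance:
  assumes "0 \<le> s" "s \<le> t" and U: "U \<in> borel_measurable (F s)" "integrable M U"
  shows "integrable M (\<lambda>\<omega>. U \<omega> * ((w t \<omega> - w s \<omega>) $ k * (w t \<omega> - w s \<omega>) $ j))"
    and "expectation (\<lambda>\<omega>. U \<omega> * ((w t \<omega> - w s \<omega>) $ k * (w t \<omega> - w s \<omega>) $ j)) =
           (if k = j then (t - s) * expectation U else 0)"
proof -
  have "integrable M (\<lambda>\<omega>. U \<omega> * ((w t \<omega> - w s \<omega>) $ k * (w t \<omega> - w s \<omega>) $ j)) \<and>
     expectation (\<lambda>\<omega>. U \<omega> * ((w t \<omega> - w s \<omega>) $ k * (w t \<omega> - w s \<omega>) $ j)) =
           (if k = j then (t - s) * expectation U else 0)"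
  proof (cases "s = t")
    case False
    with assms have st: "s < t" by simp
    note ind = indep_increment[OF assms(1) st U(1), of "\<lambda>x. x $ k * x $ j", simplified]
    show ?thesis
      using indep_var_integrable[OF ind U(2) increment_moments(3)[OF assms(1) st, simplified]]
        indep_var_lebesgue_integral[OF ind U(2) increment_moments(3)[OF assms(1) st, simplified]]
        increment_moments(4)[OF assms(1) st] by simp
  qed simp
  then show "integrable M (\<lambda>\<omega>. U \<omega> * ((w t \<omega> - w s \<omega>) $ k * (w t \<omega> - w s \<omega>) $ j))"
    "expectation (\<lambda>\<omega>. U \<omega> * ((w t \<omega> - w s \<omega>) $ k * (w t \<omega> - w s \<omega>) $ j)) =
           (if k = j then (t - s) * expectation U else 0)" by auto
qed

end

section \<open>Integrals of step processes\<close>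

context driven_space begin

lemma integrable_bounded_mult:
  fixes f g :: "'w \<Rightarrow> real"
  assumes "integrable M f" "g \<in> borel_measurable M" "\<And>\<omega>. \<omega> \<in> space M \<Longrightarrow> \<bar>g \<omega>\<bar> \<le> C"
  shows "integrable M (\<lambda>\<omega>. f \<omega> * g \<omega>)"
proof (rule Bochner_Integration.integrable_bound[of M "\<lambda>\<omega>. C * \<bar>f \<omega>\<bar>"])
  show "AE \<omega> in M. norm (f \<omega> * g \<omega>) \<le> norm (C * \<bar>f \<omega>\<bar>)"
  proof (rule AE_I2)
    fix \<omega> assume "\<omega> \<in> space M"
    from assms(3)[OF this] have "\<bar>f \<omega>\<bar> * \<bar>g \<omega>\<bar> \<le> \<bar>f \<omega>\<bar> * \<bar>C\<bar>"
      by (intro mult_left_mono) auto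
    then show "norm (f \<omega> * g \<omega>) \<le> norm (C * \<bar>f \<omega>\<bar>)"
      by (simp add: abs_mult mult.commute)
  qed
qed (use assms in auto)

lemma increment_measurable_F:
  assumes "0 \<le> s" "s \<le> u" "0 \<le> t" "t \<le> u"
  shows "(\<lambda>\<omega>. (w t \<omega> - w s \<omega>) $ k) \<in> borel_measurable (F u)"
proof -
  have [measurable]: "w s \<in> borel_measurable (F u)" "w t \<in> borel_measurable (F u)"
    using F_measurable_mono w_measurable_F assms by blast+
  show ?thesis unfolding vector_minus_component
    by (intro borel_measurable_diff measurable_compose[OF _ borel_measurable_nth]) measurable
qed

lemma increment_product_same_start:
  assumes s: "0 \<le> s" "s \<le> t" "s \<le> t'" and G: "G \<in> borel_measurable (F s)" "integrable M G"
  shows "integrable M (\<lambda>\<omega>. G \<omega> * ((w t \<omega> - w s \<omega>) $ k * (w t' \<omega> - w s \<omega>) $ j)) \<and>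
    expectation (\<lambda>\<omega>. G \<omega> * ((w t \<omega> - w s \<omega>) $ k * (w t' \<omega> - w s \<omega>) $ j)) =
      (if k = j then (min t t' - s) * expectation G else 0)"
proof -
  have main: "integrable M (\<lambda>\<omega>. G \<omega> * ((w t \<omega> - w s \<omega>) $ k * (w t' \<omega> - w s \<omega>) $ j)) \<and>
    expectation (\<lambda>\<omega>. G \<omega> * ((w t \<omega> - w s \<omega>) $ k * (w t' \<omega> - w s \<omega>) $ j)) =
      (if k = j then (t - s) * expectation G else 0)"
    if "s \<le> t" "t \<le> t'" for t t' k j
  proof -
    note a = increment_covariance[OF s(1) that(1) G, of k j]
    have m: "(\<lambda>\<omega>. G \<omega> * (w t \<omega> - w s \<omega>) $ k) \<in> borel_measurable (F t)"
      by (intro borel_measurable_times F_measurable_mono[OF s(1) that(1) G(1)] increment_measurable_F)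
        (use s that in auto)
    note b = increment_mean_zero[OF _ that(2) m increment_mean_zero(1)[OF s(1) that(1) G], of j]
    have eq: "G \<omega> * ((w t \<omega> - w s \<omega>) $ k * (w t' \<omega> - w s \<omega>) $ j) =
      G \<omega> * ((w t \<omega> - w s \<omega>) $ k * (w t \<omega> - w s \<omega>) $ j)
      + (G \<omega> * (w t \<omega> - w s \<omega>) $ k) * (w t' \<omega> - w t \<omega>) $ j" for \<omega>
      by (simp add: algebra_simps)
    from a b show ?thesis using s that unfolding eq by (auto simp del: vector_minus_component)
  qed
  show ?thesis
  proof (cases "t \<le> t'")
    case True then show ?thesis using main[of t t' k j] s by simp
  next
    case False
    then show ?thesis using main[of t' t j k] s by (simp add: mult.commute)
  qed
qed

definition overlap :: "real \<Rightarrow> real \<Rightarrow> real \<Rightarrow> real \<Rightarrow> real" where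
  "overlap l r l' r' = max 0 (min r r' - max l l')"

lemma increment_product_ordered:
  assumes l: "0 \<le> l" "l < r" "l' < r'" "l \<le> l'"
    and U: "U \<in> borel_measurable (F l)" "\<And>\<omega>. \<omega> \<in> space M \<Longrightarrow> \<bar>U \<omega>\<bar> \<le> (C::real)"
    and V: "V \<in> borel_measurable (F l')" "\<And>\<omega>. \<omega> \<in> space M \<Longrightarrow> \<bar>V \<omega>\<bar> \<le> (C'::real)"
  shows "integrable M (\<lambda>\<omega>. (U \<omega> * (w r \<omega> - w l \<omega>) $ k) * (V \<omega> * (w r' \<omega> - w l' \<omega>) $ j)) \<and>
    expectation (\<lambda>\<omega>. (U \<omega> * (w r \<omega> - w l \<omega>) $ k) * (V \<omega> * (w r' \<omega> - w l' \<omega>) $ j)) =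
      (if k = j then overlap l r l' r' * expectation (\<lambda>\<omega>. U \<omega> * V \<omega>) else 0)"
proof -
  have l': "0 \<le> l'" using l by simp
  note UM = F_measurable_M[OF l(1) U(1)] and VM = F_measurable_M[OF l' V(1)]
  note Ul' = F_measurable_mono[OF l(1) l(4) U(1)]
  have iU: "integrable M U" by (rule integrable_const_bound[of _ C]) (use U UM in auto)
  have iUV: "integrable M (\<lambda>\<omega>. U \<omega> * V \<omega>)" by (rule integrable_bounded_mult[OF iU VM V(2)])
  have mid: "integrable M (\<lambda>\<omega>. ((U \<omega> * (w q \<omega> - w l \<omega>) $ k) * V \<omega>) * (w r' \<omega> - w l' \<omega>) $ j) \<and>
     expectation (\<lambda>\<omega>. ((U \<omega> * (w q \<omega> - w l \<omega>) $ k) * V \<omega>) * (w r' \<omega> - w l' \<omega>) $ j) = 0"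
    if "l \<le> q" "q \<le> l'" for q
  proof -
    have q: "0 \<le> q" using that l by simp
    have m: "(\<lambda>\<omega>. (U \<omega> * (w q \<omega> - w l \<omega>) $ k) * V \<omega>) \<in> borel_measurable (F l')"
      by (intro borel_measurable_times Ul' V(1) increment_measurable_F) (use q that l in auto)
    have i: "integrable M (\<lambda>\<omega>. (U \<omega> * (w q \<omega> - w l \<omega>) $ k) * V \<omega>)"
      by (rule integrable_bounded_mult[OF increment_mean_zero(1)[OF l(1) that(1) U(1) iU] VM V(2)])
    show ?thesis using increment_mean_zero[OF l' less_imp_le[OF l(3)] m i] by blast
  qed
  show ?thesis
  proof (cases "r \<le> l'")
    case True
    then show ?thesis using mid[of r] l by (simp add: overlap_def mult.assoc)
  next
    case False
    have mUV: "(\<lambda>\<omega>. U \<omega> * V \<omega>) \<in> borel_measurable (F l')" using Ul' V(1) by measurable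
    note b = increment_product_same_start[OF l' _ _ mUV iUV, of r r' k j]
    have eq: "(U \<omega> * (w r \<omega> - w l \<omega>) $ k) * (V \<omega> * (w r' \<omega> - w l' \<omega>) $ j) =
       ((U \<omega> * (w l' \<omega> - w l \<omega>) $ k) * V \<omega>) * (w r' \<omega> - w l' \<omega>) $ j
       + U \<omega> * V \<omega> * ((w r \<omega> - w l' \<omega>) $ k * (w r' \<omega> - w l' \<omega>) $ j)" for \<omega>
      by (simp add: algebra_simps)
    have "overlap l r l' r' = min r r' - l'" using False l by (simp add: overlap_def)
    with b mid[of l'] False l show ?thesis unfolding eq by (auto simp del: vector_minus_component)
  qed
qed

lemma increment_product:
  assumes l: "0 \<le> l" "l < r" "0 \<le> l'" "l' < r'"
    and U: "U \<in> borel_measurable (F l)" "\<And>\<omega>. \<omega> \<in> space M \<Longrightarrow> \<bar>U \<omega>\<bar> \<le> (C::real)"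
    and V: "V \<in> borel_measurable (F l')" "\<And>\<omega>. \<omega> \<in> space M \<Longrightarrow> \<bar>V \<omega>\<bar> \<le> (C'::real)"
  shows "integrable M (\<lambda>\<omega>. (U \<omega> * (w r \<omega> - w l \<omega>) $ k) * (V \<omega> * (w r' \<omega> - w l' \<omega>) $ j)) \<and>
    expectation (\<lambda>\<omega>. (U \<omega> * (w r \<omega> - w l \<omega>) $ k) * (V \<omega> * (w r' \<omega> - w l' \<omega>) $ j)) =
      (if k = j then overlap l r l' r' * expectation (\<lambda>\<omega>. U \<omega> * V \<omega>) else 0)"
proof (cases "l \<le> l'")
  case True
  show ?thesis by (rule increment_product_ordered[OF l(1,2,4) True U V])
next
  case False
  have "overlap l' r' l r = overlap l r l' r'" by (simp add: overlap_def min.commute max.commute)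
  then show ?thesis
    using increment_product_ordered[OF l(3,4,2) _ V U, of j k] False by (auto simp: mult.commute)
qed

lemma inner_sum_sum:
  fixes a b :: "nat \<Rightarrow> 'v::real_inner"
  shows "(\<Sum>i<N. a i) \<bullet> (\<Sum>j<N'. b j) = (\<Sum>i<N. \<Sum>j<N'. a i \<bullet> b j)"
  by (subst inner_sum_left) (simp add: inner_sum_right)

lemma integral_quadratic:
  fixes A B C :: "'x \<Rightarrow> real"
  assumes "integrable P A" "integrable P B" "integrable P C"
  shows "(\<integral>x. A x - 2 * B x + C x \<partial>P) = integral\<^sup>L P A - 2 * integral\<^sup>L P B + integral\<^sup>L P C"
  using assms by simp

lemma integral_double_sum_eq:
  fixes A :: "nat \<Rightarrow> nat \<Rightarrow> 'x \<Rightarrow> real" and B :: "nat \<Rightarrow> nat \<Rightarrow> 'y \<Rightarrow> real"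
  assumes "\<And>i j. i < N \<Longrightarrow> j < N' \<Longrightarrow> integrable P (A i j)"
    and "\<And>i j. i < N \<Longrightarrow> j < N' \<Longrightarrow> integrable R (B i j)"
    and "\<And>i j. i < N \<Longrightarrow> j < N' \<Longrightarrow> integral\<^sup>L P (A i j) = integral\<^sup>L R (B i j)"
  shows "(\<integral>x. (\<Sum>i<N. \<Sum>j<N'. A i j x) \<partial>P) = (\<integral>x. (\<Sum>i<N. \<Sum>j<N'. B i j x) \<partial>R)"
proof -
  have *: "(\<integral>x. (\<Sum>i<N. \<Sum>j<N'. D i j x) \<partial>L) = (\<Sum>i<N. \<Sum>j<N'. integral\<^sup>L L (D i j))"
    if D: "\<And>i j. i < N \<Longrightarrow> j < N' \<Longrightarrow> integrable L (D i j)"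
    for D :: "nat \<Rightarrow> nat \<Rightarrow> 'z \<Rightarrow> real" and L
  proof -
    have "(\<integral>x. (\<Sum>i<N. \<Sum>j<N'. D i j x) \<partial>L) = (\<Sum>i<N. \<integral>x. (\<Sum>j<N'. D i j x) \<partial>L)"
      using D by (intro Bochner_Integration.integral_sum Bochner_Integration.integrable_sum) auto
    also have "\<dots> = (\<Sum>i<N. \<Sum>j<N'. integral\<^sup>L L (D i j))"
      using D by (intro sum.cong refl Bochner_Integration.integral_sum) auto
    finally show ?thesis .
  qed
  show ?thesis using assms by (simp add: *)
qed

text \<open>The time intervals may overlap, so that step processes with different jump times can be
  compared without a common refinement.\<close>

definition step_integral :: "(real \<Rightarrow> 'w \<Rightarrow> real^'d) \<Rightarrow> ('w \<Rightarrow> real) \<Rightarrow> bool" where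
  "step_integral Z X \<longleftrightarrow> (\<exists>(N::nat) l r \<xi>.
     (\<forall>i<N. 0 \<le> l i \<and> l i < r i \<and> \<xi> i \<in> borel_measurable (F (l i)) \<and>
        (\<exists>C. \<forall>\<omega>\<in>space M. norm (\<xi> i \<omega>) \<le> C)) \<and>
     Z = (\<lambda>s \<omega>. \<Sum>i<N. indicator {l i<..r i} s *\<^sub>R \<xi> i \<omega>) \<and>
     X = (\<lambda>\<omega>. \<Sum>i<N. \<xi> i \<omega> \<bullet> (w (r i) \<omega> - w (l i) \<omega>)))"

lemma integral_overlap:
  assumes "l < r" "l' < r'"
  shows "integrable lborel (\<lambda>s. indicator {l<..r} s * indicator {l'<..r'} s :: real)"
    and "(\<integral>s. indicator {l<..r} s * indicator {l'<..r'} s \<partial>lborel) = overlap l r l' r'"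
proof -
  have eq: "(\<lambda>s. indicator {l<..r} s * indicator {l'<..r'} s :: real) = indicator {max l l'<..min r r'}"
    by (auto simp: indicator_def fun_eq_iff)
  show "integrable lborel (\<lambda>s. indicator {l<..r} s * indicator {l'<..r'} s :: real)"
    unfolding eq by (cases "max l l' \<le> min r r'") (auto simp: integrable_indicator_iff)
  show "(\<integral>s. indicator {l<..r} s * indicator {l'<..r'} s \<partial>lborel) = overlap l r l' r'"
    unfolding eq by (cases "max l l' \<le> min r r'") (auto simp: overlap_def)
qed

sublocale PL: pair_sigma_finite M lborel
  by unfold_locales

lemma step_integral_isometry_term:
  assumes l: "0 \<le> l" "l < r" "0 \<le> l'" "l' < r'"
    and U: "\<xi> \<in> borel_measurable (F l)" "\<And>\<omega>. \<omega> \<in> space M \<Longrightarrow> norm (\<xi> \<omega> :: real^'d) \<le> C"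
    and V: "\<eta> \<in> borel_measurable (F l')" "\<And>\<omega>. \<omega> \<in> space M \<Longrightarrow> norm (\<eta> \<omega> :: real^'d) \<le> C'"
  defines "X \<equiv> \<lambda>\<omega>. (\<xi> \<omega> \<bullet> (w r \<omega> - w l \<omega>)) * (\<eta> \<omega> \<bullet> (w r' \<omega> - w l' \<omega>))"
    and "Z \<equiv> \<lambda>(\<omega>, s). (indicator {l<..r} s *\<^sub>R \<xi> \<omega>) \<bullet> (indicator {l'<..r'} s *\<^sub>R \<eta> \<omega>)"
  shows "integrable M X" "integrable (M \<Otimes>\<^sub>M lborel) Z" "expectation X = integral\<^sup>L (M \<Otimes>\<^sub>M lborel) Z"
proof -
  note UM[measurable] = F_measurable_M[OF l(1) U(1)] and VM[measurable] = F_measurable_M[OF l(3) V(1)]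
  have U': "\<bar>\<xi> \<omega> $ k\<bar> \<le> C" if "\<omega> \<in> space M" for \<omega> k
    using component_le_norm_cart[of "\<xi> \<omega>" k] U(2)[OF that] by linarith
  have V': "\<bar>\<eta> \<omega> $ k\<bar> \<le> C'" if "\<omega> \<in> space M" for \<omega> k
    using component_le_norm_cart[of "\<eta> \<omega>" k] V(2)[OF that] by linarith
  have t: "integrable M (\<lambda>\<omega>. (\<xi> \<omega> $ k * (w r \<omega> - w l \<omega>) $ k) * (\<eta> \<omega> $ j * (w r' \<omega> - w l' \<omega>) $ j)) \<and>
    expectation (\<lambda>\<omega>. (\<xi> \<omega> $ k * (w r \<omega> - w l \<omega>) $ k) * (\<eta> \<omega> $ j * (w r' \<omega> - w l' \<omega>) $ j)) =
      (if k = j then overlap l r l' r' * expectation (\<lambda>\<omega>. \<xi> \<omega> $ k * \<eta> \<omega> $ j) else 0)" for k j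
    by (rule increment_product[OF l _ U' _ V'])
       (auto intro: measurable_compose[OF U(1) borel_measurable_nth] measurable_compose[OF V(1) borel_measurable_nth])
  have X: "X = (\<lambda>\<omega>. \<Sum>k\<in>UNIV. \<Sum>j\<in>UNIV.
      (\<xi> \<omega> $ k * (w r \<omega> - w l \<omega>) $ k) * (\<eta> \<omega> $ j * (w r' \<omega> - w l' \<omega>) $ j))"
    unfolding X_def inner_vec_def sum_product by simp
  show "integrable M X" unfolding X using t by (intro Bochner_Integration.integrable_sum) blast
  have ik: "integrable M (\<lambda>\<omega>. \<xi> \<omega> $ k * \<eta> \<omega> $ k)" for k
    by (rule integrable_bounded_mult[OF integrable_const_bound[of _ C]])
       (use U' V' in \<open>auto intro: measurable_compose[OF UM borel_measurable_nth] measurable_compose[OF VM borel_measurable_nth]\<close>)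
  have "expectation X = (\<Sum>k\<in>UNIV. \<Sum>j\<in>UNIV. if k = j then overlap l r l' r' * expectation (\<lambda>\<omega>. \<xi> \<omega> $ k * \<eta> \<omega> $ j) else 0)"
    unfolding X using t by (simp add: Bochner_Integration.integral_sum Bochner_Integration.integrable_sum)
  also have "\<dots> = overlap l r l' r' * expectation (\<lambda>\<omega>. \<xi> \<omega> \<bullet> \<eta> \<omega>)"
    using ik by (simp add: inner_vec_def sum_distrib_left)
  finally have eX: "expectation X = overlap l r l' r' * expectation (\<lambda>\<omega>. \<xi> \<omega> \<bullet> \<eta> \<omega>)" .
  have ii: "integrable M (\<lambda>\<omega>. \<xi> \<omega> \<bullet> \<eta> \<omega>)" using ik by (simp add: inner_vec_def)
  have Z: "Z = (\<lambda>(\<omega>, s). (\<xi> \<omega> \<bullet> \<eta> \<omega>) *\<^sub>R (indicator {l<..r} s * indicator {l'<..r'} s))"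
    unfolding Z_def by (auto simp: fun_eq_iff)
  show iZ: "integrable (M \<Otimes>\<^sub>M lborel) Z"
  proof (rule PL.Fubini_integrable)
    show "Z \<in> borel_measurable (M \<Otimes>\<^sub>M lborel)" unfolding Z by measurable
    show "integrable M (\<lambda>x. LINT y|lborel. norm (Z (x, y)))"
      using ii integral_overlap[OF l(2,4)] by (simp add: Z abs_mult)
    show "AE x in M. integrable lborel (\<lambda>y. Z (x, y))"
      using integral_overlap[OF l(2,4)] by (simp add: Z)
  qed
  have "integral\<^sup>L (M \<Otimes>\<^sub>M lborel) Z = (\<integral>\<omega>. \<integral>s. Z (\<omega>, s) \<partial>lborel \<partial>M)"
    using PL.integral_fst'[OF iZ] by simp
  also have "\<dots> = overlap l r l' r' * expectation (\<lambda>\<omega>. \<xi> \<omega> \<bullet> \<eta> \<omega>)"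
    using integral_overlap[OF l(2,4)] by (simp add: Z)
  finally show "expectation X = integral\<^sup>L (M \<Otimes>\<^sub>M lborel) Z" using eX by simp
qed

lemma step_integral_isometry:
  assumes "step_integral Z X" "step_integral W Y"
  shows "integrable M (\<lambda>\<omega>. X \<omega> * Y \<omega>)"
    and "integrable (M \<Otimes>\<^sub>M lborel) (\<lambda>(\<omega>, s). Z s \<omega> \<bullet> W s \<omega>)"
    and "expectation (\<lambda>\<omega>. X \<omega> * Y \<omega>) = (\<integral>(\<omega>, s). Z s \<omega> \<bullet> W s \<omega> \<partial>(M \<Otimes>\<^sub>M lborel))"
proof -
  obtain N l r \<xi> where 1: "\<forall>i<N::nat. 0 \<le> l i \<and> l i < r i \<and> \<xi> i \<in> borel_measurable (F (l i)) \<and>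
        (\<exists>C. \<forall>\<omega>\<in>space M. norm (\<xi> i \<omega>) \<le> C)" and Z: "Z = (\<lambda>s \<omega>. \<Sum>i<N. indicator {l i<..r i} s *\<^sub>R \<xi> i \<omega>)"
    and X: "X = (\<lambda>\<omega>. \<Sum>i<N. \<xi> i \<omega> \<bullet> (w (r i) \<omega> - w (l i) \<omega>))"
    using assms(1) unfolding step_integral_def by blast
  obtain N' l' r' \<eta> where 2: "\<forall>i<N'::nat. 0 \<le> l' i \<and> l' i < r' i \<and> \<eta> i \<in> borel_measurable (F (l' i)) \<and>
        (\<exists>C. \<forall>\<omega>\<in>space M. norm (\<eta> i \<omega>) \<le> C)" and W: "W = (\<lambda>s \<omega>. \<Sum>i<N'. indicator {l' i<..r' i} s *\<^sub>R \<eta> i \<omega>)"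
    and Y: "Y = (\<lambda>\<omega>. \<Sum>i<N'. \<eta> i \<omega> \<bullet> (w (r' i) \<omega> - w (l' i) \<omega>))"
    using assms(2) unfolding step_integral_def by blast
  let ?x = "\<lambda>i j \<omega>. (\<xi> i \<omega> \<bullet> (w (r i) \<omega> - w (l i) \<omega>)) * (\<eta> j \<omega> \<bullet> (w (r' j) \<omega> - w (l' j) \<omega>))"
  let ?z = "\<lambda>i j. \<lambda>(\<omega>, s). (indicator {l i<..r i} s *\<^sub>R \<xi> i \<omega>) \<bullet> (indicator {l' j<..r' j} s *\<^sub>R \<eta> j \<omega>)"
  have t: "integrable M (?x i j) \<and> integrable (M \<Otimes>\<^sub>M lborel) (?z i j) \<and>
      expectation (?x i j) = integral\<^sup>L (M \<Otimes>\<^sub>M lborel) (?z i j)"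
    if ij: "i < N" "j < N'" for i j
  proof -
    from 1 2 ij obtain C C' where "\<And>\<omega>. \<omega> \<in> space M \<Longrightarrow> norm (\<xi> i \<omega>) \<le> C"
      "\<And>\<omega>. \<omega> \<in> space M \<Longrightarrow> norm (\<eta> j \<omega>) \<le> C'" by blast
    with 1 2 ij step_integral_isometry_term[of "l i" "r i" "l' j" "r' j" "\<xi> i" C "\<eta> j" C']
    show ?thesis by blast
  qed
  have eX: "(\<lambda>\<omega>. X \<omega> * Y \<omega>) = (\<lambda>\<omega>. \<Sum>i<N. \<Sum>j<N'. ?x i j \<omega>)"
    unfolding X Y sum_product ..
  have eZ: "(\<lambda>(\<omega>, s). Z s \<omega> \<bullet> W s \<omega>) = (\<lambda>x. \<Sum>i<N. \<Sum>j<N'. ?z i j x)"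
    unfolding Z W inner_sum_sum case_prod_unfold ..
  show "integrable M (\<lambda>\<omega>. X \<omega> * Y \<omega>)"
    unfolding eX using t by (intro Bochner_Integration.integrable_sum) auto
  show "integrable (M \<Otimes>\<^sub>M lborel) (\<lambda>(\<omega>, s). Z s \<omega> \<bullet> W s \<omega>)"
    unfolding eZ using t by (intro Bochner_Integration.integrable_sum) auto
  show "expectation (\<lambda>\<omega>. X \<omega> * Y \<omega>) = (\<integral>(\<omega>, s). Z s \<omega> \<bullet> W s \<omega> \<partial>(M \<Otimes>\<^sub>M lborel))"
    unfolding eX eZ using t by (intro integral_double_sum_eq) auto
qed

lemma step_integral_mean:
  assumes "step_integral Z X"
  shows "integrable M X" "expectation X = 0"
proof -
  obtain N l r \<xi> where 1: "\<forall>i<N::nat. 0 \<le> l i \<and> l i < r i \<and> \<xi> i \<in> borel_measurable (F (l i)) \<and>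
        (\<exists>C. \<forall>\<omega>\<in>space M. norm (\<xi> i \<omega>) \<le> C)"
    and X: "X = (\<lambda>\<omega>. \<Sum>i<N. \<xi> i \<omega> \<bullet> (w (r i) \<omega> - w (l i) \<omega>))"
    using assms(1) unfolding step_integral_def by blast
  have t: "integrable M (\<lambda>\<omega>. \<xi> i \<omega> $ k * (w (r i) \<omega> - w (l i) \<omega>) $ k) \<and>
     expectation (\<lambda>\<omega>. \<xi> i \<omega> $ k * (w (r i) \<omega> - w (l i) \<omega>) $ k) = 0" if i: "i < N" for i k
  proof -
    from 1 i obtain C where C: "\<And>\<omega>. \<omega> \<in> space M \<Longrightarrow> norm (\<xi> i \<omega>) \<le> C"
      and m: "\<xi> i \<in> borel_measurable (F (l i))" and l: "0 \<le> l i" "l i \<le> r i" by force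
    have mk: "(\<lambda>\<omega>. \<xi> i \<omega> $ k) \<in> borel_measurable (F (l i))" by (rule measurable_compose[OF m borel_measurable_nth])
    have "integrable M (\<lambda>\<omega>. \<xi> i \<omega> $ k)"
      by (rule integrable_const_bound[of _ C])
         (use F_measurable_M[OF l(1) mk] C component_le_norm_cart[of "\<xi> i _" k] in \<open>auto intro: order_trans\<close>)
    from increment_mean_zero[OF l mk this] show ?thesis by blast
  qed
  show "integrable M X" unfolding X inner_vec_def using t
    by (auto intro!: Bochner_Integration.integrable_sum simp del: vector_minus_component)
  show "expectation X = 0" unfolding X inner_vec_def using t
    by (simp add: Bochner_Integration.integral_sum Bochner_Integration.integrable_sum del: vector_minus_component)
qed

lemma step_integral_measurable:
  assumes "step_integral Z X"
  shows "(\<lambda>(\<omega>, s). Z s \<omega>) \<in> borel_measurable (M \<Otimes>\<^sub>M lborel)" "X \<in> borel_measurable M"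
proof -
  obtain N l r \<xi> where 1: "\<forall>i<N::nat. 0 \<le> l i \<and> l i < r i \<and> \<xi> i \<in> borel_measurable (F (l i)) \<and>
        (\<exists>C. \<forall>\<omega>\<in>space M. norm (\<xi> i \<omega>) \<le> C)" and Z: "Z = (\<lambda>s \<omega>. \<Sum>i<N. indicator {l i<..r i} s *\<^sub>R \<xi> i \<omega>)"
    using assms(1) unfolding step_integral_def by blast
  have m: "\<xi> i \<in> borel_measurable M" if "i < N" for i
    using 1 that F_measurable_M by blast
  have "(\<lambda>x. \<Sum>i<N. indicator {l i<..r i} (snd x) *\<^sub>R \<xi> i (fst x)) \<in> borel_measurable (M \<Otimes>\<^sub>M lborel)"
    using m by (intro borel_measurable_sum borel_measurable_scaleR) (auto intro: measurable_compose[OF measurable_fst])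
  then show "(\<lambda>(\<omega>, s). Z s \<omega>) \<in> borel_measurable (M \<Otimes>\<^sub>M lborel)"
    unfolding Z by (simp add: case_prod_unfold)
  show "X \<in> borel_measurable M" using step_integral_mean(1)[OF assms] by auto
qed

lemma step_integral_distance:
  assumes "step_integral Z X" "step_integral W Y"
  shows "integrable M (\<lambda>\<omega>. (X \<omega> - Y \<omega>)\<^sup>2)"
    and "integrable (M \<Otimes>\<^sub>M lborel) (\<lambda>(\<omega>, s). (norm (Z s \<omega> - W s \<omega>))\<^sup>2)"
    and "expectation (\<lambda>\<omega>. (X \<omega> - Y \<omega>)\<^sup>2) = (\<integral>(\<omega>, s). (norm (Z s \<omega> - W s \<omega>))\<^sup>2 \<partial>(M \<Otimes>\<^sub>M lborel))"
proof -
  note ZZ = step_integral_isometry[OF assms(1,1)] and ZW = step_integral_isometry[OF assms]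
    and WW = step_integral_isometry[OF assms(2,2)]
  have eX: "(\<lambda>\<omega>. (X \<omega> - Y \<omega>)\<^sup>2) = (\<lambda>\<omega>. X \<omega> * X \<omega> - 2 * (X \<omega> * Y \<omega>) + Y \<omega> * Y \<omega>)"
    by (auto simp: power2_eq_square algebra_simps)
  have eZ: "(\<lambda>(\<omega>, s). (norm (Z s \<omega> - W s \<omega>))\<^sup>2) = (\<lambda>x. (\<lambda>(\<omega>, s). Z s \<omega> \<bullet> Z s \<omega>) x
      - 2 * (\<lambda>(\<omega>, s). Z s \<omega> \<bullet> W s \<omega>) x + (\<lambda>(\<omega>, s). W s \<omega> \<bullet> W s \<omega>) x)"
    by (auto simp: power2_norm_eq_inner fun_eq_iff inner_diff inner_commute)
  show "integrable M (\<lambda>\<omega>. (X \<omega> - Y \<omega>)\<^sup>2)" unfolding eX using ZZ ZW WW by auto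
  show "integrable (M \<Otimes>\<^sub>M lborel) (\<lambda>(\<omega>, s). (norm (Z s \<omega> - W s \<omega>))\<^sup>2)"
    unfolding eZ using ZZ(2) ZW(2) WW(2) by (intro Bochner_Integration.integrable_add
      Bochner_Integration.integrable_diff integrable_mult_right)
  show "expectation (\<lambda>\<omega>. (X \<omega> - Y \<omega>)\<^sup>2) = (\<integral>(\<omega>, s). (norm (Z s \<omega> - W s \<omega>))\<^sup>2 \<partial>(M \<Otimes>\<^sub>M lborel))"
  proof -
    have "expectation (\<lambda>\<omega>. (X \<omega> - Y \<omega>)\<^sup>2) = expectation (\<lambda>\<omega>. X \<omega> * X \<omega>) - 2 * expectation (\<lambda>\<omega>. X \<omega> * Y \<omega>)
       + expectation (\<lambda>\<omega>. Y \<omega> * Y \<omega>)" unfolding eX using ZZ(1) ZW(1) WW(1) by simp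
    also have "\<dots> = (\<integral>(\<omega>, s). (norm (Z s \<omega> - W s \<omega>))\<^sup>2 \<partial>(M \<Otimes>\<^sub>M lborel))"
      unfolding eZ using ZZ(2) ZW(2) WW(2)
      by (subst integral_quadratic) (simp_all add: ZZ(3) ZW(3) WW(3))
    finally show ?thesis .
  qed
qed

end

section \<open>Mean-square limits of step integrals\<close>

lemma integrable_inner_of_squares:
  fixes f g :: "'x \<Rightarrow> 'v::euclidean_space"
  assumes [measurable]: "f \<in> borel_measurable P" "g \<in> borel_measurable P"
    and "integrable P (\<lambda>x. (norm (f x))\<^sup>2)" "integrable P (\<lambda>x. (norm (g x))\<^sup>2)"
  shows "integrable P (\<lambda>x. f x \<bullet> g x)"
proof (rule Bochner_Integration.integrable_bound[of P "\<lambda>x. (norm (f x))\<^sup>2 + (norm (g x))\<^sup>2"])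
  show "AE x in P. norm (f x \<bullet> g x) \<le> norm ((norm (f x))\<^sup>2 + (norm (g x))\<^sup>2)"
  proof (rule AE_I2)
    fix x
    have "\<bar>f x \<bullet> g x\<bar> \<le> norm (f x) * norm (g x)" by (rule Cauchy_Schwarz_ineq2)
    also have "\<dots> \<le> (norm (f x))\<^sup>2 + (norm (g x))\<^sup>2"
      using sum_squares_bound[of "norm (f x)" "norm (g x)"] mult_nonneg_nonneg[OF norm_ge_zero norm_ge_zero, of "f x" "g x"]
      by linarith
    finally show "norm (f x \<bullet> g x) \<le> norm ((norm (f x))\<^sup>2 + (norm (g x))\<^sup>2)" by simp
  qed
qed (use assms in auto)

lemma integrable_square_diff:
  fixes f g :: "'x \<Rightarrow> 'v::euclidean_space"
  assumes [measurable]: "f \<in> borel_measurable P" "g \<in> borel_measurable P"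
    and "integrable P (\<lambda>x. (norm (f x))\<^sup>2)" "integrable P (\<lambda>x. (norm (g x))\<^sup>2)"
  shows "integrable P (\<lambda>x. (norm (f x - g x))\<^sup>2)"
proof -
  have "(\<lambda>x. (norm (f x - g x))\<^sup>2) = (\<lambda>x. (norm (f x))\<^sup>2 - 2 * (f x \<bullet> g x) + (norm (g x))\<^sup>2)"
    by (auto simp: power2_norm_eq_inner inner_diff inner_commute)
  then show ?thesis using assms integrable_inner_of_squares[OF assms] by simp
qed

lemma young: fixes a b l :: real assumes "l > 0" shows "\<bar>a * b\<bar> \<le> a\<^sup>2 / l + l * b\<^sup>2"
proof -
  have "0 \<le> (\<bar>a\<bar> - l * \<bar>b\<bar>)\<^sup>2" by simp
  then have *: "2 * \<bar>a\<bar> * (l * \<bar>b\<bar>) \<le> a\<^sup>2 + l\<^sup>2 * b\<^sup>2"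
    by (simp add: power2_diff power_mult_distrib)
  have "\<bar>a * b\<bar> * l \<le> 2 * \<bar>a\<bar> * (l * \<bar>b\<bar>)" using assms by (simp add: abs_mult)
  also note *
  finally have "\<bar>a * b\<bar> \<le> (a\<^sup>2 + l\<^sup>2 * b\<^sup>2) / l"
    using assms by (simp add: pos_le_divide_eq)
  also have "\<dots> = a\<^sup>2 / l + l * b\<^sup>2"
    using assms by (simp add: add_divide_distrib power2_eq_square)
  finally show ?thesis .
qed

lemma L2_inner_bound:
  fixes f g :: "'x \<Rightarrow> 'v::euclidean_space"
  assumes "f \<in> borel_measurable P" "g \<in> borel_measurable P"
    and "integrable P (\<lambda>x. (norm (f x))\<^sup>2)" "integrable P (\<lambda>x. (norm (g x))\<^sup>2)" and l: "l > 0"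
  shows "\<bar>\<integral>x. f x \<bullet> g x \<partial>P\<bar> \<le> (\<integral>x. (norm (f x))\<^sup>2 \<partial>P) / l + l * (\<integral>x. (norm (g x))\<^sup>2 \<partial>P)"
proof -
  have "\<bar>\<integral>x. f x \<bullet> g x \<partial>P\<bar> \<le> (\<integral>x. \<bar>f x \<bullet> g x\<bar> \<partial>P)" by (rule integral_abs_bound)
  also have "\<dots> \<le> (\<integral>x. (norm (f x))\<^sup>2 / l + l * (norm (g x))\<^sup>2 \<partial>P)"
  proof (rule integral_mono)
    show "integrable P (\<lambda>x. \<bar>f x \<bullet> g x\<bar>)" using integrable_inner_of_squares[OF assms(1-4)] by simp
    show "\<bar>f x \<bullet> g x\<bar> \<le> (norm (f x))\<^sup>2 / l + l * (norm (g x))\<^sup>2" for x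
      using Cauchy_Schwarz_ineq2[of "f x" "g x"] young[OF l, of "norm (f x)" "norm (g x)"] by simp
  qed (use assms in auto)
  also have "\<dots> = (\<integral>x. (norm (f x))\<^sup>2 \<partial>P) / l + l * (\<integral>x. (norm (g x))\<^sup>2 \<partial>P)"
    using assms by simp
  finally show ?thesis .
qed

lemma small_coefficient:
  fixes A B r :: real
  assumes "A \<ge> 0" "B \<ge> 0" "r > 0"
  shows "\<exists>l>0. l * B + l * A < r / 2"
proof (intro exI conjI)
  let ?l = "r / (2 * (A + B + 1))"
  show l: "?l > 0" using assms by (intro divide_pos_pos) auto
  have "?l * B + ?l * A = ?l * (A + B)" by (simp add: distrib_left)
  also have "\<dots> < ?l * (A + B + 1)" using l by (intro mult_strict_left_mono) auto
  also have "\<dots> = r / 2"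
  proof -
    have "r / (2 * S) * S = r / 2" if "S \<noteq> 0" for S using that by simp
    from this[of "A + B + 1"] assms show ?thesis by linarith
  qed
  finally show "?l * B + ?l * A < r / 2" .
qed

lemma L2_inner_tendsto:
  fixes f g :: "'x \<Rightarrow> 'v::euclidean_space"
  assumes m[measurable]: "f \<in> borel_measurable P" "g \<in> borel_measurable P"
      "\<And>k. fk k \<in> borel_measurable P" "\<And>k. gk k \<in> borel_measurable P"
    and i: "integrable P (\<lambda>x. (norm (f x))\<^sup>2)" "integrable P (\<lambda>x. (norm (g x))\<^sup>2)"
      "\<And>k. integrable P (\<lambda>x. (norm (fk k x))\<^sup>2)" "\<And>k. integrable P (\<lambda>x. (norm (gk k x))\<^sup>2)"
    and lim: "(\<lambda>k. \<integral>x. (norm (fk k x - f x))\<^sup>2 \<partial>P) \<longlonglongrightarrow> 0"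
      "(\<lambda>k. \<integral>x. (norm (gk k x - g x))\<^sup>2 \<partial>P) \<longlonglongrightarrow> 0"
  shows "(\<lambda>k. \<integral>x. fk k x \<bullet> gk k x \<partial>P) \<longlonglongrightarrow> (\<integral>x. f x \<bullet> g x \<partial>P)"
proof -
  let ?e = "\<lambda>k. \<integral>x. (norm (fk k x - f x))\<^sup>2 \<partial>P" and ?d = "\<lambda>k. \<integral>x. (norm (gk k x - g x))\<^sup>2 \<partial>P"
  let ?A = "\<integral>x. (norm (f x))\<^sup>2 \<partial>P" and ?B = "\<integral>x. (norm (g x))\<^sup>2 \<partial>P"
  have df: "integrable P (\<lambda>x. (norm (fk k x - f x))\<^sup>2)" and dg: "integrable P (\<lambda>x. (norm (gk k x - g x))\<^sup>2)" for k
    by (rule integrable_square_diff; use i in measurable)+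
  have bound: "\<bar>(\<integral>x. fk k x \<bullet> gk k x \<partial>P) - (\<integral>x. f x \<bullet> g x \<partial>P)\<bar>
      \<le> (?e k + ?d k) + (?e k / l + l * ?B) + (?d k / l + l * ?A)" if l: "l > 0" for k l
  proof -
    have 1: "integrable P (\<lambda>x. (fk k x - f x) \<bullet> (gk k x - g x))"
      "integrable P (\<lambda>x. (fk k x - f x) \<bullet> g x)" "integrable P (\<lambda>x. (gk k x - g x) \<bullet> f x)"
      "integrable P (\<lambda>x. f x \<bullet> g x)"
      by (rule integrable_inner_of_squares; use i df dg in measurable)+
    have "(\<integral>x. fk k x \<bullet> gk k x \<partial>P) = (\<integral>x. (fk k x - f x) \<bullet> (gk k x - g x) + (fk k x - f x) \<bullet> g x
        + (gk k x - g x) \<bullet> f x + f x \<bullet> g x \<partial>P)"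
      by (rule Bochner_Integration.integral_cong) (auto simp: inner_diff inner_commute)
    also have "\<dots> = (\<integral>x. (fk k x - f x) \<bullet> (gk k x - g x) \<partial>P) + (\<integral>x. (fk k x - f x) \<bullet> g x \<partial>P)
        + (\<integral>x. (gk k x - g x) \<bullet> f x \<partial>P) + (\<integral>x. f x \<bullet> g x \<partial>P)" using 1 by simp
    finally have "(\<integral>x. fk k x \<bullet> gk k x \<partial>P) - (\<integral>x. f x \<bullet> g x \<partial>P) =
      (\<integral>x. (fk k x - f x) \<bullet> (gk k x - g x) \<partial>P) + (\<integral>x. (fk k x - f x) \<bullet> g x \<partial>P)
        + (\<integral>x. (gk k x - g x) \<bullet> f x \<partial>P)" by simp
    moreover have "\<bar>\<integral>x. (fk k x - f x) \<bullet> (gk k x - g x) \<partial>P\<bar> \<le> ?e k + ?d k"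
      using L2_inner_bound[OF _ _ df dg, where l=1] by simp
    moreover have "\<bar>\<integral>x. (fk k x - f x) \<bullet> g x \<partial>P\<bar> \<le> ?e k / l + l * ?B"
      using L2_inner_bound[OF _ _ df i(2) l] by simp
    moreover have "\<bar>\<integral>x. (gk k x - g x) \<bullet> f x \<partial>P\<bar> \<le> ?d k / l + l * ?A"
      using L2_inner_bound[OF _ _ dg i(1) l] by simp
    ultimately show ?thesis by linarith
  qed
  have AB: "?A \<ge> 0" "?B \<ge> 0" by auto
  show ?thesis
  proof (rule LIMSEQ_I)
    fix r :: real assume r: "r > 0"
    obtain l where l: "l > 0" and l2: "l * ?B + l * ?A < r / 2"
      using small_coefficient[OF AB r] by blast
    have "(\<lambda>k. (?e k + ?d k) + ?e k / l + ?d k / l) \<longlonglongrightarrow> (0 + 0) + 0 / l + 0 / l"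
      using l by (intro tendsto_intros lim) auto
    then have "\<forall>\<^sub>F k in sequentially. (?e k + ?d k) + ?e k / l + ?d k / l < r / 2"
      using r by (intro order_tendstoD(2)) auto
    then show "\<exists>no. \<forall>n\<ge>no. norm ((\<integral>x. fk n x \<bullet> gk n x \<partial>P) - (\<integral>x. f x \<bullet> g x \<partial>P)) < r"
      unfolding eventually_sequentially
    proof (elim exE, intro exI allI impI)
      fix N n assume "\<forall>n\<ge>N. (?e n + ?d n) + ?e n / l + ?d n / l < r / 2" "N \<le> n"
      then have "(?e n + ?d n) + ?e n / l + ?d n / l < r / 2" by blast
      with bound[OF l, of n] l2 show "norm ((\<integral>x. fk n x \<bullet> gk n x \<partial>P) - (\<integral>x. f x \<bullet> g x \<partial>P)) < r"
        unfolding real_norm_def by linarith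
    qed
  qed
qed

context driven_space begin

text \<open>Metrizes convergence in probability.\<close>

definition prob_size :: "('w \<Rightarrow> real) \<Rightarrow> real" where
  "prob_size X = expectation (\<lambda>\<omega>. min 1 \<bar>X \<omega>\<bar>)"

lemma prob_size_integrable [simp]:
  "X \<in> borel_measurable M \<Longrightarrow> integrable M (\<lambda>\<omega>. min 1 \<bar>X \<omega> :: real\<bar>)"
  by (rule integrable_const_bound[of _ 1]) auto

lemma step_L2_limit:
  assumes st: "\<And>k. step_integral (Z k) (Y k)"
    and h[measurable]: "(\<lambda>(\<omega>, s). h s \<omega>) \<in> borel_measurable (M \<Otimes>\<^sub>M lborel)"
    and hi: "integrable (M \<Otimes>\<^sub>M lborel) (\<lambda>(\<omega>, s). (norm (h s \<omega>))\<^sup>2)"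
    and X[measurable]: "X \<in> borel_measurable M"
    and lim: "(\<lambda>k. \<integral>(\<omega>, s). (norm (Z k s \<omega> - h s \<omega>))\<^sup>2 \<partial>(M \<Otimes>\<^sub>M lborel)) \<longlonglongrightarrow> 0"
      "(\<lambda>k. prob_size (\<lambda>\<omega>. Y k \<omega> - X \<omega>)) \<longlonglongrightarrow> 0"
  shows "integrable M (\<lambda>\<omega>. (X \<omega>)\<^sup>2)" "(\<lambda>k. expectation (\<lambda>\<omega>. (Y k \<omega> - X \<omega>)\<^sup>2)) \<longlonglongrightarrow> 0"
proof -
  note Ym[measurable] = step_integral_measurable(2)[OF st]
  note Zm[measurable] = step_integral_measurable(1)[OF st]
  let ?P = "M \<Otimes>\<^sub>M lborel"
  define e where "e = (\<lambda>k. \<integral>(\<omega>, s). (norm (Z k s \<omega> - h s \<omega>))\<^sup>2 \<partial>?P)"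
  have ei: "integrable ?P (\<lambda>(\<omega>, s). (norm (Z k s \<omega> - h s \<omega>))\<^sup>2)" for k
    using integrable_square_diff[OF Zm h, of k] hi step_integral_isometry(2)[OF st st, of k]
    by (simp add: case_prod_unfold power2_norm_eq_inner)
  have e0: "e k \<ge> 0" for k unfolding e_def by (auto intro: integral_nonneg_AE simp: case_prod_unfold)
  have D: "(\<integral>\<^sup>+\<omega>. ennreal ((Y k \<omega> - Y l \<omega>)\<^sup>2) \<partial>M) \<le> ennreal (2 * e k + 2 * e l)" for k l
  proof -
    note d = step_integral_distance[OF st st, of k l]
    have "(\<integral>(\<omega>, s). (norm (Z k s \<omega> - Z l s \<omega>))\<^sup>2 \<partial>?P)
      \<le> (\<integral>x. 2 * (\<lambda>(\<omega>, s). (norm (Z k s \<omega> - h s \<omega>))\<^sup>2) x + 2 * (\<lambda>(\<omega>, s). (norm (Z l s \<omega> - h s \<omega>))\<^sup>2) x \<partial>?P)"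
    proof (rule integral_mono[OF d(2)])
      show "integrable ?P (\<lambda>x. 2 * (\<lambda>(\<omega>, s). (norm (Z k s \<omega> - h s \<omega>))\<^sup>2) x + 2 * (\<lambda>(\<omega>, s). (norm (Z l s \<omega> - h s \<omega>))\<^sup>2) x)"
        using ei by (intro Bochner_Integration.integrable_add integrable_mult_right)
      fix x :: "'w \<times> real"
      obtain \<omega> s where x: "x = (\<omega>, s)" by (cases x)
      have "norm (Z k s \<omega> - Z l s \<omega>) \<le> norm (Z k s \<omega> - h s \<omega>) + norm (Z l s \<omega> - h s \<omega>)"
        by (metis dist_norm dist_triangle2)
      then have "(norm (Z k s \<omega> - Z l s \<omega>))\<^sup>2 \<le> (norm (Z k s \<omega> - h s \<omega>) + norm (Z l s \<omega> - h s \<omega>))\<^sup>2"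
        by (intro power_mono) auto
      also have "\<dots> \<le> 2 * (norm (Z k s \<omega> - h s \<omega>))\<^sup>2 + 2 * (norm (Z l s \<omega> - h s \<omega>))\<^sup>2"
        using sum_squares_bound[of "norm (Z k s \<omega> - h s \<omega>)" "norm (Z l s \<omega> - h s \<omega>)"] by (simp add: power2_sum)
      finally show "(\<lambda>(\<omega>, s). (norm (Z k s \<omega> - Z l s \<omega>))\<^sup>2) x \<le>
        2 * (\<lambda>(\<omega>, s). (norm (Z k s \<omega> - h s \<omega>))\<^sup>2) x + 2 * (\<lambda>(\<omega>, s). (norm (Z l s \<omega> - h s \<omega>))\<^sup>2) x"
        by (simp add: x)
    qed
    also have "\<dots> = 2 * e k + 2 * e l" unfolding e_def using ei by simp
    finally have "expectation (\<lambda>\<omega>. (Y k \<omega> - Y l \<omega>)\<^sup>2) \<le> 2 * e k + 2 * e l" using d(3) by simp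
    then show ?thesis by (subst nn_integral_eq_integral[OF d(1)]) (auto intro: ennreal_leI)
  qed
  have "\<exists>r. strict_mono r \<and> (AE \<omega> in M. (\<lambda>n. min 1 \<bar>Y (r n) \<omega> - X \<omega>\<bar>) \<longlonglongrightarrow> 0)"
    using lim(2) by (intro tendsto_L1_AE_subseq) (auto simp: prob_size_def)
  then obtain r where r: "strict_mono r" and ae: "AE \<omega> in M. (\<lambda>n. min 1 \<bar>Y (r n) \<omega> - X \<omega>\<bar>) \<longlonglongrightarrow> 0" by blast
  have ae': "AE \<omega> in M. (\<lambda>n. Y (r n) \<omega>) \<longlonglongrightarrow> X \<omega>"
    using ae
  proof eventually_elim
    case (elim \<omega>)
    then have "\<forall>\<^sub>F n in sequentially. min 1 \<bar>Y (r n) \<omega> - X \<omega>\<bar> < 1" by (rule order_tendstoD(2)) simp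
    then have "\<forall>\<^sub>F n in sequentially. min 1 \<bar>Y (r n) \<omega> - X \<omega>\<bar> = \<bar>Y (r n) \<omega> - X \<omega>\<bar>"
      by eventually_elim auto
    with elim have "(\<lambda>n. \<bar>Y (r n) \<omega> - X \<omega>\<bar>) \<longlonglongrightarrow> 0" by (rule Lim_transform_eventually)
    then show ?case by (simp add: tendsto_rabs_zero_iff LIM_zero_iff)
  qed
  have fat: "(\<integral>\<^sup>+\<omega>. ennreal ((Y k \<omega> - X \<omega>)\<^sup>2) \<partial>M) \<le> ennreal (2 * e k)" for k
  proof -
    have "(\<integral>\<^sup>+\<omega>. ennreal ((Y k \<omega> - X \<omega>)\<^sup>2) \<partial>M) \<le> (\<integral>\<^sup>+\<omega>. liminf (\<lambda>n. ennreal ((Y k \<omega> - Y (r n) \<omega>)\<^sup>2)) \<partial>M)"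
    proof (rule nn_integral_mono_AE)
      show "AE \<omega> in M. ennreal ((Y k \<omega> - X \<omega>)\<^sup>2) \<le> liminf (\<lambda>n. ennreal ((Y k \<omega> - Y (r n) \<omega>)\<^sup>2))"
        using ae'
      proof eventually_elim
        case (elim \<omega>)
        then have "(\<lambda>n. ennreal ((Y k \<omega> - Y (r n) \<omega>)\<^sup>2)) \<longlonglongrightarrow> ennreal ((Y k \<omega> - X \<omega>)\<^sup>2)"
          by (intro tendsto_intros)
        from lim_imp_Liminf[OF trivial_limit_sequentially this] show ?case by simp
      qed
    qed
    also have "\<dots> \<le> liminf (\<lambda>n. \<integral>\<^sup>+\<omega>. ennreal ((Y k \<omega> - Y (r n) \<omega>)\<^sup>2) \<partial>M)"
      by (rule nn_integral_liminf) measurable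
    also have "\<dots> \<le> liminf (\<lambda>n. ennreal (2 * e k + 2 * e (r n)))"
      by (intro Liminf_mono always_eventually allI D)
    also have "\<dots> = ennreal (2 * e k)"
    proof -
      have "(\<lambda>n. e (r n)) \<longlonglongrightarrow> 0" using LIMSEQ_subseq_LIMSEQ[OF lim(1) r] by (simp add: e_def o_def)
      then have "(\<lambda>n. ennreal (2 * e k + 2 * e (r n))) \<longlonglongrightarrow> ennreal (2 * e k + 2 * 0)"
        by (intro tendsto_intros)
      from lim_imp_Liminf[OF trivial_limit_sequentially this] show ?thesis by simp
    qed
    finally show ?thesis .
  qed
  have di: "integrable M (\<lambda>\<omega>. (Y k \<omega> - X \<omega>)\<^sup>2)" for k
  proof (rule integrableI_bounded)
    show "(\<integral>\<^sup>+\<omega>. ennreal (norm ((Y k \<omega> - X \<omega>)\<^sup>2)) \<partial>M) < \<infinity>"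
      using fat[of k] by (simp add: le_less_trans)
  qed measurable
  have dle: "expectation (\<lambda>\<omega>. (Y k \<omega> - X \<omega>)\<^sup>2) \<le> 2 * e k" for k
    using fat[of k] e0[of k] by (subst (asm) nn_integral_eq_integral[OF di]) (auto simp: ennreal_le_iff)
  show "(\<lambda>k. expectation (\<lambda>\<omega>. (Y k \<omega> - X \<omega>)\<^sup>2)) \<longlonglongrightarrow> 0"
  proof (rule tendsto_sandwich[OF _ _ tendsto_const])
    show "(\<lambda>k. 2 * e k) \<longlonglongrightarrow> 0" using tendsto_mult_right_zero[OF lim(1), of 2] by (simp add: e_def)
  qed (use dle in \<open>auto intro!: always_eventually\<close>)
  have "integrable M (\<lambda>\<omega>. (norm (Y 0 \<omega> - (Y 0 \<omega> - X \<omega>)))\<^sup>2)"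
    by (rule integrable_square_diff)
       (use di[of 0] step_integral_isometry(1)[OF st st, of 0] in \<open>auto simp: power2_eq_square\<close>)
  then show "integrable M (\<lambda>\<omega>. (X \<omega>)\<^sup>2)" by simp
qed

definition ito_L2 :: "(real \<Rightarrow> 'w \<Rightarrow> real^'d) \<Rightarrow> ('w \<Rightarrow> real) \<Rightarrow> bool" where
  "ito_L2 h X \<longleftrightarrow> X \<in> borel_measurable M \<and> (\<lambda>(\<omega>, s). h s \<omega>) \<in> borel_measurable (M \<Otimes>\<^sub>M lborel) \<and>
     integrable (M \<Otimes>\<^sub>M lborel) (\<lambda>(\<omega>, s). (norm (h s \<omega>))\<^sup>2) \<and>
     (\<forall>\<epsilon>>0. \<exists>Z Y. step_integral Z Y \<and> (\<integral>(\<omega>, s). (norm (Z s \<omega> - h s \<omega>))\<^sup>2 \<partial>(M \<Otimes>\<^sub>M lborel)) \<le> \<epsilon> \<and>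
        prob_size (\<lambda>\<omega>. Y \<omega> - X \<omega>) \<le> \<epsilon>)"

lemma ito_L2_sequence:
  assumes "ito_L2 h X"
  obtains Z Y where "\<And>k::nat. step_integral (Z k) (Y k)"
    "(\<lambda>k. \<integral>(\<omega>, s). (norm (Z k s \<omega> - h s \<omega>))\<^sup>2 \<partial>(M \<Otimes>\<^sub>M lborel)) \<longlonglongrightarrow> 0"
    "integrable M (\<lambda>\<omega>. (X \<omega>)\<^sup>2)" "(\<lambda>k. expectation (\<lambda>\<omega>. (Y k \<omega> - X \<omega>)\<^sup>2)) \<longlonglongrightarrow> 0"
proof -
  have "\<exists>Z Y. step_integral Z Y \<and> (\<integral>(\<omega>, s). (norm (Z s \<omega> - h s \<omega>))\<^sup>2 \<partial>(M \<Otimes>\<^sub>M lborel)) \<le> 1 / Suc k \<and>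
        prob_size (\<lambda>\<omega>. Y \<omega> - X \<omega>) \<le> 1 / Suc k" for k
    using assms unfolding ito_L2_def by simp
  then have "\<exists>Z. \<forall>k. \<exists>Y. step_integral (Z k) Y \<and> (\<integral>(\<omega>, s). (norm (Z k s \<omega> - h s \<omega>))\<^sup>2 \<partial>(M \<Otimes>\<^sub>M lborel)) \<le> 1 / Suc k \<and>
        prob_size (\<lambda>\<omega>. Y \<omega> - X \<omega>) \<le> 1 / Suc k" by (intro choice allI)
  then obtain Z where "\<forall>k. \<exists>Y. step_integral (Z k) Y \<and> (\<integral>(\<omega>, s). (norm (Z k s \<omega> - h s \<omega>))\<^sup>2 \<partial>(M \<Otimes>\<^sub>M lborel)) \<le> 1 / Suc k \<and>
        prob_size (\<lambda>\<omega>. Y \<omega> - X \<omega>) \<le> 1 / Suc k" ..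
  then have "\<exists>Y. \<forall>k. step_integral (Z k) (Y k) \<and> (\<integral>(\<omega>, s). (norm (Z k s \<omega> - h s \<omega>))\<^sup>2 \<partial>(M \<Otimes>\<^sub>M lborel)) \<le> 1 / Suc k \<and>
        prob_size (\<lambda>\<omega>. Y k \<omega> - X \<omega>) \<le> 1 / Suc k" by (rule choice)
  then obtain Y where st: "\<And>k. step_integral (Z k) (Y k)"
    and 1: "\<And>k. (\<integral>(\<omega>, s). (norm (Z k s \<omega> - h s \<omega>))\<^sup>2 \<partial>(M \<Otimes>\<^sub>M lborel)) \<le> 1 / Suc k"
    and 2: "\<And>k. prob_size (\<lambda>\<omega>. Y k \<omega> - X \<omega>) \<le> 1 / Suc k" by blast
  have l: "(\<lambda>k. 1 / real (Suc k)) \<longlonglongrightarrow> 0" using LIMSEQ_inverse_real_of_nat by (simp add: inverse_eq_divide)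
  have 3: "(\<lambda>k. \<integral>(\<omega>, s). (norm (Z k s \<omega> - h s \<omega>))\<^sup>2 \<partial>(M \<Otimes>\<^sub>M lborel)) \<longlonglongrightarrow> 0"
    by (rule tendsto_sandwich[OF _ _ tendsto_const l])
       (use 1 in \<open>auto intro!: always_eventually integral_nonneg_AE simp: case_prod_unfold\<close>)
  have 4: "(\<lambda>k. prob_size (\<lambda>\<omega>. Y k \<omega> - X \<omega>)) \<longlonglongrightarrow> 0"
    by (rule tendsto_sandwich[OF _ _ tendsto_const l])
       (use 2 in \<open>auto intro!: always_eventually integral_nonneg_AE simp: prob_size_def\<close>)
  show thesis using that[OF st 3] step_L2_limit[OF st _ _ _ 3 4] assms unfolding ito_L2_def by blast
qed

lemma ito_L2_isometry:
  assumes hX: "ito_L2 h X" and gY: "ito_L2 g Y"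
  shows "expectation (\<lambda>\<omega>. X \<omega> * Y \<omega>) = (\<integral>(\<omega>, s). h s \<omega> \<bullet> g s \<omega> \<partial>(M \<Otimes>\<^sub>M lborel))"
proof -
  obtain Z Xk where Z: "\<And>k::nat. step_integral (Z k) (Xk k)"
    "(\<lambda>k. \<integral>(\<omega>, s). (norm (Z k s \<omega> - h s \<omega>))\<^sup>2 \<partial>(M \<Otimes>\<^sub>M lborel)) \<longlonglongrightarrow> 0"
    "integrable M (\<lambda>\<omega>. (X \<omega>)\<^sup>2)" "(\<lambda>k. expectation (\<lambda>\<omega>. (Xk k \<omega> - X \<omega>)\<^sup>2)) \<longlonglongrightarrow> 0"
    using ito_L2_sequence[OF hX] by blast
  obtain W Yk where W: "\<And>k::nat. step_integral (W k) (Yk k)"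
    "(\<lambda>k. \<integral>(\<omega>, s). (norm (W k s \<omega> - g s \<omega>))\<^sup>2 \<partial>(M \<Otimes>\<^sub>M lborel)) \<longlonglongrightarrow> 0"
    "integrable M (\<lambda>\<omega>. (Y \<omega>)\<^sup>2)" "(\<lambda>k. expectation (\<lambda>\<omega>. (Yk k \<omega> - Y \<omega>)\<^sup>2)) \<longlonglongrightarrow> 0"
    using ito_L2_sequence[OF gY] by blast
  note [measurable] = step_integral_measurable[OF Z(1)] step_integral_measurable[OF W(1)]
  have [measurable]: "X \<in> borel_measurable M" "Y \<in> borel_measurable M"
    "(\<lambda>(\<omega>, s). h s \<omega>) \<in> borel_measurable (M \<Otimes>\<^sub>M lborel)" "(\<lambda>(\<omega>, s). g s \<omega>) \<in> borel_measurable (M \<Otimes>\<^sub>M lborel)"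
    and hi: "integrable (M \<Otimes>\<^sub>M lborel) (\<lambda>(\<omega>, s). (norm (h s \<omega>))\<^sup>2)"
    and gi: "integrable (M \<Otimes>\<^sub>M lborel) (\<lambda>(\<omega>, s). (norm (g s \<omega>))\<^sup>2)"
    using hX gY by (auto simp: ito_L2_def)
  have a: "(\<lambda>k. \<integral>\<omega>. Xk k \<omega> \<bullet> Yk k \<omega> \<partial>M) \<longlonglongrightarrow> (\<integral>\<omega>. X \<omega> \<bullet> Y \<omega> \<partial>M)"
    by (rule L2_inner_tendsto)
       (use Z W step_integral_isometry(1)[OF Z(1) Z(1)] step_integral_isometry(1)[OF W(1) W(1)]
        in \<open>auto simp: power2_eq_square\<close>)
  have b: "(\<lambda>k. \<integral>x. (\<lambda>(\<omega>, s). Z k s \<omega>) x \<bullet> (\<lambda>(\<omega>, s). W k s \<omega>) x \<partial>(M \<Otimes>\<^sub>M lborel)) \<longlonglongrightarrow>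
      (\<integral>x. (\<lambda>(\<omega>, s). h s \<omega>) x \<bullet> (\<lambda>(\<omega>, s). g s \<omega>) x \<partial>(M \<Otimes>\<^sub>M lborel))"
    by (rule L2_inner_tendsto)
       (use Z(2) W(2) hi gi step_integral_isometry(2)[OF Z(1) Z(1)] step_integral_isometry(2)[OF W(1) W(1)]
        in \<open>auto simp: case_prod_unfold power2_norm_eq_inner\<close>)
  have "(\<lambda>k. \<integral>\<omega>. Xk k \<omega> \<bullet> Yk k \<omega> \<partial>M) = (\<lambda>k. \<integral>x. (\<lambda>(\<omega>, s). Z k s \<omega>) x \<bullet> (\<lambda>(\<omega>, s). W k s \<omega>) x \<partial>(M \<Otimes>\<^sub>M lborel))"
    using step_integral_isometry(3)[OF Z(1) W(1)] by (simp add: case_prod_unfold)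
  with a have "(\<lambda>k. \<integral>x. (\<lambda>(\<omega>, s). Z k s \<omega>) x \<bullet> (\<lambda>(\<omega>, s). W k s \<omega>) x \<partial>(M \<Otimes>\<^sub>M lborel)) \<longlonglongrightarrow> (\<integral>\<omega>. X \<omega> \<bullet> Y \<omega> \<partial>M)"
    by simp
  from LIMSEQ_unique[OF this b] have "(\<integral>\<omega>. X \<omega> \<bullet> Y \<omega> \<partial>M) = (\<integral>x. (\<lambda>(\<omega>, s). h s \<omega>) x \<bullet> (\<lambda>(\<omega>, s). g s \<omega>) x \<partial>(M \<Otimes>\<^sub>M lborel))"
    .
  then show ?thesis by (simp add: case_prod_unfold)
qed

lemma ito_L2_mean:
  assumes hX: "ito_L2 h X"
  shows "expectation X = 0"
proof -
  obtain Z Xk where Z: "\<And>k::nat. step_integral (Z k) (Xk k)"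
    "integrable M (\<lambda>\<omega>. (X \<omega>)\<^sup>2)" "(\<lambda>k. expectation (\<lambda>\<omega>. (Xk k \<omega> - X \<omega>)\<^sup>2)) \<longlonglongrightarrow> 0"
    using ito_L2_sequence[OF hX] by blast
  have [measurable]: "X \<in> borel_measurable M" using hX by (auto simp: ito_L2_def)
  note [measurable] = step_integral_measurable(2)[OF Z(1)]
  have a: "(\<lambda>k. \<integral>\<omega>. Xk k \<omega> \<bullet> 1 \<partial>M) \<longlonglongrightarrow> (\<integral>\<omega>. X \<omega> \<bullet> 1 \<partial>M)"
    by (rule L2_inner_tendsto)
       (use Z step_integral_isometry(1)[OF Z(1) Z(1)] in \<open>auto simp: power2_eq_square\<close>)
  then show ?thesis using step_integral_mean[OF Z(1)] LIMSEQ_unique[OF _ tendsto_const] by simp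
qed

end

section \<open>Partitions and Lenglart's inequality\<close>

lemma sorted_grid:
  fixes P :: "real set"
  assumes "finite P" "s \<in> P" "t \<in> P" "P \<subseteq> {s..t}"
  obtains N p where "\<And>i. i < N \<Longrightarrow> p i < p (Suc i)" "p 0 = s" "p N = t" "P = p ` {..N::nat}"
    "\<And>i x. i < N \<Longrightarrow> x \<in> P \<Longrightarrow> \<not> (p i < x \<and> x < p (Suc i))"
proof -
  define xs where "xs = sorted_list_of_set P"
  define N where "N = length xs - 1"
  define p where "p = (\<lambda>i. xs ! i)"
  have xs: "set xs = P" "sorted_wrt (<) xs" using assms by (auto simp: xs_def)
  have ne: "xs \<noteq> []" using xs(1) assms(2) by auto
  have len: "length xs = Suc N" using ne by (cases xs) (auto simp: N_def)
  have lt: "p i < p j" if "i < j" "j \<le> N" for i j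
    using sorted_wrt_nth_less[OF xs(2) that(1)] that len by (auto simp: p_def)
  have P: "P = p ` {..N}" unfolding xs(1)[symmetric] set_conv_nth p_def using len by (auto simp: less_Suc_eq_le)
  have p0: "p 0 = s"
  proof -
    obtain i where i: "i \<le> N" "s = p i" using assms(2) P by auto
    have "p 0 \<in> P" using P by auto
    then have "s \<le> p 0" using assms(4) by auto
    with i lt[of 0 i] show ?thesis by (cases i) auto
  qed
  have pN: "p N = t"
  proof -
    obtain i where i: "i \<le> N" "t = p i" using assms(3) P by auto
    have "p N \<in> P" using P by auto
    then have "p N \<le> t" using assms(4) by auto
    with i lt[of i N] show ?thesis by (cases "i = N") auto
  qed
  have gap: "\<not> (p i < x \<and> x < p (Suc i))" if i: "i < N" and x: "x \<in> P" for i x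
  proof
    assume *: "p i < x \<and> x < p (Suc i)"
    obtain j where j: "j \<le> N" "x = p j" using x P by auto
    have "\<not> j \<le> i" using * j lt[of j i] i by (cases "j = i") auto
    moreover have "\<not> Suc i \<le> j" using * j lt[of "Suc i" j] i by (cases "j = Suc i") auto
    ultimately show False by simp
  qed
  show thesis by (rule that[OF _ p0 pN P gap]) (use lt in auto)
qed

definition grid :: "nat \<Rightarrow> (nat \<Rightarrow> real) \<Rightarrow> bool" where
  "grid N p \<longleftrightarrow> (\<forall>i<N. p i < p (Suc i))"

lemma grid_mono: "grid N p \<Longrightarrow> i \<le> j \<Longrightarrow> j \<le> N \<Longrightarrow> p i \<le> p j"
proof (induction "j - i" arbitrary: j)
  case (Suc k)
  then obtain j' where j: "j = Suc j'" by (cases j) auto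
  show ?case
  proof (cases "i = j")
    case False
    then have "p i \<le> p j'" using Suc j by auto
    moreover have "p j' < p j" using Suc j by (auto simp: grid_def)
    ultimately show ?thesis by simp
  qed simp
qed auto

lemma grid_cell:
  assumes "grid N p" "p 0 < r" "r \<le> p N"
  shows "\<exists>j<N. p j < r \<and> r \<le> p (Suc j)"
proof -
  define j where "j = (LEAST j. r \<le> p j)"
  have 1: "r \<le> p j" unfolding j_def by (rule LeastI[of _ N]) (use assms in simp)
  have jN: "j \<le> N" unfolding j_def by (rule Least_le) (use assms in simp)
  obtain i where i: "j = Suc i" using 1 assms by (cases j) auto
  have "\<not> r \<le> p i" using not_less_Least[of i "\<lambda>j. r \<le> p j"] i by (auto simp: j_def)
  with 1 jN i show ?thesis by (intro exI[of _ i]) auto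
qed

lemma grid_step_value:
  fixes f :: "nat \<Rightarrow> 'v::real_vector"
  assumes g: "grid N p" and j: "j < N" "p j < r" "r \<le> p (Suc j)"
  shows "(\<Sum>i<N. indicator {p i<..p (Suc i)} r *\<^sub>R f i) = f j"
proof -
  have z: "indicator {p i<..p (Suc i)} r = (0::real)" if "i < N" "i \<noteq> j" for i
  proof (cases "i < j")
    case True
    then have "p (Suc i) \<le> p j" using grid_mono[OF g, of "Suc i" j] j by auto
    then show ?thesis using j by auto
  next
    case False
    then have "p (Suc j) \<le> p i" using grid_mono[OF g, of "Suc j" i] that by auto
    then show ?thesis using j by auto
  qed
  have "(\<Sum>i<N. indicator {p i<..p (Suc i)} r *\<^sub>R f i) = (\<Sum>i\<in>{j}. indicator {p i<..p (Suc i)} r *\<^sub>R f i)"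
    by (rule sum.mono_neutral_right) (use j z in auto)
  also have "\<dots> = f j" using j by simp
  finally show ?thesis .
qed

lemma grid_step_zero:
  fixes f :: "nat \<Rightarrow> 'v::real_vector"
  assumes g: "grid N p" and r: "r \<notin> {p 0<..p N}"
  shows "(\<Sum>i<N. indicator {p i<..p (Suc i)} r *\<^sub>R f i) = 0"
proof (rule sum.neutral, safe)
  fix i assume i: "i < N"
  have "p 0 \<le> p i" "p (Suc i) \<le> p N" using grid_mono[OF g, of 0 i] grid_mono[OF g, of "Suc i" N] i by auto
  then show "indicator {p i<..p (Suc i)} r *\<^sub>R f i = 0" using r by (auto simp: indicator_def)
qed

lemma grid_step_square:
  fixes f :: "nat \<Rightarrow> 'v::real_normed_vector"
  assumes g: "grid N p"
  shows "(norm (\<Sum>i<N. indicator {p i<..p (Suc i)} r *\<^sub>R f i))\<^sup>2 = (\<Sum>i<N. indicator {p i<..p (Suc i)} r *\<^sub>R (norm (f i))\<^sup>2)"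
proof (cases "r \<in> {p 0<..p N}")
  case True
  then obtain j where j: "j < N" "p j < r" "r \<le> p (Suc j)" using grid_cell[OF g] by auto
  show ?thesis by (simp only: grid_step_value[OF g j])
next
  case False
  show ?thesis by (simp only: grid_step_zero[OF g False]) simp
qed

lemma grid_step_integral:
  fixes f :: "nat \<Rightarrow> real"
  assumes g: "grid N p"
  shows "integrable lborel (\<lambda>r. \<Sum>i<N. indicator {p i<..p (Suc i)} r *\<^sub>R f i)"
    "(\<integral>r. (\<Sum>i<N. indicator {p i<..p (Suc i)} r *\<^sub>R f i) \<partial>lborel) = (\<Sum>i<N. (p (Suc i) - p i) * f i)"
proof -
  have i: "integrable lborel (\<lambda>r. indicator {p i<..p (Suc i)} r *\<^sub>R f i)" if "i < N" for i
    using g that by (auto simp: grid_def integrable_indicator_iff)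
  show "integrable lborel (\<lambda>r. \<Sum>i<N. indicator {p i<..p (Suc i)} r *\<^sub>R f i)"
    using i by (intro Bochner_Integration.integrable_sum) auto
  have "(\<integral>r. (\<Sum>i<N. indicator {p i<..p (Suc i)} r *\<^sub>R f i) \<partial>lborel)
      = (\<Sum>i<N. \<integral>r. indicator {p i<..p (Suc i)} r *\<^sub>R f i \<partial>lborel)"
    using i by (intro Bochner_Integration.integral_sum) auto
  also have "\<dots> = (\<Sum>i<N. (p (Suc i) - p i) * f i)"
    using g by (intro sum.cong) (auto simp: grid_def less_imp_le)
  finally show "(\<integral>r. (\<Sum>i<N. indicator {p i<..p (Suc i)} r *\<^sub>R f i) \<partial>lborel) = (\<Sum>i<N. (p (Suc i) - p i) * f i)" .
qed

context driven_space begin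

lemma grid_step_integral_process:
  assumes "grid N p" "0 \<le> p 0" "\<And>j. j < N \<Longrightarrow> c j \<in> borel_measurable (F (p j))"
    "\<And>j. j < N \<Longrightarrow> \<exists>C. \<forall>\<omega>\<in>space M. norm (c j \<omega>) \<le> C"
  shows "step_integral (\<lambda>r \<omega>. \<Sum>i<N. indicator {p i<..p (Suc i)} r *\<^sub>R c i \<omega>)
    (\<lambda>\<omega>. \<Sum>i<N. c i \<omega> \<bullet> (w (p (Suc i)) \<omega> - w (p i) \<omega>))"
  unfolding step_integral_def
proof (rule exI[of _ N], rule exI[of _ p], rule exI[of _ "\<lambda>i. p (Suc i)"], rule exI[of _ c], intro conjI allI impI refl)
  fix i assume i: "i < N"
  show "0 \<le> p i" using grid_mono[OF assms(1), of 0 i] assms(2) i by simp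
qed (use assms in \<open>auto simp: grid_def\<close>)

text \<open>Lenglart's inequality for step processes: the integrand is switched off just before its
  accumulated square would exceed \<^term>\<open>\<delta>\<close>, which is possible without overshoot because a step
  process is known at the left end of each step.\<close>

lemma lenglart_step:
  assumes g: "grid N p" and p0: "0 \<le> p 0" and c: "\<And>j. j < N \<Longrightarrow> c j \<in> borel_measurable (F (p j))"
    and cb: "\<And>j. j < N \<Longrightarrow> \<exists>C. \<forall>\<omega>\<in>space M. norm (c j \<omega>) \<le> C" and d: "\<delta> > 0"
  shows "prob_size (\<lambda>\<omega>. \<Sum>i<N. c i \<omega> \<bullet> (w (p (Suc i)) \<omega> - w (p i) \<omega>))
     \<le> prob {\<omega>\<in>space M. (\<Sum>i<N. (p (Suc i) - p i) * (norm (c i \<omega>))\<^sup>2) > \<delta>} + sqrt \<delta>"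
proof -
  define V where "V = (\<lambda>j \<omega>. \<Sum>i<j. (p (Suc i) - p i) * (norm (c i \<omega>))\<^sup>2)"
  define c' where "c' = (\<lambda>j \<omega>. if V (Suc j) \<omega> \<le> \<delta> then c j \<omega> else 0)"
  have pj: "0 \<le> p j" if "j \<le> N" for j using grid_mono[OF g, of 0 j] p0 that by simp
  have cm: "c i \<in> borel_measurable (F (p j))" if "i \<le> j" "j < N" for i j
    using F_measurable_mono[OF pj _ c] grid_mono[OF g, of i j] that by auto
  have Vm: "V (Suc j) \<in> borel_measurable (F (p j))" if "j < N" for j
    unfolding V_def using cm that
    by (intro borel_measurable_sum borel_measurable_times borel_measurable_power borel_measurable_norm
        borel_measurable_const measurable_compose[OF _ borel_measurable_norm]) auto
  have c'm: "c' j \<in> borel_measurable (F (p j))" if j: "j < N" for j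
  proof -
    note [measurable] = Vm[OF j] c[OF j]
    show ?thesis unfolding c'_def by measurable
  qed
  have c'b: "\<exists>C. \<forall>\<omega>\<in>space M. norm (c' j \<omega>) \<le> C" if j: "j < N" for j
  proof -
    obtain C where "\<forall>\<omega>\<in>space M. norm (c j \<omega>) \<le> C" using cb[OF j] by blast
    then show ?thesis by (intro exI[of _ "max C 0"]) (auto simp: c'_def le_max_iff_disj)
  qed
  let ?Z = "\<lambda>r \<omega>. \<Sum>i<N. indicator {p i<..p (Suc i)} r *\<^sub>R c' i \<omega>"
  define D where "D = (\<lambda>\<omega>. \<Sum>i<N. c i \<omega> \<bullet> (w (p (Suc i)) \<omega> - w (p i) \<omega>))"
  define D' where "D' = (\<lambda>\<omega>. \<Sum>i<N. c' i \<omega> \<bullet> (w (p (Suc i)) \<omega> - w (p i) \<omega>))"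
  have st': "step_integral ?Z D'" unfolding D'_def by (rule grid_step_integral_process[OF g p0 c'm c'b])
  have st: "step_integral (\<lambda>r \<omega>. \<Sum>i<N. indicator {p i<..p (Suc i)} r *\<^sub>R c i \<omega>) D"
    unfolding D_def by (rule grid_step_integral_process[OF g p0 c cb])
  note [measurable] = step_integral_measurable(2)[OF st] step_integral_measurable(2)[OF st']
  have pos: "p (Suc i) - p i \<ge> 0" if "i < N" for i using g that by (auto simp: grid_def less_imp_le)
  have Vmono: "V i \<omega> \<le> V j \<omega>" if "i \<le> j" "j \<le> N" for i j \<omega>
    unfolding V_def by (rule sum_mono2) (use that pos in auto)
  have V': "(\<Sum>i<n. (p (Suc i) - p i) * (norm (c' i \<omega>))\<^sup>2) \<le> \<delta>" if "n \<le> N" for n \<omega>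
    using that
  proof (induction n)
    case (Suc n)
    show ?case
    proof (cases "V (Suc n) \<omega> \<le> \<delta>")
      case True
      have "c' i \<omega> = c i \<omega>" if "i < Suc n" for i
        using Vmono[of "Suc i" "Suc n" \<omega>] that Suc.prems True by (simp add: c'_def)
      then have "(\<Sum>i<Suc n. (p (Suc i) - p i) * (norm (c' i \<omega>))\<^sup>2) = V (Suc n) \<omega>"
        unfolding V_def by (intro sum.cong) auto
      then show ?thesis using True by simp
    next
      case False
      then show ?thesis using Suc by (simp add: c'_def)
    qed
  qed (use d in simp)
  have E2: "expectation (\<lambda>\<omega>. (D' \<omega>)\<^sup>2) \<le> \<delta>"
  proof -
    note iso = step_integral_isometry[OF st' st']
    have "expectation (\<lambda>\<omega>. (D' \<omega>)\<^sup>2) = (\<integral>x. (\<lambda>(\<omega>, r). ?Z r \<omega> \<bullet> ?Z r \<omega>) x \<partial>(M \<Otimes>\<^sub>M lborel))"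
      using iso(3) by (simp add: power2_eq_square)
    also have "\<dots> = (\<integral>\<omega>. \<integral>r. ?Z r \<omega> \<bullet> ?Z r \<omega> \<partial>lborel \<partial>M)"
      using PL.integral_fst'[OF iso(2)] by simp
    also have "\<dots> = (\<integral>\<omega>. (\<Sum>i<N. (p (Suc i) - p i) * (norm (c' i \<omega>))\<^sup>2) \<partial>M)"
      unfolding power2_norm_eq_inner[symmetric] grid_step_square[OF g] grid_step_integral(2)[OF g] ..
    also have "\<dots> \<le> (\<integral>\<omega>. \<delta> \<partial>M)"
    proof (rule integral_mono')
      show "(\<Sum>i<N. (p (Suc i) - p i) * (norm (c' i \<omega>))\<^sup>2) \<le> \<delta>" for \<omega> using V' by blast
    qed (use d in auto)
    finally show ?thesis by (simp add: prob_space)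
  qed
  have iD': "integrable M (\<lambda>\<omega>. (D' \<omega>)\<^sup>2)" using step_integral_isometry(1)[OF st' st'] by (simp add: power2_eq_square)
  let ?A = "{\<omega>\<in>space M. V N \<omega> > \<delta>}"
  have [measurable]: "c i \<in> borel_measurable M" if "i < N" for i using F_measurable_M[OF pj c] that by auto
  have VN: "V N \<in> borel_measurable M" unfolding V_def
    by (intro borel_measurable_sum borel_measurable_times borel_measurable_power borel_measurable_norm
        borel_measurable_const measurable_compose[OF _ borel_measurable_norm]) auto
  have Am: "?A \<in> sets M" using VN by measurable
  have "prob_size D \<le> expectation (\<lambda>\<omega>. indicator ?A \<omega> + (sqrt \<delta> + (D' \<omega>)\<^sup>2 / sqrt \<delta>) / 2)"
    unfolding prob_size_def
  proof (rule integral_mono)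
    show "integrable M (\<lambda>\<omega>. indicator ?A \<omega> + (sqrt \<delta> + (D' \<omega>)\<^sup>2 / sqrt \<delta>) / 2)"
      using iD' Am by (intro Bochner_Integration.integrable_add integrable_divide)
        (auto simp: integrable_indicator_iff emeasure_eq_measure)
    fix \<omega> assume w: "\<omega> \<in> space M"
    have sq: "sqrt \<delta> * sqrt \<delta> = \<delta>" "sqrt \<delta> > 0" using d by auto
    have nn: "(sqrt \<delta> + (D' \<omega>)\<^sup>2 / sqrt \<delta>) / 2 \<ge> 0" using sq by simp
    show "min 1 \<bar>D \<omega>\<bar> \<le> indicator ?A \<omega> + (sqrt \<delta> + (D' \<omega>)\<^sup>2 / sqrt \<delta>) / 2"
    proof (cases "\<omega> \<in> ?A")
      case False
      then have V: "V N \<omega> \<le> \<delta>" using w by auto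
      have "c' i \<omega> = c i \<omega>" if "i < N" for i
        using Vmono[of "Suc i" N \<omega>] that V by (simp add: c'_def)
      then have D: "D \<omega> = D' \<omega>" unfolding D_def D'_def by (intro sum.cong) auto
      have "0 \<le> (\<bar>D' \<omega>\<bar> - sqrt \<delta>)\<^sup>2" by simp
      then have "2 * \<bar>D' \<omega>\<bar> * sqrt \<delta> \<le> (D' \<omega>)\<^sup>2 + \<delta>" using d by (simp add: power2_diff)
      then have "2 * \<bar>D' \<omega>\<bar> \<le> ((D' \<omega>)\<^sup>2 + \<delta>) / sqrt \<delta>" using sq by (simp add: pos_le_divide_eq)
      also have "\<dots> = sqrt \<delta> + (D' \<omega>)\<^sup>2 / sqrt \<delta>" using sq d by (simp add: add_divide_distrib real_div_sqrt)
      finally show ?thesis using D False by simp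
    next
      case True
      have "min 1 \<bar>D \<omega>\<bar> \<le> 1" by simp
      then show ?thesis using nn by (simp only: indicator_simps(1)[OF True])
    qed
  qed simp
  also have "\<dots> = prob ?A + (sqrt \<delta> + expectation (\<lambda>\<omega>. (D' \<omega>)\<^sup>2) / sqrt \<delta>) / 2"
    using iD' Am by (simp add: prob_space integrable_indicator_iff emeasure_eq_measure)
  also have "\<dots> \<le> prob ?A + (sqrt \<delta> + \<delta> / sqrt \<delta>) / 2"
    using E2 d by (intro add_left_mono divide_right_mono add_mono) auto
  also have "\<dots> = prob ?A + sqrt \<delta>" using d by (simp add: real_div_sqrt)
  finally show ?thesis unfolding D_def V_def .
qed

lemma matrix_vector_mult_sum_left:
  fixes A :: "nat \<Rightarrow> real^'k^'l"
  shows "(\<Sum>i<m. A i) *v x = (\<Sum>i<m. A i *v x)"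
  by (induction m) (auto simp: matrix_vector_mult_add_rdistrib)

lemma simple_value_const:
  assumes "\<And>i. i \<le> m \<Longrightarrow> \<not> (p < \<tau> i \<and> \<tau> i < q)" "p < r" "r \<le> q"
  shows "simple_value (m, \<tau>, \<xi>) r \<omega> = simple_value (m, \<tau>, \<xi>) q \<omega>"
proof -
  have "indicator {\<tau> i <.. \<tau> (Suc i)} r = (indicator {\<tau> i <.. \<tau> (Suc i)} q :: real)" if "i < m" for i
    using assms(1)[of i] assms(1)[of "Suc i"] assms(2,3) that by (auto simp: indicator_def)
  then show ?thesis unfolding simple_value_def prod.case
    by (intro sum.cong refl) (simp only: lessThan_iff)
qed

lemma simple_integral_increment:
  fixes S :: "('w, 'n::finite, 'd) simple_data"
  assumes S: "S = (m, \<tau>, \<xi>)" "simple_process F S" and gap: "\<And>i. i \<le> m \<Longrightarrow> \<not> (p < \<tau> i \<and> \<tau> i < q)" and pq: "p < q"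
  shows "simple_integral w S q \<omega> - simple_integral w S p \<omega> = simple_value S q \<omega> *v (w q \<omega> - w p \<omega>)"
proof -
  have le: "\<tau> i \<le> \<tau> (Suc i)" if "i < m" for i using S that by (auto simp: simple_process_def)
  have "\<xi> i \<omega> *v (w (min q (\<tau> (Suc i))) \<omega> - w (min q (\<tau> i)) \<omega>) - \<xi> i \<omega> *v (w (min p (\<tau> (Suc i))) \<omega> - w (min p (\<tau> i)) \<omega>)
     = (indicator {\<tau> i <.. \<tau> (Suc i)} q *\<^sub>R \<xi> i \<omega>) *v (w q \<omega> - w p \<omega>)" if i: "i < m" for i
  proof -
    consider "\<tau> (Suc i) \<le> p" | "q \<le> \<tau> i" | "\<tau> i \<le> p" "q \<le> \<tau> (Suc i)"
      using gap[of i] gap[of "Suc i"] i by fastforce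
    then show ?thesis
    proof cases
      case 1
      then have "min q (\<tau> (Suc i)) = \<tau> (Suc i)" "min q (\<tau> i) = \<tau> i" "min p (\<tau> (Suc i)) = \<tau> (Suc i)" "min p (\<tau> i) = \<tau> i"
        "q \<notin> {\<tau> i <.. \<tau> (Suc i)}"
        using le[OF i] pq by auto
      then show ?thesis by simp
    next
      case 2
      then have "min q (\<tau> (Suc i)) = q" "min q (\<tau> i) = q" "min p (\<tau> (Suc i)) = p" "min p (\<tau> i) = p"
        "q \<notin> {\<tau> i <.. \<tau> (Suc i)}"
        using le[OF i] pq by auto
      then show ?thesis by simp
    next
      case 3
      then have "min q (\<tau> (Suc i)) = q" "min q (\<tau> i) = \<tau> i" "min p (\<tau> (Suc i)) = p" "min p (\<tau> i) = \<tau> i"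
        "q \<in> {\<tau> i <.. \<tau> (Suc i)}"
        using le[OF i] pq by auto
      then show ?thesis by (simp add: matrix_vector_mult_diff_distrib)
    qed
  qed
  then show ?thesis
    unfolding S simple_integral_def simple_value_def
    unfolding prod.case sum_subtractf[symmetric] matrix_vector_mult_sum_left
    by (intro sum.cong refl) (simp only: lessThan_iff)
qed

lemma simple_value_measurable:
  fixes S :: "('w, 'n::finite, 'd) simple_data"
  assumes S: "S = (m, \<tau>, \<xi>)" "simple_process F S" and gap: "\<And>i. i \<le> m \<Longrightarrow> \<not> (p < \<tau> i \<and> \<tau> i < q)" and pq: "0 \<le> p" "p < q"
  shows "simple_value S q \<in> borel_measurable (F p)" "\<exists>C. \<forall>\<omega>\<in>space M. norm (simple_value S q \<omega>) \<le> C"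
proof -
  have le: "\<tau> i \<le> \<tau> (Suc i)" if "i < m" for i using S that by (auto simp: simple_process_def)
  have t0: "0 \<le> \<tau> i" if "i \<le> m" for i using that
  proof (induction i)
    case 0 then show ?case using S by (auto simp: simple_process_def)
  next
    case (Suc i) then show ?case using le[of i] by simp
  qed
  have m: "(\<lambda>\<omega>. indicator {\<tau> i <.. \<tau> (Suc i)} q *\<^sub>R \<xi> i \<omega>) \<in> borel_measurable (F p)" if i: "i < m" for i
  proof (cases "q \<in> {\<tau> i <.. \<tau> (Suc i)}")
    case True
    then have "\<tau> i \<le> p" using gap[of i] i pq by fastforce
    moreover have "\<xi> i \<in> borel_measurable (F (\<tau> i))" using S i by (auto simp: simple_process_def)
    ultimately have "\<xi> i \<in> borel_measurable (F p)" using F_measurable_mono[of "\<tau> i" p] t0[of i] i by auto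
    then show ?thesis by (intro borel_measurable_scaleR borel_measurable_const)
  qed simp
  show "simple_value S q \<in> borel_measurable (F p)"
    unfolding S simple_value_def prod.case using m by (intro borel_measurable_sum) auto
  have "\<exists>C. \<forall>\<omega>\<in>space M. norm (\<xi> i \<omega>) \<le> C" if "i < m" for i
    using S that F_space[OF t0[of i]] less_imp_le[OF that] by (auto simp: simple_process_def) metis
  then obtain C where C: "\<And>i \<omega>. i < m \<Longrightarrow> \<omega> \<in> space M \<Longrightarrow> norm (\<xi> i \<omega>) \<le> C i" by metis
  show "\<exists>C. \<forall>\<omega>\<in>space M. norm (simple_value S q \<omega>) \<le> C"
  proof (intro exI ballI)
    fix \<omega> assume w: "\<omega> \<in> space M"
    have "norm (indicator {\<tau> i <.. \<tau> (Suc i)} q *\<^sub>R \<xi> i \<omega>) \<le> C i" if "i < m" for i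
      using C[OF that w] norm_ge_zero[of "\<xi> i \<omega>"] by (auto simp: indicator_def simp del: norm_ge_zero)
    then show "norm (simple_value S q \<omega>) \<le> (\<Sum>i<m. C i)"
      unfolding S simple_value_def prod.case by (intro order_trans[OF norm_sum] sum_mono) auto
  qed
qed

end

context driven_space begin

lemma prob_size_nonneg: "0 \<le> prob_size X"
  unfolding prob_size_def by (rule integral_nonneg_AE) auto

lemma prob_size_mono:
  assumes "X \<in> borel_measurable M" "Y \<in> borel_measurable M" "AE \<omega> in M. \<bar>X \<omega>\<bar> \<le> \<bar>Y \<omega>\<bar>"
  shows "prob_size X \<le> prob_size Y"
  unfolding prob_size_def by (rule integral_mono_AE) (use assms in \<open>auto elim!: AE_mp\<close>)

lemma prob_size_add:
  assumes [measurable]: "X \<in> borel_measurable M" "Y \<in> borel_measurable M"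
  shows "prob_size (\<lambda>\<omega>. X \<omega> + Y \<omega>) \<le> prob_size X + prob_size Y"
proof -
  have "prob_size (\<lambda>\<omega>. X \<omega> + Y \<omega>) \<le> expectation (\<lambda>\<omega>. min 1 \<bar>X \<omega>\<bar> + min 1 \<bar>Y \<omega>\<bar>)"
    unfolding prob_size_def by (rule integral_mono) (auto split: split_min)
  also have "\<dots> = prob_size X + prob_size Y" unfolding prob_size_def by (simp)
  finally show ?thesis .
qed

lemma prob_size_scale:
  assumes [measurable]: "X \<in> borel_measurable M" "g \<in> borel_measurable M"
    and g: "\<And>\<omega>. \<omega> \<in> space M \<Longrightarrow> \<bar>g \<omega>\<bar> \<le> G" "1 \<le> G"
  shows "prob_size (\<lambda>\<omega>. g \<omega> * X \<omega>) \<le> G * prob_size X"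
proof -
  have "prob_size (\<lambda>\<omega>. g \<omega> * X \<omega>) \<le> expectation (\<lambda>\<omega>. G * min 1 \<bar>X \<omega>\<bar>)"
    unfolding prob_size_def
  proof (rule integral_mono)
    fix \<omega> assume w: "\<omega> \<in> space M"
    have "\<bar>g \<omega> * X \<omega>\<bar> \<le> G * \<bar>X \<omega>\<bar>" using g(1)[OF w] by (simp add: abs_mult mult_right_mono)
    then show "min 1 \<bar>g \<omega> * X \<omega>\<bar> \<le> G * min 1 \<bar>X \<omega>\<bar>" using g(2) by (auto simp: min_def)
  qed auto
  then show ?thesis by (simp add: prob_size_def)
qed

lemma prob_size_tendsto:
  assumes [measurable]: "\<And>n. X n \<in> borel_measurable M" and "AE \<omega> in M. (\<lambda>n. X n \<omega>) \<longlonglongrightarrow> 0"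
  shows "(\<lambda>n. prob_size (X n)) \<longlonglongrightarrow> 0"
proof -
  have "(\<lambda>n. expectation (\<lambda>\<omega>. min 1 \<bar>X n \<omega>\<bar>)) \<longlonglongrightarrow> expectation (\<lambda>\<omega>. 0)"
  proof (rule integral_dominated_convergence[where w="\<lambda>_. 1"])
    show "AE \<omega> in M. (\<lambda>n. min 1 \<bar>X n \<omega>\<bar>) \<longlonglongrightarrow> 0"
      using assms(2)
    proof eventually_elim
      case (elim \<omega>)
      have "(\<lambda>n. min 1 \<bar>X n \<omega>\<bar>) \<longlonglongrightarrow> min 1 \<bar>0\<bar>" by (intro tendsto_intros elim)
      then show ?case by simp
    qed
  qed auto
  then show ?thesis by (simp add: prob_size_def)
qed

lemma prob_size_markov:
  assumes [measurable]: "X \<in> borel_measurable M" and d: "0 < \<delta>" "\<delta> \<le> 1"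
  shows "prob {\<omega>\<in>space M. \<bar>X \<omega>\<bar> > \<delta>} \<le> prob_size X / \<delta>"
proof -
  let ?A = "{\<omega>\<in>space M. \<bar>X \<omega>\<bar> > \<delta>}"
  have "\<delta> * prob ?A = expectation (\<lambda>\<omega>. \<delta> * indicator ?A \<omega>)" by simp
  also have "\<dots> \<le> prob_size X" unfolding prob_size_def
  proof (rule integral_mono)
    show "integrable M (\<lambda>\<omega>. \<delta> * indicator ?A \<omega>)"
      by (intro integrable_mult_right) (auto simp: integrable_indicator_iff emeasure_eq_measure)
  qed (use d in \<open>auto simp: indicator_def split: split_min\<close>)
  finally show ?thesis using d by (simp add: field_simps)
qed

lemma prob_size_tends_in_probability:
  fixes X :: "nat \<Rightarrow> 'w \<Rightarrow> 'b::{metric_space, second_countable_topology}"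
  assumes m[measurable]: "\<And>k. X k \<in> borel_measurable M" "Y \<in> borel_measurable M" and t: "tends_in_probability M X Y"
  shows "(\<lambda>k. prob_size (\<lambda>\<omega>. dist (X k \<omega>) (Y \<omega>))) \<longlonglongrightarrow> 0"
proof (rule LIMSEQ_I)
  fix r :: real assume r: "r > 0"
  let ?A = "\<lambda>k. {\<omega>\<in>space M. dist (X k \<omega>) (Y \<omega>) > r / 2}"
  have "(\<lambda>k. prob (?A k)) \<longlonglongrightarrow> 0" using t[unfolded tends_in_probability_def, rule_format, of "r / 2"] r by simp
  then have "\<forall>\<^sub>F k in sequentially. prob (?A k) < r / 2" using r by (intro order_tendstoD(2)) auto
  then obtain N where N: "\<And>k. k \<ge> N \<Longrightarrow> prob (?A k) < r / 2" by (auto simp: eventually_sequentially)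
  have "norm (prob_size (\<lambda>\<omega>. dist (X k \<omega>) (Y \<omega>)) - 0) < r" if k: "k \<ge> N" for k
  proof -
    have "prob_size (\<lambda>\<omega>. dist (X k \<omega>) (Y \<omega>)) \<le> expectation (\<lambda>\<omega>. r / 2 + indicator (?A k) \<omega>)"
      unfolding prob_size_def
    proof (rule integral_mono)
      show "min 1 \<bar>dist (X k \<omega>) (Y \<omega>)\<bar> \<le> r / 2 + indicator (?A k) \<omega>" if "\<omega> \<in> space M" for \<omega>
        using r that by (auto simp: indicator_def min_def)
    qed (use prob_size_integrable[of "\<lambda>\<omega>. dist (X k \<omega>) (Y \<omega>)"] in
         \<open>auto simp: integrable_indicator_iff emeasure_eq_measure\<close>)
    also have "\<dots> = r / 2 + prob (?A k)" by (simp add: prob_space integrable_indicator_iff emeasure_eq_measure)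
    also have "\<dots> < r" using N[OF k] by simp
    finally show ?thesis using prob_size_nonneg by simp
  qed
  then show "\<exists>no. \<forall>n\<ge>no. norm (prob_size (\<lambda>\<omega>. dist (X n \<omega>) (Y \<omega>)) - 0) < r" by blast
qed

lemma prob_size_sum:
  assumes "\<And>i. i \<le> (n::nat) \<Longrightarrow> X i \<in> borel_measurable M"
  shows "prob_size (\<lambda>\<omega>. \<Sum>i\<le>n. X i \<omega>) \<le> (\<Sum>i\<le>n. prob_size (X i))"
  using assms
proof (induction n)
  case (Suc n)
  have "prob_size (\<lambda>\<omega>. (\<Sum>i\<le>n. X i \<omega>) + X (Suc n) \<omega>) \<le> prob_size (\<lambda>\<omega>. \<Sum>i\<le>n. X i \<omega>) + prob_size (X (Suc n))"
    by (rule prob_size_add) (use Suc.prems in auto)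
  then show ?case using Suc by fastforce
qed simp

lemma measurable_to_F: "0 \<le> t \<Longrightarrow> (\<lambda>\<omega>. \<omega>) \<in> measurable M (F t)"
  using F_space[of t] F_sub[of t] sets.sets_into_space by (auto simp: measurable_def Int_absorb2 subset_iff)

lemma progressive_clamp:
  fixes H :: "real \<Rightarrow> 'w \<Rightarrow> 'b::topological_space"
  assumes H: "progressive F H" and t: "0 \<le> t"
  shows "(\<lambda>(\<omega>, r). H (max 0 (min t r)) \<omega>) \<in> borel_measurable (F t \<Otimes>\<^sub>M lborel)"
    and "(\<lambda>(\<omega>, r). H (max 0 (min t r)) \<omega>) \<in> borel_measurable (M \<Otimes>\<^sub>M lborel)"
proof -
  have p: "(\<lambda>(s, \<omega>). H s \<omega>) \<in> borel_measurable (restrict_space borel {0..t} \<Otimes>\<^sub>M F t)"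
    using H t by (auto simp: progressive_def)
  have 1: "(\<lambda>x. (max 0 (min t (snd x)), fst x)) \<in> measurable (F t \<Otimes>\<^sub>M lborel) (restrict_space borel {0..t} \<Otimes>\<^sub>M F t)"
    by (intro measurable_Pair measurable_restrict_space2) (use t in auto)
  have 2: "(\<lambda>x. (max 0 (min t (snd x)), fst x)) \<in> measurable (M \<Otimes>\<^sub>M lborel) (restrict_space borel {0..t} \<Otimes>\<^sub>M F t)"
    by (intro measurable_Pair measurable_restrict_space2 measurable_compose[OF measurable_fst measurable_to_F]) (use t in auto)
  show "(\<lambda>(\<omega>, r). H (max 0 (min t r)) \<omega>) \<in> borel_measurable (F t \<Otimes>\<^sub>M lborel)"
    using measurable_compose[OF 1 p] by (simp add: case_prod_unfold)
  show "(\<lambda>(\<omega>, r). H (max 0 (min t r)) \<omega>) \<in> borel_measurable (M \<Otimes>\<^sub>M lborel)"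
    using measurable_compose[OF 2 p] by (simp add: case_prod_unfold)
qed

lemma simple_value_joint_measurable:
  fixes S :: "('w, 'n::finite, 'd) simple_data"
  assumes "simple_process F S"
  shows "(\<lambda>(\<omega>, r). simple_value S r \<omega>) \<in> borel_measurable (M \<Otimes>\<^sub>M lborel)"
    and "0 \<le> t \<Longrightarrow> simple_integral w S t \<in> borel_measurable M"
    and "\<omega> \<in> space M \<Longrightarrow> \<exists>C. \<forall>r. norm (simple_value S r \<omega>) \<le> C"
proof -
  obtain m \<tau> \<xi> where S: "S = (m, \<tau>, \<xi>)" by (cases S) auto
  have t0: "0 \<le> \<tau> i" if "i \<le> m" for i using that
  proof (induction i)
    case 0 then show ?case using assms by (auto simp: S simple_process_def)
  next
    case (Suc i)
    then have "\<tau> i \<le> \<tau> (Suc i)" using assms by (auto simp: S simple_process_def)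
    with Suc show ?case by simp
  qed
  have m: "\<xi> i \<in> borel_measurable M" if "i < m" for i
    using assms F_measurable_M[OF t0[of i]] that by (auto simp: S simple_process_def)
  have "(\<lambda>x. \<Sum>i<m. indicator {\<tau> i <.. \<tau> (Suc i)} (snd x) *\<^sub>R \<xi> i (fst x)) \<in> borel_measurable (M \<Otimes>\<^sub>M lborel)"
    using m by (intro borel_measurable_sum borel_measurable_scaleR) (auto intro: measurable_compose[OF measurable_fst])
  then show "(\<lambda>(\<omega>, r). simple_value S r \<omega>) \<in> borel_measurable (M \<Otimes>\<^sub>M lborel)"
    by (simp add: S simple_value_def case_prod_unfold)
  show "simple_integral w S t \<in> borel_measurable M" if t: "0 \<le> t"
  proof -
    have [measurable]: "w (min t (\<tau> i)) \<in> borel_measurable M" if "i \<le> m" for i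
      using w_measurable[of "min t (\<tau> i)"] t0[OF that] t by simp
    have c: "continuous_on UNIV (\<lambda>z::(real^'d^'n) \<times> (real^'d). fst z *v snd z)"
      unfolding matrix_vector_mult_def by (intro continuous_intros)
    have "(\<lambda>\<omega>. \<xi> i \<omega> *v (w (min t (\<tau> (Suc i))) \<omega> - w (min t (\<tau> i)) \<omega>)) \<in> borel_measurable M" if i: "i < m" for i
    proof -
      have "(\<lambda>\<omega>. (\<xi> i \<omega>, w (min t (\<tau> (Suc i))) \<omega> - w (min t (\<tau> i)) \<omega>)) \<in> borel_measurable M"
        using m[OF i] i by (intro borel_measurable_Pair) auto
      from measurable_compose[OF this borel_measurable_continuous_onI[OF c]] show ?thesis by simp
    qed
    then show ?thesis unfolding S simple_integral_def prod.case by (intro borel_measurable_sum) auto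
  qed
  show "\<exists>C. \<forall>r. norm (simple_value S r \<omega>) \<le> C"
  proof (intro exI allI)
    fix r
    have "norm (indicator {\<tau> i <.. \<tau> (Suc i)} r *\<^sub>R \<xi> i \<omega>) \<le> norm (\<xi> i \<omega>)" for i
      by (auto simp: indicator_def)
    then show "norm (simple_value S r \<omega>) \<le> (\<Sum>i<m. norm (\<xi> i \<omega>))"
      unfolding S simple_value_def prod.case by (intro order_trans[OF norm_sum] sum_mono)
  qed
qed

end

lemma round_up_iff:
  fixes s d x y z :: real
  assumes d: "d > 0" and xy: "x < y" and gap: "\<And>k::int. \<not> (x < s + d * k \<and> s + d * k < y)"
  shows "y \<le> s + d * of_int \<lceil>(z - s) / d\<rceil> \<longleftrightarrow> s + d * of_int \<lfloor>(x - s) / d\<rfloor> < z"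
proof
  assume a: "y \<le> s + d * of_int \<lceil>(z - s) / d\<rceil>"
  show "s + d * of_int \<lfloor>(x - s) / d\<rfloor> < z"
  proof (rule ccontr)
    assume "\<not> ?thesis"
    then have "(z - s) / d \<le> of_int \<lfloor>(x - s) / d\<rfloor>" using d by (simp add: pos_divide_le_eq mult.commute)
    then have "\<lceil>(z - s) / d\<rceil> \<le> \<lfloor>(x - s) / d\<rfloor>" by (simp add: ceiling_le_iff)
    then have "of_int \<lceil>(z - s) / d\<rceil> \<le> (x - s) / d" by (simp add: le_floor_iff)
    then have "s + d * of_int \<lceil>(z - s) / d\<rceil> \<le> x" using d by (simp add: pos_le_divide_eq mult.commute)
    with a xy show False by simp
  qed
next
  assume a: "s + d * of_int \<lfloor>(x - s) / d\<rfloor> < z"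
  then have "of_int \<lfloor>(x - s) / d\<rfloor> < (z - s) / d" using d by (simp add: pos_less_divide_eq mult.commute)
  then have "\<lfloor>(x - s) / d\<rfloor> < \<lceil>(z - s) / d\<rceil>" by (simp add: less_ceiling_iff)
  then have "(x - s) / d < of_int \<lceil>(z - s) / d\<rceil>" by (simp add: floor_less_iff)
  then have "x < s + d * of_int \<lceil>(z - s) / d\<rceil>" using d by (simp add: pos_divide_less_eq mult.commute)
  with gap show "y \<le> s + d * of_int \<lceil>(z - s) / d\<rceil>" by (meson not_le)
qed

section \<open>Increments of the Ito integral up to a stopping time\<close>

context driven_space begin

context
  fixes H :: "real \<Rightarrow> 'w \<Rightarrow> real^'d^'n::finite" and I :: "real \<Rightarrow> 'w \<Rightarrow> real^'n" and a :: 'n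
    and s t :: real and \<theta> :: "'w \<Rightarrow> real" and g :: "'w \<Rightarrow> real" and G B :: real
  assumes Hprog: "progressive F H"
    and Hsq: "AE \<omega> in M. set_integrable lborel {0..t} (\<lambda>r. (norm (H r \<omega>))\<^sup>2)"
    and Im: "\<And>r. 0 \<le> r \<Longrightarrow> I r \<in> borel_measurable M"
    and Icont: "AE \<omega> in M. continuous_on {0..} (\<lambda>r. I r \<omega>)"
    and st: "0 \<le> s" "s < t"
    and \<theta>: "\<And>\<omega>. \<omega> \<in> space M \<Longrightarrow> s \<le> \<theta> \<omega> \<and> \<theta> \<omega> \<le> t"
    and stop: "\<And>r. s \<le> r \<Longrightarrow> r < t \<Longrightarrow> {\<omega>\<in>space M. \<theta> \<omega> \<le> r} \<in> sets (F r)"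
    and g: "g \<in> borel_measurable (F s)" "\<And>\<omega>. \<omega> \<in> space M \<Longrightarrow> \<bar>g \<omega>\<bar> \<le> G" and G: "1 \<le> G"
    and B: "0 \<le> B" "\<And>\<omega> r. \<omega> \<in> space M \<Longrightarrow> s < r \<Longrightarrow> r \<le> \<theta> \<omega> \<Longrightarrow> norm (H r \<omega> $ a) \<le> B"
begin

definition Hc :: "real \<Rightarrow> 'w \<Rightarrow> real^'d^'n" where "Hc r \<omega> = H (max 0 (min t r)) \<omega>"

lemma Hc_eq: "0 \<le> r \<Longrightarrow> r \<le> t \<Longrightarrow> Hc r \<omega> = H r \<omega>" by (simp add: Hc_def)

lemma Hc_measurable: "(\<lambda>(\<omega>, r). Hc r \<omega>) \<in> borel_measurable (M \<Otimes>\<^sub>M lborel)"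
  unfolding Hc_def using progressive_clamp(2)[OF Hprog, of t] st by simp

lemma \<theta>_measurable: "\<theta> \<in> borel_measurable M"
proof (rule borel_measurable_iff_le[THEN iffD2], rule allI)
  fix r
  consider "r < s" | "s \<le> r" "r < t" | "t \<le> r" by linarith
  then show "{\<omega> \<in> space M. \<theta> \<omega> \<le> r} \<in> sets M"
  proof cases
    case 1
    then have "{\<omega> \<in> space M. \<theta> \<omega> \<le> r} = {}" using \<theta> by fastforce
    then show ?thesis by (simp only: sets.empty_sets)
  next
    case 2
    then show ?thesis using stop F_sub[of r] st by auto
  next
    case 3
    then have "{\<omega> \<in> space M. \<theta> \<omega> \<le> r} = space M" using \<theta> by fastforce
    then show ?thesis by (simp only: sets.top)
  qed
qed

lemma g_measurable: "g \<in> borel_measurable M" using F_measurable_M[OF st(1) g(1)] .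

definition integrand :: "real \<Rightarrow> 'w \<Rightarrow> real^'d" where
  "integrand r \<omega> = (indicator {s<..\<theta> \<omega>} r * g \<omega>) *\<^sub>R (Hc r \<omega> $ a)"

lemma row_measurable: "(\<lambda>x. Hc (snd x) (fst x) $ a) \<in> borel_measurable (M \<Otimes>\<^sub>M lborel)"
proof -
  have "continuous_on UNIV (\<lambda>A::real^'d^'n. A $ a)" by (intro continuous_intros)
  from measurable_compose[OF Hc_measurable borel_measurable_continuous_onI[OF this]]
  show ?thesis by (simp add: case_prod_unfold)
qed

lemma integrand_measurable: "(\<lambda>(\<omega>, r). integrand r \<omega>) \<in> borel_measurable (M \<Otimes>\<^sub>M lborel)"
proof -
  note [measurable] = row_measurable \<theta>_measurable g_measurable
  have "(\<lambda>x. (indicator {x. s < snd x \<and> snd x \<le> \<theta> (fst x)} x * g (fst x)) *\<^sub>R (Hc (snd x) (fst x) $ a))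
     \<in> borel_measurable (M \<Otimes>\<^sub>M lborel)" by measurable
  moreover have "(\<lambda>(\<omega>, r). integrand r \<omega>) = (\<lambda>x. (indicator {x. s < snd x \<and> snd x \<le> \<theta> (fst x)} x * g (fst x)) *\<^sub>R (Hc (snd x) (fst x) $ a))"
    by (auto simp: integrand_def fun_eq_iff indicator_def)
  ultimately show ?thesis by simp
qed

lemma integrable_bounded_strip:
  fixes f :: "'w \<times> real \<Rightarrow> real"
  assumes [measurable]: "f \<in> borel_measurable (M \<Otimes>\<^sub>M lborel)"
    and b: "\<And>\<omega> r. \<omega> \<in> space M \<Longrightarrow> \<bar>f (\<omega>, r)\<bar> \<le> indicator {s..t} r * C"
  shows "integrable (M \<Otimes>\<^sub>M lborel) f"
proof (rule Bochner_Integration.integrable_bound)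
  show "integrable (M \<Otimes>\<^sub>M lborel) (\<lambda>(\<omega>, r). indicator {s..t} r * C)"
  proof (rule PL.Fubini_integrable)
    show "integrable M (\<lambda>x. LINT y|lborel. norm (case (x, y) of (\<omega>, r) \<Rightarrow> indicator {s..t} r * C))"
      by simp
    show "AE x in M. integrable lborel (\<lambda>y. case (x, y) of (\<omega>, r) \<Rightarrow> indicator {s..t} r * C)"
      using st by (auto simp: integrable_indicator_iff)
  qed measurable
  show "AE x in M \<Otimes>\<^sub>M lborel. norm (f x) \<le> norm (case x of (\<omega>, r) \<Rightarrow> indicator {s..t} r * C)"
  proof (rule AE_I2)
    fix x :: "'w \<times> real" assume "x \<in> space (M \<Otimes>\<^sub>M lborel)"
    then obtain \<omega> r where "x = (\<omega>, r)" "\<omega> \<in> space M" by (auto simp: space_pair_measure)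
    with b[of \<omega> r] show "norm (f x) \<le> norm (case x of (\<omega>, r) \<Rightarrow> indicator {s..t} r * C)" by simp
  qed
qed fact

lemma integrand_bound:
  assumes "\<omega> \<in> space M"
  shows "norm (integrand r \<omega>) \<le> indicator {s..t} r * (G * B)"
proof (cases "s < r \<and> r \<le> \<theta> \<omega>")
  case True
  with \<theta>[OF assms] st have "Hc r \<omega> = H r \<omega>" "r \<in> {s..t}" by (auto intro: Hc_eq)
  moreover have "\<bar>g \<omega>\<bar> * norm (H r \<omega> $ a) \<le> G * B"
    using g(2)[OF assms] B(2)[OF assms] True G by (intro mult_mono) auto
  ultimately show ?thesis using True by (simp add: integrand_def)
next
  case False
  then have "integrand r \<omega> = 0" by (auto simp: integrand_def)
  then show ?thesis using G B(1) by simp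
qed

lemma integrand_square_integrable: "integrable (M \<Otimes>\<^sub>M lborel) (\<lambda>(\<omega>, r). (norm (integrand r \<omega>))\<^sup>2)"
proof (rule integrable_bounded_strip[where C="(G * B)\<^sup>2"])
  show "(\<lambda>(\<omega>, r). (norm (integrand r \<omega>))\<^sup>2) \<in> borel_measurable (M \<Otimes>\<^sub>M lborel)"
    using measurable_compose[OF integrand_measurable borel_measurable_norm]
    by (simp add: case_prod_unfold)
  show "\<bar>case (\<omega>, r) of (\<omega>, r) \<Rightarrow> (norm (integrand r \<omega>))\<^sup>2\<bar> \<le> indicator {s..t} r * (G * B)\<^sup>2" if "\<omega> \<in> space M" for \<omega> r
    using power_mono[OF integrand_bound[OF that, of r], of 2] by (cases "r \<in> {s..t}") (simp_all add: power_mult_distrib)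
qed

definition mesh :: "nat \<Rightarrow> real" where "mesh n = (t - s) / n"
definition \<theta>up :: "nat \<Rightarrow> 'w \<Rightarrow> real" where "\<theta>up n \<omega> = s + mesh n * of_int \<lceil>(\<theta> \<omega> - s) / mesh n\<rceil>"

lemma mesh_pos: "n > 0 \<Longrightarrow> mesh n > 0" using st by (simp add: mesh_def)

lemma \<theta>up_bounds:
  assumes n: "n > 0" and w: "\<omega> \<in> space M"
  shows "\<theta> \<omega> \<le> \<theta>up n \<omega>" "\<theta>up n \<omega> \<le> \<theta> \<omega> + mesh n" "\<exists>i\<le>n. \<theta>up n \<omega> = s + mesh n * real i"
proof -
  let ?x = "(\<theta> \<omega> - s) / mesh n"
  note m = mesh_pos[OF n]
  have e: "\<theta> \<omega> = s + mesh n * ?x" using m by simp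
  show "\<theta> \<omega> \<le> \<theta>up n \<omega>"
  proof -
    have "mesh n * ?x \<le> mesh n * of_int \<lceil>?x\<rceil>" using m by (intro mult_left_mono) auto
    then show ?thesis using e unfolding \<theta>up_def by linarith
  qed
  show "\<theta>up n \<omega> \<le> \<theta> \<omega> + mesh n"
  proof -
    have "of_int \<lceil>?x\<rceil> \<le> ?x + 1" by linarith
    then have "mesh n * of_int \<lceil>?x\<rceil> \<le> mesh n * (?x + 1)" using m by (intro mult_left_mono) auto
    then show ?thesis using e unfolding \<theta>up_def distrib_left by linarith
  qed
  have "0 \<le> ?x" using \<theta>[OF w] m by simp
  then have 0: "0 \<le> \<lceil>?x\<rceil>" by (metis ceiling_mono ceiling_zero)
  have "mesh n * n = t - s" using n by (simp add: mesh_def)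
  then have xn: "?x \<le> n" using \<theta>[OF w] by (subst pos_divide_le_eq[OF m]) (simp add: mult.commute)
  then have "\<lceil>?x\<rceil> \<le> int n" by (simp add: ceiling_le_iff)
  with 0 show "\<exists>i\<le>n. \<theta>up n \<omega> = s + mesh n * real i"
    unfolding \<theta>up_def using xn by (intro exI[of _ "nat \<lceil>?x\<rceil>"]) auto
qed

lemma \<theta>up_le:
  assumes n: "n > 0" and w: "\<omega> \<in> space M"
  shows "\<theta>up n \<omega> \<le> t" "s \<le> \<theta>up n \<omega>"
proof -
  obtain i where i: "i \<le> n" "\<theta>up n \<omega> = s + mesh n * real i" using \<theta>up_bounds(3)[OF n w] by blast
  have "mesh n * real i \<le> mesh n * real n" using i mesh_pos[OF n] by (intro mult_left_mono) auto
  then show "\<theta>up n \<omega> \<le> t" using i n by (simp add: mesh_def)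
  show "s \<le> \<theta>up n \<omega>" using i mesh_pos[OF n] by simp
qed

lemma \<theta>up_measurable: "\<theta>up n \<in> borel_measurable M"
  unfolding \<theta>up_def using \<theta>_measurable by measurable

lemma \<theta>up_index:
  assumes n: "n > 0"
  obtains idx where "idx \<in> measurable M (count_space UNIV)"
    "\<And>\<omega>. \<omega> \<in> space M \<Longrightarrow> \<theta>up n \<omega> = s + mesh n * real (idx \<omega>)" "\<And>\<omega>. \<omega> \<in> space M \<Longrightarrow> idx \<omega> \<le> n"
proof
  let ?idx = "\<lambda>\<omega>. nat \<lceil>(\<theta> \<omega> - s) / mesh n\<rceil>"
  show "?idx \<in> measurable M (count_space UNIV)" using \<theta>_measurable by measurable
  fix \<omega> assume w: "\<omega> \<in> space M"
  obtain i where i: "i \<le> n" "\<theta>up n \<omega> = s + mesh n * real i" using \<theta>up_bounds(3)[OF n w] by blast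
  then have "of_int \<lceil>(\<theta> \<omega> - s) / mesh n\<rceil> = real i" using mesh_pos[OF n] by (simp add: \<theta>up_def)
  then have "\<lceil>(\<theta> \<omega> - s) / mesh n\<rceil> = int i" by linarith
  then show "\<theta>up n \<omega> = s + mesh n * real (?idx \<omega>)" "?idx \<omega> \<le> n" using i by auto
qed

lemma I_component_measurable: "0 \<le> r \<Longrightarrow> (\<lambda>\<omega>. I r \<omega> $ a) \<in> borel_measurable M"
  using measurable_compose[OF Im borel_measurable_nth] by simp

lemma I_\<theta>up_measurable:
  assumes n: "n > 0"
  shows "(\<lambda>\<omega>. I (\<theta>up n \<omega>) \<omega> $ a) \<in> borel_measurable M"
proof -
  obtain idx where idx: "idx \<in> measurable M (count_space UNIV)"
    "\<And>\<omega>. \<omega> \<in> space M \<Longrightarrow> \<theta>up n \<omega> = s + mesh n * real (idx \<omega>)" using \<theta>up_index[OF n] by metis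
  have "(\<lambda>\<omega>. I (s + mesh n * real (idx \<omega>)) \<omega> $ a) \<in> borel_measurable M"
    by (rule measurable_compose_countable[OF _ idx(1)])
       (use st mesh_pos[OF n] in \<open>auto intro!: I_component_measurable\<close>)
  then show ?thesis using idx(2) by (subst measurable_cong) auto
qed

definition approx_error :: "('w, 'n, 'd) simple_data \<Rightarrow> 'w \<Rightarrow> real" where
  "approx_error S \<omega> = (LINT r:{0..t}|lborel. (norm (simple_value S r \<omega> - Hc r \<omega>))\<^sup>2)"
definition overshoot :: "nat \<Rightarrow> 'w \<Rightarrow> real" where
  "overshoot n \<omega> = (\<integral>r. indicator {\<theta> \<omega><..\<theta>up n \<omega>} r * (norm (Hc r \<omega> $ a))\<^sup>2 \<partial>lborel)"

lemma approx_error_integrable: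
  assumes S: "simple_process F S"
  shows "AE \<omega> in M. integrable lborel (\<lambda>r. indicator {0..t} r * (norm (simple_value S r \<omega> - Hc r \<omega>))\<^sup>2)
     \<and> integrable lborel (\<lambda>r. indicator {0..t} r * (norm (Hc r \<omega>))\<^sup>2)"
  using Hsq AE_space
proof eventually_elim
  case (elim \<omega>)
  have eq: "(\<lambda>r. indicator {0..t} r *\<^sub>R (norm (H r \<omega>))\<^sup>2) = (\<lambda>r. indicator {0..t} r * (norm (Hc r \<omega>))\<^sup>2)"
    by (auto simp: fun_eq_iff indicator_def Hc_eq)
  have 1: "integrable lborel (\<lambda>r. indicator {0..t} r * (norm (Hc r \<omega>))\<^sup>2)"
    using elim unfolding set_integrable_def eq by simp
  obtain C where C: "\<And>r. norm (simple_value S r \<omega>) \<le> C" using simple_value_joint_measurable(3)[OF S elim(2)] by blast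
  have [measurable]: "(\<lambda>r. simple_value S r \<omega>) \<in> borel_measurable lborel" "(\<lambda>r. Hc r \<omega>) \<in> borel_measurable lborel"
    using measurable_compose[OF measurable_Pair1'[OF elim(2)] simple_value_joint_measurable(1)[OF S]]
      measurable_compose[OF measurable_Pair1'[OF elim(2)] Hc_measurable] by simp_all
  have "integrable lborel (\<lambda>r. indicator {0..t} r * (norm (simple_value S r \<omega> - Hc r \<omega>))\<^sup>2)"
  proof (rule Bochner_Integration.integrable_bound)
    show "integrable lborel (\<lambda>r. 2 * C\<^sup>2 * indicator {0..t} r + 2 * (indicator {0..t} r * (norm (Hc r \<omega>))\<^sup>2))"
      using 1 by (intro Bochner_Integration.integrable_add integrable_mult_right) (use st in \<open>auto simp: integrable_indicator_iff\<close>)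
    show "AE r in lborel. norm (indicator {0..t} r * (norm (simple_value S r \<omega> - Hc r \<omega>))\<^sup>2)
       \<le> norm (2 * C\<^sup>2 * indicator {0..t} r + 2 * (indicator {0..t} r * (norm (Hc r \<omega>))\<^sup>2))"
    proof (rule AE_I2)
      fix r
      have "(norm (simple_value S r \<omega> - Hc r \<omega>))\<^sup>2 \<le> (norm (simple_value S r \<omega>) + norm (Hc r \<omega>))\<^sup>2"
        by (intro power_mono norm_triangle_ineq4) auto
      also have "\<dots> \<le> 2 * (norm (simple_value S r \<omega>))\<^sup>2 + 2 * (norm (Hc r \<omega>))\<^sup>2"
        using sum_squares_bound[of "norm (simple_value S r \<omega>)" "norm (Hc r \<omega>)"] by (simp add: power2_sum)
      also have "\<dots> \<le> 2 * C\<^sup>2 + 2 * (norm (Hc r \<omega>))\<^sup>2"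
        using power_mono[OF C[of r], of 2] by simp
      finally show "norm (indicator {0..t} r * (norm (simple_value S r \<omega> - Hc r \<omega>))\<^sup>2)
       \<le> norm (2 * C\<^sup>2 * indicator {0..t} r + 2 * (indicator {0..t} r * (norm (Hc r \<omega>))\<^sup>2))"
        by (auto simp: indicator_def)
    qed
  qed measurable
  with 1 show ?case by simp
qed

lemma approx_error_measurable:
  assumes S: "simple_process F S"
  shows "approx_error S \<in> borel_measurable M"
proof -
  note [measurable] = simple_value_joint_measurable(1)[OF S, simplified case_prod_unfold] Hc_measurable[simplified case_prod_unfold]
  show ?thesis unfolding approx_error_def set_lebesgue_integral_def
    by (rule lborel.borel_measurable_lebesgue_integral) (simp add: case_prod_unfold, measurable)
qed

lemma overshoot_measurable: "overshoot n \<in> borel_measurable M"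
proof -
  note [measurable] = row_measurable \<theta>_measurable \<theta>up_measurable
  have "(\<lambda>x. indicator {x. \<theta> (fst x) < snd x \<and> snd x \<le> \<theta>up n (fst x)} x * (norm (Hc (snd x) (fst x) $ a))\<^sup>2)
     \<in> borel_measurable (M \<Otimes>\<^sub>M lborel)" by measurable
  moreover have "(\<lambda>x. indicator {x. \<theta> (fst x) < snd x \<and> snd x \<le> \<theta>up n (fst x)} x * (norm (Hc (snd x) (fst x) $ a))\<^sup>2)
    = (\<lambda>(\<omega>, r). indicator {\<theta> \<omega><..\<theta>up n \<omega>} r * (norm (Hc r \<omega> $ a))\<^sup>2)"
    by (auto simp: fun_eq_iff indicator_def)
  ultimately show ?thesis unfolding overshoot_def
    by (intro lborel.borel_measurable_lebesgue_integral) simp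
qed

lemma mesh_tendsto: "(\<lambda>n. mesh (Suc n)) \<longlonglongrightarrow> 0"
  unfolding mesh_def using LIMSEQ_Suc[OF lim_const_over_n[of "t - s"]] by simp

lemma \<theta>up_tendsto:
  assumes w: "\<omega> \<in> space M" shows "(\<lambda>n. \<theta>up (Suc n) \<omega>) \<longlonglongrightarrow> \<theta> \<omega>"
proof (rule tendsto_sandwich[OF _ _ tendsto_const])
  show "(\<lambda>n. \<theta> \<omega> + mesh (Suc n)) \<longlonglongrightarrow> \<theta> \<omega>" using tendsto_add[OF tendsto_const mesh_tendsto, of "\<theta> \<omega>"] by simp
qed (use \<theta>up_bounds[OF _ w] in \<open>auto intro!: always_eventually\<close>)

lemma row_norm_le: "norm (Hc r \<omega> $ a) \<le> norm (Hc r \<omega>)" by (rule Finite_Cartesian_Product.norm_nth_le)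

lemma overshoot_integrable:
  assumes n: "n > 0" and w: "\<omega> \<in> space M" and i: "integrable lborel (\<lambda>r. indicator {0..t} r * (norm (Hc r \<omega>))\<^sup>2)"
  shows "integrable lborel (\<lambda>r. indicator {\<theta> \<omega><..\<theta>up n \<omega>} r * (norm (Hc r \<omega> $ a))\<^sup>2)"
proof (rule Bochner_Integration.integrable_bound[OF i])
  have [measurable]: "(\<lambda>r. Hc r \<omega> $ a) \<in> borel_measurable lborel"
    using measurable_compose[OF measurable_Pair1'[OF w] row_measurable] by simp
  show "(\<lambda>r. indicator {\<theta> \<omega><..\<theta>up n \<omega>} r * (norm (Hc r \<omega> $ a))\<^sup>2) \<in> borel_measurable lborel" by measurable
  show "AE r in lborel. norm (indicator {\<theta> \<omega><..\<theta>up n \<omega>} r * (norm (Hc r \<omega> $ a))\<^sup>2)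
      \<le> norm (indicator {0..t} r * (norm (Hc r \<omega>))\<^sup>2)"
    using \<theta>up_le[OF n w] \<theta>[OF w] st power_mono[OF row_norm_le norm_ge_zero, of _ \<omega> 2]
    by (intro AE_I2) (auto simp: indicator_def)
qed

lemma overshoot_tendsto: "(\<lambda>n. prob_size (overshoot (Suc n))) \<longlonglongrightarrow> 0"
proof (rule prob_size_tendsto[OF overshoot_measurable])
  have "simple_process F (0, \<lambda>_. 0, \<lambda>_ _. 0 :: real^'d^'n)" by (simp add: simple_process_def)
  from approx_error_integrable[OF this] AE_space
  show "AE \<omega> in M. (\<lambda>n. overshoot (Suc n) \<omega>) \<longlonglongrightarrow> 0"
  proof eventually_elim
    case (elim \<omega>)
    then have w: "\<omega> \<in> space M" and i: "integrable lborel (\<lambda>r. indicator {0..t} r * (norm (Hc r \<omega>))\<^sup>2)" by auto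
    have [measurable]: "(\<lambda>r. Hc r \<omega> $ a) \<in> borel_measurable lborel"
      using measurable_compose[OF measurable_Pair1'[OF w] row_measurable] by simp
    have "(\<lambda>n. \<integral>r. indicator {\<theta> \<omega><..\<theta>up (Suc n) \<omega>} r * (norm (Hc r \<omega> $ a))\<^sup>2 \<partial>lborel) \<longlonglongrightarrow> (\<integral>r. 0 \<partial>(lborel :: real measure))"
    proof (rule integral_dominated_convergence[OF _ _ i])
      show "AE r in lborel. (\<lambda>n. indicator {\<theta> \<omega><..\<theta>up (Suc n) \<omega>} r * (norm (Hc r \<omega> $ a))\<^sup>2) \<longlonglongrightarrow> 0"
      proof (rule AE_I2)
        fix r
        have "\<forall>\<^sub>F n in sequentially. indicator {\<theta> \<omega><..\<theta>up (Suc n) \<omega>} r * (norm (Hc r \<omega> $ a))\<^sup>2 = 0"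
        proof (cases "\<theta> \<omega> < r")
          case True
          from order_tendstoD(2)[OF \<theta>up_tendsto[OF w] this] show ?thesis by eventually_elim auto
        qed simp
        then show "(\<lambda>n. indicator {\<theta> \<omega><..\<theta>up (Suc n) \<omega>} r * (norm (Hc r \<omega> $ a))\<^sup>2) \<longlonglongrightarrow> 0"
          by (rule tendsto_eventually)
      qed
      show "AE r in lborel. norm (indicator {\<theta> \<omega><..\<theta>up (Suc n) \<omega>} r * (norm (Hc r \<omega> $ a))\<^sup>2)
          \<le> indicator {0..t} r * (norm (Hc r \<omega>))\<^sup>2" for n
        using \<theta>up_le[of "Suc n", OF _ w] \<theta>[OF w] st power_mono[OF row_norm_le norm_ge_zero, of _ \<omega> 2]
        by (intro AE_I2) (auto simp: indicator_def)
    qed measurable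
    then show ?case by (simp add: overshoot_def)
  qed
qed

text \<open>The stopping time is rounded up to the mesh, because a step process can only be switched off at
  a partition point, and the values of \<open>S\<close> are projected onto the ball of radius \<open>B\<close>, which does not
  increase the distance to the bounded integrand: convergence in probability becomes convergence in
  mean square.  Lenglart's inequality controls the integral of what the projection cuts off.\<close>

lemma step_approximation:
  assumes S: "simple_process F S" and n: "n > 0" and X[measurable]: "X \<in> borel_measurable M"
  defines "J \<equiv> \<lambda>r \<omega>. simple_integral w S r \<omega> $ a"
  defines "Iup \<equiv> \<lambda>\<omega>. I (\<theta>up n \<omega>) \<omega> $ a"
  shows "\<exists>Z Y. step_integral Z Y \<and>
    (\<integral>(\<omega>, r). (norm (Z r \<omega> - integrand r \<omega>))\<^sup>2 \<partial>(M \<Otimes>\<^sub>M lborel))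
       \<le> G\<^sup>2 * (max 1 (4 * B\<^sup>2 * (t - s)) * prob_size (approx_error S) + B\<^sup>2 * mesh n) \<and>
    (\<forall>\<delta>>0. \<delta> \<le> 1 \<longrightarrow> prob_size (\<lambda>\<omega>. Y \<omega> - g \<omega> * X \<omega>) \<le>
       G * (2 * (\<Sum>i\<le>n. prob_size (\<lambda>\<omega>. J (s + mesh n * real i) \<omega> - I (s + mesh n * real i) \<omega> $ a))
          + prob_size (\<lambda>\<omega>. Iup \<omega> - I s \<omega> $ a - X \<omega>)
          + (2 * prob_size (approx_error S) + 2 * prob_size (overshoot n)) / \<delta> + sqrt \<delta>))"
proof -
  obtain m \<tau> \<xi> where Seq: "S = (m, \<tau>, \<xi>)" by (cases S) auto
  note mp = mesh_pos[OF n]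
  define q where "q = (\<lambda>i::nat. s + mesh n * real i)"
  have qst: "q i \<in> {s..t}" if "i \<le> n" for i
  proof -
    have "mesh n * real i \<le> mesh n * real n" using that mp by (intro mult_left_mono) auto
    moreover have "0 \<le> mesh n * real i" using mp by simp
    moreover have "mesh n * real n = t - s" using n by (simp add: mesh_def)
    ultimately show ?thesis by (simp add: q_def)
  qed
  define P where "P = q ` {..n} \<union> (\<tau> ` {..m} \<inter> {s..t})"
  have q0: "q 0 = s" and qn: "q n = t" using n by (auto simp: q_def mesh_def)
  have "q 0 \<in> P" "q n \<in> P" by (auto simp: P_def)
  then have "finite P" "s \<in> P" "t \<in> P" "P \<subseteq> {s..t}"
    using qst unfolding q0 qn by (auto simp: P_def)
  from sorted_grid[OF this] obtain N p where lt: "\<And>i. i < N \<Longrightarrow> p i < p (Suc i)" and p0: "p 0 = s" and pN: "p N = t"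
    and Pp: "P = p ` {..N::nat}" and gap: "\<And>i x. i < N \<Longrightarrow> x \<in> P \<Longrightarrow> \<not> (p i < x \<and> x < p (Suc i))" by metis
  have gr: "grid N p" using lt by (simp add: grid_def)
  have pst: "p i \<in> {s..t}" if "i \<le> N" for i using grid_mono[OF gr, of 0 i] grid_mono[OF gr, of i N] that p0 pN by auto
  have p_nn: "0 \<le> p i" if "i \<le> N" for i using pst[OF that] st by auto
  have gap\<tau>: "\<not> (p j < \<tau> i \<and> \<tau> i < p (Suc j))" if "j < N" "i \<le> m" for i j
  proof
    assume *: "p j < \<tau> i \<and> \<tau> i < p (Suc j)"
    then have "\<tau> i \<in> P" using pst[of j] pst[of "Suc j"] that by (auto simp: P_def)
    with gap[OF that(1)] * show False by blast
  qed
  have gapq: "\<not> (p j < s + mesh n * of_int k \<and> s + mesh n * of_int k < p (Suc j))" if j: "j < N" for j and k :: int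
  proof
    assume *: "p j < s + mesh n * of_int k \<and> s + mesh n * of_int k < p (Suc j)"
    then have "0 < mesh n * of_int k" "mesh n * of_int k < mesh n * n"
      using pst[of j] pst[of "Suc j"] j n by (auto simp: mesh_def)
    then have "0 < k" "k < int n" using mp by (auto simp: zero_less_mult_iff)
    then have "s + mesh n * of_int k = q (nat k)" "nat k \<le> n" by (auto simp: q_def)
    then have "s + mesh n * of_int k \<in> P" by (auto simp: P_def)
    with gap[OF j] * show False by blast
  qed
  define \<zeta> where "\<zeta> = (\<lambda>j \<omega>. simple_value S (p (Suc j)) \<omega> $ a)"
  define \<kappa> where "\<kappa> = (\<lambda>j \<omega>. if p (Suc j) \<le> \<theta>up n \<omega> then 1 else 0 :: real)"
  define cl where "cl = (closest_point (cball 0 B) :: real^'d \<Rightarrow> real^'d)"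
  have ball: "convex (cball (0::real^'d) B)" "closed (cball (0::real^'d) B)" "cball (0::real^'d) B \<noteq> {}" using B by auto
  have cl_norm: "norm (cl x) \<le> B" for x
    using closest_point_in_set[OF ball(2,3), of x] by (simp add: cl_def)
  have cl_fix: "cl x = x" if "norm x \<le> B" for x unfolding cl_def by (rule closest_point_self) (use that in simp)
  have cl_lip: "norm (cl x - cl y) \<le> norm (x - y)" for x y
    using closest_point_lipschitz[OF ball, of x y] by (simp add: cl_def dist_norm)
  have cl_le: "norm (x - cl x) \<le> norm (x - y)" if "norm y \<le> B" for x y
    using closest_point_le[OF ball(2), of y x] that by (simp add: cl_def dist_norm)
  have cl_m: "cl \<in> borel_measurable borel"
    unfolding cl_def by (rule borel_measurable_continuous_onI[OF continuous_on_closest_point[OF ball]])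
  have nth_m: "(\<lambda>A::real^'d^'n. A $ a) \<in> borel_measurable borel"
    by (rule borel_measurable_continuous_onI) (intro continuous_intros)
  have \<zeta>m: "\<zeta> j \<in> borel_measurable (F (p j))" and \<zeta>b: "\<exists>C. \<forall>\<omega>\<in>space M. norm (\<zeta> j \<omega>) \<le> C" if j: "j < N" for j
  proof -
    note sv = simple_value_measurable[OF Seq S gap\<tau>[OF j] p_nn[OF less_imp_le[OF j]] lt[OF j]]
    show "\<zeta> j \<in> borel_measurable (F (p j))" unfolding \<zeta>_def using measurable_compose[OF sv(1) nth_m] by simp
    show "\<exists>C. \<forall>\<omega>\<in>space M. norm (\<zeta> j \<omega>) \<le> C"
      using sv(2) unfolding \<zeta>_def by (meson Finite_Cartesian_Product.norm_nth_le order_trans)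
  qed
  have \<kappa>m: "\<kappa> j \<in> borel_measurable (F (p j))" if j: "j < N" for j
  proof -
    define r where "r = s + mesh n * of_int \<lfloor>(p j - s) / mesh n\<rfloor>"
    have iff: "p (Suc j) \<le> \<theta>up n \<omega> \<longleftrightarrow> r < \<theta> \<omega>" for \<omega>
      unfolding \<theta>up_def r_def by (rule round_up_iff[OF mp lt[OF j] gapq[OF j]])
    have "of_int \<lfloor>(p j - s) / mesh n\<rfloor> \<le> (p j - s) / mesh n" by (rule of_int_floor_le)
    then have "of_int \<lfloor>(p j - s) / mesh n\<rfloor> * mesh n \<le> p j - s" by (simp only: pos_le_divide_eq[OF mp])
    then have rp: "r \<le> p j" unfolding r_def by (simp add: mult.commute)
    have "0 \<le> (p j - s) / mesh n" using pst[of j] j mp by simp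
    then have "0 \<le> \<lfloor>(p j - s) / mesh n\<rfloor>" by simp
    then have rs: "s \<le> r" using mp unfolding r_def by simp
    have "r < t" using rp lt[OF j] pst[of "Suc j"] j by auto
    then have "{\<omega>\<in>space M. \<theta> \<omega> \<le> r} \<in> sets (F (p j))"
      using F_sets_mono[OF _ rp stop[OF rs]] rs st by auto
    then have "{\<omega>\<in>space (F (p j)). \<theta> \<omega> \<le> r} \<in> sets (F (p j))" using F_space p_nn j by simp
    then have [measurable]: "Measurable.pred (F (p j)) (\<lambda>\<omega>. \<theta> \<omega> \<le> r)" by (simp add: pred_def)
    have "\<kappa> j = (\<lambda>\<omega>. if \<theta> \<omega> \<le> r then 0 else 1)" unfolding \<kappa>_def iff by auto
    then show ?thesis by simp
  qed
  have gm: "g \<in> borel_measurable (F (p j))" if "j < N" for j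
    using F_measurable_mono[OF st(1) _ g(1)] pst[of j] that by auto
  define c where "c = (\<lambda>j \<omega>. \<kappa> j \<omega> *\<^sub>R (\<zeta> j \<omega> - cl (\<zeta> j \<omega>)))"
  define z where "z = (\<lambda>j \<omega>. (g \<omega> * \<kappa> j \<omega>) *\<^sub>R cl (\<zeta> j \<omega>))"
  have clz: "(\<lambda>\<omega>. cl (\<zeta> j \<omega>)) \<in> borel_measurable (F (p j))" if "j < N" for j
    using measurable_compose[OF \<zeta>m[OF that] cl_m] .
  have cm: "c j \<in> borel_measurable (F (p j))" if "j < N" for j
    unfolding c_def using \<kappa>m[OF that] \<zeta>m[OF that] clz[OF that]
    by (intro borel_measurable_scaleR borel_measurable_diff)
  have zm: "z j \<in> borel_measurable (F (p j))" if "j < N" for j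
    unfolding z_def using \<kappa>m[OF that] gm[OF that] clz[OF that]
    by (intro borel_measurable_scaleR borel_measurable_times)
  have \<kappa>b: "0 \<le> \<kappa> j \<omega>" "\<kappa> j \<omega> \<le> 1" for j \<omega> by (auto simp: \<kappa>_def)
  have cb: "\<exists>C. \<forall>\<omega>\<in>space M. norm (c j \<omega>) \<le> C" if j: "j < N" for j
  proof -
    obtain C where C: "\<forall>\<omega>\<in>space M. norm (\<zeta> j \<omega>) \<le> C" using \<zeta>b[OF j] by blast
    have "norm (c j \<omega>) \<le> C" if "\<omega> \<in> space M" for \<omega>
    proof -
      have "norm (c j \<omega>) \<le> 1 * norm (\<zeta> j \<omega> - 0)"
        unfolding c_def norm_scaleR using \<kappa>b[of j \<omega>] cl_le[of 0 "\<zeta> j \<omega>"] B(1) by (intro mult_mono) auto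
      then show ?thesis using C that by fastforce
    qed
    then show ?thesis by blast
  qed
  have zb: "norm (z j \<omega>) \<le> G * B" if "\<omega> \<in> space M" for j \<omega>
  proof -
    have "\<bar>g \<omega>\<bar> * \<bar>\<kappa> j \<omega>\<bar> \<le> G * 1" using g(2)[OF that] \<kappa>b[of j \<omega>] by (intro mult_mono) auto
    then show ?thesis unfolding z_def norm_scaleR abs_mult using cl_norm[of "\<zeta> j \<omega>"] G by (intro mult_mono) auto
  qed
  define Z where "Z = (\<lambda>r \<omega>. \<Sum>i<N. indicator {p i<..p (Suc i)} r *\<^sub>R z i \<omega>)"
  define Y where "Y = (\<lambda>\<omega>. \<Sum>i<N. z i \<omega> \<bullet> (w (p (Suc i)) \<omega> - w (p i) \<omega>))"
  define D where "D = (\<lambda>\<omega>. \<Sum>i<N. c i \<omega> \<bullet> (w (p (Suc i)) \<omega> - w (p i) \<omega>))"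
  have ZY: "step_integral Z Y" unfolding Z_def Y_def
    by (rule grid_step_integral_process[OF gr _ zm]) (use p0 st zb in auto)
  have D_st: "step_integral (\<lambda>r \<omega>. \<Sum>i<N. indicator {p i<..p (Suc i)} r *\<^sub>R c i \<omega>) D"
    unfolding D_def by (rule grid_step_integral_process[OF gr _ cm cb]) (use p0 st in auto)
  note [measurable] = step_integral_measurable(2)[OF ZY] step_integral_measurable(2)[OF D_st]
  have cell: "simple_value S r \<omega> $ a = \<zeta> j \<omega>" if "j < N" "p j < r" "r \<le> p (Suc j)" for j r \<omega>
    using simple_value_const[of m "p j" \<tau> "p (Suc j)" r \<xi> \<omega>, OF gap\<tau>[OF that(1)] that(2,3)]
    by (simp add: \<zeta>_def Seq)
  have past: "\<kappa> j \<omega> = 1" if j: "j < N" and "p j < r" "r \<le> \<theta> \<omega>" and w: "\<omega> \<in> space M" for j r \<omega>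
  proof -
    obtain i where i: "i \<le> n" "\<theta>up n \<omega> = q i" using \<theta>up_bounds(3)[OF n w] by (auto simp: q_def)
    then have "\<theta>up n \<omega> \<in> P" by (auto simp: P_def)
    moreover have "p j < \<theta>up n \<omega>" using that(2,3) \<theta>up_bounds(1)[OF n w] by linarith
    ultimately have "p (Suc j) \<le> \<theta>up n \<omega>" using gap[OF j] by force
    then show ?thesis by (simp add: \<kappa>_def)
  qed
  have row_le: "norm (\<zeta> j \<omega> - Hc r \<omega> $ a) \<le> norm (simple_value S r \<omega> - Hc r \<omega>)"
    if "j < N" "p j < r" "r \<le> p (Suc j)" for j r \<omega>
    using Finite_Cartesian_Product.norm_nth_le[of "simple_value S r \<omega> - Hc r \<omega>" a] cell[OF that, of \<omega>] by simp
  have Hb: "norm (Hc r \<omega> $ a) \<le> B" if "\<omega> \<in> space M" "s < r" "r \<le> \<theta> \<omega>" for r \<omega>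
    using B(2)[OF that] Hc_eq[of r \<omega>] \<theta>[OF that(1)] that st by simp
  have Zh: "(norm (Z r \<omega> - integrand r \<omega>))\<^sup>2 \<le> G\<^sup>2 * (indicator {s<..t} r * min ((norm (simple_value S r \<omega> - Hc r \<omega>))\<^sup>2) (4 * B\<^sup>2)
      + B\<^sup>2 * indicator {\<theta> \<omega><..\<theta>up n \<omega>} r)" if w: "\<omega> \<in> space M" for r \<omega>
  proof (cases "r \<in> {s<..t}")
    case True
    then obtain j where j: "j < N" "p j < r" "r \<le> p (Suc j)" using grid_cell[OF gr] p0 pN by auto
    have Zr: "Z r \<omega> = z j \<omega>" unfolding Z_def by (rule grid_step_value[OF gr j])
    have gG: "\<bar>g \<omega>\<bar> \<le> G" by (rule g(2)[OF w])
    show ?thesis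
    proof (cases "r \<le> \<theta> \<omega>")
      case le: True
      have "Z r \<omega> - integrand r \<omega> = g \<omega> *\<^sub>R (cl (\<zeta> j \<omega>) - cl (Hc r \<omega> $ a))"
        using True le past[OF j(1,2) le w] cl_fix[OF Hb[OF w _ le]] by (simp add: Zr z_def integrand_def scaleR_diff_right)
      then have nz: "norm (Z r \<omega> - integrand r \<omega>) \<le> G * norm (cl (\<zeta> j \<omega>) - cl (Hc r \<omega> $ a))"
        using gG by (simp add: mult_right_mono)
      have "norm (cl (\<zeta> j \<omega>) - cl (Hc r \<omega> $ a)) \<le> norm (simple_value S r \<omega> - Hc r \<omega>)"
        using cl_lip row_le[OF j] by (meson order_trans)
      moreover have "norm (cl (\<zeta> j \<omega>) - cl (Hc r \<omega> $ a)) \<le> 2 * B"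
        using norm_triangle_ineq4[of "cl (\<zeta> j \<omega>)" "cl (Hc r \<omega> $ a)"] cl_norm[of "\<zeta> j \<omega>"] cl_norm[of "Hc r \<omega> $ a"] by linarith
      ultimately have "(norm (cl (\<zeta> j \<omega>) - cl (Hc r \<omega> $ a)))\<^sup>2 \<le> min ((norm (simple_value S r \<omega> - Hc r \<omega>))\<^sup>2) (4 * B\<^sup>2)"
        using power_mono[of "norm (cl (\<zeta> j \<omega>) - cl (Hc r \<omega> $ a))" "2 * B" 2]
          power_mono[of "norm (cl (\<zeta> j \<omega>) - cl (Hc r \<omega> $ a))" "norm (simple_value S r \<omega> - Hc r \<omega>)" 2]
        by (simp add: power_mult_distrib)
      then have "G\<^sup>2 * (norm (cl (\<zeta> j \<omega>) - cl (Hc r \<omega> $ a)))\<^sup>2 \<le> G\<^sup>2 * min ((norm (simple_value S r \<omega> - Hc r \<omega>))\<^sup>2) (4 * B\<^sup>2)"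
        by (intro mult_left_mono) auto
      moreover have "(norm (Z r \<omega> - integrand r \<omega>))\<^sup>2 \<le> G\<^sup>2 * (norm (cl (\<zeta> j \<omega>) - cl (Hc r \<omega> $ a)))\<^sup>2"
        using power_mono[OF nz, of 2] by (simp add: power_mult_distrib)
      ultimately show ?thesis using True le by (simp add: indicator_def)
    next
      case gt: False
      have i0: "integrand r \<omega> = 0" using gt by (simp add: integrand_def)
      show ?thesis
      proof (cases "r \<le> \<theta>up n \<omega>")
        case up: True
        have "(norm (z j \<omega>))\<^sup>2 \<le> (G * B)\<^sup>2" using zb[OF w, of j] by (intro power_mono) auto
        moreover have "0 \<le> G\<^sup>2 * min ((norm (simple_value S r \<omega> - Hc r \<omega>))\<^sup>2) (4 * B\<^sup>2)" by simp
        moreover have "G\<^sup>2 * (indicator {s<..t} r * min ((norm (simple_value S r \<omega> - Hc r \<omega>))\<^sup>2) (4 * B\<^sup>2)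
            + B\<^sup>2 * indicator {\<theta> \<omega><..\<theta>up n \<omega>} r) =
          G\<^sup>2 * min ((norm (simple_value S r \<omega> - Hc r \<omega>))\<^sup>2) (4 * B\<^sup>2) + (G * B)\<^sup>2"
          using True gt up by (simp add: indicator_def power_mult_distrib distrib_left)
        ultimately show ?thesis unfolding Zr i0 diff_0_right by linarith
      next
        case nup: False
        have "\<kappa> j \<omega> = 0" using nup j by (simp add: \<kappa>_def)
        then have "Z r \<omega> = 0" by (simp add: Zr z_def)
        then show ?thesis by (simp add: i0)
      qed
    qed
  next
    case False
    have "Z r \<omega> = 0" unfolding Z_def by (rule grid_step_zero[OF gr]) (use False p0 pN in auto)
    moreover have "integrand r \<omega> = 0" using False \<theta>[OF w] by (auto simp: integrand_def indicator_def)
    ultimately show ?thesis by simp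
  qed
  have c2: "(norm (\<Sum>i<N. indicator {p i<..p (Suc i)} r *\<^sub>R c i \<omega>))\<^sup>2 \<le>
     2 * (indicator {0..t} r * (norm (simple_value S r \<omega> - Hc r \<omega>))\<^sup>2) + 2 * (indicator {\<theta> \<omega><..\<theta>up n \<omega>} r * (norm (Hc r \<omega> $ a))\<^sup>2)"
    (is "?l \<le> ?r") if w: "\<omega> \<in> space M" for r \<omega>
  proof (cases "r \<in> {s<..t}")
    case True
    then obtain j where j: "j < N" "p j < r" "r \<le> p (Suc j)" using grid_cell[OF gr] p0 pN by auto
    have cr: "(\<Sum>i<N. indicator {p i<..p (Suc i)} r *\<^sub>R c i \<omega>) = c j \<omega>" by (rule grid_step_value[OF gr j])
    have r0: "r \<in> {0..t}" using True st by auto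
    let ?A = "norm (simple_value S r \<omega> - Hc r \<omega>)"
    show ?thesis
    proof (cases "p (Suc j) \<le> \<theta>up n \<omega>")
      case le: True
      have c: "c j \<omega> = \<zeta> j \<omega> - cl (\<zeta> j \<omega>)" using le by (simp add: c_def \<kappa>_def)
      show ?thesis
      proof (cases "r \<le> \<theta> \<omega>")
        case rle: True
        have "norm (c j \<omega>) \<le> ?A" unfolding c
          using cl_le[OF Hb[OF w _ rle], of "\<zeta> j \<omega>"] row_le[OF j, of \<omega>] True by auto
        then have "(norm (c j \<omega>))\<^sup>2 \<le> ?A\<^sup>2" by (intro power_mono) auto
        moreover have "0 \<le> ?A\<^sup>2" "0 \<le> indicator {\<theta> \<omega><..\<theta>up n \<omega>} r * (norm (Hc r \<omega> $ a))\<^sup>2" by simp_all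
        ultimately show ?thesis unfolding cr indicator_simps(1)[OF r0] mult_1_left by linarith
      next
        case rgt: False
        have rr: "r \<in> {\<theta> \<omega><..\<theta>up n \<omega>}" using rgt le j by auto
        have "norm (c j \<omega>) \<le> norm (\<zeta> j \<omega> - 0)" unfolding c using cl_le[of 0] B(1) by simp
        also have "\<dots> \<le> norm (\<zeta> j \<omega> - Hc r \<omega> $ a) + norm (Hc r \<omega> $ a)"
          using norm_triangle_ineq[of "\<zeta> j \<omega> - Hc r \<omega> $ a" "Hc r \<omega> $ a"] by simp
        also have "\<dots> \<le> ?A + norm (Hc r \<omega> $ a)" using row_le[OF j] by simp
        finally have "(norm (c j \<omega>))\<^sup>2 \<le> (?A + norm (Hc r \<omega> $ a))\<^sup>2" by (intro power_mono) auto
        also have "\<dots> \<le> 2 * ?A\<^sup>2 + 2 * (norm (Hc r \<omega> $ a))\<^sup>2"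
          using sum_squares_bound[of ?A "norm (Hc r \<omega> $ a)"] by (simp add: power2_sum)
        finally show ?thesis unfolding cr indicator_simps(1)[OF rr] indicator_simps(1)[OF r0] by simp
      qed
    next
      case False
      then have "c j \<omega> = 0" by (simp add: c_def \<kappa>_def)
      then show ?thesis unfolding cr by simp
    qed
  next
    case False
    have "(\<Sum>i<N. indicator {p i<..p (Suc i)} r *\<^sub>R c i \<omega>) = 0" by (rule grid_step_zero[OF gr]) (use False p0 pN in auto)
    then show ?thesis by simp
  qed
  have V: "AE \<omega> in M. (\<Sum>i<N. (p (Suc i) - p i) * (norm (c i \<omega>))\<^sup>2) \<le> 2 * approx_error S \<omega> + 2 * overshoot n \<omega>"
    using approx_error_integrable[OF S] AE_space
  proof eventually_elim
    case (elim \<omega>)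
    then have w: "\<omega> \<in> space M" and i1: "integrable lborel (\<lambda>r. indicator {0..t} r * (norm (simple_value S r \<omega> - Hc r \<omega>))\<^sup>2)"
      and i2: "integrable lborel (\<lambda>r. indicator {\<theta> \<omega><..\<theta>up n \<omega>} r * (norm (Hc r \<omega> $ a))\<^sup>2)"
      using overshoot_integrable[OF n] by auto
    have "(\<Sum>i<N. (p (Suc i) - p i) * (norm (c i \<omega>))\<^sup>2) = (\<integral>r. (norm (\<Sum>i<N. indicator {p i<..p (Suc i)} r *\<^sub>R c i \<omega>))\<^sup>2 \<partial>lborel)"
      unfolding grid_step_square[OF gr] grid_step_integral(2)[OF gr] ..
    also have "\<dots> \<le> (\<integral>r. 2 * (indicator {0..t} r * (norm (simple_value S r \<omega> - Hc r \<omega>))\<^sup>2) + 2 * (indicator {\<theta> \<omega><..\<theta>up n \<omega>} r * (norm (Hc r \<omega> $ a))\<^sup>2) \<partial>lborel)"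
    proof (rule integral_mono)
      show "integrable lborel (\<lambda>r. (norm (\<Sum>i<N. indicator {p i<..p (Suc i)} r *\<^sub>R c i \<omega>))\<^sup>2)"
        unfolding grid_step_square[OF gr] by (rule grid_step_integral(1)[OF gr])
      show "integrable lborel (\<lambda>r. 2 * (indicator {0..t} r * (norm (simple_value S r \<omega> - Hc r \<omega>))\<^sup>2) + 2 * (indicator {\<theta> \<omega><..\<theta>up n \<omega>} r * (norm (Hc r \<omega> $ a))\<^sup>2))"
        by (intro Bochner_Integration.integrable_add integrable_mult_right i1 i2)
    qed (rule c2[OF w])
    also have "\<dots> = 2 * approx_error S \<omega> + 2 * overshoot n \<omega>"
      unfolding approx_error_def overshoot_def set_lebesgue_integral_def real_scaleR_def
      by (subst Bochner_Integration.integral_add[OF integrable_mult_right[OF i1] integrable_mult_right[OF i2]]) simp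
    finally show ?case .
  qed
  note [measurable] = approx_error_measurable[OF S] overshoot_measurable
  have Dsize: "prob_size D \<le> (2 * prob_size (approx_error S) + 2 * prob_size (overshoot n)) / \<delta> + sqrt \<delta>"
    if d: "0 < \<delta>" "\<delta> \<le> 1" for \<delta>
  proof -
    let ?W = "\<lambda>\<omega>. (approx_error S \<omega> + approx_error S \<omega>) + (overshoot n \<omega> + overshoot n \<omega>)"
    have [measurable]: "c i \<in> borel_measurable M" if "i < N" for i using F_measurable_M[OF p_nn cm] that by auto
    have Vm: "(\<lambda>\<omega>. \<Sum>i<N. (p (Suc i) - p i) * (norm (c i \<omega>))\<^sup>2) \<in> borel_measurable M"
      by (intro borel_measurable_sum borel_measurable_times borel_measurable_power borel_measurable_const
          measurable_compose[OF _ borel_measurable_norm]) auto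
    have "prob_size D \<le> prob {\<omega>\<in>space M. (\<Sum>i<N. (p (Suc i) - p i) * (norm (c i \<omega>))\<^sup>2) > \<delta>} + sqrt \<delta>"
      unfolding D_def by (rule lenglart_step[OF gr _ cm cb d(1)]) (use p0 st in auto)
    also have "prob {\<omega>\<in>space M. (\<Sum>i<N. (p (Suc i) - p i) * (norm (c i \<omega>))\<^sup>2) > \<delta>} \<le> prob {\<omega>\<in>space M. \<bar>?W \<omega>\<bar> > \<delta>}"
      by (rule finite_measure_mono_AE) (use V in \<open>auto elim!: AE_mp\<close>)
    also have "prob {\<omega>\<in>space M. \<bar>?W \<omega>\<bar> > \<delta>} \<le> prob_size ?W / \<delta>" by (rule prob_size_markov) (use d in measurable)
    also have "prob_size ?W \<le> 2 * prob_size (approx_error S) + 2 * prob_size (overshoot n)"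
      using prob_size_add[of "\<lambda>\<omega>. approx_error S \<omega> + approx_error S \<omega>" "\<lambda>\<omega>. overshoot n \<omega> + overshoot n \<omega>"]
        prob_size_add[of "approx_error S" "approx_error S"] prob_size_add[of "overshoot n" "overshoot n"] by simp
    finally show ?thesis using d by (simp add: divide_right_mono)
  qed

  have Jtel: "J (p k) \<omega> - J s \<omega> = (\<Sum>i<k. \<zeta> i \<omega> \<bullet> (w (p (Suc i)) \<omega> - w (p i) \<omega>))" if "k \<le> N" for k \<omega>
    using that
  proof (induction k)
    case (Suc k)
    then have k: "k < N" by simp
    have "J (p (Suc k)) \<omega> - J (p k) \<omega> = (simple_integral w S (p (Suc k)) \<omega> - simple_integral w S (p k) \<omega>) $ a"
      by (simp add: J_def)
    also have "\<dots> = \<zeta> k \<omega> \<bullet> (w (p (Suc k)) \<omega> - w (p k) \<omega>)"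
      using simple_integral_increment[OF Seq S gap\<tau>[OF k] lt[OF k], of \<omega>]
      by (simp only: matrix_vector_mul_component \<zeta>_def)
    finally show ?case using Suc by simp
  qed (simp add: p0)
  have Jup: "(\<Sum>i<N. \<kappa> i \<omega> * (\<zeta> i \<omega> \<bullet> (w (p (Suc i)) \<omega> - w (p i) \<omega>))) = J (\<theta>up n \<omega>) \<omega> - J s \<omega>"
    if w: "\<omega> \<in> space M" for \<omega>
  proof -
    obtain i where i: "i \<le> n" "\<theta>up n \<omega> = q i" using \<theta>up_bounds(3)[OF n w] by (auto simp: q_def)
    then have "\<theta>up n \<omega> \<in> P" by (auto simp: P_def)
    then obtain k where k: "k \<le> N" "\<theta>up n \<omega> = p k" unfolding Pp by auto
    have \<kappa>k: "\<kappa> i \<omega> = (if i < k then 1 else 0)" if "i < N" for i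
    proof (cases "i < k")
      case True
      then show ?thesis using grid_mono[OF gr, of "Suc i" k] k by (simp add: \<kappa>_def)
    next
      case False
      then show ?thesis using grid_mono[OF gr, of k i] lt[OF that] k that by (simp add: \<kappa>_def)
    qed
    have "(\<Sum>i<N. \<kappa> i \<omega> * (\<zeta> i \<omega> \<bullet> (w (p (Suc i)) \<omega> - w (p i) \<omega>))) = (\<Sum>i<k. \<kappa> i \<omega> * (\<zeta> i \<omega> \<bullet> (w (p (Suc i)) \<omega> - w (p i) \<omega>)))"
      by (rule sum.mono_neutral_right) (use k \<kappa>k in auto)
    also have "\<dots> = (\<Sum>i<k. \<zeta> i \<omega> \<bullet> (w (p (Suc i)) \<omega> - w (p i) \<omega>))"
      using k \<kappa>k by (intro sum.cong) auto
    also have "\<dots> = J (\<theta>up n \<omega>) \<omega> - J s \<omega>" using Jtel[OF k(1)] k(2) by simp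
    finally show ?thesis .
  qed
  have YD: "Y \<omega> + g \<omega> * D \<omega> = g \<omega> * (J (\<theta>up n \<omega>) \<omega> - J s \<omega>)" if w: "\<omega> \<in> space M" for \<omega>
    unfolding Jup[OF w, symmetric] Y_def D_def z_def c_def
    by (simp add: sum_distrib_left sum.distrib[symmetric] inner_diff_left algebra_simps)
  define e where "e = (\<lambda>i \<omega>. J (q i) \<omega> - I (q i) \<omega> $ a)"
  have qnn: "0 \<le> q i" for i using st mp by (simp add: q_def)
  have ntm: "(\<lambda>x::real^'n. x $ a) \<in> borel_measurable borel" by simp
  have Jm: "(\<lambda>\<omega>. J (q i) \<omega>) \<in> borel_measurable M" and Iqm: "(\<lambda>\<omega>. I (q i) \<omega> $ a) \<in> borel_measurable M" for i
    unfolding J_def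
    using measurable_compose[OF simple_value_joint_measurable(2)[OF S qnn] ntm] measurable_compose[OF Im[OF qnn] ntm] by auto
  have em: "e i \<in> borel_measurable M" for i unfolding e_def by (intro borel_measurable_diff Jm Iqm)
  obtain idx where idxm: "idx \<in> measurable M (count_space UNIV)"
    and idx: "\<And>\<omega>. \<omega> \<in> space M \<Longrightarrow> \<theta>up n \<omega> = q (idx \<omega>)" "\<And>\<omega>. \<omega> \<in> space M \<Longrightarrow> idx \<omega> \<le> n"
    using \<theta>up_index[OF n] unfolding q_def by metis
  have upm: "(\<lambda>\<omega>. f (idx \<omega>) \<omega>) \<in> borel_measurable M" if "\<And>i. f i \<in> borel_measurable M" for f :: "nat \<Rightarrow> 'w \<Rightarrow> real"
    by (rule measurable_compose_countable[OF _ idxm]) (use that in simp)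
  have Iupm: "Iup \<in> borel_measurable M" unfolding Iup_def by (rule I_\<theta>up_measurable[OF n])
  have eidxm: "(\<lambda>\<omega>. e (idx \<omega>) \<omega>) \<in> borel_measurable M" by (rule upm[OF em])
  note [measurable] = em Iupm eidxm g_measurable
  have Ism[measurable]: "(\<lambda>\<omega>. I s \<omega> $ a) \<in> borel_measurable M" using Iqm[of 0] q0 by simp
  have sumle: "prob_size (\<lambda>\<omega>. \<Sum>i\<le>n. \<bar>e i \<omega>\<bar>) \<le> (\<Sum>i\<le>n. prob_size (e i))"
  proof -
    have "prob_size (\<lambda>\<omega>. \<Sum>i\<le>n. \<bar>e i \<omega>\<bar>) \<le> (\<Sum>i\<le>n. prob_size (\<lambda>\<omega>. \<bar>e i \<omega>\<bar>))"
      by (rule prob_size_sum) measurable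
    then show ?thesis by (simp add: prob_size_def)
  qed
  have e1: "prob_size (\<lambda>\<omega>. e (idx \<omega>) \<omega>) \<le> (\<Sum>i\<le>n. prob_size (e i))"
  proof (rule order_trans[OF prob_size_mono sumle])
    show "AE \<omega> in M. \<bar>e (idx \<omega>) \<omega>\<bar> \<le> \<bar>\<Sum>i\<le>n. \<bar>e i \<omega>\<bar>\<bar>"
    proof (rule AE_I2)
      fix \<omega> assume w: "\<omega> \<in> space M"
      have "\<bar>e (idx \<omega>) \<omega>\<bar> \<le> (\<Sum>i\<le>n. \<bar>e i \<omega>\<bar>)"
        using member_le_sum[of "idx \<omega>" "{..n}" "\<lambda>i. \<bar>e i \<omega>\<bar>"] idx(2)[OF w] by simp
      then show "\<bar>e (idx \<omega>) \<omega>\<bar> \<le> \<bar>\<Sum>i\<le>n. \<bar>e i \<omega>\<bar>\<bar>" by linarith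
    qed
  qed measurable
  have e2: "prob_size (\<lambda>\<omega>. - e 0 \<omega>) \<le> (\<Sum>i\<le>n. prob_size (e i))"
  proof -
    have "prob_size (\<lambda>\<omega>. - e 0 \<omega>) = prob_size (e 0)" by (simp add: prob_size_def)
    then show ?thesis using member_le_sum[of 0 "{..n}" "\<lambda>i. prob_size (e i)"] prob_size_nonneg by simp
  qed
  have Ysize: "prob_size (\<lambda>\<omega>. Y \<omega> - g \<omega> * X \<omega>) \<le>
       G * (2 * (\<Sum>i\<le>n. prob_size (e i)) + prob_size (\<lambda>\<omega>. Iup \<omega> - I s \<omega> $ a - X \<omega>)
          + (2 * prob_size (approx_error S) + 2 * prob_size (overshoot n)) / \<delta> + sqrt \<delta>)"
    if d: "0 < \<delta>" "\<delta> \<le> 1" for \<delta>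
  proof -
    let ?E = "\<lambda>\<omega>. Iup \<omega> - I s \<omega> $ a - X \<omega>"
    let ?W = "\<lambda>\<omega>. (e (idx \<omega>) \<omega> + - e 0 \<omega>) + (?E \<omega> + - D \<omega>)"
    have "Y \<omega> - g \<omega> * X \<omega> = g \<omega> * ?W \<omega>" if w: "\<omega> \<in> space M" for \<omega>
    proof -
      have "?W \<omega> = (J (\<theta>up n \<omega>) \<omega> - J s \<omega>) - D \<omega> - X \<omega>"
        using idx(1)[OF w] by (simp add: e_def Iup_def q0)
      then have "g \<omega> * ?W \<omega> = g \<omega> * (J (\<theta>up n \<omega>) \<omega> - J s \<omega>) - g \<omega> * D \<omega> - g \<omega> * X \<omega>"
        by (simp only: right_diff_distrib)
      then show ?thesis using YD[OF w] by simp
    qed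
    then have "prob_size (\<lambda>\<omega>. Y \<omega> - g \<omega> * X \<omega>) = prob_size (\<lambda>\<omega>. g \<omega> * ?W \<omega>)"
      unfolding prob_size_def by (intro Bochner_Integration.integral_cong) auto
    also have "\<dots> \<le> G * prob_size ?W" by (rule prob_size_scale[OF _ _ g(2) G]) measurable
    also have "prob_size ?W \<le> prob_size (\<lambda>\<omega>. e (idx \<omega>) \<omega> + - e 0 \<omega>) + prob_size (\<lambda>\<omega>. ?E \<omega> + - D \<omega>)"
      by (rule prob_size_add) measurable
    also have "prob_size (\<lambda>\<omega>. e (idx \<omega>) \<omega> + - e 0 \<omega>) \<le> prob_size (\<lambda>\<omega>. e (idx \<omega>) \<omega>) + prob_size (\<lambda>\<omega>. - e 0 \<omega>)"
      by (rule prob_size_add) measurable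
    also have "prob_size (\<lambda>\<omega>. ?E \<omega> + - D \<omega>) \<le> prob_size ?E + prob_size (\<lambda>\<omega>. - D \<omega>)"
      by (rule prob_size_add) measurable
    also have "prob_size (\<lambda>\<omega>. - D \<omega>) = prob_size D" by (simp add: prob_size_def)
    finally show ?thesis using e1 e2 Dsize[OF d] G
      by (smt (verit) mult_left_mono)
  qed
  have Zdist: "(\<integral>(\<omega>, r). (norm (Z r \<omega> - integrand r \<omega>))\<^sup>2 \<partial>(M \<Otimes>\<^sub>M lborel))
       \<le> G\<^sup>2 * (max 1 (4 * B\<^sup>2 * (t - s)) * prob_size (approx_error S) + B\<^sup>2 * mesh n)"
  proof -
    let ?c = "4 * B\<^sup>2 * (t - s)"
    have int: "integrable (M \<Otimes>\<^sub>M lborel) (\<lambda>(\<omega>, r). (norm (Z r \<omega> - integrand r \<omega>))\<^sup>2)"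
      using integrable_square_diff[OF step_integral_measurable(1)[OF ZY] integrand_measurable]
        step_integral_isometry(2)[OF ZY ZY] integrand_square_integrable
      by (simp add: case_prod_unfold power2_norm_eq_inner)
    have inner: "AE \<omega> in M. (\<integral>r. (norm (Z r \<omega> - integrand r \<omega>))\<^sup>2 \<partial>lborel)
        \<le> G\<^sup>2 * (max 1 ?c * min 1 \<bar>approx_error S \<omega>\<bar> + B\<^sup>2 * mesh n)"
      using approx_error_integrable[OF S] AE_space PL.AE_integrable_fst'[OF int]
    proof eventually_elim
      case (elim \<omega>)
      then have w: "\<omega> \<in> space M" and i1: "integrable lborel (\<lambda>r. indicator {0..t} r * (norm (simple_value S r \<omega> - Hc r \<omega>))\<^sup>2)" by auto
      let ?m = "\<lambda>r. indicator {s<..t} r * min ((norm (simple_value S r \<omega> - Hc r \<omega>))\<^sup>2) (4 * B\<^sup>2)"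
      let ?o = "\<lambda>r. B\<^sup>2 * indicator {\<theta> \<omega><..\<theta>up n \<omega>} r"
      have [measurable]: "(\<lambda>r. simple_value S r \<omega>) \<in> borel_measurable lborel" "(\<lambda>r. Hc r \<omega>) \<in> borel_measurable lborel"
        using measurable_compose[OF measurable_Pair1'[OF w] simple_value_joint_measurable(1)[OF S]]
          measurable_compose[OF measurable_Pair1'[OF w] Hc_measurable] by simp_all
      have ic: "integrable lborel (\<lambda>r. 4 * B\<^sup>2 * indicator {s<..t} r)"
        using st by (intro integrable_mult_right) (auto simp: integrable_indicator_iff)
      have im: "integrable lborel ?m"
        by (rule Bochner_Integration.integrable_bound[OF ic]) (auto simp: indicator_def)
      have io: "integrable lborel ?o"
        using \<theta>up_bounds(1)[OF n w] by (intro integrable_mult_right) (auto simp: integrable_indicator_iff)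
      have "(\<integral>r. (norm (Z r \<omega> - integrand r \<omega>))\<^sup>2 \<partial>lborel) \<le> (\<integral>r. G\<^sup>2 * (?m r + ?o r) \<partial>lborel)"
      proof (rule integral_mono)
        show "integrable lborel (\<lambda>r. (norm (Z r \<omega> - integrand r \<omega>))\<^sup>2)" using elim by simp
        show "integrable lborel (\<lambda>r. G\<^sup>2 * (?m r + ?o r))"
          by (intro integrable_mult_right Bochner_Integration.integrable_add im io)
      qed (rule Zh[OF w])
      also have "\<dots> = G\<^sup>2 * (integral\<^sup>L lborel ?m + integral\<^sup>L lborel ?o)"
        by (simp only: integral_mult_right_zero Bochner_Integration.integral_add[OF im io])
      also have "integral\<^sup>L lborel ?o = B\<^sup>2 * (\<theta>up n \<omega> - \<theta> \<omega>)" using \<theta>up_bounds(1)[OF n w] by simp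
      also have "\<dots> \<le> B\<^sup>2 * mesh n" using \<theta>up_bounds(2)[OF n w] by (intro mult_left_mono) auto
      also have "integral\<^sup>L lborel ?m \<le> max 1 ?c * min 1 \<bar>approx_error S \<omega>\<bar>"
      proof -
        have m1: "integral\<^sup>L lborel ?m \<le> ?c"
        proof -
          have "integral\<^sup>L lborel ?m \<le> (\<integral>r. 4 * B\<^sup>2 * indicator {s<..t} r \<partial>lborel)"
            by (rule integral_mono[OF im ic]) (auto simp: indicator_def)
          then show ?thesis using st by simp
        qed
        have m2: "integral\<^sup>L lborel ?m \<le> approx_error S \<omega>"
          unfolding approx_error_def set_lebesgue_integral_def real_scaleR_def
          by (rule integral_mono[OF im i1]) (use st in \<open>auto simp: indicator_def\<close>)
        have m0: "0 \<le> integral\<^sup>L lborel ?m" by (rule integral_nonneg_AE) auto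
        show ?thesis
        proof (cases "approx_error S \<omega> \<le> 1")
          case True
          have A0: "0 \<le> approx_error S \<omega>" using m0 m2 by linarith
          have "1 * approx_error S \<omega> \<le> max 1 ?c * approx_error S \<omega>" using A0 by (intro mult_right_mono) auto
          moreover have "min 1 \<bar>approx_error S \<omega>\<bar> = approx_error S \<omega>" using True A0 by simp
          ultimately show ?thesis using m2 by linarith
        next
          case False
          then show ?thesis using m1 by simp
        qed
      qed
      finally show ?case by (simp add: mult_left_mono)
    qed
    have "(\<integral>(\<omega>, r). (norm (Z r \<omega> - integrand r \<omega>))\<^sup>2 \<partial>(M \<Otimes>\<^sub>M lborel)) =
       (\<integral>\<omega>. \<integral>r. (norm (Z r \<omega> - integrand r \<omega>))\<^sup>2 \<partial>lborel \<partial>M)"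
      using PL.integral_fst'[OF int] by simp
    also have "\<dots> \<le> (\<integral>\<omega>. G\<^sup>2 * (max 1 ?c * min 1 \<bar>approx_error S \<omega>\<bar> + B\<^sup>2 * mesh n) \<partial>M)"
    proof (rule integral_mono_AE[OF _ _ inner])
      show "integrable M (\<lambda>\<omega>. \<integral>r. (norm (Z r \<omega> - integrand r \<omega>))\<^sup>2 \<partial>lborel)"
        using PL.integrable_fst'[OF int] by simp
    qed simp
    also have "\<dots> = G\<^sup>2 * (max 1 ?c * prob_size (approx_error S) + B\<^sup>2 * mesh n)"
      by (simp add: prob_size_def prob_space)
    finally show ?thesis .
  qed
  show ?thesis
    using ZY Zdist Ysize unfolding e_def q_def by blast
qed

lemma ito_L2_increment:
  assumes S: "\<And>k. simple_process F (Sk k)"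
    and conv: "tends_in_probability M
             (\<lambda>k \<omega>. LINT r:{0..t}|lborel. (norm (simple_value (Sk k) r \<omega> - H r \<omega>))\<^sup>2) (\<lambda>_. 0)"
      "\<And>r. 0 \<le> r \<Longrightarrow> tends_in_probability M (\<lambda>k. simple_integral w (Sk k) r) (I r)"
    and X[measurable]: "X \<in> borel_measurable M"
    and XI: "AE \<omega> in M. X \<omega> = (I (\<theta> \<omega>) \<omega> - I s \<omega>) $ a"
  shows "ito_L2 integrand (\<lambda>\<omega>. g \<omega> * X \<omega>)"
  unfolding ito_L2_def
proof (intro conjI allI impI)
  show "(\<lambda>\<omega>. g \<omega> * X \<omega>) \<in> borel_measurable M" using g_measurable by measurable
  show "(\<lambda>(\<omega>, r). integrand r \<omega>) \<in> borel_measurable (M \<Otimes>\<^sub>M lborel)" by (rule integrand_measurable)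
  show "integrable (M \<Otimes>\<^sub>M lborel) (\<lambda>(\<omega>, r). (norm (integrand r \<omega>))\<^sup>2)" by (rule integrand_square_integrable)
  fix \<epsilon> :: real assume \<epsilon>: "\<epsilon> > 0"
  define al where "al = (\<lambda>k. prob_size (approx_error (Sk k)))"
  define er where "er = (\<lambda>n. prob_size (\<lambda>\<omega>. I (\<theta>up (Suc n) \<omega>) \<omega> $ a - I s \<omega> $ a - X \<omega>))"
  define bt where "bt = (\<lambda>r k. prob_size (\<lambda>\<omega>. simple_integral w (Sk k) r \<omega> $ a - I r \<omega> $ a))"
  define C1 where "C1 = max 1 (4 * B\<^sup>2 * (t - s))"
  have al: "al \<longlonglongrightarrow> 0"
  proof -
    have eq: "approx_error (Sk k) = (\<lambda>\<omega>. LINT r:{0..t}|lborel. (norm (simple_value (Sk k) r \<omega> - H r \<omega>))\<^sup>2)" for k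
      unfolding approx_error_def by (intro ext set_lebesgue_integral_cong) (auto simp: Hc_eq)
    have "(\<lambda>k. prob_size (\<lambda>\<omega>. dist (approx_error (Sk k) \<omega>) 0)) \<longlonglongrightarrow> 0"
      by (rule prob_size_tends_in_probability[OF approx_error_measurable[OF S]]) (use conv(1) in \<open>simp_all add: eq\<close>)
    then show ?thesis by (simp add: al_def prob_size_def)
  qed
  have bt: "bt r \<longlonglongrightarrow> 0" if r: "0 \<le> r" for r
  proof (rule tendsto_sandwich[OF _ _ tendsto_const])
    note [measurable] = simple_value_joint_measurable(2)[OF S r] Im[OF r]
    show "(\<lambda>k. prob_size (\<lambda>\<omega>. dist (simple_integral w (Sk k) r \<omega>) (I r \<omega>))) \<longlonglongrightarrow> 0"
      by (rule prob_size_tends_in_probability[OF _ _ conv(2)[OF r]]) measurable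
    show "\<forall>\<^sub>F k in sequentially. bt r k \<le> prob_size (\<lambda>\<omega>. dist (simple_integral w (Sk k) r \<omega>) (I r \<omega>))"
      unfolding bt_def
    proof (intro always_eventually allI prob_size_mono AE_I2)
      fix k \<omega>
      show "\<bar>simple_integral w (Sk k) r \<omega> $ a - I r \<omega> $ a\<bar> \<le> \<bar>dist (simple_integral w (Sk k) r \<omega>) (I r \<omega>)\<bar>"
        using component_le_norm_cart[of "simple_integral w (Sk k) r \<omega> - I r \<omega>" a] by (simp add: dist_norm)
    next
      fix k show "(\<lambda>\<omega>. simple_integral w (Sk k) r \<omega> $ a - I r \<omega> $ a) \<in> borel_measurable M"
        using measurable_compose[OF simple_value_joint_measurable(2)[OF S r] borel_measurable_nth]
          I_component_measurable[OF r] by (intro borel_measurable_diff) auto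
    qed measurable
  qed (auto intro!: always_eventually simp: bt_def prob_size_nonneg)
  have er: "er \<longlonglongrightarrow> 0"
    unfolding er_def
  proof (rule prob_size_tendsto)
    show "(\<lambda>\<omega>. I (\<theta>up (Suc n) \<omega>) \<omega> $ a - I s \<omega> $ a - X \<omega>) \<in> borel_measurable M" for n
      using I_\<theta>up_measurable[of "Suc n"] I_component_measurable[OF st(1)] X by (intro borel_measurable_diff) auto
    show "AE \<omega> in M. (\<lambda>n. I (\<theta>up (Suc n) \<omega>) \<omega> $ a - I s \<omega> $ a - X \<omega>) \<longlonglongrightarrow> 0"
      using XI Icont AE_space
    proof eventually_elim
      case (elim \<omega>)
      have "(\<lambda>n. I (\<theta>up (Suc n) \<omega>) \<omega>) \<longlonglongrightarrow> I (\<theta> \<omega>) \<omega>"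
        by (rule continuous_on_tendsto_compose[OF elim(2) \<theta>up_tendsto[OF elim(3)]])
           (use \<theta>[OF elim(3)] \<theta>up_le(2)[of "Suc _", OF _ elim(3)] st in \<open>auto intro!: always_eventually intro: order_trans\<close>)
      then have "(\<lambda>n. I (\<theta>up (Suc n) \<omega>) \<omega> $ a - I s \<omega> $ a - X \<omega>) \<longlonglongrightarrow> I (\<theta> \<omega>) \<omega> $ a - I s \<omega> $ a - X \<omega>"
        by (intro tendsto_intros)
      then show ?case using elim(1) by simp
    qed
  qed
  define \<eta> where "\<eta> = \<epsilon> / (4 * G)"
  have \<eta>: "\<eta> > 0" using \<epsilon> G by (simp add: \<eta>_def)
  define \<delta> where "\<delta> = min 1 (\<eta>\<^sup>2)"
  have \<delta>: "0 < \<delta>" "\<delta> \<le> 1" "sqrt \<delta> \<le> \<eta>" using \<eta> by (auto simp: \<delta>_def real_sqrt_le_iff intro: real_le_lsqrt)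
  have "(\<lambda>n. er n + 2 * prob_size (overshoot (Suc n)) / \<delta>) \<longlonglongrightarrow> 0 + 2 * 0 / \<delta>"
    using \<delta> by (intro tendsto_intros er overshoot_tendsto) auto
  then have ev1: "\<forall>\<^sub>F n in sequentially. er n + 2 * prob_size (overshoot (Suc n)) / \<delta> < \<eta>"
    using \<eta> by (intro order_tendstoD(2)) auto
  have "(\<lambda>n. G\<^sup>2 * (B\<^sup>2 * mesh (Suc n))) \<longlonglongrightarrow> G\<^sup>2 * (B\<^sup>2 * 0)" by (intro tendsto_intros mesh_tendsto)
  then have ev2: "\<forall>\<^sub>F n in sequentially. G\<^sup>2 * (B\<^sup>2 * mesh (Suc n)) < \<epsilon> / 2"
    using \<epsilon> by (intro order_tendstoD(2)) auto
  obtain n where n: "er n + 2 * prob_size (overshoot (Suc n)) / \<delta> < \<eta>" "G\<^sup>2 * (B\<^sup>2 * mesh (Suc n)) < \<epsilon> / 2"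
    using eventually_happens[OF eventually_conj[OF ev1 ev2]] by auto
  let ?q = "\<lambda>i. s + mesh (Suc n) * real i"
  have q: "0 \<le> ?q i" for i using st mesh_pos[of "Suc n"] by simp
  have "(\<lambda>k. 2 * (\<Sum>i\<le>Suc n. bt (?q i) k) + 2 * al k / \<delta>) \<longlonglongrightarrow> 2 * (\<Sum>i\<le>Suc n. 0) + 2 * 0 / \<delta>"
    using \<delta> by (intro tendsto_intros al bt q) auto
  then have ev3: "\<forall>\<^sub>F k in sequentially. 2 * (\<Sum>i\<le>Suc n. bt (?q i) k) + 2 * al k / \<delta> < \<eta>"
    using \<eta> by (intro order_tendstoD(2)) auto
  have "(\<lambda>k. G\<^sup>2 * (C1 * al k)) \<longlonglongrightarrow> G\<^sup>2 * (C1 * 0)" by (intro tendsto_intros al)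
  then have ev4: "\<forall>\<^sub>F k in sequentially. G\<^sup>2 * (C1 * al k) < \<epsilon> / 2" using \<epsilon> by (intro order_tendstoD(2)) auto
  obtain k where k: "2 * (\<Sum>i\<le>Suc n. bt (?q i) k) + 2 * al k / \<delta> < \<eta>" "G\<^sup>2 * (C1 * al k) < \<epsilon> / 2"
    using eventually_happens[OF eventually_conj[OF ev3 ev4]] by auto
  have "\<exists>Z Y. step_integral Z Y \<and>
    (\<integral>(\<omega>, r). (norm (Z r \<omega> - integrand r \<omega>))\<^sup>2 \<partial>(M \<Otimes>\<^sub>M lborel)) \<le> G\<^sup>2 * (C1 * al k + B\<^sup>2 * mesh (Suc n)) \<and>
    (\<forall>\<delta>>0. \<delta> \<le> 1 \<longrightarrow> prob_size (\<lambda>\<omega>. Y \<omega> - g \<omega> * X \<omega>) \<le> G * (2 * (\<Sum>i\<le>Suc n. bt (?q i) k) + er n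
          + (2 * al k + 2 * prob_size (overshoot (Suc n))) / \<delta> + sqrt \<delta>))"
    unfolding al_def er_def bt_def C1_def by (rule step_approximation[OF S[of k] zero_less_Suc[of n] X])
  then obtain Z Y where ZY: "step_integral Z Y"
    "(\<integral>(\<omega>, r). (norm (Z r \<omega> - integrand r \<omega>))\<^sup>2 \<partial>(M \<Otimes>\<^sub>M lborel)) \<le> G\<^sup>2 * (C1 * al k + B\<^sup>2 * mesh (Suc n))"
    and ZY': "\<forall>\<delta>>0. \<delta> \<le> 1 \<longrightarrow> prob_size (\<lambda>\<omega>. Y \<omega> - g \<omega> * X \<omega>) \<le> G * (2 * (\<Sum>i\<le>Suc n. bt (?q i) k) + er n
          + (2 * al k + 2 * prob_size (overshoot (Suc n))) / \<delta> + sqrt \<delta>)"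
    by (elim exE conjE)
  note ZY3 = ZY'[rule_format, OF \<delta>(1,2)]
  have "2 * (\<Sum>i\<le>Suc n. bt (?q i) k) + er n + (2 * al k + 2 * prob_size (overshoot (Suc n))) / \<delta> + sqrt \<delta> \<le> 3 * \<eta>"
    using n(1) k(1) \<delta>(3) by (simp add: add_divide_distrib)
  then have "prob_size (\<lambda>\<omega>. Y \<omega> - g \<omega> * X \<omega>) \<le> G * (3 * \<eta>)"
    using G by (intro order_trans[OF ZY3] mult_left_mono) auto
  also have "\<dots> \<le> \<epsilon>" using G \<epsilon> by (simp add: \<eta>_def)
  finally have "prob_size (\<lambda>\<omega>. Y \<omega> - g \<omega> * X \<omega>) \<le> \<epsilon>" .
  moreover have "(\<integral>(\<omega>, r). (norm (Z r \<omega> - integrand r \<omega>))\<^sup>2 \<partial>(M \<Otimes>\<^sub>M lborel)) \<le> \<epsilon>"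
    using ZY(2) n(2) k(2) by (simp add: distrib_left)
  ultimately show "\<exists>Z Y. step_integral Z Y \<and> (\<integral>(\<omega>, r). (norm (Z r \<omega> - integrand r \<omega>))\<^sup>2 \<partial>(M \<Otimes>\<^sub>M lborel)) \<le> \<epsilon> \<and>
        prob_size (\<lambda>\<omega>. Y \<omega> - g \<omega> * X \<omega>) \<le> \<epsilon>" using ZY(1) by blast
qed

lemmas ito_L2_increment' = ito_L2_increment[unfolded integrand_def[abs_def] Hc_def]

end

end

section \<open>Taylor remainders and quadratic variation\<close>

lemma has_derivative_line:
  fixes u :: "real^'n::finite \<Rightarrow> real"
  assumes "u differentiable (at (x + t *\<^sub>R v))"
  shows "((\<lambda>t. u (x + t *\<^sub>R v)) has_real_derivative (\<Sum>b\<in>UNIV. partial b u (x + t *\<^sub>R v) * v $ b)) (at t)"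
proof -
  let ?D = "frechet_derivative u (at (x + t *\<^sub>R v))"
  have D: "(u has_derivative ?D) (at (x + t *\<^sub>R v))" using assms by (simp add: frechet_derivative_works)
  have l: "((\<lambda>t. x + t *\<^sub>R v) has_derivative (\<lambda>h. h *\<^sub>R v)) (at t)" by (auto intro!: derivative_eq_intros)
  have lin: "linear ?D" using D has_derivative_linear by blast
  have "?D v = ?D (\<Sum>b\<in>UNIV. v $ b *\<^sub>R axis b 1)"
    by (simp add: basis_expansion scalar_mult_eq_scaleR[symmetric])
  also have "\<dots> = (\<Sum>b\<in>UNIV. v $ b * ?D (axis b 1))"
    using lin by (simp add: linear_sum linear_scale)
  finally have Dv: "?D v = (\<Sum>b\<in>UNIV. partial b u (x + t *\<^sub>R v) * v $ b)" by (simp add: partial_def mult.commute)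
  have "((\<lambda>t. u (x + t *\<^sub>R v)) has_derivative (\<lambda>h. ?D (h *\<^sub>R v))) (at t)"
    using has_derivative_compose[OF l D] by simp
  also have "(\<lambda>h. ?D (h *\<^sub>R v)) = (\<lambda>h. (\<Sum>b\<in>UNIV. partial b u (x + t *\<^sub>R v) * v $ b) * h)"
    using lin Dv by (auto simp: linear_scale mult.commute)
  finally show ?thesis by (simp add: has_field_derivative_def)
qed

lemma Ck_on_SucD:
  assumes "Ck_on (Suc k) Q u"
  shows "x \<in> Q \<Longrightarrow> u differentiable (at x)" "Ck_on k Q (partial j u)"
  using assms by auto

lemma Ck_on_continuous:
  "Ck_on k Q u \<Longrightarrow> continuous_on Q u"
  by (cases k) (auto intro!: continuous_at_imp_continuous_on differentiable_imp_continuous_within)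

definition quadratic_remainder :: "(real^'n::finite \<Rightarrow> real) \<Rightarrow> real^'n \<Rightarrow> real^'n \<Rightarrow> real" where
  "quadratic_remainder u x z = u z - u x - (\<Sum>b\<in>UNIV. partial b u x * (z - x) $ b)
     - 1/2 * (\<Sum>a\<in>UNIV. \<Sum>b\<in>UNIV. partial a (partial b u) x * ((z - x) $ a * (z - x) $ b))"

lemma quadratic_remainder_mean_value:
  fixes u :: "real^'n::finite \<Rightarrow> real"
  assumes u: "Ck_on 2 Q u" and seg: "closed_segment x z \<subseteq> Q"
  obtains p where "p \<in> closed_segment x z" "quadratic_remainder u x z =
     1/2 * (\<Sum>a\<in>UNIV. \<Sum>b\<in>UNIV. (partial a (partial b u) p - partial a (partial b u) x) * ((z - x) $ a * (z - x) $ b))"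
proof -
  define v where "v = z - x"
  have u': "Ck_on (Suc (Suc 0)) Q u" using u by (simp add: numeral_2_eq_2)
  have inseg: "x + t *\<^sub>R v \<in> closed_segment x z" if "0 \<le> t" "t \<le> 1" for t
    unfolding in_segment by (rule exI[of _ t]) (use that in \<open>simp add: v_def algebra_simps\<close>)
  define d where "d = (\<lambda>m t. if m = 0 then u (x + t *\<^sub>R v)
     else if m = Suc 0 then (\<Sum>b\<in>UNIV. partial b u (x + t *\<^sub>R v) * v $ b)
     else (\<Sum>b\<in>UNIV. (\<Sum>a\<in>UNIV. partial a (partial b u) (x + t *\<^sub>R v) * v $ a) * v $ b))"
  have "\<exists>t. 0 < t \<and> t \<le> 1 \<and> u (x + 1 *\<^sub>R v) = (\<Sum>m<2. d m 0 / (fact m) * 1 ^ m) + d 2 t / fact 2 * 1 ^ 2"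
  proof (rule Maclaurin2[where f="\<lambda>t. u (x + t *\<^sub>R v)" and h=1 and n=2 and diff=d])
    show "d 0 = (\<lambda>t. u (x + t *\<^sub>R v))" by (simp add: d_def)
    show "\<forall>m t. m < 2 \<and> 0 \<le> t \<and> t \<le> 1 \<longrightarrow> (d m has_real_derivative d (Suc m) t) (at t)"
    proof (intro allI impI)
      fix m :: nat and t :: real assume mt: "m < 2 \<and> 0 \<le> t \<and> t \<le> 1"
      then have q: "x + t *\<^sub>R v \<in> Q" using inseg seg by blast
      consider "m = 0" | "m = 1" using mt by linarith
      then show "(d m has_real_derivative d (Suc m) t) (at t)"
      proof cases
        case 1
        then show ?thesis using has_derivative_line[OF Ck_on_SucD(1)[OF u' q]] by (simp add: d_def)
      next
        case 2
        have "((\<lambda>t. \<Sum>b\<in>UNIV. partial b u (x + t *\<^sub>R v) * v $ b) has_real_derivative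
           (\<Sum>b\<in>UNIV. (\<Sum>a\<in>UNIV. partial a (partial b u) (x + t *\<^sub>R v) * v $ a) * v $ b)) (at t)"
          by (intro DERIV_sum DERIV_cmult_right has_derivative_line Ck_on_SucD(1)[OF Ck_on_SucD(2)[OF u'] q])
        with 2 show ?thesis by (simp add: d_def[abs_def])
      qed
    qed
  qed simp
  then obtain t where t: "0 < t" "t \<le> 1" and eq: "u (x + 1 *\<^sub>R v) = (\<Sum>m<2. d m 0 / (fact m) * 1 ^ m) + d 2 t / fact 2 * 1 ^ 2"
    by blast
  let ?p = "x + t *\<^sub>R v"
  have sw: "(\<Sum>b\<in>UNIV. (\<Sum>a\<in>UNIV. h a b * v $ a) * v $ b) = (\<Sum>a\<in>UNIV. \<Sum>b\<in>UNIV. h a b * (v $ a * v $ b))" for h :: "'n \<Rightarrow> 'n \<Rightarrow> real"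
    by (subst sum.swap) (simp add: sum_distrib_right mult.assoc)
  have "u z = u x + (\<Sum>b\<in>UNIV. partial b u x * v $ b) + 1/2 * (\<Sum>a\<in>UNIV. \<Sum>b\<in>UNIV. partial a (partial b u) ?p * (v $ a * v $ b))"
    using eq by (simp add: d_def lessThan_nat_numeral v_def[symmetric] sw numeral_2_eq_2) (simp add: v_def)
  then have "quadratic_remainder u x z =
     1/2 * (\<Sum>a\<in>UNIV. \<Sum>b\<in>UNIV. (partial a (partial b u) ?p - partial a (partial b u) x) * ((z - x) $ a * (z - x) $ b))"
    unfolding quadratic_remainder_def v_def[symmetric] by (simp add: left_diff_distrib sum_subtractf)
  with inseg t show thesis by (intro that[of ?p]) auto
qed

lemma quadratic_remainder_bound:
  fixes u :: "real^'n::finite \<Rightarrow> real"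
  assumes Q: "open Q" and C: "compact C" "C \<subseteq> Q" and u: "Ck_on 2 Q u" and e: "\<epsilon> > 0"
  obtains L \<delta> where "L \<ge> 0" "\<delta> > 0" "\<And>x z. x \<in> C \<Longrightarrow> z \<in> C \<Longrightarrow>
     \<bar>quadratic_remainder u x z\<bar> \<le> (\<epsilon> + L * (if norm (z - x) > \<delta> then 1 else 0)) * (norm (z - x))\<^sup>2"
proof -
  have u': "Ck_on (Suc (Suc 0)) Q u" using u by (simp add: numeral_2_eq_2)
  have c0: "continuous_on Q u" by (rule Ck_on_continuous[OF u])
  have c1: "continuous_on Q (partial b u)" for b by (rule Ck_on_continuous[OF Ck_on_SucD(2)[OF u']])
  have c2: "continuous_on Q (partial a (partial b u))" for a b
    by (rule Ck_on_continuous[OF Ck_on_SucD(2)[OF Ck_on_SucD(2)[OF u']]])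
  obtain d where d: "d > 0" "(\<Union>x\<in>C. cball x d) \<subseteq> Q"
    using compact_subset_open_imp_cball_epsilon_subset[OF C(1) Q C(2)] by blast
  define C' where "C' = {x + y |x y. x \<in> C \<and> y \<in> cball 0 d}"
  have C'c: "compact C'" unfolding C'_def by (rule compact_sums[OF C(1) compact_cball])
  have near: "p \<in> C'" if "x \<in> C" "norm (p - x) \<le> d" for p x
    unfolding C'_def using that by (intro CollectI exI[of _ x] exI[of _ "p - x"]) auto
  have C'Q: "C' \<subseteq> Q"
  proof
    fix p assume "p \<in> C'"
    then obtain x y where "x \<in> C" "norm y \<le> d" "p = x + y" by (auto simp: C'_def)
    then have "p \<in> cball x d" by (simp add: dist_norm)
    with \<open>x \<in> C\<close> d(2) show "p \<in> Q" by blast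
  qed
  define \<epsilon>' where "\<epsilon>' = \<epsilon> / (real CARD('n))\<^sup>2"
  have cn: "real CARD('n) > 0" by simp
  have e': "\<epsilon>' > 0" using e by (simp add: \<epsilon>'_def)
  have "\<exists>\<delta>>0. \<forall>x\<in>C'. \<forall>p\<in>C'. dist p x < \<delta> \<longrightarrow> dist (partial a (partial b u) p) (partial a (partial b u) x) < \<epsilon>'" for a b
    using compact_uniformly_continuous[OF continuous_on_subset[OF c2 C'Q] C'c] e' unfolding uniformly_continuous_on_def by blast
  then obtain \<delta>f where \<delta>f: "\<And>a b. \<delta>f a b > (0::real)"
    "\<And>a b x p. x \<in> C' \<Longrightarrow> p \<in> C' \<Longrightarrow> dist p x < \<delta>f a b \<Longrightarrow> dist (partial a (partial b u) p) (partial a (partial b u) x) < \<epsilon>'"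
    by metis
  define \<delta> where "\<delta> = min d (Min (range (\<lambda>(a, b). \<delta>f a b)) / 2)"
  have fin: "finite (range (\<lambda>(a, b). \<delta>f a b))" by simp
  have mp: "Min (range (\<lambda>(a, b). \<delta>f a b)) > 0" using \<delta>f(1) by (subst Min_gr_iff[OF fin]) auto
  then have \<delta>0: "\<delta> > 0" using d by (simp add: \<delta>_def)
  have \<delta>lt: "\<delta> < \<delta>f a b" for a b
  proof -
    have "Min (range (\<lambda>(a, b). \<delta>f a b)) \<le> \<delta>f a b" by (rule Min_le[OF fin]) force
    moreover have "\<delta> \<le> Min (range (\<lambda>(a, b). \<delta>f a b)) / 2" unfolding \<delta>_def by (rule min.cobounded2)
    ultimately show ?thesis using mp by linarith
  qed
  have comp: "\<bar>(z - x) $ a * (z - x) $ b\<bar> \<le> (norm (z - x))\<^sup>2" for x z :: "real^'n" and a b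
    unfolding abs_mult power2_eq_square by (intro mult_mono component_le_norm_cart) auto
  have small: "\<bar>quadratic_remainder u x z\<bar> \<le> \<epsilon> * (norm (z - x))\<^sup>2" if xz: "x \<in> C" "z \<in> C" "norm (z - x) \<le> \<delta>" for x z
  proof -
    have segC: "p \<in> C' \<and> norm (p - x) \<le> \<delta>" if "p \<in> closed_segment x z" for p
    proof -
      have "norm (p - x) \<le> norm (z - x)" using segment_bound(1)[OF that] by simp
      then have n: "norm (p - x) \<le> \<delta>" using xz(3) by linarith
      have "\<delta> \<le> d" unfolding \<delta>_def by (rule min.cobounded1)
      then show ?thesis using n near[OF xz(1), of p] by (meson order_trans)
    qed
    obtain p where p: "p \<in> closed_segment x z" and req: "quadratic_remainder u x z =
     1/2 * (\<Sum>a\<in>UNIV. \<Sum>b\<in>UNIV. (partial a (partial b u) p - partial a (partial b u) x) * ((z - x) $ a * (z - x) $ b))"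
      using quadratic_remainder_mean_value[OF u, of x z] segC C'Q by blast
    have xC': "x \<in> C'" using near[OF xz(1), of x] d by simp
    have "\<bar>(partial a (partial b u) p - partial a (partial b u) x) * ((z - x) $ a * (z - x) $ b)\<bar> \<le> \<epsilon>' * (norm (z - x))\<^sup>2" for a b
    proof -
      have "dist (partial a (partial b u) p) (partial a (partial b u) x) < \<epsilon>'"
        using segC[OF p] \<delta>lt[of a b] xC' by (intro \<delta>f(2)) (auto simp: dist_norm)
      then show ?thesis unfolding abs_mult[of "partial a (partial b u) p - partial a (partial b u) x"]
        using comp[of z x a b] e' by (intro mult_mono) (auto simp: dist_real_def)
    qed
    then have "\<bar>\<Sum>a\<in>UNIV. \<Sum>b\<in>UNIV. (partial a (partial b u) p - partial a (partial b u) x) * ((z - x) $ a * (z - x) $ b)\<bar>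
        \<le> (\<Sum>a\<in>(UNIV::'n set). \<Sum>b\<in>(UNIV::'n set). \<epsilon>' * (norm (z - x))\<^sup>2)"
      by (intro order_trans[OF sum_abs] sum_mono order_trans[OF sum_abs]) auto
    also have "\<dots> = \<epsilon> * (norm (z - x))\<^sup>2" by (simp add: \<epsilon>'_def power2_eq_square)
    finally have "\<bar>quadratic_remainder u x z\<bar> \<le> 1/2 * (\<epsilon> * (norm (z - x))\<^sup>2)" unfolding req by (simp add: abs_mult)
    also have "\<dots> \<le> \<epsilon> * (norm (z - x))\<^sup>2" using e by simp
    finally show ?thesis .
  qed
  have cont: "continuous_on (C \<times> C) (\<lambda>(x, z). quadratic_remainder u x z)"
    unfolding quadratic_remainder_def case_prod_unfold
    by (intro continuous_intros continuous_on_compose2[OF c0] continuous_on_compose2[OF c1] continuous_on_compose2[OF c2])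
       (use C in auto)
  have "bounded ((\<lambda>(x, z). quadratic_remainder u x z) ` (C \<times> C))"
    by (rule compact_imp_bounded[OF compact_continuous_image[OF cont compact_Times[OF C(1) C(1)]]])
  then obtain B0 where B0: "B0 > 0" "\<And>x z. x \<in> C \<Longrightarrow> z \<in> C \<Longrightarrow> \<bar>quadratic_remainder u x z\<bar> \<le> B0"
    unfolding bounded_pos by force
  show thesis
  proof (rule that[of "B0 / \<delta>\<^sup>2" \<delta>])
    fix x z assume xz: "x \<in> C" "z \<in> C"
    show "\<bar>quadratic_remainder u x z\<bar> \<le> (\<epsilon> + B0 / \<delta>\<^sup>2 * (if norm (z - x) > \<delta> then 1 else 0)) * (norm (z - x))\<^sup>2"
    proof (cases "norm (z - x) > \<delta>")
      case True
      have "\<delta>\<^sup>2 \<le> (norm (z - x))\<^sup>2" using True \<delta>0 by (intro power_mono) auto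
      then have "B0 / \<delta>\<^sup>2 * \<delta>\<^sup>2 \<le> B0 / \<delta>\<^sup>2 * (norm (z - x))\<^sup>2" using B0 by (intro mult_left_mono) auto
      then have "B0 \<le> B0 / \<delta>\<^sup>2 * (norm (z - x))\<^sup>2" using \<delta>0 by simp
      moreover have "0 \<le> \<epsilon> * (norm (z - x))\<^sup>2" using e by simp
      ultimately show ?thesis using B0(2)[OF xz] True by (simp add: distrib_right)
    qed (use small[OF xz] in simp)
  qed (use B0 \<delta>0 in auto)
qed

text \<open>The sum \<open>q\<close> of the squared increments satisfies \<open>q = |X\<^sub>n|\<^sup>2 - 2 \<Sum> c\<^sub>j\<close> with orthogonal
  \<open>c\<^sub>j = X\<^sub>j \<bullet> (X\<^sub>j\<^sub>+\<^sub>1 - X\<^sub>j)\<close> and \<open>\<Sum> c\<^sub>j\<^sup>2 \<le> B\<^sup>2 q\<close>, whence \<open>E q\<^sup>2 \<le> 2 B\<^sup>4 + 8 B\<^sup>2 E q\<close>.\<close>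

lemma (in prob_space) quadratic_variation_bound:
  fixes X :: "nat \<Rightarrow> 'a \<Rightarrow> 'v::euclidean_space"
  assumes m[measurable]: "\<And>j. j \<le> n \<Longrightarrow> X j \<in> borel_measurable M"
    and b: "\<And>j \<omega>. j \<le> n \<Longrightarrow> \<omega> \<in> space M \<Longrightarrow> norm (X j \<omega>) \<le> B" and X0: "\<And>\<omega>. \<omega> \<in> space M \<Longrightarrow> X 0 \<omega> = 0"
    and o1: "\<And>j. j < n \<Longrightarrow> expectation (\<lambda>\<omega>. X j \<omega> \<bullet> (X (Suc j) \<omega> - X j \<omega>)) = 0"
    and o2: "\<And>j k. j < k \<Longrightarrow> k < n \<Longrightarrow>
       expectation (\<lambda>\<omega>. (X j \<omega> \<bullet> (X (Suc j) \<omega> - X j \<omega>)) * (X k \<omega> \<bullet> (X (Suc k) \<omega> - X k \<omega>))) = 0"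
  shows "expectation (\<lambda>\<omega>. (\<Sum>j<n. (norm (X (Suc j) \<omega> - X j \<omega>))\<^sup>2)\<^sup>2) \<le> 10 * B ^ 4"
proof -
  define D where "D = (\<lambda>j \<omega>. X (Suc j) \<omega> - X j \<omega>)"
  define c where "c = (\<lambda>j \<omega>. X j \<omega> \<bullet> D j \<omega>)"
  define q where "q = (\<lambda>\<omega>. \<Sum>j<n. (norm (D j \<omega>))\<^sup>2)"
  have [measurable]: "D j \<in> borel_measurable M" if "j < n" for j unfolding D_def using m[of "Suc j"] m[of j] that by simp
  have [measurable]: "c j \<in> borel_measurable M" if "j < n" for j unfolding c_def using m[of j] that by simp
  obtain \<omega>0 where w0: "\<omega>0 \<in> space M" using not_empty by blast
  have B0: "0 \<le> B" using b[OF _ w0, of 0] norm_ge_zero order_trans by blast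
  have Db: "norm (D j \<omega>) \<le> 2 * B" if "j < n" "\<omega> \<in> space M" for j \<omega>
    using norm_triangle_ineq4[of "X (Suc j) \<omega>" "X j \<omega>"] b[of "Suc j" \<omega>] b[of j \<omega>] that by (simp add: D_def)
  have cb: "\<bar>c j \<omega>\<bar> \<le> B * norm (D j \<omega>)" if "j < n" "\<omega> \<in> space M" for j \<omega>
    unfolding c_def using Cauchy_Schwarz_ineq2[of "X j \<omega>" "D j \<omega>"] b[of j \<omega>] that
    by (meson less_imp_le mult_right_mono norm_ge_zero order_trans)
  have cb': "\<bar>c j \<omega>\<bar> \<le> B * (2 * B)" if "j < n" "\<omega> \<in> space M" for j \<omega>
    using cb[OF that] mult_left_mono[OF Db[OF that] B0] by linarith
  have ic: "integrable M (c j)" if "j < n" for j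
    by (rule integrable_const_bound[of _ "B * (2 * B)"]) (use that cb' in auto)
  have icc: "integrable M (\<lambda>\<omega>. c j \<omega> * c k \<omega>)" if "j < n" "k < n" for j k
  proof (rule integrable_const_bound[of _ "(B * (2 * B)) * (B * (2 * B))"])
    show "AE \<omega> in M. norm (c j \<omega> * c k \<omega>) \<le> (B * (2 * B)) * (B * (2 * B))"
      unfolding real_norm_def abs_mult by (intro AE_I2 mult_mono) (use cb' that B0 in auto)
  qed (use that in measurable)
  have q: "q \<omega> = (norm (X n \<omega>))\<^sup>2 - 2 * (\<Sum>j<n. c j \<omega>)" if "\<omega> \<in> space M" for \<omega>
  proof -
    have "(norm (D j \<omega>))\<^sup>2 = ((norm (X (Suc j) \<omega>))\<^sup>2 - (norm (X j \<omega>))\<^sup>2) - 2 * c j \<omega>" for j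
      by (simp add: D_def c_def power2_norm_eq_inner inner_diff inner_commute)
    then have "q \<omega> = (\<Sum>j<n. (norm (X (Suc j) \<omega>))\<^sup>2 - (norm (X j \<omega>))\<^sup>2) - 2 * (\<Sum>j<n. c j \<omega>)"
      by (simp add: q_def sum_subtractf sum_distrib_left)
    then show ?thesis using X0[OF that] sum_lessThan_telescope[of "\<lambda>j. (norm (X j \<omega>))\<^sup>2" n] by simp
  qed
  have iD: "integrable M (\<lambda>\<omega>. (norm (D j \<omega>))\<^sup>2)" if "j < n" for j
    by (rule integrable_const_bound[of _ "4 * B\<^sup>2"])
       (use power_mono[OF Db, of j _ 2] that in \<open>auto simp: power_mult_distrib\<close>)
  have iXn: "integrable M (\<lambda>\<omega>. (norm (X n \<omega>))\<^sup>2)"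
    by (rule integrable_const_bound[of _ "B\<^sup>2"]) (use b in \<open>auto intro!: power_mono\<close>)
  have iq: "integrable M q" unfolding q_def using iD by (intro Bochner_Integration.integrable_sum) auto
  have isum: "integrable M (\<lambda>\<omega>. \<Sum>j<n. c j \<omega>)" using ic by (intro Bochner_Integration.integrable_sum) auto
  have Eq: "expectation q \<le> B\<^sup>2"
  proof -
    have "expectation q = expectation (\<lambda>\<omega>. (norm (X n \<omega>))\<^sup>2 - 2 * (\<Sum>j<n. c j \<omega>))"
      using q by (intro Bochner_Integration.integral_cong) auto
    also have "\<dots> = expectation (\<lambda>\<omega>. (norm (X n \<omega>))\<^sup>2) - 2 * (\<Sum>j<n. expectation (c j))"
      using iXn isum ic by (simp add: Bochner_Integration.integral_sum)
    also have "\<dots> = expectation (\<lambda>\<omega>. (norm (X n \<omega>))\<^sup>2)" using o1 by (simp add: c_def D_def)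
    also have "\<dots> \<le> expectation (\<lambda>\<omega>. B\<^sup>2)"
      by (rule integral_mono[OF iXn]) (use b in \<open>auto intro!: power_mono\<close>)
    finally show ?thesis by (simp add: prob_space)
  qed
  have sq: "(\<Sum>j<n. c j \<omega>)\<^sup>2 = (\<Sum>j<n. \<Sum>k<n. c j \<omega> * c k \<omega>)" for \<omega>
    by (simp add: power2_eq_square sum_product)
  have isq: "integrable M (\<lambda>\<omega>. (\<Sum>j<n. c j \<omega>)\<^sup>2)"
    unfolding sq using icc by (intro Bochner_Integration.integrable_sum) auto
  have Ec: "expectation (\<lambda>\<omega>. (\<Sum>j<n. c j \<omega>)\<^sup>2) \<le> B ^ 4"
  proof -
    have ex: "expectation (\<lambda>\<omega>. c j \<omega> * c k \<omega>) = 0" if jk: "j < n" "k < n" "j \<noteq> k" for j k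
    proof -
      consider "j < k" | "k < j" using jk(3) by linarith
      then show ?thesis
      proof cases
        case 1 then show ?thesis using o2[OF 1 jk(2)] by (simp add: c_def D_def)
      next
        case 2 then show ?thesis using o2[OF 2 jk(1)] by (simp add: c_def D_def mult.commute)
      qed
    qed
    have "expectation (\<lambda>\<omega>. (\<Sum>j<n. c j \<omega>)\<^sup>2) = (\<Sum>j<n. expectation (\<lambda>\<omega>. \<Sum>k<n. c j \<omega> * c k \<omega>))"
      unfolding sq using icc by (intro Bochner_Integration.integral_sum Bochner_Integration.integrable_sum) auto
    also have "\<dots> = (\<Sum>j<n. \<Sum>k<n. expectation (\<lambda>\<omega>. c j \<omega> * c k \<omega>))"
      using icc by (intro sum.cong refl Bochner_Integration.integral_sum) auto
    also have "\<dots> = (\<Sum>j<n. expectation (\<lambda>\<omega>. c j \<omega> * c j \<omega>))"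
    proof (intro sum.cong refl)
      fix j assume j: "j \<in> {..<n}"
      have "(\<Sum>k<n. expectation (\<lambda>\<omega>. c j \<omega> * c k \<omega>)) = (\<Sum>k\<in>{j}. expectation (\<lambda>\<omega>. c j \<omega> * c k \<omega>))"
        by (rule sum.mono_neutral_right) (use j ex in auto)
      then show "(\<Sum>k<n. expectation (\<lambda>\<omega>. c j \<omega> * c k \<omega>)) = expectation (\<lambda>\<omega>. c j \<omega> * c j \<omega>)" by simp
    qed
    also have "\<dots> \<le> (\<Sum>j<n. expectation (\<lambda>\<omega>. B\<^sup>2 * (norm (D j \<omega>))\<^sup>2))"
    proof (intro sum_mono integral_mono)
      fix j \<omega> assume j: "j \<in> {..<n}" and w: "\<omega> \<in> space M"
      show "c j \<omega> * c j \<omega> \<le> B\<^sup>2 * (norm (D j \<omega>))\<^sup>2"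
        using power_mono[OF cb[OF _ w, of j], of 2] j by (simp add: power2_eq_square mult_ac)
    qed (use icc iD in auto)
    also have "\<dots> = B\<^sup>2 * expectation q"
      unfolding q_def using iD by (simp add: Bochner_Integration.integral_sum sum_distrib_left)
    also have "\<dots> \<le> B\<^sup>2 * B\<^sup>2" using Eq by (intro mult_left_mono) auto
    finally show ?thesis by (simp add: power4_eq_xxxx power2_eq_square mult.assoc)
  qed
  have "expectation (\<lambda>\<omega>. (q \<omega>)\<^sup>2) \<le> expectation (\<lambda>\<omega>. 2 * B ^ 4 + 8 * (\<Sum>j<n. c j \<omega>)\<^sup>2)"
  proof (rule integral_mono')
    fix \<omega> assume w: "\<omega> \<in> space M"
    have "((norm (X n \<omega>))\<^sup>2)\<^sup>2 \<le> (B\<^sup>2)\<^sup>2" using b[OF _ w] by (intro power_mono) auto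
    moreover have "(B\<^sup>2)\<^sup>2 = B ^ 4" by (simp add: power4_eq_xxxx power2_eq_square)
    moreover have xy: "(x - 2 * y)\<^sup>2 \<le> 2 * x\<^sup>2 + 8 * y\<^sup>2" for x y :: real
      using zero_le_power2[of "x + 2 * y"] by (simp add: power2_sum power2_diff power_mult_distrib)
    ultimately show "(q \<omega>)\<^sup>2 \<le> 2 * B ^ 4 + 8 * (\<Sum>j<n. c j \<omega>)\<^sup>2"
      unfolding q[OF w] using xy[of "(norm (X n \<omega>))\<^sup>2" "\<Sum>j<n. c j \<omega>"] by linarith
  qed (use isq in auto)
  also have "\<dots> = 2 * B ^ 4 + 8 * expectation (\<lambda>\<omega>. (\<Sum>j<n. c j \<omega>)\<^sup>2)" using isq by (simp add: prob_space)
  also have "\<dots> \<le> 10 * B ^ 4" using Ec by simp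
  finally show ?thesis by (simp add: q_def D_def)
qed

lemma (in driven_space) adapted_continuous_progressive:
  fixes X :: "real \<Rightarrow> 'w \<Rightarrow> 'b::metric_space"
  assumes X: "adapted F X" "continuous_paths M X"
  shows "progressive F X"
  unfolding progressive_def
proof (intro allI impI)
  fix t :: real assume t: "0 \<le> t"
  let ?P = "restrict_space borel {0..t} \<Otimes>\<^sub>M F t"
  let ?q = "\<lambda>n (i::int). max 0 (min t ((of_int i + 1) / real (Suc n)))"
  have Xm: "X r \<in> borel_measurable (F t)" if "0 \<le> r" "r \<le> t" for r
    using F_measurable_mono[OF that] X(1) that by (auto simp: adapted_def)
  have fst_m: "fst \<in> borel_measurable ?P"
    using measurable_compose[OF measurable_fst measurable_restrict_space1[OF measurable_ident]] by simp
  show "(\<lambda>(s, \<omega>). X s \<omega>) \<in> borel_measurable ?P"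
  proof (rule borel_measurable_LIMSEQ_metric[where f="\<lambda>n x. X (?q n \<lfloor>real (Suc n) * fst x\<rfloor>) (snd x)"])
    fix n :: nat
    show "(\<lambda>x. X (?q n \<lfloor>real (Suc n) * fst x\<rfloor>) (snd x)) \<in> borel_measurable ?P"
    proof (rule measurable_compose_countable[where f="\<lambda>i x. X (?q n i) (snd x)" and g="\<lambda>x. \<lfloor>real (Suc n) * fst x\<rfloor>"])
      show "(\<lambda>x. X (?q n i) (snd x)) \<in> borel_measurable ?P" for i
        by (rule measurable_compose[OF measurable_snd Xm]) (use t in auto)
      show "(\<lambda>x. \<lfloor>real (Suc n) * fst x\<rfloor>) \<in> measurable ?P (count_space UNIV)"
        using fst_m by measurable
    qed
  next
    fix x assume x: "x \<in> space ?P"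
    obtain s \<omega> where sw: "x = (s, \<omega>)" by (cases x)
    have s: "0 \<le> s" "s \<le> t" and w: "\<omega> \<in> space M"
      using x F_space[OF t] by (auto simp: sw space_pair_measure space_restrict_space)
    have c: "continuous_on {0..} (\<lambda>r. X r \<omega>)" using X(2) w by (auto simp: continuous_paths_def)
    have 1: "(\<lambda>n. (of_int \<lfloor>real (Suc n) * s\<rfloor> + 1) / real (Suc n)) \<longlonglongrightarrow> s"
    proof (rule tendsto_sandwich[OF _ _ tendsto_const])
      show "(\<lambda>n. s + 1 / real (Suc n)) \<longlonglongrightarrow> s"
        using tendsto_add[OF tendsto_const LIMSEQ_inverse_real_of_nat, of s] by (simp add: inverse_eq_divide)
      show "\<forall>\<^sub>F n in sequentially. s \<le> (of_int \<lfloor>real (Suc n) * s\<rfloor> + 1) / real (Suc n)"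
      proof (intro always_eventually allI)
        fix n
        have "s * real (Suc n) \<le> of_int \<lfloor>real (Suc n) * s\<rfloor> + 1" unfolding mult.commute[of s] by linarith
        then show "s \<le> (of_int \<lfloor>real (Suc n) * s\<rfloor> + 1) / real (Suc n)" by (subst pos_le_divide_eq) auto
      qed
      show "\<forall>\<^sub>F n in sequentially. (of_int \<lfloor>real (Suc n) * s\<rfloor> + 1) / real (Suc n) \<le> s + 1 / real (Suc n)"
      proof (intro always_eventually allI)
        fix n
        have "of_int \<lfloor>real (Suc n) * s\<rfloor> + 1 \<le> (s + 1 / real (Suc n)) * real (Suc n)"
          unfolding distrib_right mult.commute[of s] by simp
        then show "(of_int \<lfloor>real (Suc n) * s\<rfloor> + 1) / real (Suc n) \<le> s + 1 / real (Suc n)"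
          by (subst pos_divide_le_eq) auto
      qed
    qed
    have "(\<lambda>n. ?q n \<lfloor>real (Suc n) * s\<rfloor>) \<longlonglongrightarrow> max 0 (min t s)"
      by (intro tendsto_intros 1)
    then have "(\<lambda>n. ?q n \<lfloor>real (Suc n) * s\<rfloor>) \<longlonglongrightarrow> s" using s by simp
    from continuous_on_tendsto_compose[OF c this] s
    show "(\<lambda>n. X (?q n \<lfloor>real (Suc n) * fst x\<rfloor>) (snd x)) \<longlonglongrightarrow> (case x of (s, \<omega>) \<Rightarrow> X s \<omega>)"
      by (simp add: sw)
  qed
qed

section \<open>Stopped diffusions\<close>

context driven_space begin

lemma stopped_ito:
  fixes H :: "real \<Rightarrow> 'w \<Rightarrow> real^'d^'n::finite" and G B :: real
  assumes ito: "ito_integral M F w H I" and st: "0 \<le> s" "s < t"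
    and \<theta>: "\<And>\<omega>. \<omega> \<in> space M \<Longrightarrow> s \<le> \<theta> \<omega> \<and> \<theta> \<omega> \<le> t"
    and stop: "\<And>r. s \<le> r \<Longrightarrow> r < t \<Longrightarrow> {\<omega>\<in>space M. \<theta> \<omega> \<le> r} \<in> sets (F r)"
    and g: "g \<in> borel_measurable (F s)" "\<And>\<omega>. \<omega> \<in> space M \<Longrightarrow> \<bar>g \<omega>\<bar> \<le> G"
    and B: "\<And>\<omega> r. \<omega> \<in> space M \<Longrightarrow> s < r \<Longrightarrow> r \<le> \<theta> \<omega> \<Longrightarrow> norm (H r \<omega> $ a) \<le> B"
    and X: "X \<in> borel_measurable M" "AE \<omega> in M. X \<omega> = (I (\<theta> \<omega>) \<omega> - I s \<omega>) $ a"
  shows "ito_L2 (\<lambda>r \<omega>. (indicator {s<..\<theta> \<omega>} r * g \<omega>) *\<^sub>R (H (max 0 (min t r)) \<omega> $ a)) (\<lambda>\<omega>. g \<omega> * X \<omega>)"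
proof -
  have H: "progressive F H"
    and sq: "AE \<omega> in M. set_integrable lborel {0..t} (\<lambda>s. (norm (H s \<omega>))\<^sup>2)"
    and Im: "\<And>r. 0 \<le> r \<Longrightarrow> I r \<in> borel_measurable M"
    and Ic: "AE \<omega> in M. continuous_on {0..} (\<lambda>t. I t \<omega>)"
    using ito st by (auto simp: ito_integral_def)
  obtain Sk where Sk: "\<And>k. simple_process F (Sk k)"
    "tends_in_probability M (\<lambda>k \<omega>. LINT r:{0..t}|lborel. (norm (simple_value (Sk k) r \<omega> - H r \<omega>))\<^sup>2) (\<lambda>_. 0)"
    "\<And>r. 0 \<le> r \<Longrightarrow> tends_in_probability M (\<lambda>k. simple_integral w (Sk k) r) (I r)"
    using ito st unfolding ito_integral_def by force
  show ?thesis
  proof (rule ito_L2_increment'[where G="max 1 G" and B="max 0 B"])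
    show "\<bar>g \<omega>\<bar> \<le> max 1 G" if "\<omega> \<in> space M" for \<omega> using g(2)[OF that] by simp
    show "norm (H r \<omega> $ a) \<le> max 0 B" if "\<omega> \<in> space M" "s < r" "r \<le> \<theta> \<omega>" for \<omega> r using B[OF that] by simp
  qed (use assms H sq Im Ic Sk in \<open>auto\<close>)
qed

end

locale stopped_diffusion = driven_space M F w for M :: "'w measure" and F and w :: "real \<Rightarrow> 'w \<Rightarrow> real^'d::finite" +
  fixes y :: "real \<Rightarrow> 'w \<Rightarrow> real^'n::finite" and f :: "real^'n \<Rightarrow> real^'n" and \<beta> :: "real^'n \<Rightarrow> real^'d^'n"
    and a0 :: "'w \<Rightarrow> real^'n" and I :: "real \<Rightarrow> 'w \<Rightarrow> real^'n" and \<tau> :: "'w \<Rightarrow> real" and K R Cf Cb :: real and C :: "(real^'n) set"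
  assumes adapt: "adapted F y" and paths: "continuous_paths M y"
    and ito: "ito_integral M F w (\<lambda>s \<omega>. \<beta> (y s \<omega>)) I"
    and eq: "AE \<omega> in M. \<forall>t\<ge>0. y t \<omega> = a0 \<omega> + (LINT s:{0..t}|lborel. f (y s \<omega>)) + I t \<omega>"
    and fc: "continuous_on UNIV f" and bc: "continuous_on UNIV \<beta>"
    and K: "0 < K" and \<tau>: "\<And>\<omega>. \<omega> \<in> space M \<Longrightarrow> 0 \<le> \<tau> \<omega> \<and> \<tau> \<omega> \<le> K"
    and stop: "\<And>r. 0 \<le> r \<Longrightarrow> {\<omega>\<in>space M. \<tau> \<omega> \<le> r} \<in> sets (F r)"
    and C: "compact C" and inC: "\<And>\<omega> r. \<omega> \<in> space M \<Longrightarrow> 0 \<le> r \<Longrightarrow> r < \<tau> \<omega> \<Longrightarrow> y r \<omega> \<in> C"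
    and R: "0 \<le> R" "\<And>x. x \<in> C \<Longrightarrow> norm x \<le> R"
    and Cf: "0 \<le> Cf" "\<And>x. x \<in> C \<Longrightarrow> norm (f x) \<le> Cf"
    and Cb: "0 \<le> Cb" "\<And>x. x \<in> C \<Longrightarrow> norm (\<beta> x) \<le> Cb"
begin

definition N :: "real \<Rightarrow> 'w \<Rightarrow> real^'n" where "N t \<omega> = y (min t (\<tau> \<omega>)) \<omega>"
definition drift :: "real \<Rightarrow> 'w \<Rightarrow> real^'n" where
  "drift t \<omega> = (\<integral>r. indicator {0<..min t (\<tau> \<omega>)} r *\<^sub>R f (y r \<omega>) \<partial>lborel)"
definition mart :: "real \<Rightarrow> 'w \<Rightarrow> real^'n" where "mart t \<omega> = N t \<omega> - N 0 \<omega> - drift t \<omega>"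

lemma y_continuous: "\<omega> \<in> space M \<Longrightarrow> continuous_on {0..} (\<lambda>r. y r \<omega>)"
  using paths by (simp add: continuous_paths_def)

lemma y_in_C:
  assumes w: "\<omega> \<in> space M" and r: "0 \<le> r" "r \<le> \<tau> \<omega>" "0 < \<tau> \<omega>"
  shows "y r \<omega> \<in> C"
proof (cases "r < \<tau> \<omega>")
  case False
  then have r: "r = \<tau> \<omega>" using r by simp
  have lt: "0 \<le> \<tau> \<omega> - \<tau> \<omega> / real (Suc n) \<and> \<tau> \<omega> - \<tau> \<omega> / real (Suc n) < \<tau> \<omega>" for n
    using assms by (auto simp: divide_simps)
  have "(\<lambda>n. \<tau> \<omega> - \<tau> \<omega> / real (Suc n)) \<longlonglongrightarrow> \<tau> \<omega> - 0"
    by (intro tendsto_intros LIMSEQ_Suc[OF lim_const_over_n])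
  then have lim: "(\<lambda>n. y (\<tau> \<omega> - \<tau> \<omega> / real (Suc n)) \<omega>) \<longlonglongrightarrow> y (\<tau> \<omega>) \<omega>"
    by (intro continuous_on_tendsto_compose[OF y_continuous[OF w]]) (use lt \<tau>[OF w] in auto)
  have mem: "y (\<tau> \<omega> - \<tau> \<omega> / real (Suc n)) \<omega> \<in> C" for n using inC[OF w] lt by blast
  show ?thesis unfolding r by (rule closed_sequentially[OF compact_imp_closed[OF C] mem lim])
qed (use inC w r in auto)

lemma stop_min_measurable:
  assumes t: "0 \<le> t" shows "(\<lambda>\<omega>. min t (\<tau> \<omega>)) \<in> borel_measurable (F t)"
proof (rule borel_measurable_iff_le[THEN iffD2], rule allI)
  fix r
  note sp = F_space[OF t]
  consider "r < 0" | "0 \<le> r" "r < t" | "t \<le> r" by linarith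
  then show "{\<omega> \<in> space (F t). min t (\<tau> \<omega>) \<le> r} \<in> sets (F t)"
  proof cases
    case 1
    then have "{\<omega> \<in> space (F t). min t (\<tau> \<omega>) \<le> r} = {}" using \<tau> t sp by fastforce
    then show ?thesis by (simp only: sets.empty_sets)
  next
    case 2
    then have "{\<omega> \<in> space (F t). min t (\<tau> \<omega>) \<le> r} = {\<omega> \<in> space M. \<tau> \<omega> \<le> r}" using sp by auto
    then show ?thesis using F_sets_mono[OF _ _ stop] 2 by auto
  next
    case 3
    then have "{\<omega> \<in> space (F t). min t (\<tau> \<omega>) \<le> r} = space (F t)" by auto
    then show ?thesis by (simp only: sets.top)
  qed
qed

lemma \<tau>_measurable: "\<tau> \<in> borel_measurable M"
proof -
  have "(\<lambda>\<omega>. min K (\<tau> \<omega>)) \<in> borel_measurable M"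
    using F_measurable_M[OF _ stop_min_measurable] K by simp
  then show ?thesis by (rule measurable_cong[THEN iffD1, rotated]) (use \<tau> in \<open>auto simp: min_def intro: antisym\<close>)
qed

lemma y_clamp_measurable: "0 \<le> t \<Longrightarrow> (\<lambda>x. y (max 0 (min t (snd x))) (fst x)) \<in> borel_measurable (F t \<Otimes>\<^sub>M lborel)"
  using progressive_clamp(1)[OF adapted_continuous_progressive[OF adapt paths], of t] by (simp add: case_prod_unfold)

lemma N_measurable:
  assumes t: "0 \<le> t" shows "N t \<in> borel_measurable (F t)"
proof -
  have "(\<lambda>\<omega>. (\<omega>, min t (\<tau> \<omega>))) \<in> measurable (F t) (F t \<Otimes>\<^sub>M lborel)"
    using stop_min_measurable[OF t] by (intro measurable_Pair) auto
  from measurable_compose[OF this y_clamp_measurable[OF t]]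
  have "(\<lambda>\<omega>. y (max 0 (min t (min t (\<tau> \<omega>)))) \<omega>) \<in> borel_measurable (F t)" by simp
  then show ?thesis
    by (rule measurable_cong[THEN iffD1, rotated]) (use \<tau> t F_space[OF t] in \<open>auto simp: N_def max_def\<close>)
qed

lemma drift_measurable:
  assumes t: "0 \<le> t" shows "drift t \<in> borel_measurable (F t)"
proof -
  note [measurable] = stop_min_measurable[OF t] measurable_compose[OF y_clamp_measurable[OF t] borel_measurable_continuous_onI[OF fc]]
  have "(\<lambda>x. indicator {x. 0 < snd x \<and> snd x \<le> min t (\<tau> (fst x))} x *\<^sub>R f (y (max 0 (min t (snd x))) (fst x)))
    \<in> borel_measurable (F t \<Otimes>\<^sub>M lborel)" by measurable
  then have "(\<lambda>\<omega>. \<integral>r. indicator {x. 0 < snd x \<and> snd x \<le> min t (\<tau> (fst x))} (\<omega>, r) *\<^sub>R f (y (max 0 (min t r)) \<omega>) \<partial>lborel) \<in> borel_measurable (F t)"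
    by (intro lborel.borel_measurable_lebesgue_integral) (simp add: case_prod_unfold)
  moreover have "drift t \<omega> = (\<integral>r. indicator {x. 0 < snd x \<and> snd x \<le> min t (\<tau> (fst x))} (\<omega>, r) *\<^sub>R f (y (max 0 (min t r)) \<omega>) \<partial>lborel)" for \<omega>
    unfolding drift_def by (intro Bochner_Integration.integral_cong refl) (auto simp: indicator_def)
  ultimately show ?thesis by presburger
qed

lemma mart_measurable:
  assumes t: "0 \<le> t" shows "mart t \<in> borel_measurable (F t)"
proof -
  have "N 0 \<in> borel_measurable (F t)" by (rule F_measurable_mono[OF order_refl t N_measurable[OF order_refl]])
  then show ?thesis unfolding mart_def[abs_def] by (intro borel_measurable_diff N_measurable drift_measurable t)
qed

lemma fy_integrable:
  assumes w: "\<omega> \<in> space M" and s: "0 \<le> s"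
  shows "integrable lborel (\<lambda>r. indicator {s<..min t (\<tau> \<omega>)} r *\<^sub>R f (y r \<omega>))"
proof -
  have "continuous_on {s..min t (\<tau> \<omega>)} (\<lambda>r. f (y r \<omega>))"
    by (rule continuous_on_compose2[OF fc continuous_on_subset[OF y_continuous[OF w]]]) (use s in auto)
  then have "set_integrable lborel {s..min t (\<tau> \<omega>)} (\<lambda>r. f (y r \<omega>))" by (rule borel_integrable_atLeastAtMost')
  then have "set_integrable lborel {s<..min t (\<tau> \<omega>)} (\<lambda>r. f (y r \<omega>))" by (rule set_integrable_subset) auto
  then show ?thesis by (simp add: set_integrable_def)
qed

lemma drift_increment:
  assumes w: "\<omega> \<in> space M" and s: "0 \<le> s" "s \<le> t"
  shows "drift t \<omega> - drift s \<omega> = (\<integral>r. indicator {s<..min t (\<tau> \<omega>)} r *\<^sub>R f (y r \<omega>) \<partial>lborel)"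
proof -
  have "drift t \<omega> = (\<integral>r. indicator {0<..min s (\<tau> \<omega>)} r *\<^sub>R f (y r \<omega>) + indicator {s<..min t (\<tau> \<omega>)} r *\<^sub>R f (y r \<omega>) \<partial>lborel)"
    unfolding drift_def by (intro Bochner_Integration.integral_cong) (use s in \<open>auto simp: indicator_def\<close>)
  also have "\<dots> = drift s \<omega> + (\<integral>r. indicator {s<..min t (\<tau> \<omega>)} r *\<^sub>R f (y r \<omega>) \<partial>lborel)"
    unfolding drift_def by (intro Bochner_Integration.integral_add fy_integrable w s) auto
  finally show ?thesis by simp
qed

lemma drift_increment_bound:
  assumes w: "\<omega> \<in> space M" and s: "0 \<le> s" "s \<le> t"
  shows "norm (drift t \<omega> - drift s \<omega>) \<le> Cf * (t - s)"
proof -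
  have "norm (drift t \<omega> - drift s \<omega>) \<le> (\<integral>r. norm (indicator {s<..min t (\<tau> \<omega>)} r *\<^sub>R f (y r \<omega>)) \<partial>lborel)"
    unfolding drift_increment[OF assms] by (rule integral_norm_bound)
  also have "\<dots> \<le> (\<integral>r. Cf * indicator {s<..t} r \<partial>lborel)"
  proof (rule integral_mono)
    show "integrable lborel (\<lambda>r. norm (indicator {s<..min t (\<tau> \<omega>)} r *\<^sub>R f (y r \<omega>)))"
      by (intro integrable_norm fy_integrable w s)
    show "integrable lborel (\<lambda>r. Cf * indicator {s<..t} r)"
      using s by (intro integrable_mult_right) (auto simp: integrable_indicator_iff)
    show "norm (indicator {s<..min t (\<tau> \<omega>)} r *\<^sub>R f (y r \<omega>)) \<le> Cf * indicator {s<..t} r" for r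
      using Cf y_in_C[OF w, of r] s by (auto simp: indicator_def)
  qed
  also have "\<dots> = Cf * (t - s)" using s by simp
  finally show ?thesis .
qed

lemma drift_0: "drift 0 \<omega> = 0"
proof -
  have "(\<lambda>r::real. indicator {0<..min 0 (\<tau> \<omega>)} r *\<^sub>R f (y r \<omega>)) = (\<lambda>r. 0)" by (auto simp: indicator_def fun_eq_iff)
  then show ?thesis by (simp add: drift_def)
qed

lemma N_in_C: "\<omega> \<in> space M \<Longrightarrow> 0 \<le> t \<Longrightarrow> 0 < \<tau> \<omega> \<Longrightarrow> N t \<omega> \<in> C"
  unfolding N_def using \<tau>[of \<omega>] by (intro y_in_C) auto

lemma N_stopped: "\<omega> \<in> space M \<Longrightarrow> 0 \<le> t \<Longrightarrow> \<not> 0 < \<tau> \<omega> \<Longrightarrow> N t \<omega> = N 0 \<omega>"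
  using \<tau>[of \<omega>] by (simp add: N_def min_def)

lemma N_diff_bound: "\<omega> \<in> space M \<Longrightarrow> 0 \<le> s \<Longrightarrow> 0 \<le> t \<Longrightarrow> norm (N t \<omega> - N s \<omega>) \<le> 2 * R"
proof (cases "0 < \<tau> \<omega>")
  case True
  assume a: "\<omega> \<in> space M" "0 \<le> s" "0 \<le> t"
  have "norm (N t \<omega>) \<le> R" "norm (N s \<omega>) \<le> R" using N_in_C[OF a(1) _ True] a R(2) by blast+
  then show ?thesis using norm_triangle_ineq4[of "N t \<omega>" "N s \<omega>"] by linarith
next
  case False
  assume a: "\<omega> \<in> space M" "0 \<le> s" "0 \<le> t"
  show ?thesis using N_stopped[OF a(1,2) False] N_stopped[OF a(1,3) False] R(1) by simp
qed

lemma mart_bound: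
  assumes w: "\<omega> \<in> space M" and t: "0 \<le> t" "t \<le> K"
  shows "norm (mart t \<omega>) \<le> 2 * R + Cf * K"
proof -
  have "norm (drift t \<omega>) \<le> Cf * t" using drift_increment_bound[OF w order_refl t(1)] by (simp add: drift_0)
  also have "\<dots> \<le> Cf * K" using t Cf by (intro mult_left_mono)
  finally show ?thesis
    using norm_triangle_ineq4[of "N t \<omega> - N 0 \<omega>" "drift t \<omega>"] N_diff_bound[OF w order_refl t(1)] by (simp add: mart_def)
qed

lemma mart_ito:
  assumes s: "0 \<le> s" "s < t"
  shows "AE \<omega> in M. mart t \<omega> - mart s \<omega> = I (max s (min t (\<tau> \<omega>))) \<omega> - I s \<omega>"
  using eq AE_space
proof eventually_elim
  case (elim \<omega>)
  then have w: "\<omega> \<in> space M" by simp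
  show ?case
  proof (cases "\<tau> \<omega> \<le> s")
    case True
    then have "min t (\<tau> \<omega>) = min s (\<tau> \<omega>)" "max s (min t (\<tau> \<omega>)) = s" using s by auto
    then show ?thesis by (simp add: mart_def N_def drift_def)
  next
    case False
    define \<theta> where "\<theta> = min t (\<tau> \<omega>)"
    have m: "min s (\<tau> \<omega>) = s" "max s \<theta> = \<theta>" "s \<le> \<theta>" "0 \<le> \<theta>" "\<theta> \<le> t" using False s by (auto simp: \<theta>_def)
    have LI: "(LINT r:{0..q}|lborel. f (y r \<omega>)) = (\<integral>r. indicator {0<..q} r *\<^sub>R f (y r \<omega>) \<partial>lborel)" if "q \<le> \<tau> \<omega>" "0 \<le> q" for q
      unfolding set_lebesgue_integral_def
    proof (rule integral_cong_AE)
      have i: "integrable lborel (\<lambda>r. indicator {0<..q} r *\<^sub>R f (y r \<omega>))" using fy_integrable[OF w order_refl, of q] that by (simp add: min_absorb1)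
      then show "(\<lambda>r. indicator {0<..q} r *\<^sub>R f (y r \<omega>)) \<in> borel_measurable lborel" by simp
      have "continuous_on {0..q} (\<lambda>r. f (y r \<omega>))"
        by (rule continuous_on_compose2[OF fc continuous_on_subset[OF y_continuous[OF w]]]) auto
      then have "set_integrable lborel {0..q} (\<lambda>r. f (y r \<omega>))" by (rule borel_integrable_atLeastAtMost')
      then show "(\<lambda>r. indicator {0..q} r *\<^sub>R f (y r \<omega>)) \<in> borel_measurable lborel" by (simp add: set_integrable_def)
      show "AE r in lborel. indicator {0..q} r *\<^sub>R f (y r \<omega>) = indicator {0<..q} r *\<^sub>R f (y r \<omega>)"
        using AE_lborel_singleton[of 0] by eventually_elim (auto simp: indicator_def)
    qed
    have d: "drift t \<omega> = (LINT r:{0..\<theta>}|lborel. f (y r \<omega>))" "drift s \<omega> = (LINT r:{0..s}|lborel. f (y r \<omega>))"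
      using LI[of \<theta>] LI[of s] m(1,4) False s(1) by (simp_all add: drift_def \<theta>_def)
    have "y \<theta> \<omega> = a0 \<omega> + drift t \<omega> + I \<theta> \<omega>" "y s \<omega> = a0 \<omega> + drift s \<omega> + I s \<omega>"
      using elim(1) m s unfolding d by auto
    moreover have "N t \<omega> = y \<theta> \<omega>" "N s \<omega> = y s \<omega>" using m by (auto simp: N_def \<theta>_def)
    ultimately show ?thesis using m by (simp add: mart_def \<theta>_def)
  qed
qed

lemma mart_ito_L2:
  assumes s: "0 \<le> s" "s < t" and g: "g \<in> borel_measurable (F s)" "\<And>\<omega>. \<omega> \<in> space M \<Longrightarrow> \<bar>g \<omega>\<bar> \<le> G"
  shows "ito_L2 (\<lambda>r \<omega>. (indicator {s<..max s (min t (\<tau> \<omega>))} r * g \<omega>) *\<^sub>R (\<beta> (y (max 0 (min t r)) \<omega>) $ a))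
     (\<lambda>\<omega>. g \<omega> * (mart t \<omega> - mart s \<omega>) $ a)"
proof (rule stopped_ito[OF ito s _ _ g])
  show "s \<le> max s (min t (\<tau> \<omega>)) \<and> max s (min t (\<tau> \<omega>)) \<le> t" for \<omega> using s by auto
  show "{\<omega> \<in> space M. max s (min t (\<tau> \<omega>)) \<le> r} \<in> sets (F r)" if "s \<le> r" "r < t" for r
  proof -
    have "{\<omega> \<in> space M. max s (min t (\<tau> \<omega>)) \<le> r} = {\<omega> \<in> space M. \<tau> \<omega> \<le> r}" using that by auto
    then show ?thesis using stop that s by auto
  qed
  show "norm (\<beta> (y r \<omega>) $ a) \<le> Cb" if "\<omega> \<in> space M" "s < r" "r \<le> max s (min t (\<tau> \<omega>))" for \<omega> r
    using y_in_C[OF that(1), of r] that s Cb(2)[of "y r \<omega>"] Finite_Cartesian_Product.norm_nth_le[of "\<beta> (y r \<omega>)" a] by auto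
  show "(\<lambda>\<omega>. (mart t \<omega> - mart s \<omega>) $ a) \<in> borel_measurable M"
    using F_measurable_M[OF _ mart_measurable] s
    by (intro measurable_compose[OF _ borel_measurable_nth] borel_measurable_diff) auto
  show "AE \<omega> in M. (mart t \<omega> - mart s \<omega>) $ a = (I (max s (min t (\<tau> \<omega>))) \<omega> - I s \<omega>) $ a"
    using mart_ito[OF s] by eventually_elim simp
qed

lemma mart_mean:
  assumes s: "0 \<le> s" "s < t" and g: "g \<in> borel_measurable (F s)" "\<And>\<omega>. \<omega> \<in> space M \<Longrightarrow> \<bar>g \<omega>\<bar> \<le> G"
  shows "expectation (\<lambda>\<omega>. g \<omega> * (mart t \<omega> - mart s \<omega>) $ a) = 0"
proof -
  have "ito_L2 (\<lambda>r \<omega>. (indicator {s<..max s (min t (\<tau> \<omega>))} r * g \<omega>) *\<^sub>R (\<beta> (y (max 0 (min t r)) \<omega>) $ a))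
     (\<lambda>\<omega>. g \<omega> * (mart t \<omega> - mart s \<omega>) $ a)" by (rule mart_ito_L2[OF assms])
  then show ?thesis by (rule ito_L2_mean)
qed

lemma mart_covariance:
  assumes s: "0 \<le> s" "s < t" and g: "g \<in> borel_measurable (F s)" "\<And>\<omega>. \<omega> \<in> space M \<Longrightarrow> \<bar>g \<omega>\<bar> \<le> G"
  shows "expectation (\<lambda>\<omega>. g \<omega> * ((mart t \<omega> - mart s \<omega>) $ a * (mart t \<omega> - mart s \<omega>) $ b)) =
    expectation (\<lambda>\<omega>. \<integral>r. indicator {s<..min t (\<tau> \<omega>)} r * (g \<omega> * (\<beta> (y r \<omega>) $ a \<bullet> \<beta> (y r \<omega>) $ b)) \<partial>lborel)"
proof -
  have A: "ito_L2 (\<lambda>r \<omega>. (indicator {s<..max s (min t (\<tau> \<omega>))} r * g \<omega>) *\<^sub>R (\<beta> (y (max 0 (min t r)) \<omega>) $ a))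
     (\<lambda>\<omega>. g \<omega> * (mart t \<omega> - mart s \<omega>) $ a)" (is "ito_L2 ?h ?X")
    by (rule mart_ito_L2[OF assms])
  have B: "ito_L2 (\<lambda>r \<omega>. (indicator {s<..max s (min t (\<tau> \<omega>))} r * 1) *\<^sub>R (\<beta> (y (max 0 (min t r)) \<omega>) $ b))
     (\<lambda>\<omega>. 1 * (mart t \<omega> - mart s \<omega>) $ b)" (is "ito_L2 ?k ?Y")
    by (rule mart_ito_L2[OF s, where G=1]) auto
  have mA: "(\<lambda>(\<omega>, r). ?h r \<omega>) \<in> borel_measurable (M \<Otimes>\<^sub>M lborel)" "integrable (M \<Otimes>\<^sub>M lborel) (\<lambda>(\<omega>, r). (norm (?h r \<omega>))\<^sup>2)"
    using A unfolding ito_L2_def by blast+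
  have mB: "(\<lambda>(\<omega>, r). ?k r \<omega>) \<in> borel_measurable (M \<Otimes>\<^sub>M lborel)" "integrable (M \<Otimes>\<^sub>M lborel) (\<lambda>(\<omega>, r). (norm (?k r \<omega>))\<^sup>2)"
    using B unfolding ito_L2_def by blast+
  have int: "integrable (M \<Otimes>\<^sub>M lborel) (\<lambda>x. (\<lambda>(\<omega>, r). ?h r \<omega>) x \<bullet> (\<lambda>(\<omega>, r). ?k r \<omega>) x)"
    by (rule integrable_inner_of_squares[OF mA(1) mB(1)]) (use mA(2) mB(2) in \<open>simp_all only: case_prod_unfold\<close>)
  have "expectation (\<lambda>\<omega>. ?X \<omega> * ?Y \<omega>)
     = (\<integral>x. (\<lambda>(\<omega>, r). ?h r \<omega>) x \<bullet> (\<lambda>(\<omega>, r). ?k r \<omega>) x \<partial>(M \<Otimes>\<^sub>M lborel))"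
    using ito_L2_isometry[OF A B] by (simp only: case_prod_unfold)
  also have "\<dots> = expectation (\<lambda>\<omega>. \<integral>r. ?h r \<omega> \<bullet> ?k r \<omega> \<partial>lborel)"
    using PL.integral_fst'[OF int] by simp
  also have "\<dots> = expectation (\<lambda>\<omega>. \<integral>r. indicator {s<..min t (\<tau> \<omega>)} r * (g \<omega> * (\<beta> (y r \<omega>) $ a \<bullet> \<beta> (y r \<omega>) $ b)) \<partial>lborel)"
    by (intro Bochner_Integration.integral_cong refl) (use s in \<open>auto simp: indicator_def\<close>)
  finally show ?thesis by (simp only: mult.assoc mult_1_left)
qed

end

section \<open>Dynkin's formula\<close>

locale stopped_diffusion_C2 = stopped_diffusion +
  fixes u :: "real^'c \<Rightarrow> real" and Q :: "(real^'c) set"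
  assumes Q: "open Q" and CQ: "C \<subseteq> Q" and u: "Ck_on 2 Q u"
begin

definition D1 :: "'c \<Rightarrow> real^'c \<Rightarrow> real" where "D1 b x = indicator C x *\<^sub>R partial b u x"
definition D2 :: "'c \<Rightarrow> 'c \<Rightarrow> real^'c \<Rightarrow> real" where "D2 a b x = indicator C x *\<^sub>R partial a (partial b u) x"

lemma u_continuous: "continuous_on C u" "continuous_on C (partial b u)" "continuous_on C (partial a (partial b u))"
proof -
  have u': "Ck_on (Suc (Suc 0)) Q u" using u by (simp add: numeral_2_eq_2)
  show "continuous_on C u" "continuous_on C (partial b u)" "continuous_on C (partial a (partial b u))"
    using Ck_on_continuous[OF u] Ck_on_continuous[OF Ck_on_SucD(2)[OF u']]
      Ck_on_continuous[OF Ck_on_SucD(2)[OF Ck_on_SucD(2)[OF u']]] CQ continuous_on_subset by blast+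
qed

lemma C_borel: "C \<in> sets borel" using compact_imp_closed[OF C] by simp

lemma D_measurable: "D1 b \<in> borel_measurable borel" "D2 a b \<in> borel_measurable borel"
  unfolding D1_def[abs_def] D2_def[abs_def]
  by (intro borel_measurable_continuous_on_indicator C_borel u_continuous)+

lemma bounded_on_C:
  fixes h :: "real^'c \<Rightarrow> real"
  assumes "continuous_on C h"
  shows "\<exists>L\<ge>0. \<forall>x. \<bar>indicator C x *\<^sub>R h x\<bar> \<le> L"
proof -
  have "bounded (h ` C)" by (rule compact_imp_bounded[OF compact_continuous_image[OF assms C]])
  then obtain L where L: "L > 0" "\<And>x. x \<in> C \<Longrightarrow> \<bar>h x\<bar> \<le> L" unfolding bounded_pos by force
  then show ?thesis by (intro exI[of _ L]) (auto simp: indicator_def)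
qed

lemma D_bounds: obtains L where "0 \<le> L" "\<And>b x. \<bar>D1 b x\<bar> \<le> L" "\<And>a b x. \<bar>D2 a b x\<bar> \<le> L"
proof -
  have "\<exists>L\<ge>0. \<forall>x. \<bar>D1 b x\<bar> \<le> L" for b unfolding D1_def by (rule bounded_on_C[OF u_continuous(2)])
  then obtain L1 where L1: "\<And>b. 0 \<le> L1 b" "\<And>b x. \<bar>D1 b x\<bar> \<le> L1 b" by metis
  have "\<exists>L\<ge>0. \<forall>x. \<bar>D2 (fst p) (snd p) x\<bar> \<le> L" for p unfolding D2_def by (rule bounded_on_C[OF u_continuous(3)])
  then obtain L2 where L2: "\<And>p. 0 \<le> L2 p" "\<And>p x. \<bar>D2 (fst p) (snd p) x\<bar> \<le> L2 p" by metis
  define L where "L = (\<Sum>b\<in>UNIV. L1 b) + (\<Sum>p\<in>UNIV. L2 p)"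
  have n: "0 \<le> (\<Sum>b\<in>UNIV. L1 b)" "0 \<le> (\<Sum>p\<in>UNIV. L2 p)" using L1 L2 by (auto intro: sum_nonneg)
  have a: "L1 b \<le> L" for b using member_le_sum[of b UNIV L1] L1 n by (auto simp: L_def)
  have b: "L2 p \<le> L" for p using member_le_sum[of p UNIV L2] L2 n by (auto simp: L_def)
  show thesis
  proof (rule that[of L])
    show "0 \<le> L" using n by (simp add: L_def)
    show "\<bar>D1 b x\<bar> \<le> L" for b x using L1(2)[of b x] a[of b] by linarith
    show "\<bar>D2 c d x\<bar> \<le> L" for c d x using L2(2)[of "(c, d)" x] b[of "(c, d)"] by simp
  qed
qed

lemma DN_measurable_F: "0 \<le> s \<Longrightarrow> (\<lambda>\<omega>. D1 b (N s \<omega>)) \<in> borel_measurable (F s)" "0 \<le> s \<Longrightarrow> (\<lambda>\<omega>. D2 a b (N s \<omega>)) \<in> borel_measurable (F s)"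
  by (rule measurable_compose[OF N_measurable D_measurable(1)] measurable_compose[OF N_measurable D_measurable(2)], assumption)+

lemma M_measurable:
  "0 \<le> s \<Longrightarrow> N s \<in> borel_measurable M" "0 \<le> s \<Longrightarrow> drift s \<in> borel_measurable M" "0 \<le> s \<Longrightarrow> mart s \<in> borel_measurable M"
  "0 \<le> s \<Longrightarrow> (\<lambda>\<omega>. D1 b (N s \<omega>)) \<in> borel_measurable M" "0 \<le> s \<Longrightarrow> (\<lambda>\<omega>. D2 a b (N s \<omega>)) \<in> borel_measurable M"
  by (rule F_measurable_M, assumption, rule N_measurable drift_measurable mart_measurable DN_measurable_F, assumption)+

definition cov :: "'c \<Rightarrow> 'c \<Rightarrow> real \<Rightarrow> real \<Rightarrow> 'a \<Rightarrow> real" where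
  "cov a b s t \<omega> = (\<integral>r. indicator {s<..min t (\<tau> \<omega>)} r * (\<beta> (y r \<omega>) $ a \<bullet> \<beta> (y r \<omega>) $ b) \<partial>lborel)"

text \<open>\<open>compensator\<close> is the drift of the second-order Taylor expansion of \<open>u\<close> over one time step, \<open>err\<close> its
  remainder; the martingale terms in between have mean zero.\<close>

definition compensator :: "real \<Rightarrow> real \<Rightarrow> 'a \<Rightarrow> real" where
  "compensator s t \<omega> = (\<Sum>b\<in>UNIV. D1 b (N s \<omega>) * (drift t \<omega> - drift s \<omega>) $ b)
     + 1/2 * (\<Sum>a\<in>UNIV. \<Sum>b\<in>UNIV. D2 a b (N s \<omega>) * cov a b s t \<omega>)"

definition err :: "real \<Rightarrow> real \<Rightarrow> 'a \<Rightarrow> real" where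
  "err s t \<omega> = u (N t \<omega>) - u (N s \<omega>) - (\<Sum>b\<in>UNIV. D1 b (N s \<omega>) * (N t \<omega> - N s \<omega>) $ b)
     - 1/2 * (\<Sum>a\<in>UNIV. \<Sum>b\<in>UNIV. D2 a b (N s \<omega>) * ((mart t \<omega> - mart s \<omega>) $ a * (mart t \<omega> - mart s \<omega>) $ b))"

lemma bb_continuous: "continuous_on UNIV (\<lambda>x. \<beta> x $ a \<bullet> \<beta> x $ b)"
  by (intro continuous_intros bc)

lemma y_clamp_measurable_M: "0 \<le> t \<Longrightarrow> (\<lambda>x. y (max 0 (min t (snd x))) (fst x)) \<in> borel_measurable (M \<Otimes>\<^sub>M lborel)"
  using progressive_clamp(2)[OF adapted_continuous_progressive[OF adapt paths], of t] by (simp add: case_prod_unfold)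

lemma cov_measurable:
  assumes s: "0 \<le> s" "s \<le> t" shows "cov a b s t \<in> borel_measurable M"
proof -
  have t: "0 \<le> t" using s by simp
  note [measurable] = \<tau>_measurable measurable_compose[OF y_clamp_measurable_M[OF t] borel_measurable_continuous_onI[OF bb_continuous]]
  have "(\<lambda>x. indicator {x. s < snd x \<and> snd x \<le> min t (\<tau> (fst x))} x * (\<beta> (y (max 0 (min t (snd x))) (fst x)) $ a \<bullet> \<beta> (y (max 0 (min t (snd x))) (fst x)) $ b))
    \<in> borel_measurable (M \<Otimes>\<^sub>M lborel)" by measurable
  then have "(\<lambda>\<omega>. \<integral>r. indicator {x. s < snd x \<and> snd x \<le> min t (\<tau> (fst x))} (\<omega>, r) * (\<beta> (y (max 0 (min t r)) \<omega>) $ a \<bullet> \<beta> (y (max 0 (min t r)) \<omega>) $ b) \<partial>lborel) \<in> borel_measurable M"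
    by (intro lborel.borel_measurable_lebesgue_integral) (simp add: case_prod_unfold)
  moreover have "cov a b s t \<omega> = (\<integral>r. indicator {x. s < snd x \<and> snd x \<le> min t (\<tau> (fst x))} (\<omega>, r) * (\<beta> (y (max 0 (min t r)) \<omega>) $ a \<bullet> \<beta> (y (max 0 (min t r)) \<omega>) $ b) \<partial>lborel)" for \<omega>
    unfolding cov_def by (intro Bochner_Integration.integral_cong refl) (use s in \<open>auto simp: indicator_def\<close>)
  ultimately show ?thesis by presburger
qed

lemma bb_integrable:
  assumes w: "\<omega> \<in> space M" and s: "0 \<le> s"
  shows "integrable lborel (\<lambda>r. indicator {s<..min t (\<tau> \<omega>)} r * (\<beta> (y r \<omega>) $ a \<bullet> \<beta> (y r \<omega>) $ b))"
proof -
  have "continuous_on {s..min t (\<tau> \<omega>)} (\<lambda>r. \<beta> (y r \<omega>) $ a \<bullet> \<beta> (y r \<omega>) $ b)"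
    by (rule continuous_on_compose2[OF bb_continuous continuous_on_subset[OF y_continuous[OF w]]]) (use s in auto)
  then have "set_integrable lborel {s..min t (\<tau> \<omega>)} (\<lambda>r. \<beta> (y r \<omega>) $ a \<bullet> \<beta> (y r \<omega>) $ b)" by (rule borel_integrable_atLeastAtMost')
  then have "set_integrable lborel {s<..min t (\<tau> \<omega>)} (\<lambda>r. \<beta> (y r \<omega>) $ a \<bullet> \<beta> (y r \<omega>) $ b)" by (rule set_integrable_subset) auto
  then show ?thesis by (simp add: set_integrable_def)
qed

lemma bb_bound:
  assumes x: "x \<in> C" shows "\<bar>\<beta> x $ a \<bullet> \<beta> x $ b\<bar> \<le> Cb * Cb"
proof -
  have n: "norm (\<beta> x $ a) \<le> Cb" for a
    using Finite_Cartesian_Product.norm_nth_le[of "\<beta> x" a] Cb(2)[OF x] by linarith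
  have "\<bar>\<beta> x $ a \<bullet> \<beta> x $ b\<bar> \<le> norm (\<beta> x $ a) * norm (\<beta> x $ b)" by (rule Cauchy_Schwarz_ineq2)
  also have "\<dots> \<le> Cb * Cb" by (intro mult_mono n Cb(1)) auto
  finally show ?thesis .
qed

lemma cov_bound:
  assumes w: "\<omega> \<in> space M" and s: "0 \<le> s" "s \<le> t"
  shows "\<bar>cov a b s t \<omega>\<bar> \<le> Cb * Cb * (t - s)"
proof -
  have "\<bar>cov a b s t \<omega>\<bar> \<le> (\<integral>r. \<bar>indicator {s<..min t (\<tau> \<omega>)} r * (\<beta> (y r \<omega>) $ a \<bullet> \<beta> (y r \<omega>) $ b)\<bar> \<partial>lborel)"
    unfolding cov_def by (rule integral_abs_bound)
  also have "\<dots> \<le> (\<integral>r. Cb * Cb * indicator {s<..t} r \<partial>lborel)"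
  proof (rule integral_mono)
    show "integrable lborel (\<lambda>r. \<bar>indicator {s<..min t (\<tau> \<omega>)} r * (\<beta> (y r \<omega>) $ a \<bullet> \<beta> (y r \<omega>) $ b)\<bar>)"
      by (intro integrable_abs bb_integrable w s)
    show "integrable lborel (\<lambda>r. Cb * Cb * indicator {s<..t} r)"
      using s by (intro integrable_mult_right) (auto simp: integrable_indicator_iff)
    show "\<bar>indicator {s<..min t (\<tau> \<omega>)} r * (\<beta> (y r \<omega>) $ a \<bullet> \<beta> (y r \<omega>) $ b)\<bar> \<le> Cb * Cb * indicator {s<..t} r" for r
      using Cb(1) bb_bound[of "y r \<omega>" a b] y_in_C[OF w, of r] s by (auto simp: indicator_def)
  qed
  also have "\<dots> = Cb * Cb * (t - s)" using s by simp
  finally show ?thesis .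
qed

lemma u_diff:
  assumes w: "\<omega> \<in> space M" "0 \<le> s" "0 \<le> t"
  shows "u (N t \<omega>) - u (N s \<omega>) = indicator C (N t \<omega>) *\<^sub>R u (N t \<omega>) - indicator C (N s \<omega>) *\<^sub>R u (N s \<omega>)"
  using N_in_C[OF w(1,2)] N_in_C[OF w(1,3)] N_stopped[OF w(1,2)] N_stopped[OF w(1,3)]
  by (cases "0 < \<tau> \<omega>") auto

lemma u_diff_integrable:
  assumes "0 \<le> s" "0 \<le> t"
  shows "integrable M (\<lambda>\<omega>. u (N t \<omega>) - u (N s \<omega>))"
proof -
  obtain L where L: "0 \<le> L" "\<And>x. \<bar>indicator C x *\<^sub>R u x\<bar> \<le> L" using bounded_on_C[OF u_continuous(1)] by blast
  have um: "(\<lambda>x. indicator C x *\<^sub>R u x) \<in> borel_measurable borel"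
    by (intro borel_measurable_continuous_on_indicator C_borel u_continuous)
  have i: "integrable M (\<lambda>\<omega>. indicator C (N r \<omega>) *\<^sub>R u (N r \<omega>))" if "0 \<le> r" for r
    by (rule integrable_const_bound[of _ L]) (use L measurable_compose[OF M_measurable(1)[OF that] um] in auto)
  have "integrable M (\<lambda>\<omega>. indicator C (N t \<omega>) *\<^sub>R u (N t \<omega>) - indicator C (N s \<omega>) *\<^sub>R u (N s \<omega>))"
    by (intro Bochner_Integration.integrable_diff i assms)
  then show ?thesis by (rule Bochner_Integration.integrable_cong[THEN iffD1, rotated -1]) (use u_diff assms in auto)
qed

lemma N_increment: "N t \<omega> - N s \<omega> = (mart t \<omega> - mart s \<omega>) + (drift t \<omega> - drift s \<omega>)"
  by (simp add: mart_def)

lemma component_bounds: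
  assumes w: "\<omega> \<in> space M" and s: "0 \<le> s" "s \<le> t" "t \<le> K"
  shows "\<bar>(mart t \<omega> - mart s \<omega>) $ b\<bar> \<le> 2 * (2 * R + Cf * K)" "\<bar>(drift t \<omega> - drift s \<omega>) $ b\<bar> \<le> Cf * (t - s)"
    "\<bar>(N t \<omega> - N s \<omega>) $ b\<bar> \<le> 2 * R"
proof -
  have "0 \<le> t" "s \<le> K" using s by auto
  then show "\<bar>(mart t \<omega> - mart s \<omega>) $ b\<bar> \<le> 2 * (2 * R + Cf * K)"
    using component_le_norm_cart[of "mart t \<omega> - mart s \<omega>" b] norm_triangle_ineq4[of "mart t \<omega>" "mart s \<omega>"]
      mart_bound[OF w s(1)] mart_bound[OF w _ s(3)] by fastforce
  show "\<bar>(drift t \<omega> - drift s \<omega>) $ b\<bar> \<le> Cf * (t - s)"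
    using component_le_norm_cart[of "drift t \<omega> - drift s \<omega>" b] drift_increment_bound[OF w s(1,2)] by linarith
  show "\<bar>(N t \<omega> - N s \<omega>) $ b\<bar> \<le> 2 * R"
    using component_le_norm_cart[of "N t \<omega> - N s \<omega>" b] N_diff_bound[OF w s(1) \<open>0 \<le> t\<close>] by linarith
qed

lemma increment_measurable:
  assumes "0 \<le> s" "0 \<le> t"
  shows "(\<lambda>\<omega>. (mart t \<omega> - mart s \<omega>) $ b) \<in> borel_measurable M" "(\<lambda>\<omega>. (drift t \<omega> - drift s \<omega>) $ b) \<in> borel_measurable M"
    "(\<lambda>\<omega>. (N t \<omega> - N s \<omega>) $ b) \<in> borel_measurable M"
  by (intro measurable_compose[OF _ borel_measurable_nth] borel_measurable_diff M_measurable assms)+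

lemma step_integrable:
  assumes s: "0 \<le> s" "s \<le> t" "t \<le> K"
  shows "integrable M (\<lambda>\<omega>. D1 b (N s \<omega>) * (mart t \<omega> - mart s \<omega>) $ b)" "integrable M (\<lambda>\<omega>. D1 b (N s \<omega>) * (drift t \<omega> - drift s \<omega>) $ b)"
    "integrable M (\<lambda>\<omega>. D1 b (N s \<omega>) * (N t \<omega> - N s \<omega>) $ b)"
    "integrable M (\<lambda>\<omega>. D2 a b (N s \<omega>) * ((mart t \<omega> - mart s \<omega>) $ a * (mart t \<omega> - mart s \<omega>) $ b))"
    "integrable M (\<lambda>\<omega>. D2 a b (N s \<omega>) * cov a b s t \<omega>)"
proof -
  have t: "0 \<le> t" using s by simp
  obtain L where L: "0 \<le> L" "\<And>b x. \<bar>D1 b x\<bar> \<le> L" "\<And>a b x. \<bar>D2 a b x\<bar> \<le> L" using D_bounds by blast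
  note m = increment_measurable[OF s(1) t] M_measurable(4,5)[OF s(1)]
  have p: "integrable M (\<lambda>\<omega>. h \<omega> * k \<omega>)" if "h \<in> borel_measurable M" "k \<in> borel_measurable M" "\<And>\<omega>. \<bar>h \<omega>\<bar> \<le> L" "\<And>\<omega>. \<omega> \<in> space M \<Longrightarrow> \<bar>k \<omega>\<bar> \<le> c"
    for h k :: "'a \<Rightarrow> real" and c
  proof (rule integrable_const_bound[of _ "L * c"])
    show "AE \<omega> in M. norm (h \<omega> * k \<omega>) \<le> L * c"
      unfolding real_norm_def abs_mult by (intro AE_I2 mult_mono that L) auto
  qed (use that in measurable)
  show "integrable M (\<lambda>\<omega>. D1 b (N s \<omega>) * (mart t \<omega> - mart s \<omega>) $ b)" by (rule p[OF m(4) m(1) L(2) component_bounds(1)[OF _ s]])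
  show "integrable M (\<lambda>\<omega>. D1 b (N s \<omega>) * (drift t \<omega> - drift s \<omega>) $ b)" by (rule p[OF m(4) m(2) L(2) component_bounds(2)[OF _ s]])
  show "integrable M (\<lambda>\<omega>. D1 b (N s \<omega>) * (N t \<omega> - N s \<omega>) $ b)" by (rule p[OF m(4) m(3) L(2) component_bounds(3)[OF _ s]])
  show "integrable M (\<lambda>\<omega>. D2 a b (N s \<omega>) * cov a b s t \<omega>)" by (rule p[OF m(5) cov_measurable[OF s(1,2)] L(3) cov_bound[OF _ s(1,2)]])
  show "integrable M (\<lambda>\<omega>. D2 a b (N s \<omega>) * ((mart t \<omega> - mart s \<omega>) $ a * (mart t \<omega> - mart s \<omega>) $ b))"
  proof (rule p[OF m(5) borel_measurable_times[OF m(1) m(1)] L(3)])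
    fix \<omega> assume w: "\<omega> \<in> space M"
    let ?c = "2 * (2 * R + Cf * K)"
    have "0 \<le> ?c" using R Cf K by simp
    then show "\<bar>(mart t \<omega> - mart s \<omega>) $ a * (mart t \<omega> - mart s \<omega>) $ b\<bar> \<le> ?c * ?c"
      unfolding abs_mult by (intro mult_mono component_bounds(1)[OF w s]) auto
  qed
qed

lemma compensator_integrable:
  assumes s: "0 \<le> s" "s \<le> t" "t \<le> K" shows "integrable M (compensator s t)"
  unfolding compensator_def[abs_def]
  by (intro Bochner_Integration.integrable_add integrable_mult_right Bochner_Integration.integrable_sum step_integrable s)

lemma err_integrable:
  assumes s: "0 \<le> s" "s \<le> t" "t \<le> K" shows "integrable M (err s t)"
  unfolding err_def[abs_def]
proof (rule Bochner_Integration.integrable_diff, rule Bochner_Integration.integrable_diff)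
  show "integrable M (\<lambda>\<omega>. u (N t \<omega>) - u (N s \<omega>))" by (rule u_diff_integrable) (use s in auto)
qed (intro integrable_mult_right Bochner_Integration.integrable_sum step_integrable s)+

lemma step_expectation:
  assumes s: "0 \<le> s" "s < t" "t \<le> K"
  shows "expectation (\<lambda>\<omega>. u (N t \<omega>) - u (N s \<omega>)) = expectation (compensator s t) + expectation (err s t)"
proof -
  have s': "0 \<le> s" "s \<le> t" "t \<le> K" and t: "0 \<le> t" using s by auto
  obtain L where L: "0 \<le> L" "\<And>b x. \<bar>D1 b x\<bar> \<le> L" "\<And>a b x. \<bar>D2 a b x\<bar> \<le> L" using D_bounds by blast
  let ?A = "\<lambda>b \<omega>. D1 b (N s \<omega>) * (mart t \<omega> - mart s \<omega>) $ b"
  let ?B = "\<lambda>a b \<omega>. D2 a b (N s \<omega>) * ((mart t \<omega> - mart s \<omega>) $ a * (mart t \<omega> - mart s \<omega>) $ b)"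
  let ?V = "\<lambda>a b \<omega>. D2 a b (N s \<omega>) * cov a b s t \<omega>"
  have A0: "expectation (?A b) = 0" for b
    by (rule mart_mean[OF s(1,2) DN_measurable_F(1)[OF s(1)] L(2)])
  have BV: "expectation (?B a b) = expectation (?V a b)" for a b
  proof -
    have "expectation (?B a b) = expectation (\<lambda>\<omega>. \<integral>r. indicator {s<..min t (\<tau> \<omega>)} r * (D2 a b (N s \<omega>) * (\<beta> (y r \<omega>) $ a \<bullet> \<beta> (y r \<omega>) $ b)) \<partial>lborel)"
      by (rule mart_covariance[OF s(1,2) DN_measurable_F(2)[OF s(1)] L(3)])
    also have "\<dots> = expectation (?V a b)"
      unfolding cov_def by (simp only: mult.left_commute[of "indicator _ _"] integral_mult_right_zero)
    finally show ?thesis .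
  qed
  have eq: "u (N t \<omega>) - u (N s \<omega>) = compensator s t \<omega> + err s t \<omega> + (\<Sum>b\<in>UNIV. ?A b \<omega>)
      + 1/2 * (\<Sum>a\<in>UNIV. \<Sum>b\<in>UNIV. ?B a b \<omega> - ?V a b \<omega>)" for \<omega>
    unfolding err_def compensator_def N_increment[of t \<omega> s]
    by (simp only: vector_add_component distrib_left sum.distrib sum_subtractf right_diff_distrib)
  have iA: "integrable M (\<lambda>\<omega>. \<Sum>b\<in>UNIV. ?A b \<omega>)"
    by (intro Bochner_Integration.integrable_sum step_integrable s')
  have iB: "integrable M (\<lambda>\<omega>. \<Sum>b\<in>UNIV. ?B a b \<omega> - ?V a b \<omega>)" for a
    by (intro Bochner_Integration.integrable_sum Bochner_Integration.integrable_diff step_integrable s')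
  have iBB: "integrable M (\<lambda>\<omega>. \<Sum>a\<in>UNIV. \<Sum>b\<in>UNIV. ?B a b \<omega> - ?V a b \<omega>)"
    by (intro Bochner_Integration.integrable_sum iB)
  have EA: "expectation (\<lambda>\<omega>. \<Sum>b\<in>UNIV. ?A b \<omega>) = 0"
  proof -
    have "expectation (\<lambda>\<omega>. \<Sum>b\<in>UNIV. ?A b \<omega>) = (\<Sum>b\<in>UNIV. expectation (?A b))"
      by (intro Bochner_Integration.integral_sum step_integrable s')
    then show ?thesis by (simp only: A0) simp
  qed
  have EB: "expectation (\<lambda>\<omega>. \<Sum>a\<in>UNIV. \<Sum>b\<in>UNIV. ?B a b \<omega> - ?V a b \<omega>) = 0"
  proof -
    have 1: "expectation (\<lambda>\<omega>. ?B a b \<omega> - ?V a b \<omega>) = 0" for a b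
      using Bochner_Integration.integral_diff[OF step_integrable(4)[OF s', of a b] step_integrable(5)[OF s', of a b]] BV[of a b] by simp
    have 2: "expectation (\<lambda>\<omega>. \<Sum>b\<in>UNIV. ?B a b \<omega> - ?V a b \<omega>) = (\<Sum>b\<in>UNIV. expectation (\<lambda>\<omega>. ?B a b \<omega> - ?V a b \<omega>))" for a
      by (intro Bochner_Integration.integral_sum Bochner_Integration.integrable_diff step_integrable s')
    have "expectation (\<lambda>\<omega>. \<Sum>a\<in>UNIV. \<Sum>b\<in>UNIV. ?B a b \<omega> - ?V a b \<omega>) = (\<Sum>a\<in>UNIV. expectation (\<lambda>\<omega>. \<Sum>b\<in>UNIV. ?B a b \<omega> - ?V a b \<omega>))"
      by (intro Bochner_Integration.integral_sum iB)
    then show ?thesis by (simp only: 2 1) simp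
  qed
  have "expectation (\<lambda>\<omega>. u (N t \<omega>) - u (N s \<omega>)) = expectation (\<lambda>\<omega>. compensator s t \<omega> + err s t \<omega> + (\<Sum>b\<in>UNIV. ?A b \<omega>)
      + 1/2 * (\<Sum>a\<in>UNIV. \<Sum>b\<in>UNIV. ?B a b \<omega> - ?V a b \<omega>))" by (simp only: eq)
  also have "\<dots> = expectation (\<lambda>\<omega>. compensator s t \<omega> + err s t \<omega> + (\<Sum>b\<in>UNIV. ?A b \<omega>))
     + expectation (\<lambda>\<omega>. 1/2 * (\<Sum>a\<in>UNIV. \<Sum>b\<in>UNIV. ?B a b \<omega> - ?V a b \<omega>))"
    by (intro Bochner_Integration.integral_add Bochner_Integration.integrable_add integrable_mult_right
        compensator_integrable err_integrable s' iA iBB)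
  also have "expectation (\<lambda>\<omega>. 1/2 * (\<Sum>a\<in>UNIV. \<Sum>b\<in>UNIV. ?B a b \<omega> - ?V a b \<omega>)) = 0"
    by (simp only: integral_mult_right_zero EB)
  also have "expectation (\<lambda>\<omega>. compensator s t \<omega> + err s t \<omega> + (\<Sum>b\<in>UNIV. ?A b \<omega>)) = expectation (\<lambda>\<omega>. compensator s t \<omega> + err s t \<omega>) + expectation (\<lambda>\<omega>. \<Sum>b\<in>UNIV. ?A b \<omega>)"
    by (intro Bochner_Integration.integral_add Bochner_Integration.integrable_add compensator_integrable err_integrable s' iA)
  also have "expectation (\<lambda>\<omega>. compensator s t \<omega> + err s t \<omega>) = expectation (compensator s t) + expectation (err s t)"
    by (intro Bochner_Integration.integral_add compensator_integrable err_integrable s')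
  finally show ?thesis by (simp only: EA)
qed

end

context stopped_diffusion_C2 begin

lemma err_bound:
  assumes e: "\<epsilon> > 0" and LD: "0 \<le> LD" "\<And>b x. \<bar>D1 b x\<bar> \<le> LD" "\<And>a b x. \<bar>D2 a b x\<bar> \<le> LD"
  defines "c \<equiv> real CARD('c) * real CARD('c) * LD * Cf"
  obtains L \<delta> where "0 \<le> L" "0 < \<delta>" "\<And>\<omega> s t. \<omega> \<in> space M \<Longrightarrow> 0 \<le> s \<Longrightarrow> s \<le> t \<Longrightarrow>
     \<bar>err s t \<omega>\<bar> \<le> (\<epsilon> + L * (if norm (N t \<omega> - N s \<omega>) > \<delta> then 1 else 0)) * (norm (N t \<omega> - N s \<omega>))\<^sup>2
       + c * (t - s) * (2 * norm (N t \<omega> - N s \<omega>) + Cf * (t - s))"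
proof -
  obtain L \<delta> where L: "L \<ge> 0" "\<delta> > 0" "\<And>x z. x \<in> C \<Longrightarrow> z \<in> C \<Longrightarrow>
     \<bar>quadratic_remainder u x z\<bar> \<le> (\<epsilon> + L * (if norm (z - x) > \<delta> then 1 else 0)) * (norm (z - x))\<^sup>2"
    using quadratic_remainder_bound[OF Q C CQ u e] by blast
  show thesis
  proof (rule that[of L \<delta>])
    fix \<omega> s t assume w: "\<omega> \<in> space M" and s: "0 \<le> (s::real)" "s \<le> t"
    have t: "0 \<le> t" using s by simp
    let ?n = "norm (N t \<omega> - N s \<omega>)" and ?h = "t - s"
    have rhs2: "0 \<le> c * ?h * (2 * ?n + Cf * ?h)" using LD Cf s by (simp add: c_def)
    show "\<bar>err s t \<omega>\<bar> \<le> (\<epsilon> + L * (if ?n > \<delta> then 1 else 0)) * ?n\<^sup>2 + c * ?h * (2 * ?n + Cf * ?h)"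
    proof (cases "0 < \<tau> \<omega>")
      case True
      note NC = N_in_C[OF w s(1) True] N_in_C[OF w t True]
      let ?D = "\<lambda>a b. (N t \<omega> - N s \<omega>) $ a * (N t \<omega> - N s \<omega>) $ b - (mart t \<omega> - mart s \<omega>) $ a * (mart t \<omega> - mart s \<omega>) $ b"
      have e: "err s t \<omega> = quadratic_remainder u (N s \<omega>) (N t \<omega>) + 1/2 * (\<Sum>a\<in>UNIV. \<Sum>b\<in>UNIV. D2 a b (N s \<omega>) * ?D a b)"
        using NC by (simp add: err_def quadratic_remainder_def D1_def D2_def right_diff_distrib sum_subtractf)
      have D: "\<bar>?D a b\<bar> \<le> Cf * ?h * (2 * ?n + Cf * ?h)" for a b
      proof -
        define na nb fa fb where "na = (N t \<omega> - N s \<omega>) $ a" and "nb = (N t \<omega> - N s \<omega>) $ b"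
          and "fa = (drift t \<omega> - drift s \<omega>) $ a" and "fb = (drift t \<omega> - drift s \<omega>) $ b"
        have m: "(mart t \<omega> - mart s \<omega>) $ a = na - fa" "(mart t \<omega> - mart s \<omega>) $ b = nb - fb"
          unfolding na_def nb_def fa_def fb_def N_increment[of t \<omega> s] by (simp_all only: vector_add_component add_diff_cancel_right')
        have b: "\<bar>na\<bar> \<le> ?n" "\<bar>nb\<bar> \<le> ?n" "\<bar>fa\<bar> \<le> Cf * ?h" "\<bar>fb\<bar> \<le> Cf * ?h"
          unfolding na_def nb_def fa_def fb_def
          using component_le_norm_cart order_trans[OF component_le_norm_cart drift_increment_bound[OF w s]] by blast+
        have "?D a b = na * fb + fa * nb - fa * fb" unfolding m na_def[symmetric] nb_def[symmetric] by (simp add: algebra_simps)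
        then have "\<bar>?D a b\<bar> \<le> \<bar>na\<bar> * \<bar>fb\<bar> + \<bar>fa\<bar> * \<bar>nb\<bar> + \<bar>fa\<bar> * \<bar>fb\<bar>" unfolding abs_mult[symmetric] by linarith
        also have "\<dots> \<le> ?n * (Cf * ?h) + (Cf * ?h) * ?n + (Cf * ?h) * (Cf * ?h)"
          using b Cf s by (intro add_mono mult_mono) auto
        finally show ?thesis by (simp add: algebra_simps)
      qed
      have "\<bar>\<Sum>a\<in>UNIV. \<Sum>b\<in>UNIV. D2 a b (N s \<omega>) * ?D a b\<bar> \<le> (\<Sum>a\<in>(UNIV::'c set). \<Sum>b\<in>(UNIV::'c set). LD * (Cf * ?h * (2 * ?n + Cf * ?h)))"
        by (intro order_trans[OF sum_abs] sum_mono order_trans[OF sum_abs]) (unfold abs_mult, intro mult_mono LD D, auto)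
      also have "\<dots> = c * ?h * (2 * ?n + Cf * ?h)" by (simp add: c_def)
      finally have "\<bar>1/2 * (\<Sum>a\<in>UNIV. \<Sum>b\<in>UNIV. D2 a b (N s \<omega>) * ?D a b)\<bar> \<le> c * ?h * (2 * ?n + Cf * ?h)"
        using rhs2 by simp
      then show ?thesis unfolding e using L(3)[OF NC] by linarith
    next
      case False
      have n0: "N t \<omega> = N s \<omega>" using N_stopped[OF w s(1) False] N_stopped[OF w t False] by simp
      have "min t (\<tau> \<omega>) = min s (\<tau> \<omega>)" using \<tau>[OF w] False s t by auto
      then have m0: "mart t \<omega> = mart s \<omega>" using n0 by (simp add: mart_def drift_def)
      have "err s t \<omega> = 0" unfolding err_def n0 m0 by simp
      then show ?thesis using rhs2 n0 by simp
    qed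
  qed (use L in auto)
qed

definition tgrid :: "nat \<Rightarrow> nat \<Rightarrow> real" where "tgrid n j = real j * (K / real n)"

lemma tgrid_props:
  assumes "n > 0"
  shows "0 \<le> tgrid n j" "tgrid n j < tgrid n (Suc j)" "j \<le> n \<Longrightarrow> tgrid n j \<le> K" "tgrid n 0 = 0" "tgrid n n = K"
    "tgrid n (Suc j) - tgrid n j = K / real n"
proof -
  have h: "0 < K / real n" using K assms by simp
  show "0 \<le> tgrid n j" using K by (simp add: tgrid_def)
  show d: "tgrid n (Suc j) - tgrid n j = K / real n" by (simp add: tgrid_def distrib_right add_divide_distrib)
  then show "tgrid n j < tgrid n (Suc j)" using h by linarith
  show nn: "tgrid n n = K" using assms by (simp add: tgrid_def)
  show "tgrid n j \<le> K" if "j \<le> n"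
  proof -
    have "tgrid n j \<le> tgrid n n" unfolding tgrid_def using that h by (intro mult_right_mono) auto
    then show ?thesis using nn by simp
  qed
  show "tgrid n 0 = 0" by (simp add: tgrid_def)
qed

lemma mart_mean_sum:
  assumes s: "0 \<le> s" "s < t" "t \<le> K" and g: "\<And>a. g a \<in> borel_measurable (F s)" "\<And>a \<omega>. \<omega> \<in> space M \<Longrightarrow> \<bar>g a \<omega>\<bar> \<le> G"
  shows "expectation (\<lambda>\<omega>. \<Sum>a\<in>UNIV. g a \<omega> * (mart t \<omega> - mart s \<omega>) $ a) = 0"
proof -
  have i: "integrable M (\<lambda>\<omega>. g a \<omega> * (mart t \<omega> - mart s \<omega>) $ a)" for a
  proof (rule integrable_const_bound[of _ "G * (2 * (2 * R + Cf * K))"])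
    show "AE \<omega> in M. norm (g a \<omega> * (mart t \<omega> - mart s \<omega>) $ a) \<le> G * (2 * (2 * R + Cf * K))"
    proof (rule AE_I2)
      fix \<omega> assume w: "\<omega> \<in> space M"
      have "0 \<le> G" using g(2)[OF w] abs_ge_zero order_trans by blast
      then show "norm (g a \<omega> * (mart t \<omega> - mart s \<omega>) $ a) \<le> G * (2 * (2 * R + Cf * K))"
        unfolding real_norm_def abs_mult using s by (intro mult_mono g(2)[OF w] component_bounds(1)[OF w]) auto
    qed
    show "(\<lambda>\<omega>. g a \<omega> * (mart t \<omega> - mart s \<omega>) $ a) \<in> borel_measurable M"
      by (intro borel_measurable_times F_measurable_M[OF s(1) g(1)] increment_measurable) (use s in auto)
  qed
  have "expectation (\<lambda>\<omega>. \<Sum>a\<in>UNIV. g a \<omega> * (mart t \<omega> - mart s \<omega>) $ a) = (\<Sum>a\<in>UNIV. expectation (\<lambda>\<omega>. g a \<omega> * (mart t \<omega> - mart s \<omega>) $ a))"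
    by (intro Bochner_Integration.integral_sum i)
  also have "\<dots> = 0" using mart_mean[OF s(1,2) g(1) g(2)] by (intro sum.neutral ballI) blast
  finally show ?thesis .
qed

lemma mart_quadratic_variation:
  assumes n: "n > 0"
  shows "expectation (\<lambda>\<omega>. (\<Sum>j<n. (norm (mart (tgrid n (Suc j)) \<omega> - mart (tgrid n j) \<omega>))\<^sup>2)\<^sup>2) \<le> 10 * (2 * R + Cf * K) ^ 4"
proof -
  let ?B = "2 * R + Cf * K"
  note tg = tgrid_props[OF n]
  have mg: "(\<lambda>\<omega>. mart (tgrid n j) \<omega> $ a) \<in> borel_measurable (F (tgrid n j))" for j a
    by (rule measurable_compose[OF mart_measurable[OF tg(1)] borel_measurable_nth])
  have mb: "\<bar>mart (tgrid n j) \<omega> $ a\<bar> \<le> ?B" if "\<omega> \<in> space M" "j \<le> n" for \<omega> j a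
    using component_le_norm_cart[of "mart (tgrid n j) \<omega>" a] mart_bound[OF that(1) tg(1) tg(3)[OF that(2)]] by linarith
  have B0: "0 \<le> ?B" using R Cf K by simp
  show ?thesis
  proof (rule quadratic_variation_bound)
    show "mart (tgrid n j) \<in> borel_measurable M" for j by (rule M_measurable(3)[OF tg(1)])
    show "norm (mart (tgrid n j) \<omega>) \<le> ?B" if "j \<le> n" "\<omega> \<in> space M" for j \<omega>
      by (rule mart_bound[OF that(2) tg(1) tg(3)[OF that(1)]])
    show "mart (tgrid n 0) \<omega> = 0" for \<omega> by (simp add: tg(4) mart_def drift_0)
    show "expectation (\<lambda>\<omega>. mart (tgrid n j) \<omega> \<bullet> (mart (tgrid n (Suc j)) \<omega> - mart (tgrid n j) \<omega>)) = 0" if "j < n" for j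
      unfolding inner_vec_def inner_real_def
      by (rule mart_mean_sum[OF tg(1) tg(2) tg(3)[OF Suc_leI[OF that]] mg mb]) (use that in auto)
    show "expectation (\<lambda>\<omega>. (mart (tgrid n j) \<omega> \<bullet> (mart (tgrid n (Suc j)) \<omega> - mart (tgrid n j) \<omega>)) *
        (mart (tgrid n k) \<omega> \<bullet> (mart (tgrid n (Suc k)) \<omega> - mart (tgrid n k) \<omega>))) = 0" if jk: "j < k" "k < n" for j k
    proof -
      let ?c = "\<lambda>\<omega>. mart (tgrid n j) \<omega> \<bullet> (mart (tgrid n (Suc j)) \<omega> - mart (tgrid n j) \<omega>)"
      have le: "tgrid n j \<le> tgrid n k" "tgrid n (Suc j) \<le> tgrid n k"
        unfolding tgrid_def by (rule mult_right_mono; use jk K in simp)+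
      have m: "mart (tgrid n j) \<in> borel_measurable (F (tgrid n k))" "mart (tgrid n (Suc j)) \<in> borel_measurable (F (tgrid n k))"
        by (rule F_measurable_mono[OF tg(1) le(1) mart_measurable[OF tg(1)]], rule F_measurable_mono[OF tg(1) le(2) mart_measurable[OF tg(1)]])
      have cm: "?c \<in> borel_measurable (F (tgrid n k))" by (intro borel_measurable_inner borel_measurable_diff m)
      have cb: "\<bar>?c \<omega>\<bar> \<le> ?B * (2 * ?B)" if w: "\<omega> \<in> space M" for \<omega>
      proof -
        have "\<bar>?c \<omega>\<bar> \<le> norm (mart (tgrid n j) \<omega>) * norm (mart (tgrid n (Suc j)) \<omega> - mart (tgrid n j) \<omega>)" by (rule Cauchy_Schwarz_ineq2)
        also have "\<dots> \<le> ?B * (2 * ?B)"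
          using norm_triangle_ineq4[of "mart (tgrid n (Suc j)) \<omega>" "mart (tgrid n j) \<omega>"] jk
            mart_bound[OF w tg(1) tg(3), of j] mart_bound[OF w tg(1) tg(3), of "Suc j"] B0
          by (intro mult_mono) auto
        finally show ?thesis .
      qed
      have "expectation (\<lambda>\<omega>. \<Sum>a\<in>UNIV. (?c \<omega> * mart (tgrid n k) \<omega> $ a) * (mart (tgrid n (Suc k)) \<omega> - mart (tgrid n k) \<omega>) $ a) = 0"
      proof (rule mart_mean_sum[OF tg(1) tg(2) tg(3)[OF Suc_leI[OF jk(2)]]])
        show "(\<lambda>\<omega>. ?c \<omega> * mart (tgrid n k) \<omega> $ a) \<in> borel_measurable (F (tgrid n k))" for a
          by (intro borel_measurable_times cm mg)
        show "\<bar>?c \<omega> * mart (tgrid n k) \<omega> $ a\<bar> \<le> (?B * (2 * ?B)) * ?B" if "\<omega> \<in> space M" for a \<omega>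
          unfolding abs_mult[of "?c \<omega>"] using jk B0 by (intro mult_mono cb mb that) auto
      qed
      moreover have "(\<lambda>\<omega>. ?c \<omega> * (mart (tgrid n k) \<omega> \<bullet> (mart (tgrid n (Suc k)) \<omega> - mart (tgrid n k) \<omega>)))
         = (\<lambda>\<omega>. \<Sum>a\<in>UNIV. (?c \<omega> * mart (tgrid n k) \<omega> $ a) * (mart (tgrid n (Suc k)) \<omega> - mart (tgrid n k) \<omega>) $ a)"
        by (subst (2) inner_vec_def) (simp add: sum_distrib_left mult.assoc)
      ultimately show ?thesis by simp
    qed
  qed
qed

definition qv :: "nat \<Rightarrow> 'a \<Rightarrow> real" where
  "qv n \<omega> = (\<Sum>j<n. (norm (N (tgrid n (Suc j)) \<omega> - N (tgrid n j) \<omega>))\<^sup>2)"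

definition qv_bound :: real where "qv_bound = 80 * (2 * R + Cf * K) ^ 4 + 8 * (Cf * K) ^ 4"

lemma qv_measurable: "n > 0 \<Longrightarrow> qv n \<in> borel_measurable M"
  unfolding qv_def[abs_def]
  by (intro borel_measurable_sum borel_measurable_power measurable_compose[OF _ borel_measurable_norm] borel_measurable_diff
      M_measurable(1) tgrid_props(1))

lemma qv_nonneg: "0 \<le> qv n \<omega>" unfolding qv_def by (intro sum_nonneg) auto

lemma qv_le:
  assumes n: "n > 0" and w: "\<omega> \<in> space M" shows "qv n \<omega> \<le> real n * (2 * R)\<^sup>2"
proof -
  have "qv n \<omega> \<le> (\<Sum>j<n. (2 * R)\<^sup>2)"
    unfolding qv_def by (intro sum_mono power_mono N_diff_bound w tgrid_props(1) n) auto
  then show ?thesis by simp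
qed

lemma qv_integrable:
  assumes n: "n > 0" shows "integrable M (qv n)" "integrable M (\<lambda>\<omega>. (qv n \<omega>)\<^sup>2)"
proof -
  show "integrable M (qv n)"
    by (rule integrable_const_bound[of _ "real n * (2 * R)\<^sup>2"]) (use qv_le[OF n] qv_nonneg qv_measurable[OF n] in auto)
  show "integrable M (\<lambda>\<omega>. (qv n \<omega>)\<^sup>2)"
  proof (rule integrable_const_bound[of _ "(real n * (2 * R)\<^sup>2)\<^sup>2"])
    show "AE \<omega> in M. norm ((qv n \<omega>)\<^sup>2) \<le> (real n * (2 * R)\<^sup>2)\<^sup>2"
      unfolding real_norm_def abs_power2 by (intro AE_I2 power_mono qv_le n qv_nonneg)
  qed (use qv_measurable[OF n] in measurable)
qed

lemma qv_second_moment: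
  assumes n: "n > 0" shows "expectation (\<lambda>\<omega>. (qv n \<omega>)\<^sup>2) \<le> qv_bound"
proof -
  note tg = tgrid_props[OF n]
  define q where "q = (\<lambda>\<omega>. \<Sum>j<n. (norm (mart (tgrid n (Suc j)) \<omega> - mart (tgrid n j) \<omega>))\<^sup>2)"
  let ?c = "Cf * K"
  have q0: "0 \<le> q \<omega>" for \<omega> unfolding q_def by (intro sum_nonneg) auto
  have c0: "0 \<le> ?c" using Cf K by simp
  have qm: "q \<in> borel_measurable M"
    unfolding q_def by (intro borel_measurable_sum borel_measurable_power measurable_compose[OF _ borel_measurable_norm] borel_measurable_diff
      M_measurable(3) tg(1))
  have qb: "q \<omega> \<le> real n * (2 * (2 * R + Cf * K))\<^sup>2" if w: "\<omega> \<in> space M" for \<omega>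
  proof -
    have "q \<omega> \<le> (\<Sum>j<n. (2 * (2 * R + Cf * K))\<^sup>2)"
      unfolding q_def
    proof (intro sum_mono power_mono)
      fix j assume "j \<in> {..<n}"
      then show "norm (mart (tgrid n (Suc j)) \<omega> - mart (tgrid n j) \<omega>) \<le> 2 * (2 * R + Cf * K)"
        using norm_triangle_ineq4[of "mart (tgrid n (Suc j)) \<omega>" "mart (tgrid n j) \<omega>"]
          mart_bound[OF w tg(1) tg(3), of j] mart_bound[OF w tg(1) tg(3), of "Suc j"] by auto
    qed auto
    then show ?thesis by simp
  qed
  have iq: "integrable M (\<lambda>\<omega>. (q \<omega>)\<^sup>2)"
  proof (rule integrable_const_bound[of _ "(real n * (2 * (2 * R + Cf * K))\<^sup>2)\<^sup>2"])
    show "AE \<omega> in M. norm ((q \<omega>)\<^sup>2) \<le> (real n * (2 * (2 * R + Cf * K))\<^sup>2)\<^sup>2"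
      unfolding real_norm_def abs_power2 by (intro AE_I2 power_mono qb q0)
  qed (use qm in measurable)
  have le: "qv n \<omega> \<le> 2 * q \<omega> + 2 * ?c\<^sup>2" if w: "\<omega> \<in> space M" for \<omega>
  proof -
    have "(norm (N (tgrid n (Suc j)) \<omega> - N (tgrid n j) \<omega>))\<^sup>2 \<le>
       2 * (norm (mart (tgrid n (Suc j)) \<omega> - mart (tgrid n j) \<omega>))\<^sup>2 + 2 * (Cf * (K / n))\<^sup>2" for j
    proof -
      let ?m = "norm (mart (tgrid n (Suc j)) \<omega> - mart (tgrid n j) \<omega>)"
      have "norm (drift (tgrid n (Suc j)) \<omega> - drift (tgrid n j) \<omega>) \<le> Cf * (K / n)"
        using drift_increment_bound[OF w tg(1) less_imp_le[OF tg(2)]] unfolding tg(6) .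
      then have "norm (N (tgrid n (Suc j)) \<omega> - N (tgrid n j) \<omega>) \<le> ?m + Cf * (K / n)"
        unfolding N_increment[of "tgrid n (Suc j)" \<omega> "tgrid n j"] by (intro norm_triangle_le) simp
      then have "(norm (N (tgrid n (Suc j)) \<omega> - N (tgrid n j) \<omega>))\<^sup>2 \<le> (?m + Cf * (K / n))\<^sup>2" by (intro power_mono) auto
      also have "\<dots> \<le> 2 * ?m\<^sup>2 + 2 * (Cf * (K / n))\<^sup>2"
        using sum_squares_bound[of ?m "Cf * (K / n)"] by (simp add: power2_sum)
      finally show ?thesis .
    qed
    then have "qv n \<omega> \<le> (\<Sum>j<n. 2 * (norm (mart (tgrid n (Suc j)) \<omega> - mart (tgrid n j) \<omega>))\<^sup>2 + 2 * (Cf * (K / n))\<^sup>2)"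
      unfolding qv_def by (intro sum_mono)
    also have "\<dots> = 2 * q \<omega> + 2 * (real n * (Cf * (K / n))\<^sup>2)"
      by (simp add: q_def sum.distrib sum_distrib_left)
    also have "real n * (Cf * (K / n))\<^sup>2 = ?c\<^sup>2 / real n" using n by (simp add: power2_eq_square field_simps)
    also have "?c\<^sup>2 / real n \<le> ?c\<^sup>2 / 1" using n by (intro divide_left_mono) auto
    finally show ?thesis by simp
  qed
  have "expectation (\<lambda>\<omega>. (qv n \<omega>)\<^sup>2) \<le> expectation (\<lambda>\<omega>. 8 * (q \<omega>)\<^sup>2 + 8 * ?c ^ 4)"
  proof (rule integral_mono[OF qv_integrable(2)[OF n]])
    fix \<omega> assume w: "\<omega> \<in> space M"
    have "(qv n \<omega>)\<^sup>2 \<le> (2 * q \<omega> + 2 * ?c\<^sup>2)\<^sup>2" by (intro power_mono le w qv_nonneg)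
    also have "\<dots> \<le> 2 * (2 * q \<omega>)\<^sup>2 + 2 * (2 * ?c\<^sup>2)\<^sup>2"
      using sum_squares_bound[of "2 * q \<omega>" "2 * ?c\<^sup>2"] unfolding power2_sum by linarith
    also have "\<dots> = 8 * (q \<omega>)\<^sup>2 + 8 * ?c ^ 4" by (simp add: power2_eq_square power4_eq_xxxx)
    finally show "(qv n \<omega>)\<^sup>2 \<le> 8 * (q \<omega>)\<^sup>2 + 8 * ?c ^ 4" .
  qed (use iq in auto)
  also have "\<dots> = 8 * expectation (\<lambda>\<omega>. (q \<omega>)\<^sup>2) + 8 * ?c ^ 4" using iq by (simp add: prob_space)
  also have "\<dots> \<le> qv_bound"
  proof -
    have "expectation (\<lambda>\<omega>. (q \<omega>)\<^sup>2) \<le> 10 * (2 * R + Cf * K) ^ 4"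
      using mart_quadratic_variation[OF n] by (simp only: q_def)
    then show ?thesis by (simp add: qv_bound_def)
  qed
  finally show ?thesis .
qed

lemma N_continuous:
  assumes w: "\<omega> \<in> space M" shows "continuous_on {0..} (\<lambda>r. N r \<omega>)"
  unfolding N_def
  by (rule continuous_on_compose2[OF y_continuous[OF w]]) (use \<tau>[OF w] in \<open>auto intro!: continuous_intros\<close>)

definition jumpy :: "nat \<Rightarrow> real \<Rightarrow> 'a set" where
  "jumpy n \<delta> = {\<omega>\<in>space M. \<exists>j<n. norm (N (tgrid n (Suc j)) \<omega> - N (tgrid n j) \<omega>) > \<delta>}"

lemma jumpy_measurable: assumes n: "n > 0" shows "jumpy n \<delta> \<in> sets M"
proof -
  have "{\<omega>\<in>space M. norm (N (tgrid n (Suc j)) \<omega> - N (tgrid n j) \<omega>) > \<delta>} \<in> sets M" for j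
    using M_measurable(1)[OF tgrid_props(1)[OF n]] by (intro borel_measurable_less) auto
  then have "(\<Union>j<n. {\<omega>\<in>space M. norm (N (tgrid n (Suc j)) \<omega> - N (tgrid n j) \<omega>) > \<delta>}) \<in> sets M" by auto
  moreover have "jumpy n \<delta> = (\<Union>j<n. {\<omega>\<in>space M. norm (N (tgrid n (Suc j)) \<omega> - N (tgrid n j) \<omega>) > \<delta>})"
    by (auto simp: jumpy_def)
  ultimately show ?thesis by simp
qed

lemma jumpy_tendsto:
  assumes d: "\<delta> > 0" shows "(\<lambda>n. prob (jumpy (Suc n) \<delta>)) \<longlonglongrightarrow> 0"
proof -
  have "(\<lambda>n. expectation (indicator (jumpy (Suc n) \<delta>) :: 'a \<Rightarrow> real)) \<longlonglongrightarrow> expectation (\<lambda>\<omega>. 0)"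
  proof (rule integral_dominated_convergence[where w="\<lambda>_. 1"])
    show "AE \<omega> in M. (\<lambda>n. indicator (jumpy (Suc n) \<delta>) \<omega> :: real) \<longlonglongrightarrow> 0"
    proof (rule AE_I2)
      fix \<omega> assume w: "\<omega> \<in> space M"
      have "uniformly_continuous_on {0..K} (\<lambda>r. N r \<omega>)"
        by (rule compact_uniformly_continuous[OF continuous_on_subset[OF N_continuous[OF w]]]) auto
      then obtain \<eta> where e: "\<eta> > 0" "\<And>s t. s \<in> {0..K} \<Longrightarrow> t \<in> {0..K} \<Longrightarrow> dist t s < \<eta> \<Longrightarrow> dist (N t \<omega>) (N s \<omega>) < \<delta>"
        using d unfolding uniformly_continuous_on_def by metis
      have "(\<lambda>n. K / real (Suc n)) \<longlonglongrightarrow> 0" by (rule LIMSEQ_Suc[OF lim_const_over_n])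
      then have "\<forall>\<^sub>F n in sequentially. K / real (Suc n) < \<eta>" using e(1) by (rule order_tendstoD(2))
      then have "\<forall>\<^sub>F n in sequentially. indicator (jumpy (Suc n) \<delta>) \<omega> = (0::real)"
      proof eventually_elim
        case (elim n)
        note tg = tgrid_props[OF zero_less_Suc[of n]]
        have "norm (N (tgrid (Suc n) (Suc j)) \<omega> - N (tgrid (Suc n) j) \<omega>) < \<delta>" if "j < Suc n" for j
        proof -
          have "dist (tgrid (Suc n) (Suc j)) (tgrid (Suc n) j) < \<eta>"
            unfolding dist_real_def tg(6) using elim K by simp
          then show ?thesis using e(2)[of "tgrid (Suc n) j" "tgrid (Suc n) (Suc j)"] tg(1) tg(3)[of j] tg(3)[of "Suc j"] that
            by (simp add: dist_norm)
        qed
        then have "\<omega> \<notin> jumpy (Suc n) \<delta>" by (force simp: jumpy_def)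
        then show ?case by simp
      qed
      then show "(\<lambda>n. indicator (jumpy (Suc n) \<delta>) \<omega> :: real) \<longlonglongrightarrow> 0" by (rule tendsto_eventually)
    qed
  qed (use jumpy_measurable in auto)
  then show ?thesis using jumpy_measurable[OF zero_less_Suc] by simp
qed

end

context stopped_diffusion_C2 begin

text \<open>The expected sum of squared increments is bounded uniformly in the mesh, and the event that some
  increment exceeds \<open>\<delta>\<close> has vanishing probability; the weight \<open>l\<close> comes from \<open>1\<^sub>A q \<le> 1\<^sub>A / l + l q\<^sup>2\<close>.\<close>

lemma sum_err_bound:
  assumes e: "\<epsilon> > 0" and LD: "0 \<le> LD" "\<And>b x. \<bar>D1 b x\<bar> \<le> LD" "\<And>a b x. \<bar>D2 a b x\<bar> \<le> LD"
  defines "c0 \<equiv> real CARD('c) * real CARD('c) * LD * Cf"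
  obtains L \<delta> where "0 \<le> L" "0 < \<delta>" "\<And>n l. n > 0 \<Longrightarrow> l > 0 \<Longrightarrow>
    \<bar>\<Sum>j<n. expectation (err (tgrid n j) (tgrid n (Suc j)))\<bar> \<le>
      \<epsilon> * (1 + qv_bound) + L * (prob (jumpy n \<delta>) / l + l * qv_bound)
        + (c0 * K * (2 * \<epsilon> + Cf * (K / real n)) + c0 * K * (4 * R) * prob (jumpy n \<delta>))"
proof -
  have c0: "0 \<le> c0" using LD Cf by (simp add: c0_def)
  obtain L \<delta>0 where L0: "0 \<le> L" "0 < \<delta>0" and
    bnd: "\<And>\<omega> s t. \<omega> \<in> space M \<Longrightarrow> 0 \<le> s \<Longrightarrow> s \<le> t \<Longrightarrow>
     \<bar>err s t \<omega>\<bar> \<le> (\<epsilon> + L * (if norm (N t \<omega> - N s \<omega>) > \<delta>0 then 1 else 0)) * (norm (N t \<omega> - N s \<omega>))\<^sup>2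
       + c0 * (t - s) * (2 * norm (N t \<omega> - N s \<omega>) + Cf * (t - s))"
    by (rule err_bound[OF e LD, folded c0_def], rule that)
  note L = L0 c0
  define \<delta> where "\<delta> = min \<delta>0 \<epsilon>"
  show thesis
  proof (rule that[of L \<delta>])
    show "0 < \<delta>" using L e by (simp add: \<delta>_def)
    fix n :: nat and l :: real assume n: "n > 0" and l: "l > 0"
    note tg = tgrid_props[OF n]
    let ?b = "indicator (jumpy n \<delta>) :: 'a \<Rightarrow> real"
    let ?E = "\<lambda>j. err (tgrid n j) (tgrid n (Suc j))"
    let ?h = "K / real n"
    have h: "0 \<le> ?h" using K by simp
    have ie: "integrable M (?E j)" if "j < n" for j
      by (rule err_integrable[OF tg(1) less_imp_le[OF tg(2)] tg(3)[OF Suc_leI[OF that]]])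
    have pt: "(\<Sum>j<n. \<bar>?E j \<omega>\<bar>) \<le> \<epsilon> * qv n \<omega> + L * (?b \<omega> * qv n \<omega>) + (c0 * K * (2 * \<epsilon> + Cf * ?h) + c0 * K * (4 * R) * ?b \<omega>)"
      if w: "\<omega> \<in> space M" for \<omega>
    proof -
      let ?d = "\<lambda>j. norm (N (tgrid n (Suc j)) \<omega> - N (tgrid n j) \<omega>)"
      have "\<bar>?E j \<omega>\<bar> \<le> (\<epsilon> + L * ?b \<omega>) * (?d j)\<^sup>2 + c0 * ?h * (2 * (\<epsilon> + 2 * R * ?b \<omega>) + Cf * ?h)" if j: "j < n" for j
      proof -
        have i: "(if ?d j > \<delta>0 then 1 else 0) \<le> ?b \<omega>"
          using j w by (auto simp: jumpy_def \<delta>_def indicator_def)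
        have d2: "?d j \<le> \<epsilon> + 2 * R * ?b \<omega>"
        proof (cases "?d j > \<delta>")
          case True
          then have "\<omega> \<in> jumpy n \<delta>" using j w by (auto simp: jumpy_def)
          then have "?b \<omega> = 1" by simp
          then show ?thesis using N_diff_bound[OF w tg(1) tg(1), of "Suc j" j] N_diff_bound[OF w tg(1) tg(1), of j "Suc j"] e by simp
        next
          case False
          moreover have "0 \<le> 2 * R * ?b \<omega>" using R by simp
          ultimately show ?thesis by (simp add: \<delta>_def)
        qed
        have "\<bar>?E j \<omega>\<bar> \<le> (\<epsilon> + L * (if ?d j > \<delta>0 then 1 else 0)) * (?d j)\<^sup>2 + c0 * ?h * (2 * ?d j + Cf * ?h)"
          using bnd[OF w tg(1) less_imp_le[OF tg(2)], of j] unfolding tg(6) .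
        also have "\<dots> \<le> (\<epsilon> + L * ?b \<omega>) * (?d j)\<^sup>2 + c0 * ?h * (2 * (\<epsilon> + 2 * R * ?b \<omega>) + Cf * ?h)"
        proof (rule add_mono)
          show "(\<epsilon> + L * (if ?d j > \<delta>0 then 1 else 0)) * (?d j)\<^sup>2 \<le> (\<epsilon> + L * ?b \<omega>) * (?d j)\<^sup>2"
            by (intro mult_right_mono add_left_mono mult_left_mono i L(1)) auto
          show "c0 * ?h * (2 * ?d j + Cf * ?h) \<le> c0 * ?h * (2 * (\<epsilon> + 2 * R * ?b \<omega>) + Cf * ?h)"
            by (intro mult_left_mono add_right_mono d2 mult_nonneg_nonneg[OF c0 h]) auto
        qed
        finally show ?thesis .
      qed
      then have "(\<Sum>j<n. \<bar>?E j \<omega>\<bar>) \<le> (\<Sum>j<n. (\<epsilon> + L * ?b \<omega>) * (?d j)\<^sup>2 + c0 * ?h * (2 * (\<epsilon> + 2 * R * ?b \<omega>) + Cf * ?h))"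
        by (intro sum_mono) auto
      also have "\<dots> = (\<epsilon> + L * ?b \<omega>) * qv n \<omega> + real n * (c0 * ?h * (2 * (\<epsilon> + 2 * R * ?b \<omega>) + Cf * ?h))"
      proof -
        have "(\<Sum>j<n. k * (?d j)\<^sup>2 + l) = k * (\<Sum>j<n. (?d j)\<^sup>2) + real n * l" for k l
          by (simp add: sum.distrib sum_distrib_left)
        then show ?thesis unfolding qv_def .
      qed
      also have "real n * (c0 * ?h * (2 * (\<epsilon> + 2 * R * ?b \<omega>) + Cf * ?h)) = c0 * K * (2 * (\<epsilon> + 2 * R * ?b \<omega>) + Cf * ?h)"
      proof -
        have a: "real n * ?h = K" using n by simp
        have b: "x * (k * h * z) = k * (x * h) * z" for x k h z :: real by (simp only: mult_ac)
        show ?thesis unfolding b[of "real n"] a ..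
      qed
      also have "(\<epsilon> + L * ?b \<omega>) * qv n \<omega> + c0 * K * (2 * (\<epsilon> + 2 * R * ?b \<omega>) + Cf * ?h) =
          \<epsilon> * qv n \<omega> + L * (?b \<omega> * qv n \<omega>) + (c0 * K * (2 * \<epsilon> + Cf * ?h) + c0 * K * (4 * R) * ?b \<omega>)"
      proof -
        have "(x + l * b) * q + k * (2 * (x + 2 * R * b) + h) = x * q + l * (b * q) + (k * (2 * x + h) + k * (4 * R) * b)"
          for x l b q k h :: real by (simp add: algebra_simps)
        then show ?thesis .
      qed
      finally show ?thesis .
    qed
    have iq: "integrable M (qv n)" "integrable M (\<lambda>\<omega>. (qv n \<omega>)\<^sup>2)" by (rule qv_integrable[OF n])+
    have ib: "integrable M ?b" using jumpy_measurable[OF n] by (simp add: integrable_indicator_iff emeasure_eq_measure)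
    have Eq: "expectation (qv n) \<le> 1 + qv_bound"
    proof -
      have "expectation (qv n) \<le> expectation (\<lambda>\<omega>. 1 + (qv n \<omega>)\<^sup>2)"
      proof (rule integral_mono[OF iq(1)])
        show "qv n \<omega> \<le> 1 + (qv n \<omega>)\<^sup>2" for \<omega>
          using sum_squares_bound[of 1 "qv n \<omega>"] qv_nonneg[of n \<omega>] by simp
      qed (use iq in auto)
      also have "\<dots> = 1 + expectation (\<lambda>\<omega>. (qv n \<omega>)\<^sup>2)" using iq by (simp add: prob_space)
      finally show ?thesis using qv_second_moment[OF n] by simp
    qed
    have ibq: "integrable M (\<lambda>\<omega>. ?b \<omega> * qv n \<omega>)"
      using integrable_bounded_mult[OF iq(1), of ?b 1] jumpy_measurable[OF n] by (simp add: mult.commute)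
    have Ebq: "expectation (\<lambda>\<omega>. ?b \<omega> * qv n \<omega>) \<le> prob (jumpy n \<delta>) / l + l * qv_bound"
    proof -
      have "expectation (\<lambda>\<omega>. ?b \<omega> * qv n \<omega>) \<le> expectation (\<lambda>\<omega>. ?b \<omega> / l + l * (qv n \<omega>)\<^sup>2)"
      proof (rule integral_mono[OF ibq])
        show "?b \<omega> * qv n \<omega> \<le> ?b \<omega> / l + l * (qv n \<omega>)\<^sup>2" for \<omega>
          using young[OF l, of "?b \<omega>" "qv n \<omega>"] by (cases "\<omega> \<in> jumpy n \<delta>") auto
      qed (use iq ib in auto)
      also have "\<dots> = prob (jumpy n \<delta>) / l + l * expectation (\<lambda>\<omega>. (qv n \<omega>)\<^sup>2)"
        using iq ib jumpy_measurable[OF n] by simp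
      finally show ?thesis using mult_left_mono[OF qv_second_moment[OF n] less_imp_le[OF l]] by linarith
    qed
    have "\<bar>\<Sum>j<n. expectation (?E j)\<bar> \<le> (\<Sum>j<n. expectation (\<lambda>\<omega>. \<bar>?E j \<omega>\<bar>))"
      by (intro order_trans[OF sum_abs] sum_mono integral_abs_bound)
    also have "\<dots> = expectation (\<lambda>\<omega>. \<Sum>j<n. \<bar>?E j \<omega>\<bar>)"
      using ie by (intro Bochner_Integration.integral_sum[symmetric] integrable_abs) auto
    also have "\<dots> \<le> expectation (\<lambda>\<omega>. \<epsilon> * qv n \<omega> + L * (?b \<omega> * qv n \<omega>) + (c0 * K * (2 * \<epsilon> + Cf * ?h) + c0 * K * (4 * R) * ?b \<omega>))"
    proof (rule integral_mono)
      show "integrable M (\<lambda>\<omega>. \<Sum>j<n. \<bar>?E j \<omega>\<bar>)" using ie by (intro Bochner_Integration.integrable_sum integrable_abs) auto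
      show "integrable M (\<lambda>\<omega>. \<epsilon> * qv n \<omega> + L * (?b \<omega> * qv n \<omega>) + (c0 * K * (2 * \<epsilon> + Cf * ?h) + c0 * K * (4 * R) * ?b \<omega>))"
        by (intro Bochner_Integration.integrable_add integrable_mult_right iq ibq ib integrable_const)
    qed (rule pt)
    also have "\<dots> = expectation (\<lambda>\<omega>. \<epsilon> * qv n \<omega> + L * (?b \<omega> * qv n \<omega>)) + expectation (\<lambda>\<omega>. c0 * K * (2 * \<epsilon> + Cf * ?h) + c0 * K * (4 * R) * ?b \<omega>)"
      by (intro Bochner_Integration.integral_add Bochner_Integration.integrable_add integrable_mult_right iq ibq ib integrable_const)
    also have "\<dots> = \<epsilon> * expectation (qv n) + L * expectation (\<lambda>\<omega>. ?b \<omega> * qv n \<omega>) + (c0 * K * (2 * \<epsilon> + Cf * ?h) + c0 * K * (4 * R) * prob (jumpy n \<delta>))"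
      using iq ibq ib jumpy_measurable[OF n] by (simp add: prob_space)
    also have "\<dots> \<le> \<epsilon> * (1 + qv_bound) + L * (prob (jumpy n \<delta>) / l + l * qv_bound) + (c0 * K * (2 * \<epsilon> + Cf * ?h) + c0 * K * (4 * R) * prob (jumpy n \<delta>))"
      using Eq Ebq e L by (intro add_mono mult_left_mono order_refl) auto
    finally show "\<bar>\<Sum>j<n. expectation (?E j)\<bar> \<le> \<epsilon> * (1 + qv_bound) + L * (prob (jumpy n \<delta>) / l + l * qv_bound)
        + (c0 * K * (2 * \<epsilon> + Cf * (K / real n)) + c0 * K * (4 * R) * prob (jumpy n \<delta>))" .
  qed (use L in auto)
qed

lemma err_sum_tendsto:
  "(\<lambda>n. \<Sum>j<Suc n. expectation (err (tgrid (Suc n) j) (tgrid (Suc n) (Suc j)))) \<longlonglongrightarrow> 0"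
proof (rule LIMSEQ_I)
  fix r :: real assume r: "r > 0"
  obtain LD where LD: "0 \<le> LD" "\<And>b x. \<bar>D1 b x\<bar> \<le> LD" "\<And>a b x. \<bar>D2 a b x\<bar> \<le> LD" using D_bounds by blast
  define c where "c = real CARD('c) * real CARD('c) * LD * Cf"
  have c: "0 \<le> c" using LD Cf by (simp add: c_def)
  have qb: "0 \<le> qv_bound" using Cf K R by (simp add: qv_bound_def)
  define W where "W = 1 + qv_bound + 2 * c * K"
  have W: "W > 0" using qb c K by (simp add: W_def add_pos_nonneg)
  define \<epsilon> where "\<epsilon> = r / (4 * W)"
  have e: "\<epsilon> > 0" using r W by (simp add: \<epsilon>_def)
  have eW: "\<epsilon> * W = r / 4" using W by (simp add: \<epsilon>_def)
  obtain L \<delta> where L: "0 \<le> L" "0 < \<delta>" and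
    bnd: "\<And>n l. n > 0 \<Longrightarrow> l > 0 \<Longrightarrow> \<bar>\<Sum>j<n. expectation (err (tgrid n j) (tgrid n (Suc j)))\<bar> \<le>
      \<epsilon> * (1 + qv_bound) + L * (prob (jumpy n \<delta>) / l + l * qv_bound)
        + (c * K * (2 * \<epsilon> + Cf * (K / real n)) + c * K * (4 * R) * prob (jumpy n \<delta>))"
    by (rule sum_err_bound[OF e LD, folded c_def], rule that)
  define l where "l = r / (4 * (L * qv_bound + 1))"
  have Lq: "0 \<le> L * qv_bound" using L qb by simp
  have l: "l > 0" using r Lq by (simp add: l_def add_nonneg_pos)
  have lL: "L * (l * qv_bound) \<le> r / 4"
  proof -
    have "r / (4 * S) * S = r / 4" if "S \<noteq> 0" for S using that by simp
    from this[of "L * qv_bound + 1"] have "l * (L * qv_bound + 1) = r / 4" using Lq unfolding l_def by linarith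
    then show ?thesis using l by (simp add: distrib_left algebra_simps)
  qed
  have "(\<lambda>n. L * (prob (jumpy (Suc n) \<delta>) / l) + (c * K * (Cf * (K / real (Suc n))) + c * K * (4 * R) * prob (jumpy (Suc n) \<delta>)))
     \<longlonglongrightarrow> L * (0 / l) + (c * K * (Cf * 0) + c * K * (4 * R) * 0)"
    by (intro tendsto_intros jumpy_tendsto L LIMSEQ_Suc[OF lim_const_over_n]) (use l in auto)
  then have "\<forall>\<^sub>F n in sequentially. L * (prob (jumpy (Suc n) \<delta>) / l) + (c * K * (Cf * (K / real (Suc n))) + c * K * (4 * R) * prob (jumpy (Suc n) \<delta>)) < r / 4"
    by (rule order_tendstoD(2)) (use r in simp)
  then obtain n0 where n0: "\<And>n. n \<ge> n0 \<Longrightarrow> L * (prob (jumpy (Suc n) \<delta>) / l) + (c * K * (Cf * (K / real (Suc n))) + c * K * (4 * R) * prob (jumpy (Suc n) \<delta>)) < r / 4"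
    by (auto simp: eventually_sequentially)
  show "\<exists>no. \<forall>n\<ge>no. norm ((\<Sum>j<Suc n. expectation (err (tgrid (Suc n) j) (tgrid (Suc n) (Suc j)))) - 0) < r"
  proof (intro exI allI impI)
    fix n assume n: "n0 \<le> n"
    have "\<bar>\<Sum>j<Suc n. expectation (err (tgrid (Suc n) j) (tgrid (Suc n) (Suc j)))\<bar> \<le>
      \<epsilon> * (1 + qv_bound) + L * (prob (jumpy (Suc n) \<delta>) / l + l * qv_bound)
        + (c * K * (2 * \<epsilon> + Cf * (K / real (Suc n))) + c * K * (4 * R) * prob (jumpy (Suc n) \<delta>))" by (rule bnd[OF zero_less_Suc l])
    also have "\<dots> = \<epsilon> * W + L * (l * qv_bound) + (L * (prob (jumpy (Suc n) \<delta>) / l) + (c * K * (Cf * (K / real (Suc n))) + c * K * (4 * R) * prob (jumpy (Suc n) \<delta>)))"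
      by (simp only: W_def distrib_left) (simp add: algebra_simps)
    also have "\<dots> < r" using eW lL n0[OF n] r by linarith
    finally show "norm ((\<Sum>j<Suc n. expectation (err (tgrid (Suc n) j) (tgrid (Suc n) (Suc j)))) - 0) < r" by simp
  qed
qed

text \<open>The generator with the derivatives of \<open>u\<close> frozen at \<open>x\<close> and the coefficients taken at \<open>z\<close>.\<close>

definition gen2 :: "real^'c \<Rightarrow> real^'c \<Rightarrow> real" where
  "gen2 x z = (\<Sum>b\<in>UNIV. D1 b x * f z $ b) + 1/2 * (\<Sum>a\<in>UNIV. \<Sum>b\<in>UNIV. D2 a b x * (\<beta> z $ a \<bullet> \<beta> z $ b))"

lemma gen2_diagonal: "x \<in> C \<Longrightarrow> gen2 x x = generator f \<beta> u x"
  by (simp add: gen2_def generator_def D1_def D2_def diffusion_matrix_def matrix_matrix_mult_def transpose_def inner_vec_def mult.commute)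

lemma compensator_eq:
  assumes w: "\<omega> \<in> space M" and s: "0 \<le> s" "s \<le> t"
  shows "integrable lborel (\<lambda>r. indicator {s<..min t (\<tau> \<omega>)} r * gen2 (N s \<omega>) (y r \<omega>))"
    "compensator s t \<omega> = (\<integral>r. indicator {s<..min t (\<tau> \<omega>)} r * gen2 (N s \<omega>) (y r \<omega>) \<partial>lborel)"
proof -
  let ?I = "\<lambda>r. indicator {s<..min t (\<tau> \<omega>)} r :: real"
  note fi = fy_integrable[OF w s(1), of t]
  have fb: "integrable lborel (\<lambda>r. ?I r * f (y r \<omega>) $ b)" "(drift t \<omega> - drift s \<omega>) $ b = (\<integral>r. ?I r * f (y r \<omega>) $ b \<partial>lborel)" for b
    using integrable_bounded_linear[OF bounded_linear_vec_nth fi, of b] integral_bounded_linear[OF bounded_linear_vec_nth fi, of b]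
    by (simp_all add: drift_increment[OF w s])
  note bi = bb_integrable[OF w s(1), of t]
  have eq: "?I r * gen2 (N s \<omega>) (y r \<omega>) = (\<Sum>b\<in>UNIV. D1 b (N s \<omega>) * (?I r * f (y r \<omega>) $ b)) +
     1/2 * (\<Sum>a\<in>UNIV. \<Sum>b\<in>UNIV. D2 a b (N s \<omega>) * (?I r * (\<beta> (y r \<omega>) $ a \<bullet> \<beta> (y r \<omega>) $ b)))" for r
    by (simp add: gen2_def distrib_left sum_distrib_left mult.left_commute)
  have i1: "integrable lborel (\<lambda>r. \<Sum>b\<in>UNIV. D1 b (N s \<omega>) * (?I r * f (y r \<omega>) $ b))"
    by (intro Bochner_Integration.integrable_sum integrable_mult_right fb)
  have i2: "integrable lborel (\<lambda>r. \<Sum>b\<in>UNIV. D2 a b (N s \<omega>) * (?I r * (\<beta> (y r \<omega>) $ a \<bullet> \<beta> (y r \<omega>) $ b)))" for a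
    by (intro Bochner_Integration.integrable_sum integrable_mult_right bi)
  have i3: "integrable lborel (\<lambda>r. \<Sum>a\<in>UNIV. \<Sum>b\<in>UNIV. D2 a b (N s \<omega>) * (?I r * (\<beta> (y r \<omega>) $ a \<bullet> \<beta> (y r \<omega>) $ b)))"
    by (intro Bochner_Integration.integrable_sum i2)
  show "integrable lborel (\<lambda>r. ?I r * gen2 (N s \<omega>) (y r \<omega>))"
    unfolding eq by (intro Bochner_Integration.integrable_add integrable_mult_right i1 i3)
  have e1: "(\<integral>r. (\<Sum>b\<in>UNIV. D1 b (N s \<omega>) * (?I r * f (y r \<omega>) $ b)) \<partial>lborel) = (\<Sum>b\<in>UNIV. D1 b (N s \<omega>) * (drift t \<omega> - drift s \<omega>) $ b)"
    unfolding fb(2) integral_mult_right_zero[symmetric]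
    by (intro Bochner_Integration.integral_sum integrable_mult_right fb)
  have e2: "(\<integral>r. (\<Sum>b\<in>UNIV. D2 a b (N s \<omega>) * (?I r * (\<beta> (y r \<omega>) $ a \<bullet> \<beta> (y r \<omega>) $ b))) \<partial>lborel) = (\<Sum>b\<in>UNIV. D2 a b (N s \<omega>) * cov a b s t \<omega>)" for a
    unfolding cov_def integral_mult_right_zero[symmetric]
    by (intro Bochner_Integration.integral_sum integrable_mult_right bi)
  have e3: "(\<integral>r. (\<Sum>a\<in>UNIV. \<Sum>b\<in>UNIV. D2 a b (N s \<omega>) * (?I r * (\<beta> (y r \<omega>) $ a \<bullet> \<beta> (y r \<omega>) $ b))) \<partial>lborel)
     = (\<Sum>a\<in>UNIV. \<Sum>b\<in>UNIV. D2 a b (N s \<omega>) * cov a b s t \<omega>)"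
    unfolding e2[symmetric] by (intro Bochner_Integration.integral_sum i2)
  show "compensator s t \<omega> = (\<integral>r. ?I r * gen2 (N s \<omega>) (y r \<omega>) \<partial>lborel)"
    unfolding eq compensator_def e1[symmetric] e3[symmetric] integral_mult_right_zero[symmetric]
    by (intro Bochner_Integration.integral_add[symmetric] integrable_mult_right i1 i3)
qed

lemma gen2_bounded: obtains Lg where "0 \<le> Lg" "\<And>x z. z \<in> C \<Longrightarrow> \<bar>gen2 x z\<bar> \<le> Lg"
proof -
  obtain LD where LD: "0 \<le> LD" "\<And>b x. \<bar>D1 b x\<bar> \<le> LD" "\<And>a b x. \<bar>D2 a b x\<bar> \<le> LD" using D_bounds by blast
  let ?d = "real CARD('c)"
  show thesis
  proof (rule that[of "?d * (LD * Cf) + 1/2 * (?d * (?d * (LD * (Cb * Cb))))"])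
    show "0 \<le> ?d * (LD * Cf) + 1/2 * (?d * (?d * (LD * (Cb * Cb))))" using LD Cf Cb by simp
    fix x z assume z: "z \<in> C"
    have "\<bar>\<Sum>b\<in>UNIV. D1 b x * f z $ b\<bar> \<le> (\<Sum>b\<in>(UNIV::'c set). LD * Cf)"
      by (intro order_trans[OF sum_abs] sum_mono)
         (unfold abs_mult, intro mult_mono LD order_trans[OF component_le_norm_cart Cf(2)[OF z]], auto)
    moreover have "\<bar>\<Sum>a\<in>UNIV. \<Sum>b\<in>UNIV. D2 a b x * (\<beta> z $ a \<bullet> \<beta> z $ b)\<bar> \<le> (\<Sum>a\<in>(UNIV::'c set). \<Sum>b\<in>(UNIV::'c set). LD * (Cb * Cb))"
      by (intro order_trans[OF sum_abs] sum_mono order_trans[OF sum_abs])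
         (unfold abs_mult, intro mult_mono LD bb_bound[OF z], auto)
    ultimately show "\<bar>gen2 x z\<bar> \<le> ?d * (LD * Cf) + 1/2 * (?d * (?d * (LD * (Cb * Cb))))"
      unfolding gen2_def sum_constant by (intro order_trans[OF abs_triangle_ineq] add_mono) auto
  qed
qed

lemma compensator_sum_pathwise:
  assumes w: "\<omega> \<in> space M"
  shows "(\<lambda>n. \<Sum>j<Suc n. compensator (tgrid (Suc n) j) (tgrid (Suc n) (Suc j)) \<omega>) \<longlonglongrightarrow>
     (\<integral>r. indicator {0<..\<tau> \<omega>} r * generator f \<beta> u (y r \<omega>) \<partial>lborel)"
proof -
  obtain Lg where Lg: "0 \<le> Lg" "\<And>x z. z \<in> C \<Longrightarrow> \<bar>gen2 x z\<bar> \<le> Lg" using gen2_bounded by blast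
  let ?t = "\<lambda>n j. tgrid (Suc n) j"
  let ?g = "\<lambda>n j r. indicator {?t n j<..min (?t n (Suc j)) (\<tau> \<omega>)} r * gen2 (N (?t n j) \<omega>) (y r \<omega>)"
  note tg = tgrid_props[OF zero_less_Suc]
  have gi: "integrable lborel (?g n j)" for n j by (rule compensator_eq(1)[OF w tg(1) less_imp_le[OF tg(2)]])
  have gr: "grid (Suc n) (?t n)" for n using tg(2) by (simp add: grid_def)
  have split: "?g n j r = indicator {?t n j<..?t n (Suc j)} r *\<^sub>R (indicator {0<..\<tau> \<omega>} r * gen2 (N (?t n j) \<omega>) (y r \<omega>))" for n j r
    using tg(1)[of n j] by (auto simp: indicator_def)
  have sumeq: "(\<Sum>j<Suc n. compensator (?t n j) (?t n (Suc j)) \<omega>) = (\<integral>r. (\<Sum>j<Suc n. ?g n j r) \<partial>lborel)" for n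
    unfolding compensator_eq(2)[OF w tg(1) less_imp_le[OF tg(2)]]
    by (intro Bochner_Integration.integral_sum[symmetric] gi)
  have val: "(\<Sum>j<Suc n. ?g n j r) = indicator {0<..\<tau> \<omega>} r * gen2 (N (?t n j) \<omega>) (y r \<omega>)"
    if "j < Suc n" "?t n j < r" "r \<le> ?t n (Suc j)" for n j r
    unfolding split by (rule grid_step_value[OF gr that])
  have out: "(\<Sum>j<Suc n. ?g n j r) = 0" if "r \<notin> {0<..\<tau> \<omega>}" for n r
    unfolding split by (rule sum.neutral) (use that in auto)
  have cell: "\<exists>j<Suc n. ?t n j < r \<and> r \<le> ?t n (Suc j)" if "r \<in> {0<..\<tau> \<omega>}" for n r
    using grid_cell[OF gr, of n r] that \<tau>[OF w] tg(4,5)[of n] by simp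
  show ?thesis unfolding sumeq
  proof (rule integral_dominated_convergence[where w="\<lambda>r. Lg * indicator {0<..K} r"])
    show "integrable lborel (\<lambda>r. Lg * indicator {0<..K} r)"
      using K by (intro integrable_mult_right) (auto simp: integrable_indicator_iff)
    show meas: "(\<lambda>r. \<Sum>j<Suc n. ?g n j r) \<in> borel_measurable lborel" for n
      using gi by (intro borel_measurable_sum borel_measurable_integrable)
    show "AE r in lborel. norm (\<Sum>j<Suc n. ?g n j r) \<le> Lg * indicator {0<..K} r" for n
    proof (rule AE_I2)
      fix r
      show "norm (\<Sum>j<Suc n. ?g n j r) \<le> Lg * indicator {0<..K} r"
      proof (cases "r \<in> {0<..\<tau> \<omega>}")
        case True
        then obtain j where j: "j < Suc n" "?t n j < r" "r \<le> ?t n (Suc j)" using cell by blast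
        have "y r \<omega> \<in> C" using y_in_C[OF w, of r] True by auto
        then show ?thesis unfolding val[OF j] using True \<tau>[OF w] Lg(2) by auto
      next
        case False
        then show ?thesis unfolding out[OF False] using Lg by simp
      qed
    qed
    have lim: "(\<lambda>n. \<Sum>j<Suc n. ?g n j r) \<longlonglongrightarrow> indicator {0<..\<tau> \<omega>} r * generator f \<beta> u (y r \<omega>)" for r
    proof (cases "r \<in> {0<..\<tau> \<omega>}")
      case True
      then have "\<forall>n. \<exists>j. j < Suc n \<and> ?t n j < r \<and> r \<le> ?t n (Suc j)" using cell by blast
      then obtain J where J: "\<And>n. J n < Suc n" "\<And>n. ?t n (J n) < r" "\<And>n. r \<le> ?t n (Suc (J n))" by metis
      define q where "q = (\<lambda>n. ?t n (J n))"
      have q0: "0 \<le> q n" "q n < r" for n using tg(1) J(2) by (auto simp: q_def)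
      have yr: "y r \<omega> \<in> C" using y_in_C[OF w, of r] True by auto
      have yq: "y (q n) \<omega> \<in> C" for n using y_in_C[OF w, of "q n"] q0[of n] True by auto
      have Nq: "N (q n) \<omega> = y (q n) \<omega>" for n using q0[of n] True by (simp add: N_def)
      have "q \<longlonglongrightarrow> r"
      proof (rule tendsto_sandwich)
        show "(\<lambda>n. r - K / real (Suc n)) \<longlonglongrightarrow> r"
          using tendsto_diff[OF tendsto_const LIMSEQ_Suc[OF lim_const_over_n[of K]], of r] by simp
        show "\<forall>\<^sub>F n in sequentially. r - K / real (Suc n) \<le> q n"
        proof (intro always_eventually allI)
          fix n show "r - K / real (Suc n) \<le> q n" using J(3)[of n] tg(6)[of n "J n"] unfolding q_def by linarith
        qed
        show "\<forall>\<^sub>F n in sequentially. q n \<le> r" using q0 by (intro always_eventually allI less_imp_le)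
      qed simp
      then have yl: "(\<lambda>n. y (q n) \<omega>) \<longlonglongrightarrow> y r \<omega>"
        by (intro continuous_on_tendsto_compose[OF y_continuous[OF w]]) (use q0 True in auto)
      have c1: "(\<lambda>n. D1 b (y (q n) \<omega>)) \<longlonglongrightarrow> D1 b (y r \<omega>)" for b
        using continuous_on_tendsto_compose[OF u_continuous(2) yl yr] yq yr by (simp add: D1_def)
      have c2: "(\<lambda>n. D2 a b (y (q n) \<omega>)) \<longlonglongrightarrow> D2 a b (y r \<omega>)" for a b
        using continuous_on_tendsto_compose[OF u_continuous(3) yl yr] yq yr by (simp add: D2_def)
      have "(\<lambda>n. indicator {0<..\<tau> \<omega>} r * gen2 (y (q n) \<omega>) (y r \<omega>)) \<longlonglongrightarrow> indicator {0<..\<tau> \<omega>} r * gen2 (y r \<omega>) (y r \<omega>)"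
        unfolding gen2_def by (intro tendsto_intros c1 c2)
      moreover have "(\<Sum>j<Suc n. ?g n j r) = indicator {0<..\<tau> \<omega>} r * gen2 (y (q n) \<omega>) (y r \<omega>)" for n
        unfolding val[OF J] using Nq[of n] by (simp add: q_def)
      ultimately show ?thesis using gen2_diagonal[OF yr] by simp
    next
      case False
      then show ?thesis unfolding out[OF False] by simp
    qed
    then show "AE r in lborel. (\<lambda>n. \<Sum>j<Suc n. ?g n j r) \<longlonglongrightarrow> indicator {0<..\<tau> \<omega>} r * generator f \<beta> u (y r \<omega>)" by simp
    show "(\<lambda>r. indicator {0<..\<tau> \<omega>} r * generator f \<beta> u (y r \<omega>)) \<in> borel_measurable lborel"
      by (rule borel_measurable_LIMSEQ_real[OF lim meas])
  qed
qed

lemma compensator_sum_bound: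
  obtains Lg where "\<And>\<omega> n. \<omega> \<in> space M \<Longrightarrow> \<bar>\<Sum>j<Suc n. compensator (tgrid (Suc n) j) (tgrid (Suc n) (Suc j)) \<omega>\<bar> \<le> Lg"
proof -
  obtain Lg where Lg: "0 \<le> Lg" "\<And>x z. z \<in> C \<Longrightarrow> \<bar>gen2 x z\<bar> \<le> Lg" using gen2_bounded by blast
  note tg = tgrid_props[OF zero_less_Suc]
  have c: "\<bar>compensator s t \<omega>\<bar> \<le> Lg * (t - s)" if w: "\<omega> \<in> space M" and s: "0 \<le> s" "s \<le> t" for \<omega> s t
  proof -
    have "\<bar>compensator s t \<omega>\<bar> \<le> (\<integral>r. \<bar>indicator {s<..min t (\<tau> \<omega>)} r * gen2 (N s \<omega>) (y r \<omega>)\<bar> \<partial>lborel)"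
      unfolding compensator_eq(2)[OF w s] by (rule integral_abs_bound)
    also have "\<dots> \<le> (\<integral>r. Lg * indicator {s<..t} r \<partial>lborel)"
    proof (rule integral_mono)
      show "integrable lborel (\<lambda>r. \<bar>indicator {s<..min t (\<tau> \<omega>)} r * gen2 (N s \<omega>) (y r \<omega>)\<bar>)"
        by (intro integrable_abs compensator_eq(1) w s)
      show "integrable lborel (\<lambda>r. Lg * indicator {s<..t} r)"
        using s by (intro integrable_mult_right) (auto simp: integrable_indicator_iff)
      show "\<bar>indicator {s<..min t (\<tau> \<omega>)} r * gen2 (N s \<omega>) (y r \<omega>)\<bar> \<le> Lg * indicator {s<..t} r" for r
        using Lg(1) Lg(2)[of "y r \<omega>" "N s \<omega>"] y_in_C[OF w, of r] s by (auto simp: indicator_def)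
    qed
    also have "\<dots> = Lg * (t - s)" using s by simp
    finally show ?thesis .
  qed
  show thesis
  proof (rule that[of "Lg * K"])
    fix \<omega> n assume w: "\<omega> \<in> space M"
    have "\<bar>\<Sum>j<Suc n. compensator (tgrid (Suc n) j) (tgrid (Suc n) (Suc j)) \<omega>\<bar> \<le> (\<Sum>j<Suc n. Lg * (K / real (Suc n)))"
      using c[OF w tg(1) less_imp_le[OF tg(2)]] unfolding tg(6) by (intro order_trans[OF sum_abs] sum_mono)
    also have "\<dots> = Lg * K" by (simp add: field_simps)
    finally show "\<bar>\<Sum>j<Suc n. compensator (tgrid (Suc n) j) (tgrid (Suc n) (Suc j)) \<omega>\<bar> \<le> Lg * K" .
  qed
qed

theorem dynkin:
  "integrable M (\<lambda>\<omega>. u (y (\<tau> \<omega>) \<omega>) - u (y 0 \<omega>))"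
  "expectation (\<lambda>\<omega>. u (y (\<tau> \<omega>) \<omega>) - u (y 0 \<omega>)) =
     expectation (\<lambda>\<omega>. \<integral>r. indicator {0<..\<tau> \<omega>} r * generator f \<beta> u (y r \<omega>) \<partial>lborel)"
proof -
  note tg = tgrid_props[OF zero_less_Suc]
  let ?t = "\<lambda>n j. tgrid (Suc n) j"
  let ?U = "\<lambda>s t \<omega>. u (N t \<omega>) - u (N s \<omega>)"
  have NK: "?U 0 K \<omega> = u (y (\<tau> \<omega>) \<omega>) - u (y 0 \<omega>)" if "\<omega> \<in> space M" for \<omega>
  proof -
    have "min K (\<tau> \<omega>) = \<tau> \<omega>" "min 0 (\<tau> \<omega>) = 0" using \<tau>[OF that] by auto
    then show ?thesis by (simp add: N_def)
  qed
  have iK: "integrable M (?U 0 K)" using u_diff_integrable[of 0 K] K by simp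
  show "integrable M (\<lambda>\<omega>. u (y (\<tau> \<omega>) \<omega>) - u (y 0 \<omega>))"
    by (rule Bochner_Integration.integrable_cong[THEN iffD1, OF refl _ iK]) (rule NK)
  have ic: "integrable M (compensator (?t n j) (?t n (Suc j)))" if "j < Suc n" for n j
    by (rule compensator_integrable[OF tg(1) less_imp_le[OF tg(2)] tg(3)[OF Suc_leI[OF that]]])
  have tel: "expectation (?U 0 K) = (\<Sum>j<Suc n. expectation (compensator (?t n j) (?t n (Suc j)))) + (\<Sum>j<Suc n. expectation (err (?t n j) (?t n (Suc j))))" for n
  proof -
    have "?U 0 K \<omega> = (\<Sum>j<Suc n. ?U (?t n j) (?t n (Suc j)) \<omega>)" for \<omega>
      using sum_lessThan_telescope[of "\<lambda>j. u (N (?t n j) \<omega>)" "Suc n"] tg(4,5)[of n] by simp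
    then have "expectation (?U 0 K) = expectation (\<lambda>\<omega>. \<Sum>j<Suc n. ?U (?t n j) (?t n (Suc j)) \<omega>)" by simp
    also have "\<dots> = (\<Sum>j<Suc n. expectation (?U (?t n j) (?t n (Suc j))))"
      by (intro Bochner_Integration.integral_sum u_diff_integrable tg(1))
    also have "\<dots> = (\<Sum>j<Suc n. expectation (compensator (?t n j) (?t n (Suc j))) + expectation (err (?t n j) (?t n (Suc j))))"
      by (intro sum.cong refl step_expectation tg(1) tg(2) tg(3)) auto
    finally show ?thesis by (simp only: sum.distrib)
  qed
  obtain Lg where Lg: "\<And>\<omega> n. \<omega> \<in> space M \<Longrightarrow> \<bar>\<Sum>j<Suc n. compensator (?t n j) (?t n (Suc j)) \<omega>\<bar> \<le> Lg"
    using compensator_sum_bound by blast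
  have cm: "(\<lambda>\<omega>. \<Sum>j<Suc n. compensator (?t n j) (?t n (Suc j)) \<omega>) \<in> borel_measurable M" for n
    using ic by (intro borel_measurable_sum borel_measurable_integrable) auto
  let ?G = "\<lambda>\<omega>. \<integral>r. indicator {0<..\<tau> \<omega>} r * generator f \<beta> u (y r \<omega>) \<partial>lborel"
  have Gm: "?G \<in> borel_measurable M"
    by (rule borel_measurable_LIMSEQ_real[OF compensator_sum_pathwise cm])
  have "(\<lambda>n. expectation (\<lambda>\<omega>. \<Sum>j<Suc n. compensator (?t n j) (?t n (Suc j)) \<omega>)) \<longlonglongrightarrow> expectation ?G"
  proof (rule integral_dominated_convergence[where w="\<lambda>_. Lg", OF Gm cm])
    show "AE \<omega> in M. (\<lambda>n. \<Sum>j<Suc n. compensator (?t n j) (?t n (Suc j)) \<omega>) \<longlonglongrightarrow> ?G \<omega>"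
      by (rule AE_I2) (rule compensator_sum_pathwise)
    show "AE \<omega> in M. norm (\<Sum>j<Suc n. compensator (?t n j) (?t n (Suc j)) \<omega>) \<le> Lg" for n
      unfolding real_norm_def by (rule AE_I2) (rule Lg)
  qed simp
  moreover have "expectation (\<lambda>\<omega>. \<Sum>j<Suc n. compensator (?t n j) (?t n (Suc j)) \<omega>) = (\<Sum>j<Suc n. expectation (compensator (?t n j) (?t n (Suc j))))" for n
    using ic by (intro Bochner_Integration.integral_sum) auto
  ultimately have "(\<lambda>n. \<Sum>j<Suc n. expectation (compensator (?t n j) (?t n (Suc j)))) \<longlonglongrightarrow> expectation ?G" by simp
  from tendsto_add[OF this err_sum_tendsto] have "(\<lambda>n::nat. expectation (?U 0 K)) \<longlonglongrightarrow> expectation ?G"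
    unfolding tel[symmetric] by simp
  then have "expectation (?U 0 K) = expectation ?G" by (simp only: LIMSEQ_const_iff)
  moreover have "expectation (?U 0 K) = expectation (\<lambda>\<omega>. u (y (\<tau> \<omega>) \<omega>) - u (y 0 \<omega>))"
    by (rule Bochner_Integration.integral_cong[OF refl NK])
  ultimately show "expectation (\<lambda>\<omega>. u (y (\<tau> \<omega>) \<omega>) - u (y 0 \<omega>)) = expectation ?G" by simp
qed

end

section \<open>Exit times\<close>

lemma continuous_on_first_exit:
  fixes h :: "real \<Rightarrow> 'b::topological_space"
  assumes h: "continuous_on {a..b} h" and G: "open G" and ex: "\<exists>t\<in>{a..b}. h t \<notin> G"
  obtains t where "t \<in> {a..b}" "h t \<notin> G" "\<And>s. a \<le> s \<Longrightarrow> s < t \<Longrightarrow> h s \<in> G"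
proof -
  let ?S = "{a..b} \<inter> h -` (- G)"
  have "closed ?S" by (rule continuous_closed_preimage[OF h]) (use G in auto)
  then have "compact ?S" by (rule compact_Int_closed[OF compact_Icc, of ?S a b, simplified Int_assoc[symmetric] Int_absorb])
  moreover have "?S \<noteq> {}" using ex by auto
  ultimately obtain t where "t \<in> ?S" "\<And>s. s \<in> ?S \<Longrightarrow> t \<le> s" using compact_attains_inf by metis
  then show thesis by (intro that[of t]) force+
qed

lemma exit_time_nonneg: "0 \<le> exit_time G X \<omega>"
  unfolding exit_time_def by (intro INF_greatest) (auto simp: zero_ereal_def)

lemma before_exit_time: "0 \<le> r \<Longrightarrow> ereal r < exit_time G X \<omega> \<Longrightarrow> X r \<omega> \<in> G"
  unfolding exit_time_def by (force dest: less_INF_D)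

lemma exit_time_le_iff:
  fixes X :: "real \<Rightarrow> 'w \<Rightarrow> 'b::topological_space"
  assumes X: "continuous_on {0..} (\<lambda>t. X t \<omega>)" and G: "open G" and t: "0 \<le> t"
  shows "exit_time G X \<omega> \<le> ereal t \<longleftrightarrow> (\<exists>s\<in>{0..t}. X s \<omega> \<notin> G)"
proof
  assume "\<exists>s\<in>{0..t}. X s \<omega> \<notin> G"
  then obtain s where s: "0 \<le> s" "s \<le> t" "X s \<omega> \<notin> G" by auto
  then have "exit_time G X \<omega> \<le> ereal s" unfolding exit_time_def by (intro INF_lower) auto
  also have "\<dots> \<le> ereal t" using s by simp
  finally show "exit_time G X \<omega> \<le> ereal t" .
next
  assume le: "exit_time G X \<omega> \<le> ereal t"
  show "\<exists>s\<in>{0..t}. X s \<omega> \<notin> G"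
  proof (cases "\<exists>s\<in>{0..t + 1}. X s \<omega> \<notin> G")
    case True
    obtain m where m: "m \<in> {0..t + 1}" "X m \<omega> \<notin> G" "\<And>s. 0 \<le> s \<Longrightarrow> s < m \<Longrightarrow> X s \<omega> \<in> G"
      using continuous_on_first_exit[OF continuous_on_subset[OF X] G True] by auto
    have "ereal m \<le> exit_time G X \<omega>" unfolding exit_time_def using m by (intro INF_greatest) force
    with le m show ?thesis by (intro bexI[of _ m]) (auto dest: order_trans)
  next
    case False
    have "ereal (t + 1) \<le> exit_time G X \<omega>" unfolding exit_time_def using False by (intro INF_greatest) force
    from order_trans[OF this le] show ?thesis by simp
  qed
qed

lemma at_exit_time:
  fixes X :: "real \<Rightarrow> 'w \<Rightarrow> 'b::topological_space"
  assumes X: "continuous_on {0..} (\<lambda>t. X t \<omega>)" and G: "open G" and t: "exit_time G X \<omega> = ereal t"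
  shows "X t \<omega> \<notin> G"
proof -
  have t0: "0 \<le> t" using exit_time_nonneg[of G X \<omega>] t by simp
  then obtain s where s: "0 \<le> s" "s \<le> t" "X s \<omega> \<notin> G" using exit_time_le_iff[where X=X and \<omega>=\<omega>, OF X G t0] t by auto
  then have "exit_time G X \<omega> \<le> ereal s" using exit_time_le_iff[where X=X and \<omega>=\<omega>, OF X G s(1)] by auto
  with s t show ?thesis by (cases "s = t") auto
qed

lemma (in driven_space) exit_time_stopping:
  fixes X :: "real \<Rightarrow> 'w \<Rightarrow> 'b::metric_space"
  assumes X: "adapted F X" "continuous_paths M X" and G: "open G" and t: "0 \<le> t"
  shows "{\<omega>\<in>space M. exit_time G X \<omega> \<le> ereal t} \<in> sets (F t)"
proof (cases "G = UNIV")
  case True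
  then have "{\<omega>\<in>space M. exit_time G X \<omega> \<le> ereal t} = {}" by (auto simp: exit_time_def top_ereal_def)
  then show ?thesis by (simp only: sets.empty_sets)
next
  case False
  have cl: "closed (- G)" "- G \<noteq> {}" using G False by auto
  define D where "D = insert t {q. q \<in> \<rat> \<and> 0 \<le> q \<and> q \<le> t}"
  have D: "countable D" unfolding D_def using countable_rat by (auto intro: countable_subset[OF _ countable_rat])
  let ?d = "\<lambda>s \<omega>. infdist (X s \<omega>) (- G)"
  have iff: "exit_time G X \<omega> \<le> ereal t \<longleftrightarrow> (\<forall>k::nat. \<exists>q\<in>D. ?d q \<omega> < 1 / real (Suc k))" if w: "\<omega> \<in> space M" for \<omega>
  proof -
    have c: "continuous_on {0..} (\<lambda>t. X t \<omega>)" using X(2) w by (auto simp: continuous_paths_def)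
    have dc: "continuous_on {0..t} (\<lambda>s. ?d s \<omega>)"
      by (intro continuous_intros continuous_on_subset[OF c]) auto
    have "(\<exists>s\<in>{0..t}. X s \<omega> \<notin> G) \<longleftrightarrow> (\<forall>k::nat. \<exists>q\<in>D. ?d q \<omega> < 1 / real (Suc k))"
    proof
      assume "\<exists>s\<in>{0..t}. X s \<omega> \<notin> G"
      then obtain s where s: "0 \<le> s" "s \<le> t" "X s \<omega> \<notin> G" by auto
      then have d0: "?d s \<omega> = 0" by simp
      show "\<forall>k::nat. \<exists>q\<in>D. ?d q \<omega> < 1 / real (Suc k)"
      proof
        fix k :: nat
        show "\<exists>q\<in>D. ?d q \<omega> < 1 / real (Suc k)"
        proof (cases "s = t")
          case True
          then show ?thesis using d0 by (intro bexI[of _ t]) (auto simp: D_def)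
        next
          case False
          obtain e where e: "e > 0" "\<And>r. r \<in> {0..t} \<Longrightarrow> dist r s < e \<Longrightarrow> dist (?d r \<omega>) (?d s \<omega>) < 1 / real (Suc k)"
            using dc s unfolding continuous_on_iff by (metis atLeastAtMost_iff of_nat_0_less_iff zero_less_Suc zero_less_divide_1_iff)
          have "s < min t (s + e)" using False s e by auto
          then obtain q where q: "q \<in> \<rat>" "s < q" "q < min t (s + e)" using Rats_dense_in_real by blast
          then have "dist (?d q \<omega>) (?d s \<omega>) < 1 / real (Suc k)" using s by (intro e(2)) (auto simp: dist_real_def)
          then show ?thesis using q s d0 by (intro bexI[of _ q]) (auto simp: D_def dist_real_def)
        qed
      qed
    next
      assume a: "\<forall>k::nat. \<exists>q\<in>D. ?d q \<omega> < 1 / real (Suc k)"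
      obtain s where s: "s \<in> {0..t}" "\<And>r. r \<in> {0..t} \<Longrightarrow> ?d s \<omega> \<le> ?d r \<omega>"
        using continuous_attains_inf[OF compact_Icc _ dc] t by auto
      have "?d s \<omega> \<le> 0"
      proof (rule ccontr)
        assume "\<not> ?thesis"
        then obtain k where k: "1 / real (Suc k) < ?d s \<omega>" using nat_approx_posE[of "?d s \<omega>"] by auto
        obtain q where "q \<in> D" "?d q \<omega> < 1 / real (Suc k)" using a by blast
        moreover from this have "?d s \<omega> \<le> ?d q \<omega>" using t by (intro s(2)) (auto simp: D_def)
        ultimately show False using k by linarith
      qed
      then have "?d s \<omega> = 0" using infdist_nonneg[of "X s \<omega>" "- G"] by linarith
      then have "X s \<omega> \<in> - G" using in_closed_iff_infdist_zero[OF cl] by simp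
      with s show "\<exists>s\<in>{0..t}. X s \<omega> \<notin> G" by auto
    qed
    then show ?thesis using exit_time_le_iff[where X=X and \<omega>=\<omega>, OF c G t] by simp
  qed
  have m: "{\<omega>\<in>space (F t). ?d q \<omega> < 1 / real (Suc k)} \<in> sets (F t)" if q: "q \<in> D" for q k
  proof -
    have "X q \<in> borel_measurable (F t)"
      using q t X(1) F_measurable_mono[of q t] by (auto simp: D_def adapted_def)
    from measurable_compose[OF this borel_measurable_continuous_onI[OF continuous_on_infdist[OF continuous_on_id]]]
    show ?thesis by (intro borel_measurable_less) auto
  qed
  have "{\<omega>\<in>space M. exit_time G X \<omega> \<le> ereal t} = (\<Inter>k::nat. \<Union>q\<in>D. {\<omega>\<in>space (F t). ?d q \<omega> < 1 / real (Suc k)})"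
    using iff F_space[OF t] by auto
  also have "\<dots> \<in> sets (F t)" using m D by (intro sets.countable_INT sets.countable_UN'') auto
  finally show ?thesis .
qed

text \<open>The segment from \<open>x\<close> to \<open>z\<close> meets the boundary, where \<open>v\<close> vanishes; the mean value theorem applies
  on its part inside \<open>Q\<close>, so \<open>Q\<close> need not be convex.\<close>

lemma dirichlet_gradient_bound:
  fixes v :: "real^'n::finite \<Rightarrow> real"
  assumes Q: "open Q" and vc: "continuous_on (closure Q) v" and vd: "\<And>x. x \<in> Q \<Longrightarrow> v differentiable (at x)"
    and v0: "\<And>x. x \<in> frontier Q \<Longrightarrow> v x = 0" and x: "x \<in> closure Q" and z: "z \<notin> Q"
  shows "ennreal (v x) \<le> (SUP p\<in>Q. ennreal (norm (grad v p))) * ennreal (norm (x - z))"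
proof (cases "x \<in> Q")
  case False
  then have "v x = 0" using x Q v0 by (auto simp: frontier_def interior_open)
  then show ?thesis by simp
next
  case True
  define \<gamma> where "\<gamma> = (\<lambda>t. x + t *\<^sub>R (z - x))"
  have gc: "continuous_on S \<gamma>" for S unfolding \<gamma>_def by (intro continuous_intros)
  have "\<gamma> 1 \<notin> Q" using z by (simp add: \<gamma>_def)
  then have "\<exists>t\<in>{0..1}. \<gamma> t \<notin> Q" by (intro bexI[of _ 1]) auto
  then obtain T where T: "T \<in> {0..1}" "\<gamma> T \<notin> Q" "\<And>s. 0 \<le> s \<Longrightarrow> s < T \<Longrightarrow> \<gamma> s \<in> Q"
    using continuous_on_first_exit[OF gc Q] by metis
  have T0: "0 < T" using T True by (cases "T = 0") (auto simp: \<gamma>_def)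
  have incl: "\<gamma> s \<in> closure Q" if "0 \<le> s" "s \<le> T" for s
  proof (cases "s = T")
    case False
    then show ?thesis using T(3)[of s] that closure_subset by force
  next
    case True
    have "(\<lambda>n. T - T / real (Suc n)) \<longlonglongrightarrow> T - 0" by (intro tendsto_intros LIMSEQ_Suc[OF lim_const_over_n])
    then have "(\<lambda>n. \<gamma> (T - T / real (Suc n))) \<longlonglongrightarrow> \<gamma> T"
      using continuous_on_tendsto_compose[OF gc[of UNIV], of "\<lambda>n. T - T / real (Suc n)" T sequentially] by simp
    moreover have "\<gamma> (T - T / real (Suc n)) \<in> closure Q" for n
    proof -
      have "\<gamma> (T - T / real (Suc n)) \<in> Q" using T0 by (intro T(3)) (auto simp: field_simps)
      then show ?thesis using closure_subset by blast
    qed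
    ultimately show ?thesis unfolding True using closed_sequentially[OF closed_closure, of "\<lambda>n. \<gamma> (T - T / real (Suc n))" Q "\<gamma> T"] by blast
  qed
  have vT: "v (\<gamma> T) = 0" using incl[of T] T T0 Q by (intro v0) (auto simp: frontier_def interior_open)
  have "\<exists>l s. 0 < s \<and> s < T \<and> DERIV (\<lambda>t. v (\<gamma> t)) s :> l \<and> v (\<gamma> T) - v (\<gamma> 0) = (T - 0) * l"
  proof (rule MVT[OF T0])
    show "continuous_on {0..T} (\<lambda>t. v (\<gamma> t))"
      by (rule continuous_on_compose2[OF vc gc]) (use incl in auto)
    fix s assume "0 < s" "s < T"
    then have "v differentiable (at (x + s *\<^sub>R (z - x)))" using T(3)[of s] vd by (simp add: \<gamma>_def)
    from has_derivative_line[OF this] show "(\<lambda>t. v (\<gamma> t)) differentiable (at s)"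
      unfolding \<gamma>_def by (auto simp: has_field_derivative_def differentiable_def)
  qed
  then obtain l s where s: "0 < s" "s < T" "DERIV (\<lambda>t. v (\<gamma> t)) s :> l" and eq: "v (\<gamma> T) - v (\<gamma> 0) = (T - 0) * l" by blast
  have pQ: "\<gamma> s \<in> Q" using s T(3) by simp
  have "v differentiable (at (x + s *\<^sub>R (z - x)))" using pQ vd by (simp add: \<gamma>_def)
  from has_derivative_line[OF this] have "DERIV (\<lambda>t. v (\<gamma> t)) s :> grad v (\<gamma> s) \<bullet> (z - x)"
    by (simp add: \<gamma>_def grad_def inner_vec_def)
  with s(3) have l: "l = grad v (\<gamma> s) \<bullet> (z - x)" by (rule DERIV_unique)
  have "v x = - (T * l)" using eq vT by (simp add: \<gamma>_def)
  also have "\<dots> \<le> 1 * (norm (grad v (\<gamma> s)) * norm (x - z))"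
  proof -
    have "- (T * l) \<le> T * \<bar>l\<bar>" using T0 by (metis abs_ge_minus_self abs_mult abs_of_pos)
    also have "\<dots> \<le> 1 * (norm (grad v (\<gamma> s)) * norm (z - x))"
      using T(1) Cauchy_Schwarz_ineq2[of "grad v (\<gamma> s)" "z - x"] unfolding l by (intro mult_mono) auto
    finally show ?thesis by (simp add: norm_minus_commute)
  qed
  finally have "ennreal (v x) \<le> ennreal (norm (grad v (\<gamma> s)) * norm (x - z))" by (simp add: ennreal_leI)
  also have "\<dots> = ennreal (norm (grad v (\<gamma> s))) * ennreal (norm (x - z))" by (simp add: ennreal_mult)
  also have "\<dots> \<le> (SUP p\<in>Q. ennreal (norm (grad v p))) * ennreal (norm (x - z))"
    by (intro mult_right_mono SUP_upper pQ) auto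
  finally show ?thesis .
qed

context driven_space begin

lemma stopping_time_measurable:
  fixes \<sigma> :: "'w \<Rightarrow> ereal"
  assumes "\<And>\<omega>. 0 \<le> \<sigma> \<omega>" and st: "\<And>t. 0 \<le> t \<Longrightarrow> {\<omega>\<in>space M. \<sigma> \<omega> \<le> ereal t} \<in> sets (F t)"
  shows "\<sigma> \<in> borel_measurable M"
  unfolding borel_measurable_iff_Iic_ereal
proof
  fix c :: ereal
  have eq: "\<sigma> -` {..c} \<inter> space M = {\<omega>\<in>space M. \<sigma> \<omega> \<le> c}" by auto
  show "\<sigma> -` {..c} \<inter> space M \<in> sets M"
  proof (cases "0 \<le> c")
    case True
    show ?thesis
    proof (cases c)
      case (real t)
      then show ?thesis unfolding eq using True st[of t] F_sub[of t] by auto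
    next
      case PInf
      then have "\<sigma> -` {..c} \<inter> space M = space M" by auto
      then show ?thesis by (simp only: sets.top)
    qed (use True in auto)
  next
    case False
    then have "\<sigma> -` {..c} \<inter> space M = {}" using assms(1) by (auto dest: order_trans)
    then show ?thesis by (simp only: sets.empty_sets)
  qed
qed

lemma process_at_random_time:
  fixes X :: "real \<Rightarrow> 'w \<Rightarrow> 'b::metric_space"
  assumes X: "adapted F X" "continuous_paths M X" and \<rho>: "\<rho> \<in> borel_measurable M" "\<And>\<omega>. \<omega> \<in> space M \<Longrightarrow> 0 \<le> \<rho> \<omega>"
  shows "(\<lambda>\<omega>. X (\<rho> \<omega>) \<omega>) \<in> borel_measurable M"
proof (rule borel_measurable_LIMSEQ_metric[where f="\<lambda>n \<omega>. X (max 0 (min (real n) (\<rho> \<omega>))) \<omega>"])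
  fix n :: nat
  have "(\<lambda>\<omega>. (\<omega>, \<rho> \<omega>)) \<in> measurable M (M \<Otimes>\<^sub>M lborel)" using \<rho>(1) by (intro measurable_Pair) auto
  from measurable_compose[OF this progressive_clamp(2)[OF adapted_continuous_progressive[OF X], of "real n"]]
  show "(\<lambda>\<omega>. X (max 0 (min (real n) (\<rho> \<omega>))) \<omega>) \<in> borel_measurable M" by simp
next
  fix \<omega> assume w: "\<omega> \<in> space M"
  obtain n0 where n0: "\<rho> \<omega> \<le> real n0" using real_arch_simple by blast
  have "\<forall>\<^sub>F n in sequentially. X (max 0 (min (real n) (\<rho> \<omega>))) \<omega> = X (\<rho> \<omega>) \<omega>"
    using eventually_ge_at_top[of n0]
  proof eventually_elim
    case (elim n)
    then have "\<rho> \<omega> \<le> real n" using n0 by linarith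
    then show ?case using \<rho>(2)[OF w] by (simp add: min_absorb2)
  qed
  then show "(\<lambda>n. X (max 0 (min (real n) (\<rho> \<omega>))) \<omega>) \<longlonglongrightarrow> X (\<rho> \<omega>) \<omega>" by (rule tendsto_eventually)
qed

end

section \<open>Mean exit times and the Dirichlet problem\<close>

lemma continuous_on_matrix_components:
  fixes g :: "real^'n::finite \<Rightarrow> real^'d::finite^'m::finite"
  assumes "\<And>j k. continuous_on S (\<lambda>x. g x $ j $ k)"
  shows "continuous_on S g"
proof -
  have "continuous_on S (\<lambda>x. \<chi> j. \<chi> k. g x $ j $ k)" by (intro continuous_intros assms)
  then show ?thesis by simp
qed

lemma continuous_on_vector_components:
  fixes g :: "real^'n::finite \<Rightarrow> real^'m::finite"
  assumes "\<And>j. continuous_on S (\<lambda>x. g x $ j)"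
  shows "continuous_on S g"
proof -
  have "continuous_on S (\<lambda>x. \<chi> j. g x $ j)" by (intro continuous_intros assms)
  then show ?thesis by simp
qed

lemma compact_norm_bound:
  fixes h :: "'x::topological_space \<Rightarrow> 'y::real_normed_vector"
  assumes "compact C" "continuous_on UNIV h"
  obtains B where "0 \<le> B" "\<And>x. x \<in> C \<Longrightarrow> norm (h x) \<le> B"
proof -
  have "bounded (h ` C)"
    by (rule compact_imp_bounded[OF compact_continuous_image[OF continuous_on_subset[OF assms(2)] assms(1)]]) auto
  then obtain B where "B > 0" "\<And>x. x \<in> C \<Longrightarrow> norm (h x) \<le> B" unfolding bounded_pos by auto
  then show thesis using that[of B] by simp
qed

context driven_space begin

context
  fixes Q :: "(real^'n::finite) set" and f :: "real^'n \<Rightarrow> real^'n" and \<beta> :: "real^'n \<Rightarrow> real^'d^'n"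
    and a :: "'w \<Rightarrow> real^'n" and y :: "real \<Rightarrow> 'w \<Rightarrow> real^'n" and v :: "real^'n \<Rightarrow> real"
  assumes Q: "open Q" "bounded Q" and fc: "continuous_on UNIV f" and bc: "continuous_on UNIV \<beta>"
    and a: "AE \<omega> in M. a \<omega> \<in> closure Q" and y: "sde_solution M F w f \<beta> a y" and v: "dirichlet_solution Q f \<beta> v"
begin

definition inner_region :: "nat \<Rightarrow> (real^'n) set" where
  "inner_region m = {x. infdist x (- Q) > 1 / real (Suc m)}"
definition inner_core :: "nat \<Rightarrow> (real^'n) set" where
  "inner_core m = {x. infdist x (- Q) \<ge> 1 / real (Suc m)}"
text \<open>The cut-off makes \<open>v\<close> Borel measurable and bounded; nothing is assumed about \<open>v\<close> off the closure.\<close>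

definition vcl :: "real^'n \<Rightarrow> real" where "vcl x = indicator (closure Q) x *\<^sub>R v x"

lemma outside: "- Q \<noteq> {}"
proof
  assume "- Q = {}"
  then have "bounded (UNIV :: (real^'n) set)" using Q(2) by (metis Compl_empty_eq double_complement)
  then show False using not_bounded_UNIV by blast
qed

lemma inner_region_open: "open (inner_region m)"
  unfolding inner_region_def by (intro open_Collect_less continuous_intros)

lemma inner_core_compact: "compact (inner_core m)" and inner_core_subset: "inner_core m \<subseteq> Q"
proof -
  show s: "inner_core m \<subseteq> Q"
  proof
    fix x assume x: "x \<in> inner_core m"
    show "x \<in> Q"
    proof (rule ccontr)
      assume "x \<notin> Q"
      then have "infdist x (- Q) = 0" by simp
      with x show False by (simp add: inner_core_def)
    qed
  qed
  have "closed (inner_core m)" unfolding inner_core_def by (intro closed_Collect_le continuous_intros)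
  then show "compact (inner_core m)" using bounded_subset[OF Q(2) s] by (simp add: compact_eq_bounded_closed)
qed

lemma inner_region_core: "inner_region m \<subseteq> inner_core m" by (auto simp: inner_region_def inner_core_def)

lemma y_adapted: "adapted F y" and y_paths: "continuous_paths M y" and y_start: "AE \<omega> in M. y 0 \<omega> = a \<omega>"
  using y by (auto simp: sde_solution_def)

lemma y_cont: "\<omega> \<in> space M \<Longrightarrow> continuous_on {0..} (\<lambda>t. y t \<omega>)"
  using y_paths by (simp add: continuous_paths_def)

lemma v_facts: "continuous_on (closure Q) v" "Ck_on 2 Q v" "\<And>x. x \<in> Q \<Longrightarrow> generator f \<beta> v x = -1"
  "\<And>x. x \<in> frontier Q \<Longrightarrow> v x = 0" "\<And>x. x \<in> Q \<Longrightarrow> v differentiable (at x)"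
  using v by (auto simp: dirichlet_solution_def C2_up_to_boundary_def numeral_2_eq_2)

lemma v_bounded: obtains B where "0 \<le> B" "\<And>x. \<bar>vcl x\<bar> \<le> B"
proof -
  have "compact (closure Q)" using Q(2) by (simp add: compact_closure)
  then have "bounded (v ` closure Q)" by (intro compact_imp_bounded compact_continuous_image v_facts(1))
  then obtain B where "B > 0" "\<And>x. x \<in> closure Q \<Longrightarrow> \<bar>v x\<bar> \<le> B" unfolding bounded_pos by force
  then show thesis by (intro that[of B]) (auto simp: vcl_def indicator_def)
qed

lemma vcl_measurable: "vcl \<in> borel_measurable borel"
  unfolding vcl_def[abs_def] by (intro borel_measurable_continuous_on_indicator v_facts(1)) simp

lemma dynkin_inner:
  fixes \<tau> :: "'w \<Rightarrow> real"
  assumes \<tau>: "\<And>\<omega>. \<omega> \<in> space M \<Longrightarrow> 0 \<le> \<tau> \<omega> \<and> \<tau> \<omega> \<le> K" and K: "0 < K"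
    and stop: "\<And>r. 0 \<le> r \<Longrightarrow> {\<omega>\<in>space M. \<tau> \<omega> \<le> r} \<in> sets (F r)"
    and inC: "\<And>\<omega> r. \<omega> \<in> space M \<Longrightarrow> 0 \<le> r \<Longrightarrow> r < \<tau> \<omega> \<Longrightarrow> y r \<omega> \<in> inner_core m"
  shows "integrable M (\<lambda>\<omega>. v (y (\<tau> \<omega>) \<omega>) - v (y 0 \<omega>))"
    "expectation (\<lambda>\<omega>. v (y (\<tau> \<omega>) \<omega>) - v (y 0 \<omega>)) = - expectation \<tau>"
    "\<And>\<omega>. \<omega> \<in> space M \<Longrightarrow> 0 < \<tau> \<omega> \<Longrightarrow> y (\<tau> \<omega>) \<omega> \<in> Q \<and> y 0 \<omega> \<in> Q"
    "\<tau> \<in> borel_measurable M"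
proof -
  obtain I where I: "ito_integral M F w (\<lambda>s \<omega>. \<beta> (y s \<omega>)) I"
    "AE \<omega> in M. \<forall>t\<ge>0. y t \<omega> = a \<omega> + (LINT s:{0..t}|lborel. f (y s \<omega>)) + I t \<omega>"
    using y by (auto simp: sde_solution_def)
  note C = inner_core_compact[of m]
  obtain R where R: "0 \<le> R" "\<And>x. x \<in> inner_core m \<Longrightarrow> norm (id x) \<le> R" using compact_norm_bound[OF C continuous_on_id'] by blast
  obtain Cf where Cf: "0 \<le> Cf" "\<And>x. x \<in> inner_core m \<Longrightarrow> norm (f x) \<le> Cf" using compact_norm_bound[OF C fc] by blast
  obtain Cb where Cb: "0 \<le> Cb" "\<And>x. x \<in> inner_core m \<Longrightarrow> norm (\<beta> x) \<le> Cb" using compact_norm_bound[OF C bc] by blast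
  interpret D: stopped_diffusion_C2 M F w y f \<beta> a I \<tau> K R Cf Cb "inner_core m" v Q
    
  proof unfold_locales
    show "norm x \<le> R" if "x \<in> inner_core m" for x using R(2)[OF that] by simp
  qed (fact y_adapted y_paths I fc bc K \<tau> stop C inC R(1) Cf Cb Q(1) inner_core_subset v_facts(2))+
  show "integrable M (\<lambda>\<omega>. v (y (\<tau> \<omega>) \<omega>) - v (y 0 \<omega>))" by (rule D.dynkin(1))
  show "\<tau> \<in> borel_measurable M" by (rule D.\<tau>_measurable)
  show "y (\<tau> \<omega>) \<omega> \<in> Q \<and> y 0 \<omega> \<in> Q" if "\<omega> \<in> space M" "0 < \<tau> \<omega>" for \<omega>
    using D.y_in_C[OF that(1), of "\<tau> \<omega>"] D.y_in_C[OF that(1), of 0] that(2) inner_core_subset by auto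
  have "(\<integral>r. indicator {0<..\<tau> \<omega>} r * generator f \<beta> v (y r \<omega>) \<partial>lborel) = - \<tau> \<omega>" if w: "\<omega> \<in> space M" for \<omega>
  proof -
    have "(\<integral>r. indicator {0<..\<tau> \<omega>} r * generator f \<beta> v (y r \<omega>) \<partial>lborel) = (\<integral>r. - indicator {0<..\<tau> \<omega>} r \<partial>lborel)"
    proof (intro Bochner_Integration.integral_cong refl)
      fix r
      show "indicator {0<..\<tau> \<omega>} r * generator f \<beta> v (y r \<omega>) = - indicator {0<..\<tau> \<omega>} r"
        using v_facts(3)[OF subsetD[OF inner_core_subset D.y_in_C[OF w, of r]]] by (cases "0 < r \<and> r \<le> \<tau> \<omega>") auto
    qed
    then show ?thesis using \<tau>[OF w] by simp
  qed
  then show "expectation (\<lambda>\<omega>. v (y (\<tau> \<omega>) \<omega>) - v (y 0 \<omega>)) = - expectation \<tau>"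
    unfolding D.dynkin(2) Bochner_Integration.integral_minus[symmetric] by (intro Bochner_Integration.integral_cong[OF refl]) simp
qed

context
  fixes \<sigma> :: "'w \<Rightarrow> ereal"
  assumes \<sigma>0: "\<And>\<omega>. 0 \<le> \<sigma> \<omega>" and \<sigma>le: "\<And>\<omega>. \<sigma> \<omega> \<le> exit_time Q y \<omega>"
    and \<sigma>stop: "\<forall>t\<ge>0. {\<omega>\<in>space M. \<sigma> \<omega> \<le> ereal t} \<in> sets (F t)"
begin

definition \<tau>s :: "nat \<Rightarrow> 'w \<Rightarrow> ereal" where
  "\<tau>s m \<omega> = min (min (\<sigma> \<omega>) (exit_time (inner_region m) y \<omega>)) (ereal (real (Suc m)))"
definition \<tau>r :: "nat \<Rightarrow> 'w \<Rightarrow> real" where "\<tau>r m \<omega> = real_of_ereal (\<tau>s m \<omega>)"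

lemma \<tau>s_real: "\<tau>s m \<omega> = ereal (\<tau>r m \<omega>)" and \<tau>r_bounds: "0 \<le> \<tau>r m \<omega>" "\<tau>r m \<omega> \<le> real (Suc m)"
proof -
  have 0: "0 \<le> \<tau>s m \<omega>" unfolding \<tau>s_def using \<sigma>0[of \<omega>] exit_time_nonneg[of "inner_region m" y \<omega>] by simp
  have 1: "\<tau>s m \<omega> \<le> ereal (real (Suc m))" unfolding \<tau>s_def by simp
  show r: "\<tau>s m \<omega> = ereal (\<tau>r m \<omega>)" using 0 1 by (cases "\<tau>s m \<omega>") (auto simp: \<tau>r_def)
  show "0 \<le> \<tau>r m \<omega>" "\<tau>r m \<omega> \<le> real (Suc m)" using 0 1 unfolding r by auto
qed

lemma \<tau>r_stop:
  assumes r: "0 \<le> r" shows "{\<omega>\<in>space M. \<tau>r m \<omega> \<le> r} \<in> sets (F r)"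
proof -
  have "{\<omega>\<in>space M. \<tau>r m \<omega> \<le> r} = {\<omega>\<in>space M. \<sigma> \<omega> \<le> ereal r} \<union> {\<omega>\<in>space M. exit_time (inner_region m) y \<omega> \<le> ereal r}
    \<union> (if real (Suc m) \<le> r then space (F r) else {})"
  proof -
    have "\<tau>r m \<omega> \<le> r \<longleftrightarrow> \<sigma> \<omega> \<le> ereal r \<or> exit_time (inner_region m) y \<omega> \<le> ereal r \<or> real (Suc m) \<le> r" for \<omega>
    proof -
      have "\<tau>r m \<omega> \<le> r \<longleftrightarrow> \<tau>s m \<omega> \<le> ereal r" unfolding \<tau>s_real by simp
      then show ?thesis unfolding \<tau>s_def min_le_iff_disj by simp
    qed
    then show ?thesis using F_space[OF r] by auto
  qed
  also have "\<dots> \<in> sets (F r)"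
    by (intro sets.Un \<sigma>stop[rule_format] exit_time_stopping[OF y_adapted y_paths inner_region_open] r) auto
  finally show ?thesis .
qed

lemma \<tau>r_inside: "0 \<le> r \<Longrightarrow> r < \<tau>r m \<omega> \<Longrightarrow> y r \<omega> \<in> inner_core m"
proof -
  assume r: "0 \<le> r" "r < \<tau>r m \<omega>"
  then have "ereal r < \<tau>s m \<omega>" unfolding \<tau>s_real by simp
  then have "ereal r < exit_time (inner_region m) y \<omega>" unfolding \<tau>s_def by simp
  then show "y r \<omega> \<in> inner_core m" by (rule subsetD[OF inner_region_core before_exit_time[OF r(1)]])
qed

lemma \<tau>s_le: "ereal (\<tau>r m \<omega>) \<le> \<sigma> \<omega>" unfolding \<tau>s_real[symmetric] \<tau>s_def by (simp add: min.coboundedI1)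

lemma \<tau>s_tendsto:
  assumes w: "\<omega> \<in> space M" shows "(\<lambda>m. ereal (\<tau>r m \<omega>)) \<longlonglongrightarrow> \<sigma> \<omega>"
proof (rule order_tendstoI)
  fix c assume c: "c < \<sigma> \<omega>"
  show "\<forall>\<^sub>F m in sequentially. c < ereal (\<tau>r m \<omega>)"
  proof (cases "c < 0")
    case True
    then show ?thesis using \<tau>r_bounds(1) by (intro always_eventually allI) (meson ereal_less_eq(5) less_le_trans)
  next
    case False
    obtain t where t: "c < ereal t" "ereal t < \<sigma> \<omega>" using ereal_dense2[OF c] by blast
    have t0: "0 \<le> t" using t False by (cases c) (auto simp: zero_ereal_def not_less)
    have inQ: "y s \<omega> \<in> Q" if "s \<in> {0..t}" for s
    proof (rule before_exit_time[where X=y and G=Q])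
      show "ereal s < exit_time Q y \<omega>" using that t(2) \<sigma>le[of \<omega>] by (meson atLeastAtMost_iff ereal_less_eq(3) le_less_trans less_le_trans)
    qed (use that in simp)
    have "continuous_on {0..t} (\<lambda>s. infdist (y s \<omega>) (- Q))"
      by (intro continuous_intros continuous_on_subset[OF y_cont[OF w]]) auto
    then obtain s where s: "s \<in> {0..t}" "\<And>r. r \<in> {0..t} \<Longrightarrow> infdist (y s \<omega>) (- Q) \<le> infdist (y r \<omega>) (- Q)"
      using continuous_attains_inf[OF compact_Icc, of 0 t] t0 by fastforce
    have cl: "closed (- Q)" using Q(1) by auto
    have "0 < infdist (y s \<omega>) (- Q)"
      using in_closed_iff_infdist_zero[OF cl outside, of "y s \<omega>"] inQ[OF s(1)] infdist_nonneg[of "y s \<omega>" "- Q"] by auto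
    then obtain m0 where m0: "1 / real (Suc m0) < infdist (y s \<omega>) (- Q)" using nat_approx_posE by blast
    obtain m1 where m1: "t < real m1" using reals_Archimedean2 by blast
    show ?thesis
      using eventually_ge_at_top[of m0] eventually_ge_at_top[of m1]
    proof eventually_elim
      case (elim m)
      have "1 / real (Suc m) \<le> 1 / real (Suc m0)" using elim by (simp add: frac_le)
      then have "y r \<omega> \<in> inner_region m" if "r \<in> {0..t}" for r using m0 s(2)[OF that] by (simp add: inner_region_def)
      then have "\<not> exit_time (inner_region m) y \<omega> \<le> ereal t"
        using exit_time_le_iff[where X=y and \<omega>=\<omega>, OF y_cont[OF w] inner_region_open t0] by auto
      then have "ereal t < \<tau>s m \<omega>" unfolding \<tau>s_def using t(2) m1 elim by simp
      with t(1) show "c < ereal (\<tau>r m \<omega>)" unfolding \<tau>s_real by (rule less_trans)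
    qed
  qed
next
  fix c assume c: "\<sigma> \<omega> < c"
  show "\<forall>\<^sub>F m in sequentially. ereal (\<tau>r m \<omega>) < c"
    by (intro always_eventually allI le_less_trans[OF \<tau>s_le c])
qed

lemma \<tau>r_dynkin:
  "integrable M (\<lambda>\<omega>. v (y (\<tau>r m \<omega>) \<omega>) - v (y 0 \<omega>))"
  "expectation (\<lambda>\<omega>. v (y (\<tau>r m \<omega>) \<omega>) - v (y 0 \<omega>)) = - expectation (\<tau>r m)"
  "\<And>\<omega>. \<omega> \<in> space M \<Longrightarrow> 0 < \<tau>r m \<omega> \<Longrightarrow> y (\<tau>r m \<omega>) \<omega> \<in> Q \<and> y 0 \<omega> \<in> Q"
  "\<tau>r m \<in> borel_measurable M"
  proof -
  have 1: "0 \<le> \<tau>r m \<omega> \<and> \<tau>r m \<omega> \<le> real (Suc m)" for \<omega> by (intro conjI \<tau>r_bounds)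
  note * = dynkin_inner[of "\<tau>r m" "real (Suc m)" m, OF 1 _ \<tau>r_stop \<tau>r_inside]
  show "integrable M (\<lambda>\<omega>. v (y (\<tau>r m \<omega>) \<omega>) - v (y 0 \<omega>))" by (rule *(1)) simp_all
  show "expectation (\<lambda>\<omega>. v (y (\<tau>r m \<omega>) \<omega>) - v (y 0 \<omega>)) = - expectation (\<tau>r m)" by (rule *(2)) simp_all
  show "y (\<tau>r m \<omega>) \<omega> \<in> Q \<and> y 0 \<omega> \<in> Q" if "\<omega> \<in> space M" "0 < \<tau>r m \<omega>" for \<omega>
    by (rule *(3)) (simp_all add: that)
  show "\<tau>r m \<in> borel_measurable M" by (rule *(4)) simp_all
qed

lemma start_in_closure: "AE \<omega> in M. y 0 \<omega> \<in> closure Q"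
  using a y_start by eventually_elim simp

lemma \<tau>r_in_closure: "AE \<omega> in M. \<forall>m. y (\<tau>r m \<omega>) \<omega> \<in> closure Q"
  using start_in_closure AE_space
proof eventually_elim
  case (elim \<omega>)
  show ?case
  proof
    fix m show "y (\<tau>r m \<omega>) \<omega> \<in> closure Q"
      using elim \<tau>r_dynkin(3)[of \<omega> m] \<tau>r_bounds(1)[of m \<omega>] closure_subset[of Q] by (cases "\<tau>r m \<omega> = 0") auto
  qed
qed

lemma \<tau>r_diff: "AE \<omega> in M. \<forall>m. v (y (\<tau>r m \<omega>) \<omega>) - v (y 0 \<omega>) = vcl (y (\<tau>r m \<omega>) \<omega>) - vcl (y 0 \<omega>)"
  using start_in_closure \<tau>r_in_closure by eventually_elim (simp add: vcl_def)

lemma \<sigma>_measurable: "\<sigma> \<in> borel_measurable M" by (rule stopping_time_measurable[OF \<sigma>0 \<sigma>stop[rule_format]])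

lemma \<tau>r_mean_bound: "\<exists>B. \<forall>m. expectation (\<tau>r m) \<le> B"
proof -
  obtain B where B: "0 \<le> B" "\<And>x. \<bar>vcl x\<bar> \<le> B" using v_bounded by blast
  have "expectation (\<tau>r m) \<le> 2 * B" for m
  proof -
    have "expectation (\<tau>r m) = expectation (\<lambda>\<omega>. - (v (y (\<tau>r m \<omega>) \<omega>) - v (y 0 \<omega>)))"
      using \<tau>r_dynkin(2)[of m] by (simp only: Bochner_Integration.integral_minus)
    also have "\<dots> \<le> expectation (\<lambda>\<omega>. 2 * B)"
    proof (rule integral_mono_AE)
      show "AE \<omega> in M. - (v (y (\<tau>r m \<omega>) \<omega>) - v (y 0 \<omega>)) \<le> 2 * B"
        using \<tau>r_diff
      proof eventually_elim
        case (elim \<omega>)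
        then show ?case using B(2)[of "y (\<tau>r m \<omega>) \<omega>"] B(2)[of "y 0 \<omega>"] by (simp add: abs_le_iff)
      qed
    qed (rule Bochner_Integration.integrable_minus[OF \<tau>r_dynkin(1)], simp)
    finally show ?thesis by (simp add: prob_space)
  qed
  then show ?thesis by blast
qed

lemma \<sigma>_finite: "AE \<omega> in M. \<sigma> \<omega> \<noteq> \<infinity>" and \<sigma>_integrable: "integrable M (\<lambda>\<omega>. real_of_ereal (\<sigma> \<omega>))"
proof -
  obtain B where B: "\<And>m. expectation (\<tau>r m) \<le> B" using \<tau>r_mean_bound by blast
  have it: "integrable M (\<tau>r m)" for m
    by (rule integrable_const_bound[of _ "real (Suc m)"]) (use \<tau>r_bounds \<tau>r_dynkin(4) in auto)
  have "(\<integral>\<^sup>+\<omega>. e2ennreal (\<sigma> \<omega>) \<partial>M) = (\<integral>\<^sup>+\<omega>. liminf (\<lambda>m. ennreal (\<tau>r m \<omega>)) \<partial>M)"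
  proof (rule nn_integral_cong)
    fix \<omega> assume w: "\<omega> \<in> space M"
    have "(\<lambda>m. e2ennreal (ereal (\<tau>r m \<omega>))) \<longlonglongrightarrow> e2ennreal (\<sigma> \<omega>)" by (intro tendsto_e2ennrealI \<tau>s_tendsto w)
    then have "(\<lambda>m. ennreal (\<tau>r m \<omega>)) \<longlonglongrightarrow> e2ennreal (\<sigma> \<omega>)" by simp
    from lim_imp_Liminf[OF trivial_limit_sequentially this]
    show "e2ennreal (\<sigma> \<omega>) = liminf (\<lambda>m. ennreal (\<tau>r m \<omega>))" by simp
  qed
  also have "\<dots> \<le> liminf (\<lambda>m. \<integral>\<^sup>+\<omega>. ennreal (\<tau>r m \<omega>) \<partial>M)"
    using \<tau>r_dynkin(4) by (intro nn_integral_liminf) auto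
  also have "\<dots> \<le> liminf (\<lambda>m::nat. ennreal B)"
  proof (intro Liminf_mono always_eventually allI)
    fix m show "(\<integral>\<^sup>+\<omega>. ennreal (\<tau>r m \<omega>) \<partial>M) \<le> ennreal B"
      by (subst nn_integral_eq_integral[OF it]) (use \<tau>r_bounds B in \<open>auto intro: ennreal_leI\<close>)
  qed
  also have "\<dots> = ennreal B" by (simp add: Liminf_const)
  finally have fin: "(\<integral>\<^sup>+\<omega>. e2ennreal (\<sigma> \<omega>) \<partial>M) < \<infinity>" by (simp add: le_less_trans)
  have m: "(\<lambda>\<omega>. e2ennreal (\<sigma> \<omega>)) \<in> borel_measurable M" using \<sigma>_measurable by measurable
  have "AE \<omega> in M. e2ennreal (\<sigma> \<omega>) \<noteq> \<infinity>" by (rule nn_integral_PInf_AE[OF m]) (use fin in simp)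
  then show f: "AE \<omega> in M. \<sigma> \<omega> \<noteq> \<infinity>" by eventually_elim auto
  show "integrable M (\<lambda>\<omega>. real_of_ereal (\<sigma> \<omega>))"
  proof (rule integrableI_bounded)
    show "(\<lambda>\<omega>. real_of_ereal (\<sigma> \<omega>)) \<in> borel_measurable M" using \<sigma>_measurable by measurable
    have "(\<integral>\<^sup>+\<omega>. ennreal (norm (real_of_ereal (\<sigma> \<omega>))) \<partial>M) = (\<integral>\<^sup>+\<omega>. e2ennreal (\<sigma> \<omega>) \<partial>M)"
    proof (rule nn_integral_cong_AE)
      show "AE \<omega> in M. ennreal (norm (real_of_ereal (\<sigma> \<omega>))) = e2ennreal (\<sigma> \<omega>)"
        using f
      proof eventually_elim
        case (elim \<omega>)
        then obtain r where "\<sigma> \<omega> = ereal r" "0 \<le> r" using \<sigma>0[of \<omega>] by (cases "\<sigma> \<omega>") auto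
        then show ?case by simp
      qed
    qed
    then show "(\<integral>\<^sup>+\<omega>. ennreal (norm (real_of_ereal (\<sigma> \<omega>))) \<partial>M) < \<infinity>" using fin by simp
  qed
qed

lemma \<tau>r_tendsto: "AE \<omega> in M. (\<lambda>m. \<tau>r m \<omega>) \<longlonglongrightarrow> real_of_ereal (\<sigma> \<omega>)"
  using \<sigma>_finite AE_space
proof eventually_elim
  case (elim \<omega>)
  then obtain r where "\<sigma> \<omega> = ereal r" using \<sigma>0[of \<omega>] by (cases "\<sigma> \<omega>") auto
  then show ?case using \<tau>s_tendsto[OF elim(2)] by simp
qed

lemma y\<sigma>_limit: "AE \<omega> in M. y (real_of_ereal (\<sigma> \<omega>)) \<omega> \<in> closure Q \<and>
    (\<lambda>m. y (\<tau>r m \<omega>) \<omega>) \<longlonglongrightarrow> y (real_of_ereal (\<sigma> \<omega>)) \<omega>"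
  using \<tau>r_tendsto \<tau>r_in_closure AE_space
proof eventually_elim
  case (elim \<omega>)
  have l: "(\<lambda>m. y (\<tau>r m \<omega>) \<omega>) \<longlonglongrightarrow> y (real_of_ereal (\<sigma> \<omega>)) \<omega>"
    by (rule continuous_on_tendsto_compose[OF y_cont[OF elim(3)] elim(1)])
       (use \<tau>r_bounds \<sigma>0 in \<open>auto simp: real_of_ereal_pos\<close>)
  have "y (real_of_ereal (\<sigma> \<omega>)) \<omega> \<in> closure Q"
    by (rule closed_sequentially[OF closed_closure _ l]) (use elim(2) in blast)
  with l show ?case by blast
qed

lemma y\<sigma>_in_closure: "AE \<omega> in M. y (real_of_ereal (\<sigma> \<omega>)) \<omega> \<in> closure Q"
  using y\<sigma>_limit by eventually_elim blast

lemma y\<sigma>_measurable: "(\<lambda>\<omega>. y (real_of_ereal (\<sigma> \<omega>)) \<omega>) \<in> borel_measurable M"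
  by (rule process_at_random_time[OF y_adapted y_paths]) (use \<sigma>_measurable \<sigma>0 in \<open>auto simp: real_of_ereal_pos\<close>)

lemma y0_measurable: "y 0 \<in> borel_measurable M"
  using y_adapted F_measurable_M[of 0] by (auto simp: adapted_def)

lemma vcl_integrable: "g \<in> borel_measurable M \<Longrightarrow> integrable M (\<lambda>\<omega>. vcl (g \<omega>))"
proof -
  assume g: "g \<in> borel_measurable M"
  obtain B where B: "0 \<le> B" "\<And>x. \<bar>vcl x\<bar> \<le> B" using v_bounded by blast
  show ?thesis by (rule integrable_const_bound[of _ B]) (use B measurable_compose[OF g vcl_measurable] in auto)
qed

lemma mean_stopping_time:
  "expectation (\<lambda>\<omega>. real_of_ereal (\<sigma> \<omega>)) =
     expectation (\<lambda>\<omega>. vcl (y 0 \<omega>)) - expectation (\<lambda>\<omega>. vcl (y (real_of_ereal (\<sigma> \<omega>)) \<omega>))"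
proof -
  obtain B where B: "0 \<le> B" "\<And>x. \<bar>vcl x\<bar> \<le> B" using v_bounded by blast
  have ym: "(\<lambda>\<omega>. y (\<tau>r m \<omega>) \<omega>) \<in> borel_measurable M" for m
    by (rule process_at_random_time[OF y_adapted y_paths \<tau>r_dynkin(4)]) (rule \<tau>r_bounds)
  have 1: "(\<lambda>m. expectation (\<tau>r m)) \<longlonglongrightarrow> expectation (\<lambda>\<omega>. real_of_ereal (\<sigma> \<omega>))"
  proof (rule integral_dominated_convergence[OF _ _ \<sigma>_integrable])
    show "AE \<omega> in M. norm (\<tau>r m \<omega>) \<le> real_of_ereal (\<sigma> \<omega>)" for m
      using \<sigma>_finite
    proof eventually_elim
      case (elim \<omega>)
      then obtain r where "\<sigma> \<omega> = ereal r" using \<sigma>0[of \<omega>] by (cases "\<sigma> \<omega>") auto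
      then show ?case using \<tau>s_le[of m \<omega>] \<tau>r_bounds(1)[of m \<omega>] by simp
    qed
  qed (use \<tau>r_dynkin(4) \<tau>r_tendsto borel_measurable_integrable[OF \<sigma>_integrable] in auto)
  have 2: "(\<lambda>m. expectation (\<lambda>\<omega>. vcl (y (\<tau>r m \<omega>) \<omega>))) \<longlonglongrightarrow> expectation (\<lambda>\<omega>. vcl (y (real_of_ereal (\<sigma> \<omega>)) \<omega>))"
  proof (rule integral_dominated_convergence[where w="\<lambda>_. B"])
    show "AE \<omega> in M. (\<lambda>m. vcl (y (\<tau>r m \<omega>) \<omega>)) \<longlonglongrightarrow> vcl (y (real_of_ereal (\<sigma> \<omega>)) \<omega>)"
      using y\<sigma>_limit \<tau>r_in_closure
    proof eventually_elim
      case (elim \<omega>)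
      have "(\<lambda>m. v (y (\<tau>r m \<omega>) \<omega>)) \<longlonglongrightarrow> v (y (real_of_ereal (\<sigma> \<omega>)) \<omega>)"
        by (rule continuous_on_tendsto_compose[OF v_facts(1)]) (use elim in auto)
      then show ?case using elim by (simp add: vcl_def)
    qed
  qed (use B measurable_compose[OF ym vcl_measurable] measurable_compose[OF y\<sigma>_measurable vcl_measurable] in auto)
  have 3: "expectation (\<tau>r m) = expectation (\<lambda>\<omega>. vcl (y 0 \<omega>)) - expectation (\<lambda>\<omega>. vcl (y (\<tau>r m \<omega>) \<omega>))" for m
  proof -
    have "expectation (\<lambda>\<omega>. v (y (\<tau>r m \<omega>) \<omega>) - v (y 0 \<omega>)) = expectation (\<lambda>\<omega>. vcl (y (\<tau>r m \<omega>) \<omega>) - vcl (y 0 \<omega>))"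
    proof (rule integral_cong_AE)
      show "AE \<omega> in M. v (y (\<tau>r m \<omega>) \<omega>) - v (y 0 \<omega>) = vcl (y (\<tau>r m \<omega>) \<omega>) - vcl (y 0 \<omega>)"
        using \<tau>r_diff by eventually_elim blast
      show "(\<lambda>\<omega>. vcl (y (\<tau>r m \<omega>) \<omega>) - vcl (y 0 \<omega>)) \<in> borel_measurable M"
        by (intro borel_measurable_diff measurable_compose[OF ym vcl_measurable] measurable_compose[OF y0_measurable vcl_measurable])
    qed (rule borel_measurable_integrable[OF \<tau>r_dynkin(1)])
    also have "\<dots> = expectation (\<lambda>\<omega>. vcl (y (\<tau>r m \<omega>) \<omega>)) - expectation (\<lambda>\<omega>. vcl (y 0 \<omega>))"
      by (intro Bochner_Integration.integral_diff vcl_integrable ym y0_measurable)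
    finally show ?thesis using \<tau>r_dynkin(2)[of m] by linarith
  qed
  have "(\<lambda>m. expectation (\<tau>r m)) \<longlonglongrightarrow> expectation (\<lambda>\<omega>. vcl (y 0 \<omega>)) - expectation (\<lambda>\<omega>. vcl (y (real_of_ereal (\<sigma> \<omega>)) \<omega>))"
    unfolding 3 by (intro tendsto_intros 2)
  with 1 show ?thesis by (rule LIMSEQ_unique)
qed

lemmas exit_results = \<sigma>_finite \<sigma>_integrable y\<sigma>_in_closure y\<sigma>_measurable
  vcl_integrable[unfolded vcl_def] mean_stopping_time[unfolded vcl_def]

end

end

end

theorem mainTheorem1:
  fixes Q :: "(real^'n::finite) set"
    and M :: "'w measure" and F :: "real \<Rightarrow> 'w measure"
    and w :: "real \<Rightarrow> 'w \<Rightarrow> real^'d::finite"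
    and f :: "nat \<Rightarrow> real^'n \<Rightarrow> real^'n"
    and \<beta> :: "nat \<Rightarrow> real^'n \<Rightarrow> real^'d^'n"
    and a :: "nat \<Rightarrow> 'w \<Rightarrow> real^'n"
    and y :: "nat \<Rightarrow> real \<Rightarrow> 'w \<Rightarrow> real^'n"
    and v :: "nat \<Rightarrow> real^'n \<Rightarrow> real"
    and T :: "nat \<Rightarrow> 'w \<Rightarrow> ereal" and T\<^sub>m\<^sub>i\<^sub>n :: "'w \<Rightarrow> ereal"
  assumes Q: "open Q" "connected Q" "bounded Q" "simply_connected Q" "smooth_boundary Q"
    and M: "standard_prob_space M"
    and F: "right_continuous_filtration M F"
    and w: "wiener_process M F w"
    and f: "\<And>i j. i \<in> {1, 2} \<Longrightarrow> Ck_on 1 UNIV (\<lambda>x. f i x $ j)"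
    and \<beta>: "\<And>i j k. i \<in> {1, 2} \<Longrightarrow> Ck_on 1 UNIV (\<lambda>x. \<beta> i x $ j $ k)"
    and b: "\<And>i. i \<in> {1, 2} \<Longrightarrow>
          eigenvalues_bounded_away_from_zero Q (diffusion_matrix (\<beta> i))"
    and a: "\<And>i. i \<in> {1, 2} \<Longrightarrow> a i \<in> borel_measurable (F 0)"
      "\<And>i. i \<in> {1, 2} \<Longrightarrow> AE \<omega> in M. a i \<omega> \<in> closure Q"
    and y: "\<And>i. i \<in> {1, 2} \<Longrightarrow> sde_solution M F w (f i) (\<beta> i) (a i) (y i)"
    and v: "\<And>i. i \<in> {1, 2} \<Longrightarrow> dirichlet_solution Q (f i) (\<beta> i) (v i)"
    and T: "\<And>i \<omega>. i \<in> {1, 2} \<Longrightarrow> T i \<omega> = exit_time Q (y i) \<omega>"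
    and T\<^sub>m\<^sub>i\<^sub>n: "\<And>\<omega>. T\<^sub>m\<^sub>i\<^sub>n \<omega> = min (T 1 \<omega>) (T 2 \<omega>)"
  shows "(\<integral>\<^sup>+\<omega>. e2ennreal \<bar>T 1 \<omega> - T 2 \<omega>\<bar> \<partial>M)
      \<le> (MAX i\<in>{1, 2}. SUP x\<in>Q. ennreal (norm (grad (v i) x))) *
        (\<integral>\<^sup>+\<omega>. ennreal (norm (y 1 (real_of_ereal (T\<^sub>m\<^sub>i\<^sub>n \<omega>)) \<omega> -
                              y 2 (real_of_ereal (T\<^sub>m\<^sub>i\<^sub>n \<omega>)) \<omega>)) \<partial>M)"
proof -
  interpret driven_space M F w
    using M F w by (simp add: driven_space_def driven_space_axioms_def standard_prob_space_def)
  define g where "g i x = indicator (closure Q) x *\<^sub>R v i x" for i x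
  define S where "S i = (SUP x\<in>Q. ennreal (norm (grad (v i) x)))" for i
  define D where "D \<omega> = norm (y 1 (real_of_ereal (T\<^sub>m\<^sub>i\<^sub>n \<omega>)) \<omega> - y 2 (real_of_ereal (T\<^sub>m\<^sub>i\<^sub>n \<omega>)) \<omega>)" for \<omega>
  have cont: "continuous_on UNIV (f i)" "continuous_on UNIV (\<beta> i)" if "i \<in> {1, 2}" for i
    by (rule continuous_on_vector_components Ck_on_continuous f that)+
       (rule continuous_on_matrix_components Ck_on_continuous \<beta> that)+
  have paths: "adapted F (y i)" "continuous_paths M (y i)" if "i \<in> {1, 2}" for i
    using y[OF that] by (simp_all add: sde_solution_def)
  have T0: "0 \<le> T i \<omega>" if "i \<in> {1, 2}" for i \<omega>
    unfolding T[OF that] by (rule exit_time_nonneg)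
  have Tstop: "\<forall>t\<ge>0. {\<omega>\<in>space M. T i \<omega> \<le> ereal t} \<in> sets (F t)" if "i \<in> {1, 2}" for i
    unfolding T[OF that] by (intro allI impI exit_time_stopping[OF paths[OF that] Q(1)])
  have Tmin_le: "T\<^sub>m\<^sub>i\<^sub>n \<omega> \<le> T i \<omega>" if "i \<in> {1, 2}" for i \<omega>
    using that unfolding T\<^sub>m\<^sub>i\<^sub>n by auto
  have Tmin0: "0 \<le> T\<^sub>m\<^sub>i\<^sub>n \<omega>" for \<omega>
    using T0[of 1 \<omega>] T0[of 2 \<omega>] unfolding T\<^sub>m\<^sub>i\<^sub>n by simp
  have Tmin_stop: "\<forall>t\<ge>0. {\<omega>\<in>space M. T\<^sub>m\<^sub>i\<^sub>n \<omega> \<le> ereal t} \<in> sets (F t)"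
  proof (intro allI impI)
    fix t :: real assume t: "0 \<le> t"
    have "{\<omega>\<in>space M. T\<^sub>m\<^sub>i\<^sub>n \<omega> \<le> ereal t} = {\<omega>\<in>space M. T 1 \<omega> \<le> ereal t} \<union> {\<omega>\<in>space M. T 2 \<omega> \<le> ereal t}"
      unfolding T\<^sub>m\<^sub>i\<^sub>n min_le_iff_disj by auto
    also have "\<dots> \<in> sets (F t)" by (intro sets.Un Tstop[rule_format] t) auto
    finally show "{\<omega>\<in>space M. T\<^sub>m\<^sub>i\<^sub>n \<omega> \<le> ereal t} \<in> sets (F t)" .
  qed
  have at_stop: "AE \<omega> in M. \<sigma> \<omega> \<noteq> \<infinity>" "integrable M (\<lambda>\<omega>. real_of_ereal (\<sigma> \<omega>))"
      "AE \<omega> in M. y i (real_of_ereal (\<sigma> \<omega>)) \<omega> \<in> closure Q"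
      "(\<lambda>\<omega>. y i (real_of_ereal (\<sigma> \<omega>)) \<omega>) \<in> borel_measurable M"
      "integrable M (\<lambda>\<omega>. g i (y i (real_of_ereal (\<sigma> \<omega>)) \<omega>))"
      "expectation (\<lambda>\<omega>. real_of_ereal (\<sigma> \<omega>)) =
         expectation (\<lambda>\<omega>. g i (y i 0 \<omega>)) - expectation (\<lambda>\<omega>. g i (y i (real_of_ereal (\<sigma> \<omega>)) \<omega>))"
    if i: "i \<in> {1, 2}" and \<sigma>: "\<And>\<omega>. 0 \<le> \<sigma> \<omega>" "\<And>\<omega>. \<sigma> \<omega> \<le> exit_time Q (y i) \<omega>"
      "\<forall>t\<ge>0. {\<omega>\<in>space M. \<sigma> \<omega> \<le> ereal t} \<in> sets (F t)" for i \<sigma>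
  proof -
    note r = exit_results[OF Q(1,3) cont[OF i] a(2)[OF i] y[OF i] v[OF i], of \<sigma>, OF \<sigma>]
    show "AE \<omega> in M. \<sigma> \<omega> \<noteq> \<infinity>" by (rule r(1))
    show "integrable M (\<lambda>\<omega>. real_of_ereal (\<sigma> \<omega>))" by (rule r(2))
    show "AE \<omega> in M. y i (real_of_ereal (\<sigma> \<omega>)) \<omega> \<in> closure Q" by (rule r(3))
    show "(\<lambda>\<omega>. y i (real_of_ereal (\<sigma> \<omega>)) \<omega>) \<in> borel_measurable M" by (rule r(4))
    from r(5)[OF this] show "integrable M (\<lambda>\<omega>. g i (y i (real_of_ereal (\<sigma> \<omega>)) \<omega>))" unfolding g_def .
    show "expectation (\<lambda>\<omega>. real_of_ereal (\<sigma> \<omega>)) =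
         expectation (\<lambda>\<omega>. g i (y i 0 \<omega>)) - expectation (\<lambda>\<omega>. g i (y i (real_of_ereal (\<sigma> \<omega>)) \<omega>))"
      unfolding g_def by (rule r(6))
  qed
  have T_le: "T i \<omega> \<le> exit_time Q (y i) \<omega>" if "i \<in> {1, 2}" for i \<omega> using T[OF that] by simp
  note at_T = at_stop[OF _ T0 T_le Tstop]
  note at_min = at_stop[OF _ Tmin0 order_trans[OF Tmin_le T_le] Tmin_stop]
  have gT: "AE \<omega> in M. g i (y i (real_of_ereal (T i \<omega>)) \<omega>) = 0" if i: "i \<in> {1, 2}" for i
    using at_T(1,3)[OF i i i i] AE_space
  proof eventually_elim
    case (elim \<omega>)
    then obtain t where t: "T i \<omega> = ereal t" using T0[OF i, of \<omega>] by (cases "T i \<omega>") auto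
    have "y i t \<omega> \<notin> Q"
      by (rule at_exit_time[where X="y i"]) (use paths(2)[OF i] elim(3) Q(1) t T[OF i] in \<open>auto simp: continuous_paths_def\<close>)
    then have "y i t \<omega> \<in> frontier Q" using elim(2) t Q(1) by (simp add: frontier_def interior_open)
    then show ?case using v[OF i] t by (simp add: g_def dirichlet_solution_def)
  qed
  have g_at_exit: "AE \<omega> in M. T\<^sub>m\<^sub>i\<^sub>n \<omega> = T i \<omega> \<longrightarrow> g i (y i (real_of_ereal (T\<^sub>m\<^sub>i\<^sub>n \<omega>)) \<omega>) = 0" if i: "i \<in> {1, 2}" for i
    using gT[OF i] by eventually_elim simp
  have bound: "AE \<omega> in M. ennreal (g 1 (y 1 (real_of_ereal (T\<^sub>m\<^sub>i\<^sub>n \<omega>)) \<omega>) + g 2 (y 2 (real_of_ereal (T\<^sub>m\<^sub>i\<^sub>n \<omega>)) \<omega>))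
      \<le> (MAX i\<in>{1, 2}. S i) * ennreal (D \<omega>)"
  proof -
    have one: "AE \<omega> in M. T\<^sub>m\<^sub>i\<^sub>n \<omega> = T i \<omega> \<longrightarrow> ennreal (g j (y j (real_of_ereal (T\<^sub>m\<^sub>i\<^sub>n \<omega>)) \<omega>))
      \<le> (MAX i\<in>{1, 2}. S i) * ennreal (D \<omega>)" if ij: "i \<in> {1, 2}" "j \<in> {1, 2}" "i \<noteq> j" for i j
      using at_min(1)[OF ij(1,1,1)] at_min(3)[OF ij(2,2,2)] AE_space
    proof eventually_elim
      case (elim \<omega>)
      show ?case
      proof
        assume eq: "T\<^sub>m\<^sub>i\<^sub>n \<omega> = T i \<omega>"
        obtain t where t: "T\<^sub>m\<^sub>i\<^sub>n \<omega> = ereal t" using elim(1) Tmin0[of \<omega>] by (cases "T\<^sub>m\<^sub>i\<^sub>n \<omega>") auto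
        have out: "y i t \<omega> \<notin> Q"
          by (rule at_exit_time[where X="y i"])
             (use paths(2)[OF ij(1)] elim(3) Q(1) t eq T[OF ij(1)] in \<open>auto simp: continuous_paths_def\<close>)
        have "D \<omega> = norm (y j t \<omega> - y i t \<omega>)" using ij t by (auto simp: D_def norm_minus_commute)
        moreover have "ennreal (v j (y j t \<omega>)) \<le> S j * ennreal (norm (y j t \<omega> - y i t \<omega>))"
          unfolding S_def
          by (rule dirichlet_gradient_bound[OF Q(1) _ _ _ _ out])
             (use v[OF ij(2)] elim(2) t in \<open>auto simp: dirichlet_solution_def C2_up_to_boundary_def numeral_2_eq_2\<close>)
        moreover have "S j \<le> (MAX i\<in>{1, 2}. S i)" by (rule Max_ge) (use ij(2) in auto)
        ultimately show "ennreal (g j (y j (real_of_ereal (T\<^sub>m\<^sub>i\<^sub>n \<omega>)) \<omega>)) \<le> (MAX i\<in>{1, 2}. S i) * ennreal (D \<omega>)"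
          using elim(2) t by (simp add: g_def) (meson mult_right_mono order_trans zero_le)
      qed
    qed
    have 12: "(1::nat) \<in> {1, 2}" "(2::nat) \<in> {1, 2}" "(1::nat) \<noteq> 2" "(2::nat) \<noteq> 1" by auto
    show ?thesis
      using one[OF 12(1,2,3)] one[OF 12(2,1,4)] g_at_exit[OF 12(1)] g_at_exit[OF 12(2)]
    proof eventually_elim
      case (elim \<omega>)
      have "T\<^sub>m\<^sub>i\<^sub>n \<omega> = T 1 \<omega> \<or> T\<^sub>m\<^sub>i\<^sub>n \<omega> = T 2 \<omega>" unfolding T\<^sub>m\<^sub>i\<^sub>n by (simp add: min_def)
      then show ?case using elim by auto
    qed
  qed
  have 12: "(1::nat) \<in> {1, 2}" "(2::nat) \<in> {1, 2}" by auto
  have abs_T: "AE \<omega> in M. e2ennreal \<bar>T 1 \<omega> - T 2 \<omega>\<bar> = ennreal ((real_of_ereal (T 1 \<omega>) - real_of_ereal (T\<^sub>m\<^sub>i\<^sub>n \<omega>)) +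
      (real_of_ereal (T 2 \<omega>) - real_of_ereal (T\<^sub>m\<^sub>i\<^sub>n \<omega>))) \<and>
      0 \<le> (real_of_ereal (T 1 \<omega>) - real_of_ereal (T\<^sub>m\<^sub>i\<^sub>n \<omega>)) + (real_of_ereal (T 2 \<omega>) - real_of_ereal (T\<^sub>m\<^sub>i\<^sub>n \<omega>))"
    using at_T(1)[OF 12(1,1,1,1)] at_T(1)[OF 12(2,2,2,2)]
  proof eventually_elim
    case (elim \<omega>)
    then obtain t1 t2 where "T 1 \<omega> = ereal t1" "T 2 \<omega> = ereal t2"
      using T0[OF 12(1), of \<omega>] T0[OF 12(2), of \<omega>] by (cases "T 1 \<omega>"; cases "T 2 \<omega>") auto
    then show ?case unfolding T\<^sub>m\<^sub>i\<^sub>n by (auto simp: min_def)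
  qed
  have int: "integrable M (\<lambda>\<omega>. real_of_ereal (T i \<omega>) - real_of_ereal (T\<^sub>m\<^sub>i\<^sub>n \<omega>))"
    "expectation (\<lambda>\<omega>. real_of_ereal (T i \<omega>) - real_of_ereal (T\<^sub>m\<^sub>i\<^sub>n \<omega>)) =
       expectation (\<lambda>\<omega>. g i (y i (real_of_ereal (T\<^sub>m\<^sub>i\<^sub>n \<omega>)) \<omega>))" if i: "i \<in> {1, 2}" for i
  proof -
    note T2 = at_T(2)[OF i i i i] and min2 = at_min(2)[OF i i i]
    show "integrable M (\<lambda>\<omega>. real_of_ereal (T i \<omega>) - real_of_ereal (T\<^sub>m\<^sub>i\<^sub>n \<omega>))"
      by (rule Bochner_Integration.integrable_diff[OF T2 min2])
    have "expectation (\<lambda>\<omega>. g i (y i (real_of_ereal (T i \<omega>)) \<omega>)) = 0"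
      by (rule integral_eq_zero_AE[OF gT[OF i]])
    then show "expectation (\<lambda>\<omega>. real_of_ereal (T i \<omega>) - real_of_ereal (T\<^sub>m\<^sub>i\<^sub>n \<omega>)) =
       expectation (\<lambda>\<omega>. g i (y i (real_of_ereal (T\<^sub>m\<^sub>i\<^sub>n \<omega>)) \<omega>))"
      unfolding Bochner_Integration.integral_diff[OF T2 min2] at_T(6)[OF i i i i] at_min(6)[OF i i i] by simp
  qed
  have gint: "integrable M (\<lambda>\<omega>. g 1 (y 1 (real_of_ereal (T\<^sub>m\<^sub>i\<^sub>n \<omega>)) \<omega>) + g 2 (y 2 (real_of_ereal (T\<^sub>m\<^sub>i\<^sub>n \<omega>)) \<omega>))"
    by (intro Bochner_Integration.integrable_add at_min(5) 12)
  have Dm: "D \<in> borel_measurable M"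
    unfolding D_def[abs_def] using at_min(4)[OF 12(1,1,1)] at_min(4)[OF 12(2,2,2)] by measurable
  have "(\<integral>\<^sup>+\<omega>. e2ennreal \<bar>T 1 \<omega> - T 2 \<omega>\<bar> \<partial>M) =
      (\<integral>\<^sup>+\<omega>. ennreal ((real_of_ereal (T 1 \<omega>) - real_of_ereal (T\<^sub>m\<^sub>i\<^sub>n \<omega>)) +
        (real_of_ereal (T 2 \<omega>) - real_of_ereal (T\<^sub>m\<^sub>i\<^sub>n \<omega>))) \<partial>M)"
    by (rule nn_integral_cong_AE) (use abs_T in \<open>eventually_elim, blast\<close>)
  also have "\<dots> = ennreal (expectation (\<lambda>\<omega>. (real_of_ereal (T 1 \<omega>) - real_of_ereal (T\<^sub>m\<^sub>i\<^sub>n \<omega>)) +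
        (real_of_ereal (T 2 \<omega>) - real_of_ereal (T\<^sub>m\<^sub>i\<^sub>n \<omega>))))"
    by (rule nn_integral_eq_integral[OF Bochner_Integration.integrable_add[OF int(1)[OF 12(1)] int(1)[OF 12(2)]]])
       (use abs_T in \<open>eventually_elim, blast\<close>)
  also have "\<dots> = ennreal (expectation (\<lambda>\<omega>. g 1 (y 1 (real_of_ereal (T\<^sub>m\<^sub>i\<^sub>n \<omega>)) \<omega>) + g 2 (y 2 (real_of_ereal (T\<^sub>m\<^sub>i\<^sub>n \<omega>)) \<omega>)))"
    unfolding Bochner_Integration.integral_add[OF int(1)[OF 12(1)] int(1)[OF 12(2)]]
      Bochner_Integration.integral_add[OF at_min(5)[OF 12(1,1,1)] at_min(5)[OF 12(2,2,2)]]
      int(2)[OF 12(1)] int(2)[OF 12(2)] ..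
  also have "\<dots> \<le> (\<integral>\<^sup>+\<omega>. ennreal (g 1 (y 1 (real_of_ereal (T\<^sub>m\<^sub>i\<^sub>n \<omega>)) \<omega>) + g 2 (y 2 (real_of_ereal (T\<^sub>m\<^sub>i\<^sub>n \<omega>)) \<omega>)) \<partial>M)"
    (is "_ \<le> (\<integral>\<^sup>+\<omega>. ennreal (?G \<omega>) \<partial>M)")
  proof -
    have "expectation ?G \<le> expectation (\<lambda>\<omega>. max 0 (?G \<omega>))"
      by (rule integral_mono[OF gint]) (use gint in auto)
    then have "ennreal (expectation ?G) \<le> ennreal (expectation (\<lambda>\<omega>. max 0 (?G \<omega>)))" by (rule ennreal_leI)
    also have "\<dots> = (\<integral>\<^sup>+\<omega>. ennreal (max 0 (?G \<omega>)) \<partial>M)"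
      by (rule nn_integral_eq_integral[symmetric]) (use gint in auto)
    finally show ?thesis by (simp add: ennreal_max_0)
  qed
  also have "\<dots> \<le> (\<integral>\<^sup>+\<omega>. (MAX i\<in>{1, 2}. S i) * ennreal (D \<omega>) \<partial>M)" by (rule nn_integral_mono_AE[OF bound])
  also have "\<dots> = (MAX i\<in>{1, 2}. S i) * (\<integral>\<^sup>+\<omega>. ennreal (D \<omega>) \<partial>M)"
    by (rule nn_integral_cmult) (use Dm in measurable)
  finally show ?thesis unfolding S_def D_def .
qed

end
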